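(* Let $R$ be a graded-commutative noetherian ring and $\mathsf T$ a compactly generated $R$-linear triangulated category with arbitrary coproducts. If $\mathsf T$ is noetherian and stratified by $R$ and $L\colon\mathsf T\to\mathsf T$ is a localization functor that preserves arbitrary coproducts, then the localizing subcategory $\operatorname{Ker}L=\{X\in\mathsf T\mid LX=0\}$ is generated (as a localizing subcategory) by objects that are compact in $\mathsf T$.
   Context: Graded-commutative: $R$ is $\mathbb Z$-graded with $rs=(-1)^{|r||s|}sr$ for homogeneous $r,s$. $\operatorname{Spec}R$ is the set of homogeneous prime ideals; $\mathcal V(\mathfrak a)=\{\mathfrak p\in\operatorname{Spec}R\mid\mathfrak p\supseteq\mathfrak a\}$ for a homogeneous ideal $\mathfrak a$. $R$-modules are graded and $M_{\mathfrak p}$ is homogeneous localization. A subset $\mathcal V\subseteq\operatorname{Spec}R$ is specialization closed if $\mathfrak p\in\mathcal V$, $\mathfrak p\subseteq\mathfrak q$ imply $\mathfrak q\in\mathcal V$. $\mathsf T$ has suspension $\Sigma$. A localizing subcategory is a full triangulated subcategory closed under coproducts; $\operatorname{Loc}_{\mathsf T}(\mathsf C)$, the localizing subcategory generated by $\mathsf C$, is the smallest one containing $\mathsf C$. An object $C$ is compact if $\operatorname{Hom}_{\mathsf T}(C,-)$ commutes with coproducts; $\mathsf T^c$ is the full subcategory of compact objects. $\mathsf T$ is compactly generated if $\mathsf T=\operatorname{Loc}_{\mathsf T}(\mathsf G)$ for a set $\mathsf G$ of compact objects. $\mathsf T$ is $R$-linear if there is given a homomorphism of graded rings $R\to Z^*(\mathsf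 T)$ to the graded center ($Z^n(\mathsf T)$ consists of natural transformations $\eta\colon\mathrm{Id}\to\Sigma^n$ with $\eta\Sigma=(-1)^n\Sigma\eta$); then $\operatorname{Hom}^*_{\mathsf T}(X,Y)=\bigoplus_i\operatorname{Hom}_{\mathsf T}(X,\Sigma^iY)$ is a graded $R$-module, and $\operatorname{End}^*_{\mathsf T}(X)=\operatorname{Hom}^*_{\mathsf T}(X,X)$. A localization functor is an exact functor $L\colon\mathsf T\to\mathsf T$ with a natural transformation $\eta\colon\mathrm{Id}_{\mathsf T}\to L$ such that $L(\eta X)$ is an isomorphism and $L(\eta X)=\eta(LX)$ for all $X$. For specialization closed $\mathcal V$, let $\mathsf T_{\mathcal V}=\{X\in\mathsf T\mid\operatorname{Hom}^*_{\mathsf T}(C,X)_{\mathfrak p}=0\text{ for all }C\in\mathsf T^c,\ \mathfrak p\in\operatorname{Spec}R\setminus\mathcal V\}$. This is a localizing subcategory and there is a localization functor $L_{\mathcal V}\colon\mathsf T\to\mathsf T$ with $\operatorname{Ker}L_{\mathcal V}=\mathsf T_{\mathcal V}$, giving functorial exact triangles $\varGamma_{\mathcal V}X\to X\to L_{\mathcal V}X\to$ with $\varGamma_{\mathcal V}X\in\mathsf T_{\mathcal V}$ and $\operatorname{Hom}_{\mathsf T}(\mathsf T_{\mathcal V},L_{\mathcal V}X)=0$. For $\mathfrak p\in\operatorname{Spec}R$ put $\mathcal Z(\mathfrak p)=\{\mathfrak q\in\operatorname{Spec}R\mid\mathfrak q\not\subseteq\mathfrak p\}$, $X_{\mathfrak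 p}=L_{\mathcal Z(\mathfrak p)}X$, $\varGamma_{\mathfrak p}X=\varGamma_{\mathcal V(\mathfrak p)}(X_{\mathfrak p})$. $\varGamma_{\mathfrak p}\mathsf T$ is the essential image of $\varGamma_{\mathfrak p}$, a localizing subcategory of $\mathsf T$. $\mathsf T$ is stratified by $R$ if (S1) the local-global principle holds, i.e. $\operatorname{Loc}_{\mathsf T}(X)=\operatorname{Loc}_{\mathsf T}(\{\varGamma_{\mathfrak p}X\mid\mathfrak p\in\operatorname{Spec}R\})$ for every object $X$; and (S2) for each $\mathfrak p\in\operatorname{Spec}R$ the localizing subcategory $\varGamma_{\mathfrak p}\mathsf T$ is either zero or minimal (nonzero with no proper nonzero localizing subcategories). $\mathsf T$ is noetherian if the $R$-module $\operatorname{End}^*_{\mathsf T}(C)$ is finitely generated for every compact object $C$. *)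

theory Defs
  imports "HOL-Algebra.Ring_Divisibility"
begin

section \<open>Size conventions\<close>

text \<open>
  ``Set-sized'' is read relative to an uncountable regular cardinal: a set is small if it has
  fewer than \<open>\<kappa>\<close> elements. Objects may form a set of arbitrary size, morphism sets and index
  sets of coproducts are small. For \<open>\<kappa>\<close> strongly inaccessible this is smallness with respect to a
  Grothendieck universe. (Without a size restriction, a category having all coproducts would be
  a preorder.) Every small set is in bijection with a subset of \<open>Field \<kappa>\<close>, so it suffices to
  take index sets of coproducts from the type underlying \<open>\<kappa>\<close>.
\<close>

definition size_cardinal :: "'k rel \<Rightarrow> bool" where
  "size_cardinal \<kappa> \<longleftrightarrow> Card_order \<kappa> \<and> regularCard \<kappa> \<and> (natLeq, \<kappa>) \<in> ordLess"

definition small :: "'k rel \<Rightarrow> 'a set \<Rightarrow> bool" where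
  "small \<kappa> A \<longleftrightarrow> (card_of A, \<kappa>) \<in> ordLess"


section \<open>Categories\<close>

record ('o, 'm) category =
  obj :: "'o set"
  arr :: "'m set"
  Dom :: "'m \<Rightarrow> 'o"
  Cod :: "'m \<Rightarrow> 'o"
  ident :: "'o \<Rightarrow> 'm"
  cmp :: "'m \<Rightarrow> 'm \<Rightarrow> 'm" (infixl "\<bullet>\<index>" 70)

definition Hom :: "('o, 'm, 'z) category_scheme \<Rightarrow> 'o \<Rightarrow> 'o \<Rightarrow> 'm set" where
  "Hom T X Y = {f \<in> arr T. Dom T f = X \<and> Cod T f = Y}"

locale category =
  fixes T :: "('o, 'm, 'z) category_scheme" (structure)
  assumes Dom_obj: "f \<in> arr T \<Longrightarrow> Dom T f \<in> obj T"
    and Cod_obj: "f \<in> arr T \<Longrightarrow> Cod T f \<in> obj T"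
    and ident_hom: "X \<in> obj T \<Longrightarrow> ident T X \<in> Hom T X X"
    and cmp_hom: "f \<in> Hom T X Y \<Longrightarrow> g \<in> Hom T Y Z \<Longrightarrow> g \<bullet> f \<in> Hom T X Z"
    and cmp_ident_left: "f \<in> Hom T X Y \<Longrightarrow> ident T Y \<bullet> f = f"
    and cmp_ident_right: "f \<in> Hom T X Y \<Longrightarrow> f \<bullet> ident T X = f"
    and cmp_assoc: "f \<in> Hom T W X \<Longrightarrow> g \<in> Hom T X Y \<Longrightarrow> h \<in> Hom T Y Z
                      \<Longrightarrow> (h \<bullet> g) \<bullet> f = h \<bullet> (g \<bullet> f)"

definition iso_arr :: "('o, 'm, 'z) category_scheme \<Rightarrow> 'm \<Rightarrow> bool" where
  "iso_arr T f \<longleftrightarrow> f \<in> arr T \<and>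
     (\<exists>g \<in> Hom T (Cod T f) (Dom T f).
        g \<bullet>\<^bsub>T\<^esub> f = ident T (Dom T f) \<and> f \<bullet>\<^bsub>T\<^esub> g = ident T (Cod T f))"

definition iso_obj :: "('o, 'm, 'z) category_scheme \<Rightarrow> 'o \<Rightarrow> 'o \<Rightarrow> bool" where
  "iso_obj T X Y \<longleftrightarrow> (\<exists>f \<in> Hom T X Y. iso_arr T f)"

definition zero_obj :: "('o, 'm, 'z) category_scheme \<Rightarrow> 'o \<Rightarrow> bool" where
  "zero_obj T Z \<longleftrightarrow> Z \<in> obj T \<and>
     (\<forall>X \<in> obj T. (\<exists>!f. f \<in> Hom T X Z) \<and> (\<exists>!f. f \<in> Hom T Z X))"

definition endofunctor :: "('o, 'm, 'z) category_scheme \<Rightarrow> ('o \<Rightarrow> 'o) \<Rightarrow> ('m \<Rightarrow> 'm) \<Rightarrow> bool" where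
  "endofunctor T Fo Fa \<longleftrightarrow>
     (\<forall>X \<in> obj T. Fo X \<in> obj T) \<and>
     (\<forall>f \<in> arr T. Fa f \<in> Hom T (Fo (Dom T f)) (Fo (Cod T f))) \<and>
     (\<forall>X \<in> obj T. Fa (ident T X) = ident T (Fo X)) \<and>
     (\<forall>f \<in> arr T. \<forall>g \<in> arr T. Cod T f = Dom T g \<longrightarrow> Fa (g \<bullet>\<^bsub>T\<^esub> f) = Fa g \<bullet>\<^bsub>T\<^esub> Fa f)"

definition natural_transformation ::
  "('o, 'm, 'z) category_scheme \<Rightarrow> ('o \<Rightarrow> 'o) \<Rightarrow> ('m \<Rightarrow> 'm) \<Rightarrow> ('o \<Rightarrow> 'o) \<Rightarrow> ('m \<Rightarrow> 'm)
     \<Rightarrow> ('o \<Rightarrow> 'm) \<Rightarrow> bool" where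
  "natural_transformation T Fo Fa Go Ga \<eta> \<longleftrightarrow>
     (\<forall>X \<in> obj T. \<eta> X \<in> Hom T (Fo X) (Go X)) \<and>
     (\<forall>f \<in> arr T. Ga f \<bullet>\<^bsub>T\<^esub> \<eta> (Dom T f) = \<eta> (Cod T f) \<bullet>\<^bsub>T\<^esub> Fa f)"

definition is_coproduct ::
  "('o, 'm, 'z) category_scheme \<Rightarrow> 'i set \<Rightarrow> ('i \<Rightarrow> 'o) \<Rightarrow> 'o \<Rightarrow> ('i \<Rightarrow> 'm) \<Rightarrow> bool" where
  "is_coproduct T I X P \<iota> \<longleftrightarrow>
     P \<in> obj T \<and> (\<forall>i \<in> I. X i \<in> obj T \<and> \<iota> i \<in> Hom T (X i) P) \<and>
     (\<forall>Y \<in> obj T. \<forall>f \<in> (\<Pi> i\<in>I. Hom T (X i) Y).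
        \<exists>!u. u \<in> Hom T P Y \<and> (\<forall>i \<in> I. u \<bullet>\<^bsub>T\<^esub> \<iota> i = f i))"

definition has_coproducts :: "'k rel \<Rightarrow> ('o, 'm, 'z) category_scheme \<Rightarrow> bool" where
  "has_coproducts \<kappa> T \<longleftrightarrow>
     (\<forall>(I :: 'k set) X. small \<kappa> I \<longrightarrow> (\<forall>i \<in> I. X i \<in> obj T) \<longrightarrow> (\<exists>P \<iota>. is_coproduct T I X P \<iota>))"

definition preserves_coproducts ::
  "'k rel \<Rightarrow> ('o, 'm, 'z) category_scheme \<Rightarrow> ('o \<Rightarrow> 'o) \<Rightarrow> ('m \<Rightarrow> 'm) \<Rightarrow> bool" where
  "preserves_coproducts \<kappa> T Fo Fa \<longleftrightarrow>
     (\<forall>(I :: 'k set) X P \<iota>. small \<kappa> I \<longrightarrow> is_coproduct T I X P \<iota> \<longrightarrow>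
        is_coproduct T I (\<lambda>i. Fo (X i)) (Fo P) (\<lambda>i. Fa (\<iota> i)))"

definition locally_small :: "'k rel \<Rightarrow> ('o, 'm, 'z) category_scheme \<Rightarrow> bool" where
  "locally_small \<kappa> T \<longleftrightarrow> (\<forall>X \<in> obj T. \<forall>Y \<in> obj T. small \<kappa> (Hom T X Y))"


section \<open>Additive categories\<close>

record ('o, 'm) preadditive_category = "('o, 'm) category" +
  plus_arr :: "'m \<Rightarrow> 'm \<Rightarrow> 'm"
  zero_arr :: "'o \<Rightarrow> 'o \<Rightarrow> 'm"

definition hom_group :: "('o, 'm, 'z) preadditive_category_scheme \<Rightarrow> 'o \<Rightarrow> 'o \<Rightarrow> 'm monoid" where
  "hom_group T X Y = \<lparr>carrier = Hom T X Y, mult = plus_arr T, one = zero_arr T X Y\<rparr>"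

definition neg_arr :: "('o, 'm, 'z) preadditive_category_scheme \<Rightarrow> 'm \<Rightarrow> 'm" where
  "neg_arr T f = inv\<^bsub>hom_group T (Dom T f) (Cod T f)\<^esub> f"

definition sign_arr :: "('o, 'm, 'z) preadditive_category_scheme \<Rightarrow> int \<Rightarrow> 'm \<Rightarrow> 'm" where
  "sign_arr T n f = (if even n then f else neg_arr T f)"

locale additive_category = category T
  for T :: "('o, 'm, 'z) preadditive_category_scheme" (structure) +
  assumes hom_group: "X \<in> obj T \<Longrightarrow> Y \<in> obj T \<Longrightarrow> comm_group (hom_group T X Y)"
    and cmp_plus_left: "f \<in> Hom T X Y \<Longrightarrow> g \<in> Hom T Y Z \<Longrightarrow> g' \<in> Hom T Y Z
          \<Longrightarrow> plus_arr T g g' \<bullet> f = plus_arr T (g \<bullet> f) (g' \<bullet> f)"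
    and cmp_plus_right: "f \<in> Hom T X Y \<Longrightarrow> f' \<in> Hom T X Y \<Longrightarrow> g \<in> Hom T Y Z
          \<Longrightarrow> g \<bullet> plus_arr T f f' = plus_arr T (g \<bullet> f) (g \<bullet> f')"
    and ex_zero_obj: "\<exists>Z. zero_obj T Z"
    and ex_biproduct: "X \<in> obj T \<Longrightarrow> Y \<in> obj T \<Longrightarrow>
          \<exists>P i j p q. i \<in> Hom T X P \<and> j \<in> Hom T Y P \<and> p \<in> Hom T P X \<and> q \<in> Hom T P Y \<and>
            p \<bullet> i = ident T X \<and> q \<bullet> j = ident T Y \<and>
            q \<bullet> i = zero_arr T X Y \<and> p \<bullet> j = zero_arr T Y X \<and>
            plus_arr T (i \<bullet> p) (j \<bullet> q) = ident T P"

definition additive_endofunctor ::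
  "('o, 'm, 'z) preadditive_category_scheme \<Rightarrow> ('o \<Rightarrow> 'o) \<Rightarrow> ('m \<Rightarrow> 'm) \<Rightarrow> bool" where
  "additive_endofunctor T Fo Fa \<longleftrightarrow> endofunctor T Fo Fa \<and>
     (\<forall>X \<in> obj T. \<forall>Y \<in> obj T. \<forall>f \<in> Hom T X Y. \<forall>g \<in> Hom T X Y.
        Fa (plus_arr T f g) = plus_arr T (Fa f) (Fa g))"

text \<open>
  \<open>Hom(C, -)\<close> commutes with small coproducts: the canonical map from the direct sum of the groups
  \<open>Hom(C, X i)\<close> (the finitely supported families) to \<open>Hom(C, P)\<close> is bijective.
\<close>

definition compact_obj :: "'k rel \<Rightarrow> ('o, 'm, 'z) preadditive_category_scheme \<Rightarrow> 'o \<Rightarrow> bool" where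
  "compact_obj \<kappa> T C \<longleftrightarrow> C \<in> obj T \<and>
     (\<forall>(I :: 'k set) X P \<iota>. small \<kappa> I \<longrightarrow> is_coproduct T I X P \<iota> \<longrightarrow>
        bij_betw
          (\<lambda>f. finprod (hom_group T C P) (\<lambda>i. \<iota> i \<bullet>\<^bsub>T\<^esub> f i) {i \<in> I. f i \<noteq> zero_arr T C (X i)})
          {f \<in> (\<Pi>\<^sub>E i\<in>I. Hom T C (X i)). finite {i \<in> I. f i \<noteq> zero_arr T C (X i)}}
          (Hom T C P))"

definition compacts :: "'k rel \<Rightarrow> ('o, 'm, 'z) preadditive_category_scheme \<Rightarrow> 'o set" where
  "compacts \<kappa> T = {C. compact_obj \<kappa> T C}"


section \<open>Triangulated categories\<close>

text \<open>
  The suspension is an automorphism of the category (Verdier's convention), so that its integer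
  powers are defined on the nose. A triangle \<open>X \<rightarrow> Y \<rightarrow> Z \<rightarrow> \<Sigma>X\<close> is the triple of its morphisms.
\<close>

record ('o, 'm) triangulated_category = "('o, 'm) preadditive_category" +
  susp_obj :: "'o \<Rightarrow> 'o"
  susp_arr :: "'m \<Rightarrow> 'm"
  exact_triangles :: "('m \<times> 'm \<times> 'm) set"

definition susp_pow_obj :: "('o, 'm, 'z) triangulated_category_scheme \<Rightarrow> int \<Rightarrow> 'o \<Rightarrow> 'o" where
  "susp_pow_obj T n X =
     (if 0 \<le> n then (susp_obj T ^^ nat n) X
      else (inv_into (obj T) (susp_obj T) ^^ nat (- n)) X)"

definition susp_pow_arr :: "('o, 'm, 'z) triangulated_category_scheme \<Rightarrow> int \<Rightarrow> 'm \<Rightarrow> 'm" where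
  "susp_pow_arr T n f =
     (if 0 \<le> n then (susp_arr T ^^ nat n) f
      else (inv_into (arr T) (susp_arr T) ^^ nat (- n)) f)"

definition is_triangle ::
  "('o, 'm, 'z) triangulated_category_scheme \<Rightarrow> 'm \<Rightarrow> 'm \<Rightarrow> 'm \<Rightarrow> bool" where
  "is_triangle T f g h \<longleftrightarrow> f \<in> arr T \<and> g \<in> arr T \<and> h \<in> arr T \<and>
     Cod T f = Dom T g \<and> Cod T g = Dom T h \<and> Cod T h = susp_obj T (Dom T f)"

definition triangle_morphism ::
  "('o, 'm, 'z) triangulated_category_scheme \<Rightarrow> 'm \<times> 'm \<times> 'm \<Rightarrow> 'm \<times> 'm \<times> 'm \<Rightarrow> 'm \<Rightarrow> 'm \<Rightarrow> 'm \<Rightarrow> bool"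
  where
  "triangle_morphism T t t' a b c \<longleftrightarrow>
     (case t of (f, g, h) \<Rightarrow> case t' of (f', g', h') \<Rightarrow>
        a \<in> Hom T (Dom T f) (Dom T f') \<and>
        b \<in> Hom T (Dom T g) (Dom T g') \<and>
        c \<in> Hom T (Dom T h) (Dom T h') \<and>
        b \<bullet>\<^bsub>T\<^esub> f = f' \<bullet>\<^bsub>T\<^esub> a \<and>
        c \<bullet>\<^bsub>T\<^esub> g = g' \<bullet>\<^bsub>T\<^esub> b \<and>
        susp_arr T a \<bullet>\<^bsub>T\<^esub> h = h' \<bullet>\<^bsub>T\<^esub> c)"

locale triangulated_category = additive_category T
  for T :: "('o, 'm, 'z) triangulated_category_scheme" (structure) +
  assumes susp_functor: "additive_endofunctor T (susp_obj T) (susp_arr T)"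
    and susp_obj_bij: "bij_betw (susp_obj T) (obj T) (obj T)"
    and susp_arr_bij: "bij_betw (susp_arr T) (arr T) (arr T)"
    and exact_is_triangle: "(f, g, h) \<in> exact_triangles T \<Longrightarrow> is_triangle T f g h"
    and TR1_iso: "(f, g, h) \<in> exact_triangles T \<Longrightarrow> is_triangle T f' g' h' \<Longrightarrow>
          triangle_morphism T (f, g, h) (f', g', h') a b c \<Longrightarrow>
          iso_arr T a \<Longrightarrow> iso_arr T b \<Longrightarrow> iso_arr T c \<Longrightarrow> (f', g', h') \<in> exact_triangles T"
    and TR1_ident: "X \<in> obj T \<Longrightarrow> zero_obj T Z \<Longrightarrow>
          (ident T X, zero_arr T X Z, zero_arr T Z (susp_obj T X)) \<in> exact_triangles T"
    and TR1_cone: "f \<in> arr T \<Longrightarrow> \<exists>g h. (f, g, h) \<in> exact_triangles T"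
    and TR2: "is_triangle T f g h \<Longrightarrow>
          (f, g, h) \<in> exact_triangles T \<longleftrightarrow> (g, h, neg_arr T (susp_arr T f)) \<in> exact_triangles T"
    and TR3: "(f, g, h) \<in> exact_triangles T \<Longrightarrow> (f', g', h') \<in> exact_triangles T \<Longrightarrow>
          a \<in> Hom T (Dom T f) (Dom T f') \<Longrightarrow> b \<in> Hom T (Dom T g) (Dom T g') \<Longrightarrow>
          b \<bullet> f = f' \<bullet> a \<Longrightarrow> \<exists>c. triangle_morphism T (f, g, h) (f', g', h') a b c"
    and TR4: "f \<in> Hom T X Y \<Longrightarrow> g \<in> Hom T Y Z \<Longrightarrow>
          (f, f\<^sub>1, f\<^sub>2) \<in> exact_triangles T \<Longrightarrow> (g, g\<^sub>1, g\<^sub>2) \<in> exact_triangles T \<Longrightarrow>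
          (g \<bullet> f, h\<^sub>1, h\<^sub>2) \<in> exact_triangles T \<Longrightarrow>
          \<exists>u v. (u, v, susp_arr T f\<^sub>1 \<bullet> g\<^sub>2) \<in> exact_triangles T \<and>
            u \<bullet> f\<^sub>1 = h\<^sub>1 \<bullet> g \<and> v \<bullet> h\<^sub>1 = g\<^sub>1 \<and> h\<^sub>2 \<bullet> u = f\<^sub>2 \<and> g\<^sub>2 \<bullet> v = susp_arr T f \<bullet> h\<^sub>2"

text \<open>Full subcategories closed under isomorphism are given by their sets of objects.\<close>

definition triangulated_subcategory ::
  "('o, 'm, 'z) triangulated_category_scheme \<Rightarrow> 'o set \<Rightarrow> bool" where
  "triangulated_subcategory T S \<longleftrightarrow>
     S \<subseteq> obj T \<and> (\<forall>Z. zero_obj T Z \<longrightarrow> Z \<in> S) \<and>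
     (\<forall>X \<in> S. \<forall>Y. iso_obj T X Y \<longrightarrow> Y \<in> S) \<and>
     (\<forall>X \<in> obj T. susp_obj T X \<in> S \<longleftrightarrow> X \<in> S) \<and>
     (\<forall>(f, g, h) \<in> exact_triangles T.
        (Dom T f \<in> S \<and> Dom T g \<in> S \<longrightarrow> Dom T h \<in> S) \<and>
        (Dom T g \<in> S \<and> Dom T h \<in> S \<longrightarrow> Dom T f \<in> S) \<and>
        (Dom T f \<in> S \<and> Dom T h \<in> S \<longrightarrow> Dom T g \<in> S))"

definition localizing ::
  "'k rel \<Rightarrow> ('o, 'm, 'z) triangulated_category_scheme \<Rightarrow> 'o set \<Rightarrow> bool" where
  "localizing \<kappa> T S \<longleftrightarrow> triangulated_subcategory T S \<and>
     (\<forall>(I :: 'k set) X P \<iota>. small \<kappa> I \<longrightarrow> is_coproduct T I X P \<iota> \<longrightarrow> (\<forall>i \<in> I. X i \<in> S) \<longrightarrow> P \<in> S)"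

definition Loc :: "'k rel \<Rightarrow> ('o, 'm, 'z) triangulated_category_scheme \<Rightarrow> 'o set \<Rightarrow> 'o set" where
  "Loc \<kappa> T C = \<Inter> {S. localizing \<kappa> T S \<and> C \<subseteq> S}"

definition compactly_generated ::
  "'k rel \<Rightarrow> ('o, 'm, 'z) triangulated_category_scheme \<Rightarrow> bool" where
  "compactly_generated \<kappa> T \<longleftrightarrow> (\<exists>G \<subseteq> compacts \<kappa> T. small \<kappa> G \<and> Loc \<kappa> T G = obj T)"

definition zero_subcategory :: "('o, 'm, 'z) category_scheme \<Rightarrow> 'o set \<Rightarrow> bool" where
  "zero_subcategory T S \<longleftrightarrow> (\<forall>X \<in> S. zero_obj T X)"

definition minimal_localizing ::
  "'k rel \<Rightarrow> ('o, 'm, 'z) triangulated_category_scheme \<Rightarrow> 'o set \<Rightarrow> bool" where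
  "minimal_localizing \<kappa> T S \<longleftrightarrow> localizing \<kappa> T S \<and> \<not> zero_subcategory T S \<and>
     (\<forall>S'. localizing \<kappa> T S' \<and> S' \<subseteq> S \<longrightarrow> zero_subcategory T S' \<or> S' = S)"

text \<open>The isomorphism \<open>\<theta> : F \<Sigma> \<rightarrow> \<Sigma> F\<close> that makes \<open>F\<close> an exact functor.\<close>

definition exact_functor_via ::
  "('o, 'm, 'z) triangulated_category_scheme \<Rightarrow> ('o \<Rightarrow> 'o) \<Rightarrow> ('m \<Rightarrow> 'm) \<Rightarrow> ('o \<Rightarrow> 'm) \<Rightarrow> bool" where
  "exact_functor_via T Fo Fa \<theta> \<longleftrightarrow>
     additive_endofunctor T Fo Fa \<and>
     natural_transformation T (\<lambda>X. Fo (susp_obj T X)) (\<lambda>f. Fa (susp_arr T f))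
       (\<lambda>X. susp_obj T (Fo X)) (\<lambda>f. susp_arr T (Fa f)) \<theta> \<and>
     (\<forall>X \<in> obj T. iso_arr T (\<theta> X)) \<and>
     (\<forall>(f, g, h) \<in> exact_triangles T.
        (Fa f, Fa g, \<theta> (Dom T f) \<bullet>\<^bsub>T\<^esub> Fa h) \<in> exact_triangles T)"

definition exact_functor ::
  "('o, 'm, 'z) triangulated_category_scheme \<Rightarrow> ('o \<Rightarrow> 'o) \<Rightarrow> ('m \<Rightarrow> 'm) \<Rightarrow> bool" where
  "exact_functor T Fo Fa \<longleftrightarrow> (\<exists>\<theta>. exact_functor_via T Fo Fa \<theta>)"

definition localization_functor ::
  "('o, 'm, 'z) triangulated_category_scheme \<Rightarrow> ('o \<Rightarrow> 'o) \<Rightarrow> ('m \<Rightarrow> 'm) \<Rightarrow> ('o \<Rightarrow> 'm) \<Rightarrow> bool" where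
  "localization_functor T Lo La \<eta> \<longleftrightarrow>
     exact_functor T Lo La \<and>
     natural_transformation T (\<lambda>X. X) (\<lambda>f. f) Lo La \<eta> \<and>
     (\<forall>X \<in> obj T. iso_arr T (La (\<eta> X)) \<and> La (\<eta> X) = \<eta> (Lo X))"

definition Ker :: "('o, 'm, 'z) category_scheme \<Rightarrow> ('o \<Rightarrow> 'o) \<Rightarrow> 'o set" where
  "Ker T Fo = {X \<in> obj T. zero_obj T (Fo X)}"


section \<open>Graded-commutative rings and graded modules\<close>

record 'r graded_ring = "'r ring" +
  grade :: "int \<Rightarrow> 'r set"

locale graded_commutative_ring = ring R
  for R :: "('r, 'z) graded_ring_scheme" (structure) +
  assumes grade_subgroup: "additive_subgroup (grade R n) R"
    and grade_mult: "a \<in> grade R m \<Longrightarrow> b \<in> grade R n \<Longrightarrow> a \<otimes> b \<in> grade R (m + n)"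
    and grade_one: "\<one> \<in> grade R 0"
    and grade_decomposition: "x \<in> carrier R \<Longrightarrow>
          \<exists>!c. (\<forall>n. c n \<in> grade R n) \<and> finite {n. c n \<noteq> \<zero>} \<and> x = (\<Oplus>n\<in>{n. c n \<noteq> \<zero>}. c n)"
    and graded_commute: "a \<in> grade R m \<Longrightarrow> b \<in> grade R n \<Longrightarrow>
          a \<otimes> b = (if even (m * n) then b \<otimes> a else \<ominus> (b \<otimes> a))"

definition homogeneous_ideal :: "('r, 'z) graded_ring_scheme \<Rightarrow> 'r set \<Rightarrow> bool" where
  "homogeneous_ideal R I \<longleftrightarrow> ideal I R \<and> (\<exists>A \<subseteq> (\<Union>n. grade R n). I = Idl\<^bsub>R\<^esub> A)"

text \<open>
  The clauses on \<open>p\<close> besides homogeneity are those of \<^locale>\<open>primeideal\<close>, which itself is only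
  available for commutative rings.
\<close>

definition Spec :: "('r, 'z) graded_ring_scheme \<Rightarrow> 'r set set" where
  "Spec R = {p. homogeneous_ideal R p \<and> carrier R \<noteq> p \<and>
     (\<forall>a \<in> carrier R. \<forall>b \<in> carrier R. a \<otimes>\<^bsub>R\<^esub> b \<in> p \<longrightarrow> a \<in> p \<or> b \<in> p)}"

definition Vset :: "('r, 'z) graded_ring_scheme \<Rightarrow> 'r set \<Rightarrow> 'r set set" where
  "Vset R I = {q \<in> Spec R. I \<subseteq> q}"

definition Zset :: "('r, 'z) graded_ring_scheme \<Rightarrow> 'r set \<Rightarrow> 'r set set" where
  "Zset R p = {q \<in> Spec R. \<not> q \<subseteq> p}"

text \<open>
  A graded module is given by its homogeneous components. \<open>gact M k r n x\<close> is the product \<open>r x\<close>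
  in degree \<open>k + n\<close> of \<open>r\<close> of degree \<open>k\<close> and \<open>x\<close> of degree \<open>n\<close>; degrees are explicit because the
  components need not be disjoint.
\<close>

record ('r, 'a) graded_module =
  gcar :: "int \<Rightarrow> 'a set"
  gadd :: "'a \<Rightarrow> 'a \<Rightarrow> 'a"
  gzero :: "int \<Rightarrow> 'a"
  gact :: "int \<Rightarrow> 'r \<Rightarrow> int \<Rightarrow> 'a \<Rightarrow> 'a"

definition graded_submodule ::
  "('r, 'z) graded_ring_scheme \<Rightarrow> ('r, 'a) graded_module \<Rightarrow> (int \<Rightarrow> 'a set) \<Rightarrow> bool" where
  "graded_submodule R M N \<longleftrightarrow>
     (\<forall>n. N n \<subseteq> gcar M n \<and> gzero M n \<in> N n \<and>
        (\<forall>x \<in> N n. \<forall>y \<in> N n. gadd M x y \<in> N n) \<and>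
        (\<forall>k. \<forall>r \<in> grade R k. \<forall>x \<in> N n. gact M k r n x \<in> N (k + n)))"

definition finitely_generated_module ::
  "('r, 'z) graded_ring_scheme \<Rightarrow> ('r, 'a) graded_module \<Rightarrow> bool" where
  "finitely_generated_module R M \<longleftrightarrow>
     (\<exists>A. finite A \<and> (\<forall>(n, x) \<in> A. x \<in> gcar M n) \<and>
        (\<forall>N. graded_submodule R M N \<and> (\<forall>(n, x) \<in> A. x \<in> N n) \<longrightarrow> N = gcar M))"

text \<open>
  Homogeneous localization. The triple \<open>(k, s, x)\<close> stands for the fraction \<open>s\<^sup>-\<^sup>1 x\<close> of degree \<open>d\<close>,
  where \<open>s \<notin> p\<close> has degree \<open>k\<close> and \<open>x\<close> has degree \<open>d + k\<close>. Two fractions are identified if they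
  can be expanded to a common denominator with equal numerators; expansion multiplies from the
  left in both entries, so no signs occur.
\<close>

definition fractions ::
  "('r, 'z) graded_ring_scheme \<Rightarrow> ('r, 'a) graded_module \<Rightarrow> 'r set \<Rightarrow> int \<Rightarrow> (int \<times> 'r \<times> 'a) set" where
  "fractions R M p d = {(k, s, x). s \<in> grade R k \<and> s \<notin> p \<and> x \<in> gcar M (d + k)}"

definition fraction_rel ::
  "('r, 'z) graded_ring_scheme \<Rightarrow> ('r, 'a) graded_module \<Rightarrow> 'r set \<Rightarrow> int
     \<Rightarrow> ((int \<times> 'r \<times> 'a) \<times> (int \<times> 'r \<times> 'a)) set" where
  "fraction_rel R M p d =
     {((k, s, x), (k', s', x')).
        (k, s, x) \<in> fractions R M p d \<and> (k', s', x') \<in> fractions R M p d \<and>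
        (\<exists>j j'. \<exists>a \<in> grade R j. \<exists>a' \<in> grade R j'.
           j + k = j' + k' \<and> a \<otimes>\<^bsub>R\<^esub> s = a' \<otimes>\<^bsub>R\<^esub> s' \<and> a \<otimes>\<^bsub>R\<^esub> s \<notin> p \<and>
           gact M j a (d + k) x = gact M j' a' (d + k') x')}"

definition localization ::
  "('r, 'z) graded_ring_scheme \<Rightarrow> ('r, 'a) graded_module \<Rightarrow> 'r set \<Rightarrow> int
     \<Rightarrow> (int \<times> 'r \<times> 'a) set set" where
  "localization R M p d = fractions R M p d // fraction_rel R M p d"

definition localization_is_zero ::
  "('r, 'z) graded_ring_scheme \<Rightarrow> ('r, 'a) graded_module \<Rightarrow> 'r set \<Rightarrow> bool" where
  "localization_is_zero R M p \<longleftrightarrow>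
     (\<forall>d. localization R M p d = {fraction_rel R M p d `` {(0, \<one>\<^bsub>R\<^esub>, gzero M d)}})"


section \<open>Linear triangulated categories\<close>

definition graded_center ::
  "('o, 'm, 'z) triangulated_category_scheme \<Rightarrow> int \<Rightarrow> ('o \<Rightarrow> 'm) set" where
  "graded_center T n =
     {\<eta>. natural_transformation T (\<lambda>X. X) (\<lambda>f. f) (susp_pow_obj T n) (susp_pow_arr T n) \<eta> \<and>
         (\<forall>X \<in> obj T. \<eta> (susp_obj T X) = sign_arr T n (susp_arr T (\<eta> X)))}"

text \<open>
  A homomorphism of graded rings from \<open>R\<close> to the graded center, \<open>\<phi> n r X\<close> being the component at
  \<open>X\<close> of the image of \<open>r\<close> of degree \<open>n\<close>. The product of the center is formed in \<open>End\<^sup>*(X)\<close>, where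
  the composite of \<open>f : X \<rightarrow> \<Sigma>\<^sup>n Y\<close> and \<open>g : Y \<rightarrow> \<Sigma>\<^sup>m Z\<close> is \<open>\<Sigma>\<^sup>n g \<circ> f\<close>.
\<close>

definition linear_structure ::
  "('o, 'm, 'y) triangulated_category_scheme \<Rightarrow> ('r, 'z) graded_ring_scheme
     \<Rightarrow> (int \<Rightarrow> 'r \<Rightarrow> 'o \<Rightarrow> 'm) \<Rightarrow> bool" where
  "linear_structure T R \<phi> \<longleftrightarrow>
     (\<forall>n. \<forall>r \<in> grade R n. \<phi> n r \<in> graded_center T n) \<and>
     (\<forall>n. \<forall>r \<in> grade R n. \<forall>s \<in> grade R n. \<forall>X \<in> obj T.
        \<phi> n (r \<oplus>\<^bsub>R\<^esub> s) X = plus_arr T (\<phi> n r X) (\<phi> n s X)) \<and>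
     (\<forall>m n. \<forall>r \<in> grade R m. \<forall>s \<in> grade R n. \<forall>X \<in> obj T.
        \<phi> (m + n) (r \<otimes>\<^bsub>R\<^esub> s) X = susp_pow_arr T n (\<phi> m r X) \<bullet>\<^bsub>T\<^esub> \<phi> n s X) \<and>
     (\<forall>X \<in> obj T. \<phi> 0 \<one>\<^bsub>R\<^esub> X = ident T X)"

definition hom_star ::
  "('o, 'm, 'z) triangulated_category_scheme \<Rightarrow> (int \<Rightarrow> 'r \<Rightarrow> 'o \<Rightarrow> 'm) \<Rightarrow> 'o \<Rightarrow> 'o
     \<Rightarrow> ('r, 'm) graded_module" where
  "hom_star T \<phi> X Y =
     \<lparr>gcar = (\<lambda>n. Hom T X (susp_pow_obj T n Y)),
      gadd = plus_arr T,
      gzero = (\<lambda>n. zero_arr T X (susp_pow_obj T n Y)),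
      gact = (\<lambda>k r n f. susp_pow_arr T n (\<phi> k r Y) \<bullet>\<^bsub>T\<^esub> f)\<rparr>"

definition noetherian_category ::
  "'k rel \<Rightarrow> ('o, 'm, 'y) triangulated_category_scheme \<Rightarrow> ('r, 'z) graded_ring_scheme
     \<Rightarrow> (int \<Rightarrow> 'r \<Rightarrow> 'o \<Rightarrow> 'm) \<Rightarrow> bool" where
  "noetherian_category \<kappa> T R \<phi> \<longleftrightarrow>
     (\<forall>C \<in> compacts \<kappa> T. finitely_generated_module R (hom_star T \<phi> C C))"

definition torsion ::
  "'k rel \<Rightarrow> ('o, 'm, 'y) triangulated_category_scheme \<Rightarrow> ('r, 'z) graded_ring_scheme
     \<Rightarrow> (int \<Rightarrow> 'r \<Rightarrow> 'o \<Rightarrow> 'm) \<Rightarrow> 'r set set \<Rightarrow> 'o set" where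
  "torsion \<kappa> T R \<phi> V =
     {X \<in> obj T. \<forall>C \<in> compacts \<kappa> T. \<forall>p \<in> Spec R - V. localization_is_zero R (hom_star T \<phi> C X) p}"

text \<open>
  A localization functor with kernel \<^term>\<open>torsion \<kappa> T R \<phi> V\<close>; it exists for \<open>V\<close> specialization
  closed and is unique up to isomorphism. The local cohomology object \<open>\<Gamma>\<^sub>V X\<close> completes
  \<open>X \<rightarrow> L\<^sub>V X\<close> to an exact triangle \<open>\<Gamma>\<^sub>V X \<rightarrow> X \<rightarrow> L\<^sub>V X \<rightarrow>\<close>.
\<close>

definition torsion_localization ::
  "'k rel \<Rightarrow> ('o, 'm, 'y) triangulated_category_scheme \<Rightarrow> ('r, 'z) graded_ring_scheme
     \<Rightarrow> (int \<Rightarrow> 'r \<Rightarrow> 'o \<Rightarrow> 'm) \<Rightarrow> 'r set set \<Rightarrow> ('o \<Rightarrow> 'o) \<times> ('m \<Rightarrow> 'm) \<times> ('o \<Rightarrow> 'm)" where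
  "torsion_localization \<kappa> T R \<phi> V =
     (SOME (Lo, La, \<eta>). localization_functor T Lo La \<eta> \<and> Ker T Lo = torsion \<kappa> T R \<phi> V)"

definition L_obj ::
  "'k rel \<Rightarrow> ('o, 'm, 'y) triangulated_category_scheme \<Rightarrow> ('r, 'z) graded_ring_scheme
     \<Rightarrow> (int \<Rightarrow> 'r \<Rightarrow> 'o \<Rightarrow> 'm) \<Rightarrow> 'r set set \<Rightarrow> 'o \<Rightarrow> 'o" where
  "L_obj \<kappa> T R \<phi> V = fst (torsion_localization \<kappa> T R \<phi> V)"

definition L_unit ::
  "'k rel \<Rightarrow> ('o, 'm, 'y) triangulated_category_scheme \<Rightarrow> ('r, 'z) graded_ring_scheme
     \<Rightarrow> (int \<Rightarrow> 'r \<Rightarrow> 'o \<Rightarrow> 'm) \<Rightarrow> 'r set set \<Rightarrow> 'o \<Rightarrow> 'm" where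
  "L_unit \<kappa> T R \<phi> V = snd (snd (torsion_localization \<kappa> T R \<phi> V))"

definition Gamma_obj ::
  "'k rel \<Rightarrow> ('o, 'm, 'y) triangulated_category_scheme \<Rightarrow> ('r, 'z) graded_ring_scheme
     \<Rightarrow> (int \<Rightarrow> 'r \<Rightarrow> 'o \<Rightarrow> 'm) \<Rightarrow> 'r set set \<Rightarrow> 'o \<Rightarrow> 'o" where
  "Gamma_obj \<kappa> T R \<phi> V X =
     (SOME Y. \<exists>f h. (f, L_unit \<kappa> T R \<phi> V X, h) \<in> exact_triangles T \<and> Dom T f = Y)"

definition Gamma_at ::
  "'k rel \<Rightarrow> ('o, 'm, 'y) triangulated_category_scheme \<Rightarrow> ('r, 'z) graded_ring_scheme
     \<Rightarrow> (int \<Rightarrow> 'r \<Rightarrow> 'o \<Rightarrow> 'm) \<Rightarrow> 'r set \<Rightarrow> 'o \<Rightarrow> 'o" where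
  "Gamma_at \<kappa> T R \<phi> p X = Gamma_obj \<kappa> T R \<phi> (Vset R p) (L_obj \<kappa> T R \<phi> (Zset R p) X)"

definition Gamma_subcategory ::
  "'k rel \<Rightarrow> ('o, 'm, 'y) triangulated_category_scheme \<Rightarrow> ('r, 'z) graded_ring_scheme
     \<Rightarrow> (int \<Rightarrow> 'r \<Rightarrow> 'o \<Rightarrow> 'm) \<Rightarrow> 'r set \<Rightarrow> 'o set" where
  "Gamma_subcategory \<kappa> T R \<phi> p = {Y. \<exists>X \<in> obj T. iso_obj T (Gamma_at \<kappa> T R \<phi> p X) Y}"

definition local_global_principle ::
  "'k rel \<Rightarrow> ('o, 'm, 'y) triangulated_category_scheme \<Rightarrow> ('r, 'z) graded_ring_scheme
     \<Rightarrow> (int \<Rightarrow> 'r \<Rightarrow> 'o \<Rightarrow> 'm) \<Rightarrow> bool" where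
  "local_global_principle \<kappa> T R \<phi> \<longleftrightarrow>
     (\<forall>X \<in> obj T. Loc \<kappa> T {X} = Loc \<kappa> T {Gamma_at \<kappa> T R \<phi> p X | p. p \<in> Spec R})"

definition stratified ::
  "'k rel \<Rightarrow> ('o, 'm, 'y) triangulated_category_scheme \<Rightarrow> ('r, 'z) graded_ring_scheme
     \<Rightarrow> (int \<Rightarrow> 'r \<Rightarrow> 'o \<Rightarrow> 'm) \<Rightarrow> bool" where
  "stratified \<kappa> T R \<phi> \<longleftrightarrow>
     local_global_principle \<kappa> T R \<phi> \<and>
     (\<forall>p \<in> Spec R. zero_subcategory T (Gamma_subcategory \<kappa> T R \<phi> p) \<or>
        minimal_localizing \<kappa> T (Gamma_subcategory \<kappa> T R \<phi> p))"

end

theory Submission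
  imports Defs "HOL-Library.Countable"
begin

text \<open>
  The kernel \<open>S\<close> of \<open>L\<close> and its right orthogonal, the essential image of \<open>L\<close>, are both localizing
  because \<open>L\<close> preserves coproducts. By stratification each \<open>\<Gamma>\<^sub>p T\<close> lies in one of them, and by the
  local-global principle it suffices to know which. The set of \<open>p\<close> with \<open>0 \<noteq> \<Gamma>\<^sub>p T \<subseteq> S\<close> is
  specialization closed: otherwise there is an \<open>r\<close> in it, maximal below some \<open>q\<close> with
  \<open>\<Gamma>\<^sub>q T\<close> not contained in \<open>S\<close>. For a compact Koszul object \<open>D\<close> at \<open>r\<close> with \<open>D\<^sub>r \<noteq> 0\<close> the fibre of
  \<open>D\<^sub>q \<rightarrow> D\<^sub>r\<close> is then orthogonal to \<open>S\<close>, so this morphism is a split epimorphism and \<open>Hom\<^sup>*(D, D\<^sub>r)\<close> is a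
  finitely generated module over \<open>R\<^sub>q\<close> on which the elements of \<open>q\<close> outside \<open>r\<close> are invertible,
  contradicting Nakayama's lemma. Hence the compact Koszul objects at the primes in question lie in
  \<open>S\<close>, and they generate it.
\<close>

section \<open>Categories and additive categories\<close>

text \<open>Both localizations inside \<open>Gamma_at\<close> are picked by \<open>SOME\<close>, so
  nothing is known about them until a localization functor with kernel
  \<open>torsion \<kappa> T R \<phi> V\<close> has been built. This is done for
  \<open>Zset R p\<close> and \<open>Vset R p\<close>: Koszul objects on the compact generators of
  \<open>T\<close> form a small set generating the torsion subcategory, and a telescope turns such a
  set into a Bousfield triangle. Afterwards the choices disappear, since
  \<open>Gamma_subcategory\<close> is an intersection of a torsion subcategory and an orthogonal. A
  recurring obstacle is signs. A ring element acts on morphisms into a suspension in two ways that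
  agree only up to sign, and Koszul objects are annihilated by squares. Torsion is therefore
  expressed by annihilation, and generation by submodules closed under division by elements outside
  a prime; neither notion sees a sign. The noetherian hypothesis on \<open>T\<close> enters at one
  place: once \<open>D\<^sub>q \<rightarrow> D\<^sub>r\<close> splits, every morphism from
  \<open>D\<close> to a suspension of \<open>D\<^sub>r\<close> comes, up to a denominator outside
  \<open>q\<close>, from an endomorphism of \<open>D\<close> of some degree.\<close>

lemma HomD:
  assumes "f \<in> Hom T X Y"
  shows "f \<in> arr T" "Dom T f = X" "Cod T f = Y"
  using assms by (auto simp: Hom_def)

context category
begin

lemma arr_cmp [simp]:
  assumes "f \<in> arr T" "g \<in> arr T" "Cod T f = Dom T g"
  shows "g \<bullet> f \<in> arr T" "Dom T (g \<bullet> f) = Dom T f" "Cod T (g \<bullet> f) = Cod T g"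
  using cmp_hom[of f "Dom T f" "Dom T g" g "Cod T g"] assms by (auto simp: Hom_def)

lemma arr_ident [simp]:
  assumes "X \<in> obj T"
  shows "ident T X \<in> arr T" "Dom T (ident T X) = X" "Cod T (ident T X) = X"
  using ident_hom[OF assms] by (auto simp: Hom_def)

lemma obj_Dom_Cod [simp]:
  assumes "f \<in> arr T"
  shows "Dom T f \<in> obj T" "Cod T f \<in> obj T"
  using assms Dom_obj Cod_obj by auto

lemma Hom_objD:
  assumes "f \<in> Hom T X Y"
  shows "X \<in> obj T" "Y \<in> obj T"
  using assms by (auto simp: Hom_def)

lemma cmp_ident [simp]:
  assumes "f \<in> arr T"
  shows "Cod T f = Y \<Longrightarrow> ident T Y \<bullet> f = f" "Dom T f = X \<Longrightarrow> f \<bullet> ident T X = f"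
  using assms cmp_ident_left[of f "Dom T f" Y] cmp_ident_right[of f X "Cod T f"]
  by (auto simp: Hom_def)

lemma cmp_assoc_arr [simp]:
  assumes "f \<in> arr T" "g \<in> arr T" "h \<in> arr T" "Cod T f = Dom T g" "Cod T g = Dom T h"
  shows "(h \<bullet> g) \<bullet> f = h \<bullet> (g \<bullet> f)"
  using assms cmp_assoc[of f "Dom T f" "Cod T f" g "Cod T g" h "Cod T h"] by (auto simp: Hom_def)

lemma iso_arrI:
  assumes "f \<in> Hom T X Y" "g \<in> Hom T Y X" "g \<bullet> f = ident T X" "f \<bullet> g = ident T Y"
  shows "iso_arr T f"
  using assms by (auto simp: iso_arr_def Hom_def)

lemma iso_arrE:
  assumes "iso_arr T f" "f \<in> Hom T X Y"
  obtains g where "g \<in> Hom T Y X" "g \<bullet> f = ident T X" "f \<bullet> g = ident T Y"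
  using assms by (auto simp: iso_arr_def Hom_def)

lemma iso_arr_ident: "X \<in> obj T \<Longrightarrow> iso_arr T (ident T X)"
  using iso_arrI[OF ident_hom ident_hom] by simp

lemma iso_objI: "f \<in> Hom T X Y \<Longrightarrow> iso_arr T f \<Longrightarrow> iso_obj T X Y"
  by (auto simp: iso_obj_def)

lemma iso_obj_sym: "iso_obj T X Y \<Longrightarrow> iso_obj T Y X"
  unfolding iso_obj_def by (metis iso_arrE iso_arrI)

lemma iso_arr_cmp:
  assumes "iso_arr T f" "iso_arr T g" "f \<in> Hom T X Y" "g \<in> Hom T Y Z"
  shows "iso_arr T (g \<bullet> f)"
proof -
  obtain f' where f': "f' \<in> Hom T Y X" "f' \<bullet> f = ident T X" "f \<bullet> f' = ident T Y"
    using iso_arrE assms by metis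
  obtain g' where g': "g' \<in> Hom T Z Y" "g' \<bullet> g = ident T Y" "g \<bullet> g' = ident T Z"
    using iso_arrE assms by metis
  have a: "g' \<bullet> (g \<bullet> f) = f" "f \<bullet> (f' \<bullet> g') = g'"
    using cmp_assoc[OF assms(3,4) g'(1)] cmp_assoc[OF g'(1) f'(1) assms(3)] f' g'
      cmp_ident_left[OF assms(3)] cmp_ident_left[OF g'(1)] by simp_all
  show ?thesis
  proof (rule iso_arrI)
    show "g \<bullet> f \<in> Hom T X Z" "f' \<bullet> g' \<in> Hom T Z X" using assms f' g' cmp_hom by blast+
    show "(f' \<bullet> g') \<bullet> (g \<bullet> f) = ident T X" "(g \<bullet> f) \<bullet> (f' \<bullet> g') = ident T Z"
      using a assms f' g' by (auto simp: Hom_def)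
  qed
qed

lemma iso_obj_trans: "iso_obj T X Y \<Longrightarrow> iso_obj T Y Z \<Longrightarrow> iso_obj T X Z"
  unfolding iso_obj_def using iso_arr_cmp cmp_hom by blast

text \<open>The Yoneda argument needs only the two ends as test objects. It can thus be applied to
  morphisms whose action is known only on a subcategory containing both ends.\<close>

lemma iso_arr_if_bij_precomp:
  assumes f: "f \<in> Hom T X Y"
    and bij: "\<And>Z. Z = X \<or> Z = Y \<Longrightarrow> bij_betw (\<lambda>g. g \<bullet> f) (Hom T Y Z) (Hom T X Z)"
  shows "iso_arr T f"
proof -
  note X = Hom_objD[OF f]
  have "ident T X \<in> (\<lambda>g. g \<bullet> f) ` Hom T Y X"
    using bij[of X] ident_hom[OF X(1)] by (auto simp: bij_betw_def)
  then obtain g where g: "g \<in> Hom T Y X" "g \<bullet> f = ident T X" by auto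
  have "(f \<bullet> g) \<bullet> f = ident T Y \<bullet> f" using f g by (auto simp: Hom_def)
  moreover have "inj_on (\<lambda>g. g \<bullet> f) (Hom T Y Y)" using bij[of Y] by (auto simp: bij_betw_def)
  ultimately have "f \<bullet> g = ident T Y"
    using cmp_hom[OF g(1) f] ident_hom[OF X(2)] by (auto dest: inj_onD)
  then show ?thesis using iso_arrI f g by blast
qed

lemma iso_arr_if_bij_postcomp:
  assumes f: "f \<in> Hom T X Y"
    and bij: "\<And>Z. Z = X \<or> Z = Y \<Longrightarrow> bij_betw (\<lambda>g. f \<bullet> g) (Hom T Z X) (Hom T Z Y)"
  shows "iso_arr T f"
proof -
  note X = Hom_objD[OF f]
  have "ident T Y \<in> (\<lambda>g. f \<bullet> g) ` Hom T Y X"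
    using bij[of Y] ident_hom[OF X(2)] by (auto simp: bij_betw_def)
  then obtain g where g: "g \<in> Hom T Y X" "f \<bullet> g = ident T Y" by (metis imageE)
  have "f \<bullet> (g \<bullet> f) = f \<bullet> ident T X"
    using f g cmp_assoc cmp_ident_left cmp_ident_right by metis
  moreover have "inj_on (\<lambda>g. f \<bullet> g) (Hom T X X)" using bij[of X] by (auto simp: bij_betw_def)
  ultimately have "g \<bullet> f = ident T X"
    using cmp_hom[OF f g(1)] ident_hom[OF X(1)] by (auto dest: inj_onD)
  then show ?thesis using iso_arrI f g by blast
qed

section \<open>Coproducts and their universal property\<close>

lemma is_coproduct_hom:
  assumes "is_coproduct T I X P \<iota>"
  shows "P \<in> obj T" "\<And>i. i \<in> I \<Longrightarrow> X i \<in> obj T" "\<And>i. i \<in> I \<Longrightarrow> \<iota> i \<in> Hom T (X i) P"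
  using assms by (auto simp: is_coproduct_def)

lemma coproduct_map:
  assumes "is_coproduct T I X P \<iota>" "Y \<in> obj T" "\<And>i. i \<in> I \<Longrightarrow> f i \<in> Hom T (X i) Y"
  obtains u where "u \<in> Hom T P Y" "\<And>i. i \<in> I \<Longrightarrow> u \<bullet> \<iota> i = f i"
proof -
  have "f \<in> (\<Pi> i\<in>I. Hom T (X i) Y)" using assms by auto
  then show ?thesis using assms that unfolding is_coproduct_def by metis
qed

lemma coproduct_eqI:
  assumes P: "is_coproduct T I X P \<iota>" and "u \<in> Hom T P Y" "v \<in> Hom T P Y"
    "\<And>i. i \<in> I \<Longrightarrow> u \<bullet> \<iota> i = v \<bullet> \<iota> i"
  shows "u = v"
proof -
  have "(\<lambda>i. u \<bullet> \<iota> i) \<in> (\<Pi> i\<in>I. Hom T (X i) Y)"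
    using is_coproduct_hom[OF P] assms cmp_hom by blast
  moreover have "Y \<in> obj T" using assms Hom_objD by blast
  ultimately have "\<exists>!w. w \<in> Hom T P Y \<and> (\<forall>i\<in>I. w \<bullet> \<iota> i = u \<bullet> \<iota> i)"
    using P unfolding is_coproduct_def by (metis (no_types, lifting))
  then show ?thesis using assms by metis
qed

text \<open>The definitions index coproducts by subsets of the type of \<open>\<kappa>\<close>; this
  moves them to other index types such as sets of morphisms.\<close>

lemma coproduct_reindex:
  assumes P: "is_coproduct T I X P \<iota>" and e: "bij_betw e J I"
  shows "is_coproduct T J (\<lambda>j. X (e j)) P (\<lambda>j. \<iota> (e j))"
  unfolding is_coproduct_def
proof (intro conjI ballI)
  have e': "\<And>j. j \<in> J \<Longrightarrow> e j \<in> I" using e by (auto simp: bij_betw_def)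
  show "P \<in> obj T" "\<And>j. j \<in> J \<Longrightarrow> X (e j) \<in> obj T"
    "\<And>j. j \<in> J \<Longrightarrow> \<iota> (e j) \<in> Hom T (X (e j)) P"
    using is_coproduct_hom[OF P] e' by auto
  fix Y f assume Y: "Y \<in> obj T" and f: "f \<in> (\<Pi> j\<in>J. Hom T (X (e j)) Y)"
  let ?d = "inv_into J e"
  have d: "?d i \<in> J" "e (?d i) = i" if "i \<in> I" for i
    using that e by (auto simp: bij_betw_def intro: inv_into_into f_inv_into_f)
  have de: "?d (e j) = j" if "j \<in> J" for j
    using that e by (auto simp: bij_betw_def)
  have fd: "f (?d i) \<in> Hom T (X i) Y" if "i \<in> I" for i
    using f d[OF that] by (metis PiE)
  obtain u where u: "u \<in> Hom T P Y" "\<And>i. i \<in> I \<Longrightarrow> u \<bullet> \<iota> i = f (?d i)"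
    using coproduct_map[where f="\<lambda>i. f (?d i)", OF P Y fd] by blast
  show "\<exists>!u. u \<in> Hom T P Y \<and> (\<forall>j\<in>J. u \<bullet> \<iota> (e j) = f j)"
  proof (rule ex1I[of _ u])
    show "u \<in> Hom T P Y \<and> (\<forall>j\<in>J. u \<bullet> \<iota> (e j) = f j)" using u e' de by simp
    fix v assume v: "v \<in> Hom T P Y \<and> (\<forall>j\<in>J. v \<bullet> \<iota> (e j) = f j)"
    show "v = u"
    proof (rule coproduct_eqI[OF P])
      show "v \<bullet> \<iota> i = u \<bullet> \<iota> i" if "i \<in> I" for i
        using v u(2)[OF that] d[OF that] by metis
    qed (use u v in auto)
  qed
qed

lemma coproduct_cong:
  assumes "is_coproduct T I X P \<iota>" "\<And>i. i \<in> I \<Longrightarrow> X i = X' i" "\<And>i. i \<in> I \<Longrightarrow> \<iota> i = \<iota>' i"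
  shows "is_coproduct T I X' P \<iota>'"
proof -
  have "(\<Pi> i\<in>I. Hom T (X i) Y) = (\<Pi> i\<in>I. Hom T (X' i) Y)" for Y
    using assms(2) by (auto simp: Pi_def)
  then show ?thesis using assms unfolding is_coproduct_def by (simp cong: ball_cong)
qed

end

context additive_category
begin

section \<open>Arithmetic in the groups of morphisms\<close>

abbreviation plus_infix (infixl "\<boxplus>" 65) where "f \<boxplus> g \<equiv> plus_arr T f g"
definition minus_arr (infixl "\<boxminus>" 65) where "f \<boxminus> g = f \<boxplus> neg_arr T g"

lemma hom_comm_group:
  assumes "f \<in> Hom T X Y"
  shows "comm_group (hom_group T X Y)"
  using hom_group Hom_objD[OF assms] by blast

lemma hom_group_simps [simp]:
  "carrier (hom_group T X Y) = Hom T X Y" "mult (hom_group T X Y) = plus_arr T"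
  "one (hom_group T X Y) = zero_arr T X Y"
  by (auto simp: hom_group_def)

lemma plus_hom [intro]: "f \<in> Hom T X Y \<Longrightarrow> g \<in> Hom T X Y \<Longrightarrow> f \<boxplus> g \<in> Hom T X Y"
  using comm_group.axioms(2)[OF hom_comm_group[of f X Y]]
    group.is_monoid monoid.m_closed[of "hom_group T X Y"] by fastforce

lemma zero_hom [intro]: "X \<in> obj T \<Longrightarrow> Y \<in> obj T \<Longrightarrow> zero_arr T X Y \<in> Hom T X Y"
  using monoid.one_closed[of "hom_group T X Y"] hom_group[of X Y] comm_group.axioms(2)
    group.is_monoid by fastforce

lemma neg_arr_eq: "f \<in> Hom T X Y \<Longrightarrow> neg_arr T f = inv\<^bsub>hom_group T X Y\<^esub> f"
  by (simp add: neg_arr_def Hom_def)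

lemma neg_hom [intro]: "f \<in> Hom T X Y \<Longrightarrow> neg_arr T f \<in> Hom T X Y"
  using group.inv_closed[OF comm_group.axioms(2)[OF hom_comm_group[of f X Y]], of f]
  by (simp add: neg_arr_eq)

lemma plus_zero:
  assumes "f \<in> Hom T X Y"
  shows "zero_arr T X Y \<boxplus> f = f" "f \<boxplus> zero_arr T X Y = f"
  using assms monoid.l_one[of "hom_group T X Y" f] monoid.r_one[of "hom_group T X Y" f]
    group.is_monoid[OF comm_group.axioms(2)[OF hom_comm_group[OF assms]]] by auto

lemma plus_neg:
  assumes "f \<in> Hom T X Y"
  shows "neg_arr T f \<boxplus> f = zero_arr T X Y" "f \<boxplus> neg_arr T f = zero_arr T X Y"
  using assms group.l_inv[OF comm_group.axioms(2)[OF hom_comm_group[OF assms]], of f]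
    group.r_inv[OF comm_group.axioms(2)[OF hom_comm_group[OF assms]], of f]
  by (auto simp: neg_arr_eq)

lemma plus_comm: "f \<in> Hom T X Y \<Longrightarrow> g \<in> Hom T X Y \<Longrightarrow> f \<boxplus> g = g \<boxplus> f"
  using comm_monoid.m_comm[OF comm_group.axioms(1)[OF hom_comm_group[of f X Y]], of f g] by auto

lemma plus_assoc:
  "f \<in> Hom T X Y \<Longrightarrow> g \<in> Hom T X Y \<Longrightarrow> h \<in> Hom T X Y \<Longrightarrow> (f \<boxplus> g) \<boxplus> h = f \<boxplus> (g \<boxplus> h)"
  using monoid.m_assoc[OF group.is_monoid[OF comm_group.axioms(2)[OF hom_comm_group[of f X Y]]], of f g h]
  by auto

lemma neg_unique:
  assumes "f \<in> Hom T X Y" "g \<in> Hom T X Y" "g \<boxplus> f = zero_arr T X Y"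
  shows "g = neg_arr T f"
  using plus_assoc[OF assms(2,1) neg_hom[OF assms(1)]] assms plus_neg(2)[OF assms(1)]
    plus_zero(1)[OF neg_hom[OF assms(1)]] plus_zero(2)[OF assms(2)] by simp

lemma neg_neg: "f \<in> Hom T X Y \<Longrightarrow> neg_arr T (neg_arr T f) = f"
  using neg_unique[of "neg_arr T f" X Y f] plus_neg neg_hom by metis

lemma idem_plus_zero:
  assumes "f \<in> Hom T X Y" "f \<boxplus> f = f"
  shows "f = zero_arr T X Y"
  using assms plus_assoc plus_neg plus_zero neg_hom by metis

lemma cmp_zero_left:
  assumes "f \<in> Hom T X Y" "Z \<in> obj T"
  shows "zero_arr T Y Z \<bullet> f = zero_arr T X Z"
proof (rule idem_plus_zero)
  have z: "zero_arr T Y Z \<in> Hom T Y Z" using assms Hom_objD by blast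
  then show "zero_arr T Y Z \<bullet> f \<in> Hom T X Z" using assms cmp_hom by blast
  show "zero_arr T Y Z \<bullet> f \<boxplus> zero_arr T Y Z \<bullet> f = zero_arr T Y Z \<bullet> f"
    using cmp_plus_left[OF assms(1) z z] plus_zero[OF z] by simp
qed

lemma cmp_zero_right:
  assumes "g \<in> Hom T Y Z" "X \<in> obj T"
  shows "g \<bullet> zero_arr T X Y = zero_arr T X Z"
proof (rule idem_plus_zero)
  have z: "zero_arr T X Y \<in> Hom T X Y" using assms Hom_objD by blast
  then show "g \<bullet> zero_arr T X Y \<in> Hom T X Z" using assms cmp_hom by blast
  show "g \<bullet> zero_arr T X Y \<boxplus> g \<bullet> zero_arr T X Y = g \<bullet> zero_arr T X Y"
    using cmp_plus_right[OF z z assms(1)] plus_zero[OF z] by simp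
qed

lemma cmp_neg_left:
  assumes "f \<in> Hom T X Y" "g \<in> Hom T Y Z"
  shows "neg_arr T g \<bullet> f = neg_arr T (g \<bullet> f)"
proof (rule neg_unique)
  show "g \<bullet> f \<in> Hom T X Z" "neg_arr T g \<bullet> f \<in> Hom T X Z" using assms cmp_hom neg_hom by blast+
  show "neg_arr T g \<bullet> f \<boxplus> g \<bullet> f = zero_arr T X Z"
    using assms cmp_plus_left[OF assms(1) neg_hom[OF assms(2)] assms(2)] plus_neg cmp_zero_left Hom_objD
    by metis
qed

lemma cmp_neg_right:
  assumes "f \<in> Hom T X Y" "g \<in> Hom T Y Z"
  shows "g \<bullet> neg_arr T f = neg_arr T (g \<bullet> f)"
proof (rule neg_unique)
  show "g \<bullet> f \<in> Hom T X Z" "g \<bullet> neg_arr T f \<in> Hom T X Z" using assms cmp_hom neg_hom by blast+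
  show "g \<bullet> neg_arr T f \<boxplus> g \<bullet> f = zero_arr T X Z"
    using assms cmp_plus_right[OF neg_hom[OF assms(1)] assms(1) assms(2)] plus_neg cmp_zero_right Hom_objD
    by metis
qed

lemma neg_zero: "X \<in> obj T \<Longrightarrow> Y \<in> obj T \<Longrightarrow> neg_arr T (zero_arr T X Y) = zero_arr T X Y"
  using neg_unique[of "zero_arr T X Y" X Y "zero_arr T X Y"] plus_zero zero_hom by metis

lemma neg_eq_zero: "f \<in> Hom T X Y \<Longrightarrow> neg_arr T f = zero_arr T X Y \<Longrightarrow> f = zero_arr T X Y"
  using neg_neg neg_zero Hom_objD by metis

lemma minus_hom [intro]: "f \<in> Hom T X Y \<Longrightarrow> g \<in> Hom T X Y \<Longrightarrow> f \<boxminus> g \<in> Hom T X Y"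
  unfolding minus_arr_def by blast

lemma cmp_minus_left:
  assumes "f \<in> Hom T X Y" "g \<in> Hom T Y Z" "g' \<in> Hom T Y Z"
  shows "(g \<boxminus> g') \<bullet> f = g \<bullet> f \<boxminus> g' \<bullet> f"
  unfolding minus_arr_def using cmp_plus_left[OF assms(1,2) neg_hom[OF assms(3)]]
    cmp_neg_left[OF assms(1,3)] by simp

lemma cmp_minus_right:
  assumes "f \<in> Hom T X Y" "f' \<in> Hom T X Y" "g \<in> Hom T Y Z"
  shows "g \<bullet> (f \<boxminus> f') = g \<bullet> f \<boxminus> g \<bullet> f'"
  unfolding minus_arr_def using cmp_plus_right[OF assms(1) neg_hom[OF assms(2)] assms(3)]
    cmp_neg_right[OF assms(2,3)] by simp

lemma minus_self: "f \<in> Hom T X Y \<Longrightarrow> f \<boxminus> f = zero_arr T X Y"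
  unfolding minus_arr_def by (rule plus_neg)

lemma minus_zero: "f \<in> Hom T X Y \<Longrightarrow> f \<boxminus> zero_arr T X Y = f"
  unfolding minus_arr_def using neg_zero plus_zero Hom_objD by metis

lemma minus_eq_zero:
  assumes "f \<in> Hom T X Y" "g \<in> Hom T X Y" "f \<boxminus> g = zero_arr T X Y"
  shows "f = g"
  using assms neg_unique[OF neg_hom[OF assms(2)] assms(1)] neg_neg unfolding minus_arr_def by metis

lemma minus_plus: "f \<in> Hom T X Y \<Longrightarrow> g \<in> Hom T X Y \<Longrightarrow> (f \<boxminus> g) \<boxplus> g = f"
  unfolding minus_arr_def using plus_assoc neg_hom plus_neg plus_zero by metis

lemma zero_obj_ident: "zero_obj T Z \<Longrightarrow> ident T Z = zero_arr T Z Z"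
  unfolding zero_obj_def using ident_hom zero_hom by metis

lemma zero_objI:
  assumes "Z \<in> obj T" "ident T Z = zero_arr T Z Z"
  shows "zero_obj T Z"
  unfolding zero_obj_def
proof (intro conjI ballI)
  fix X assume X: "X \<in> obj T"
  show "\<exists>!f. f \<in> Hom T X Z"
  proof (rule ex1I)
    show "zero_arr T X Z \<in> Hom T X Z" using X assms by blast
    show "f = zero_arr T X Z" if "f \<in> Hom T X Z" for f
      using that cmp_ident_left cmp_zero_left assms by metis
  qed
  show "\<exists>!f. f \<in> Hom T Z X"
  proof (rule ex1I)
    show "zero_arr T Z X \<in> Hom T Z X" using X assms by blast
    show "f = zero_arr T Z X" if "f \<in> Hom T Z X" for f
      using that cmp_ident_right cmp_zero_right assms by metis
  qed
qed (fact assms)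

lemma zero_obj_hom:
  assumes "zero_obj T Z"
  shows "f \<in> Hom T X Z \<Longrightarrow> f = zero_arr T X Z" "f \<in> Hom T Z X \<Longrightarrow> f = zero_arr T Z X"
proof -
  have Z: "Z \<in> obj T" using assms by (simp add: zero_obj_def)
  show "f = zero_arr T X Z" if f: "f \<in> Hom T X Z"
    using zero_obj_ident[OF assms] cmp_ident_left[OF f] cmp_zero_left[OF f Z] by simp
  show "f = zero_arr T Z X" if f: "f \<in> Hom T Z X"
    using zero_obj_ident[OF assms] cmp_ident_right[OF f] cmp_zero_right[OF f Z] by simp
qed

lemma zero_objD: "zero_obj T Z \<Longrightarrow> Z \<in> obj T"
  by (simp add: zero_obj_def)

lemma iso_zero_obj:
  assumes "iso_obj T X Y" "zero_obj T X"
  shows "zero_obj T Y"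
proof -
  obtain f g where fg: "f \<in> Hom T X Y" "g \<in> Hom T Y X" "f \<bullet> g = ident T Y"
    using assms unfolding iso_obj_def by (metis iso_arrE)
  moreover have "f = zero_arr T X Y" using zero_obj_hom assms fg by blast
  ultimately show ?thesis using zero_objI cmp_zero_left Hom_objD by metis
qed

lemma zero_arr_iso_zero_obj:
  assumes "iso_arr T (zero_arr T X Y)" "X \<in> obj T" "Y \<in> obj T"
  shows "zero_obj T Y" "zero_obj T X"
proof -
  obtain g where g: "g \<in> Hom T Y X" "zero_arr T X Y \<bullet> g = ident T Y" "g \<bullet> zero_arr T X Y = ident T X"
    using iso_arrE[OF assms(1) zero_hom[OF assms(2,3)]] by metis
  show "zero_obj T Y" "zero_obj T X"
    using zero_objI g cmp_zero_left cmp_zero_right assms by metis+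
qed

lemma additive_functor_zero:
  assumes F: "additive_endofunctor T Fo Fa" and X: "X \<in> obj T" "Y \<in> obj T"
  shows "Fa (zero_arr T X Y) = zero_arr T (Fo X) (Fo Y)"
proof (rule idem_plus_zero)
  have z: "zero_arr T X Y \<in> Hom T X Y" using X by blast
  then show "Fa (zero_arr T X Y) \<in> Hom T (Fo X) (Fo Y)"
    using F by (auto simp: additive_endofunctor_def endofunctor_def Hom_def)
  show "Fa (zero_arr T X Y) \<boxplus> Fa (zero_arr T X Y) = Fa (zero_arr T X Y)"
    using F z X plus_zero[OF z] by (metis additive_endofunctor_def)
qed

lemma additive_functor_hom:
  assumes F: "additive_endofunctor T Fo Fa" and f: "f \<in> Hom T X Y"
  shows "Fa f \<in> Hom T (Fo X) (Fo Y)"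
  using assms by (auto simp: additive_endofunctor_def endofunctor_def Hom_def)

lemma additive_functor_cmp:
  assumes F: "additive_endofunctor T Fo Fa" and f: "f \<in> Hom T X Y" "g \<in> Hom T Y Z"
  shows "Fa (g \<bullet> f) = Fa g \<bullet> Fa f"
  using assms by (auto simp: additive_endofunctor_def endofunctor_def Hom_def)

lemma additive_functor_neg:
  assumes F: "additive_endofunctor T Fo Fa" and f: "f \<in> Hom T X Y"
  shows "Fa (neg_arr T f) = neg_arr T (Fa f)"
proof (rule neg_unique)
  show "Fa f \<in> Hom T (Fo X) (Fo Y)" "Fa (neg_arr T f) \<in> Hom T (Fo X) (Fo Y)"
    using additive_functor_hom[OF F] f neg_hom by blast+
  show "Fa (neg_arr T f) \<boxplus> Fa f = zero_arr T (Fo X) (Fo Y)"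
    using F f neg_hom[OF f] plus_neg[OF f] additive_functor_zero[OF F] Hom_objD[OF f]
    by (metis additive_endofunctor_def)
qed

lemma coproduct_projection:
  assumes P: "is_coproduct T I X P \<iota>" and i: "i \<in> I"
  obtains \<pi> where "\<pi> \<in> Hom T P (X i)" "\<pi> \<bullet> \<iota> i = ident T (X i)"
    "\<And>j. j \<in> I \<Longrightarrow> j \<noteq> i \<Longrightarrow> \<pi> \<bullet> \<iota> j = zero_arr T (X j) (X i)"
proof -
  note h = is_coproduct_hom[OF P]
  have "(if j = i then ident T (X i) else zero_arr T (X j) (X i)) \<in> Hom T (X j) (X i)" if "j \<in> I" for j
    using h that i ident_hom zero_hom by auto
  from coproduct_map[where f="\<lambda>j. if j = i then ident T (X i) else zero_arr T (X j) (X i)",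
      OF P h(2)[OF i] this]
  obtain \<pi> where "\<pi> \<in> Hom T P (X i)"
    "\<And>j. j \<in> I \<Longrightarrow> \<pi> \<bullet> \<iota> j = (if j = i then ident T (X i) else zero_arr T (X j) (X i))"
    by blast
  then show ?thesis using that[of \<pi>] i by auto
qed

end

section \<open>Triangulated categories\<close>

text \<open>Stated for an abstract bijection so that one proof serves both the object part and the
  arrow part of the suspension.\<close>

lemma int_funpow_bij:
  fixes s :: "'a \<Rightarrow> 'a"
  assumes s: "bij_betw s A A"
    and pw: "\<And>n x. pw n x = (if 0 \<le> n then (s ^^ nat n) x else (inv_into A s ^^ nat (- n)) x)"
    and x: "x \<in> A"
  shows "pw n x \<in> A" "pw 0 x = x" "pw (m + n) x = pw m (pw n x)"
    "pw 1 x = s x" "pw (- 1) x = inv_into A s x"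
proof -
  let ?t = "inv_into A s"
  have sA: "y \<in> A \<Longrightarrow> s y \<in> A" for y using s by (auto simp: bij_betw_def)
  have tA: "y \<in> A \<Longrightarrow> ?t y \<in> A" for y
    using s by (metis bij_betw_imp_surj_on inv_into_into)
  have st: "y \<in> A \<Longrightarrow> s (?t y) = y" and ts: "y \<in> A \<Longrightarrow> ?t (s y) = y" for y
    using s by (auto simp: bij_betw_def f_inv_into_f)
  have sn: "y \<in> A \<Longrightarrow> (s ^^ k) y \<in> A" and tn: "y \<in> A \<Longrightarrow> (?t ^^ k) y \<in> A" for y k
    by (induction k) (auto simp: sA tA)
  have pA: "pw k y \<in> A" if "y \<in> A" for y k using that sn tn by (simp add: pw)
  have p1: "pw (k + 1) y = s (pw k y)" if "y \<in> A" for y k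
  proof (cases "0 \<le> k")
    case True
    then show ?thesis by (simp add: pw nat_add_distrib)
  next
    case False
    then obtain j where j: "k = - int (Suc j)" by (metis int_cases of_nat_0_le_iff)
    show ?thesis
    proof (cases j)
      case 0
      then show ?thesis using j st that by (simp add: pw)
    next
      case (Suc i)
      have "nat (- (k + 1)) = Suc i" "nat (- k) = Suc (Suc i)" "\<not> 0 \<le> k + 1" using j Suc by auto
      moreover have "?t ((?t ^^ i) y) \<in> A" using tA tn that by blast
      ultimately show ?thesis using False st by (simp add: pw)
    qed
  qed
  have p2: "pw (k - 1) y = ?t (pw k y)" if "y \<in> A" for y k
    using p1[OF that, of "k - 1"] ts pA[OF that] by simp
  show "pw n x \<in> A" "pw 0 x = x" using pA x by (auto simp: pw)
  show "pw 1 x = s x" "pw (- 1) x = ?t x" by (auto simp: pw)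
  have "pw m y \<in> A \<and> pw (m + n) x = pw m y" if "y = pw n x" for y
  proof (induction m rule: int_induct[where k = 0])
    case base
    show ?case using that pA[OF x] by (auto simp: pw)
  next
    case (step1 i)
    then show ?case using p1[OF x, of "i + n"] p1[of y i] that pA[OF x] sA
      by (auto simp: add_ac)
  next
    case (step2 i)
    then show ?case using p2[OF x, of "i + n"] p2[of y i] that pA[OF x] tA
      by (auto simp: algebra_simps)
  qed
  then show "pw (m + n) x = pw m (pw n x)" by blast
qed

context additive_category
begin

lemma additive_endofunctorI:
  assumes "\<And>X. X \<in> obj T \<Longrightarrow> Fo X \<in> obj T"
    and "\<And>f X Y. f \<in> Hom T X Y \<Longrightarrow> Fa f \<in> Hom T (Fo X) (Fo Y)"
    and "\<And>X. X \<in> obj T \<Longrightarrow> Fa (ident T X) = ident T (Fo X)"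
    and "\<And>f g X Y Z. f \<in> Hom T X Y \<Longrightarrow> g \<in> Hom T Y Z \<Longrightarrow> Fa (g \<bullet> f) = Fa g \<bullet> Fa f"
    and "\<And>f g X Y. f \<in> Hom T X Y \<Longrightarrow> g \<in> Hom T X Y \<Longrightarrow> Fa (f \<boxplus> g) = Fa f \<boxplus> Fa g"
  shows "additive_endofunctor T Fo Fa"
proof -
  have "endofunctor T Fo Fa"
    unfolding endofunctor_def
  proof (intro conjI ballI impI)
    fix f g assume "f \<in> arr T" "g \<in> arr T" "Cod T f = Dom T g"
    then show "Fa (g \<bullet> f) = Fa g \<bullet> Fa f" using assms(4)[of f _ "Dom T g" g] by (auto simp: Hom_def)
  qed (use assms(1-3) in \<open>auto simp: Hom_def\<close>)
  then show ?thesis unfolding additive_endofunctor_def using assms(5) by blast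
qed

lemma additive_functor_ident:
  "additive_endofunctor T Fo Fa \<Longrightarrow> X \<in> obj T \<Longrightarrow> Fa (ident T X) = ident T (Fo X)"
  "additive_endofunctor T Fo Fa \<Longrightarrow> X \<in> obj T \<Longrightarrow> Fo X \<in> obj T"
  by (auto simp: additive_endofunctor_def endofunctor_def)

lemma additive_functor_plus:
  "additive_endofunctor T Fo Fa \<Longrightarrow> f \<in> Hom T X Y \<Longrightarrow> g \<in> Hom T X Y \<Longrightarrow> Fa (f \<boxplus> g) = Fa f \<boxplus> Fa g"
  using Hom_objD[of f X Y] by (auto simp: additive_endofunctor_def)

lemma additive_functor_comp:
  assumes F: "additive_endofunctor T Fo Fa" and G: "additive_endofunctor T Go Ga"
    and o: "\<And>X. X \<in> obj T \<Longrightarrow> Ho X = Go (Fo X)" and a: "\<And>f. f \<in> arr T \<Longrightarrow> Ha f = Ga (Fa f)"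
  shows "additive_endofunctor T Ho Ha"
proof (rule additive_endofunctorI)
  have a': "f \<in> Hom T X Y \<Longrightarrow> Ha f = Ga (Fa f)" for f X Y using a by (auto simp: Hom_def)
  note h = additive_functor_hom[OF F] additive_functor_hom[OF G]
  show "Ho X \<in> obj T" "Ha (ident T X) = ident T (Ho X)" if "X \<in> obj T" for X
    using that o additive_functor_ident[OF F] additive_functor_ident[OF G] a by simp_all
  show "Ha f \<in> Hom T (Ho X) (Ho Y)" if "f \<in> Hom T X Y" for f X Y
    using h(2)[OF h(1)[OF that]] that a' o Hom_objD[OF that] by simp
  show "Ha (g \<bullet> f) = Ha g \<bullet> Ha f" if "f \<in> Hom T X Y" "g \<in> Hom T Y Z" for f g X Y Z
    using that a' cmp_hom[OF that] h(1) additive_functor_cmp[OF F that]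
      additive_functor_cmp[OF G h(1)[OF that(1)] h(1)[OF that(2)]] by simp
  show "Ha (f \<boxplus> g) = Ha f \<boxplus> Ha g" if "f \<in> Hom T X Y" "g \<in> Hom T X Y" for f g X Y
    using that a' plus_hom[OF that] additive_functor_plus[OF F that]
      additive_functor_plus[OF G h(1)[OF that(1)] h(1)[OF that(2)]] by simp
qed

end

text \<open>Only morphisms of degree zero are tested. For \<open>S\<close> closed under suspensions
  this is the vanishing of the graded morphism groups.\<close>

definition right_perp :: "('o, 'm, 'z) preadditive_category_scheme \<Rightarrow> 'o set \<Rightarrow> 'o set" where
  "right_perp T S = {Y \<in> obj T. \<forall>X \<in> S. Hom T X Y \<subseteq> {zero_arr T X Y}}"

definition left_perp :: "('o, 'm, 'z) preadditive_category_scheme \<Rightarrow> 'o set \<Rightarrow> 'o set" where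
  "left_perp T S = {X \<in> obj T. \<forall>Y \<in> S. Hom T X Y \<subseteq> {zero_arr T X Y}}"

definition susp_closed :: "('o, 'm, 'z) triangulated_category_scheme \<Rightarrow> 'o set \<Rightarrow> bool" where
  "susp_closed T S \<longleftrightarrow> S \<subseteq> obj T \<and> (\<forall>n. \<forall>X \<in> S. susp_pow_obj T n X \<in> S)"

context triangulated_category
begin

abbreviation Sg where "Sg \<equiv> susp_pow_obj T"
abbreviation Sa where "Sa \<equiv> susp_pow_arr T"

lemma susp_eq: "susp_obj T = Sg 1" "susp_arr T = Sa 1"
  by (auto simp: susp_pow_obj_def susp_pow_arr_def fun_eq_iff)

lemma susp_functor': "additive_endofunctor T (Sg 1) (Sa 1)"
  using susp_functor by (simp add: susp_eq)

lemma Sg_pow: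
  assumes "X \<in> obj T"
  shows "Sg n X \<in> obj T" "Sg 0 X = X" "Sg m (Sg n X) = Sg (m + n) X" "susp_obj T X = Sg 1 X"
  using int_funpow_bij[OF susp_obj_bij susp_pow_obj_def assms] by auto

lemma Sa_pow:
  assumes "f \<in> arr T"
  shows "Sa n f \<in> arr T" "Sa 0 f = f" "Sa m (Sa n f) = Sa (m + n) f" "susp_arr T f = Sa 1 f"
  using int_funpow_bij[OF susp_arr_bij susp_pow_arr_def assms] by auto

text \<open>The inverse of the suspension inherits identities, composition and sums because the
  suspension is injective on arrows. Induction in both directions then reaches every
  integer.\<close>

lemma Sa_functor: "additive_endofunctor T (Sg n) (Sa n)"
proof -
  have Fo: "X \<in> obj T \<Longrightarrow> Sg m X \<in> obj T" and Fa: "f \<in> arr T \<Longrightarrow> Sa m f \<in> arr T" for m X f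
    using Sg_pow Sa_pow by blast+
  have inv1: "X \<in> obj T \<Longrightarrow> Sg (- 1) (Sg 1 X) = X" "X \<in> obj T \<Longrightarrow> Sg 1 (Sg (- 1) X) = X"
    and inv2: "f \<in> arr T \<Longrightarrow> Sa (- 1) (Sa 1 f) = f" "f \<in> arr T \<Longrightarrow> Sa 1 (Sa (- 1) f) = f" for X f
    using Sg_pow Sa_pow by auto
  note F = susp_functor'
  have h: "Sa (- 1) f \<in> Hom T (Sg (- 1) X) (Sg (- 1) Y)" if "f \<in> Hom T X Y" for f X Y
  proof -
    let ?g = "Sa (- 1) f"
    have f: "f \<in> arr T" using that by (simp add: Hom_def)
    have g: "?g \<in> Hom T (Dom T ?g) (Cod T ?g)" using Fa[OF f] by (simp add: Hom_def)
    \<comment> \<open>The ends of \<open>?g\<close> are not known yet; suspending it shows that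
      their suspensions are \<open>X\<close> and \<open>Y\<close>.\<close>
    have "f \<in> Hom T (Sg 1 (Dom T ?g)) (Sg 1 (Cod T ?g))"
      using additive_functor_hom[OF F g] inv2(2)[OF f] by simp
    then have "X = Sg 1 (Dom T ?g)" "Y = Sg 1 (Cod T ?g)" using that by (auto simp: Hom_def)
    then show ?thesis using g inv1(1) Hom_objD[OF g] by simp
  qed
  have inj: "f = g" if "Sa 1 f = Sa 1 g" "f \<in> arr T" "g \<in> arr T" for f g
    using inv2(1) that by metis
  have G: "additive_endofunctor T (Sg (- 1)) (Sa (- 1))"
  proof (rule additive_endofunctorI)
    show "Sg (- 1) X \<in> obj T" if "X \<in> obj T" for X using that Fo by blast
    show "Sa (- 1) f \<in> Hom T (Sg (- 1) X) (Sg (- 1) Y)" if "f \<in> Hom T X Y" for f X Y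
      using that h by blast
    show "Sa (- 1) (ident T X) = ident T (Sg (- 1) X)" if "X \<in> obj T" for X
    proof (rule inj)
      show "Sa 1 (Sa (- 1) (ident T X)) = Sa 1 (ident T (Sg (- 1) X))"
        using inv2(2)[of "ident T X"] inv1(2)[OF that]
          additive_functor_ident(1)[OF F Fo[OF that, of "- 1"]] that by simp
      show "Sa (- 1) (ident T X) \<in> arr T" "ident T (Sg (- 1) X) \<in> arr T"
        using that Fa Fo by auto
    qed
    show "Sa (- 1) (g \<bullet> f) = Sa (- 1) g \<bullet> Sa (- 1) f" if "f \<in> Hom T X Y" "g \<in> Hom T Y Z" for f g X Y Z
    proof (rule inj)
      show "Sa 1 (Sa (- 1) (g \<bullet> f)) = Sa 1 (Sa (- 1) g \<bullet> Sa (- 1) f)"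
        using that additive_functor_cmp[OF F h h, OF that] inv2(2) cmp_hom[OF that]
        by (auto simp: Hom_def)
      show "Sa (- 1) (g \<bullet> f) \<in> arr T" "Sa (- 1) g \<bullet> Sa (- 1) f \<in> arr T"
        using HomD(1)[OF h[OF cmp_hom[OF that]]] HomD(1)[OF cmp_hom[OF h h, OF that]] by auto
    qed
    show "Sa (- 1) (f \<boxplus> g) = Sa (- 1) f \<boxplus> Sa (- 1) g" if "f \<in> Hom T X Y" "g \<in> Hom T X Y" for f g X Y
    proof (rule inj)
      show "Sa 1 (Sa (- 1) (f \<boxplus> g)) = Sa 1 (Sa (- 1) f \<boxplus> Sa (- 1) g)"
        using that additive_functor_plus[OF F h h, OF that] inv2(2) plus_hom[OF that]
        by (auto simp: Hom_def)
      show "Sa (- 1) (f \<boxplus> g) \<in> arr T" "Sa (- 1) f \<boxplus> Sa (- 1) g \<in> arr T"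
        using HomD(1)[OF h[OF plus_hom[OF that]]] HomD(1)[OF plus_hom[OF h h, OF that]] by auto
    qed
  qed
  show ?thesis
  proof (induction n rule: int_induct[where k = 0])
    case base
    show ?case by (rule additive_endofunctorI) (auto simp: susp_pow_obj_def susp_pow_arr_def)
  next
    case (step1 i)
    show ?case by (rule additive_functor_comp[OF step1(2) F]) (auto simp: Sg_pow Sa_pow add_ac)
  next
    case (step2 i)
    show ?case by (rule additive_functor_comp[OF step2(2) G]) (auto simp: Sg_pow Sa_pow)
  qed
qed

lemma Sg_0 [simp]: "Sg 0 X = X" "Sa 0 f = f"
  by (auto simp: susp_pow_obj_def susp_pow_arr_def)

lemma Sg_obj [simp, intro]: "X \<in> obj T \<Longrightarrow> Sg n X \<in> obj T"
  by (rule Sg_pow)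

lemma Sg_Sg [simp]: "X \<in> obj T \<Longrightarrow> Sg m (Sg n X) = Sg (m + n) X"
  by (rule Sg_pow)

lemma Sa_Sa [simp]: "f \<in> arr T \<Longrightarrow> Sa m (Sa n f) = Sa (m + n) f"
  by (rule Sa_pow)

lemmas Sa_hom = additive_functor_hom[OF Sa_functor]
lemmas Sa_cmp = additive_functor_cmp[OF Sa_functor]
lemmas Sa_ident = additive_functor_ident(1)[OF Sa_functor]
lemmas Sa_zero = additive_functor_zero[OF Sa_functor]
lemmas Sa_neg = additive_functor_neg[OF Sa_functor]
lemma Sa_inj:
  assumes "Sa n f = Sa n g" "f \<in> arr T" "g \<in> arr T"
  shows "f = g"
proof -
  have "Sa (- n) (Sa n f) = f" "Sa (- n) (Sa n g) = g" using assms(2,3) by simp_all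
  then show ?thesis using assms(1) by metis
qed

lemma Sa_surj:
  assumes g: "g \<in> Hom T (Sg n X) (Sg n Y)" and X: "X \<in> obj T" "Y \<in> obj T"
  obtains f where "f \<in> Hom T X Y" "g = Sa n f"
proof
  show "Sa (- n) g \<in> Hom T X Y" using Sa_hom[OF g, of "- n"] X by simp
  show "g = Sa n (Sa (- n) g)" using g by (simp add: Hom_def)
qed

lemma Sa_eq_zero:
  assumes "Sa n f = zero_arr T (Sg n X) (Sg n Y)" "f \<in> Hom T X Y"
  shows "f = zero_arr T X Y"
  using assms Sa_inj[of n f "zero_arr T X Y"] Sa_zero[of X Y n] Hom_objD[OF assms(2)]
  by (auto simp: Hom_def HomD(1)[OF zero_hom])

lemma Sa_coproduct:
  assumes P: "is_coproduct T I X P \<iota>"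
  shows "is_coproduct T I (\<lambda>i. Sg n (X i)) (Sg n P) (\<lambda>i. Sa n (\<iota> i))"
  unfolding is_coproduct_def
proof (intro conjI ballI)
  note h = is_coproduct_hom[OF P]
  show "Sg n P \<in> obj T" "\<And>i. i \<in> I \<Longrightarrow> Sg n (X i) \<in> obj T"
    "\<And>i. i \<in> I \<Longrightarrow> Sa n (\<iota> i) \<in> Hom T (Sg n (X i)) (Sg n P)"
    using h Sa_hom by auto
  fix Y f assume Y: "Y \<in> obj T" and f: "f \<in> (\<Pi> i\<in>I. Hom T (Sg n (X i)) Y)"
  have "Sa (- n) (f i) \<in> Hom T (X i) (Sg (- n) Y)" if "i \<in> I" for i
    using Sa_hom[of "f i" "Sg n (X i)" Y "- n"] f h that by (auto simp: Pi_def)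
  then obtain u where u: "u \<in> Hom T P (Sg (- n) Y)" "\<And>i. i \<in> I \<Longrightarrow> u \<bullet> \<iota> i = Sa (- n) (f i)"
    using coproduct_map[where f="\<lambda>i. Sa (- n) (f i)", OF P] Y by (metis Sg_obj)
  have SY: "Sg n (Sg (- n) Y) = Y" using Y by simp
  have fi: "f i \<in> arr T" if "i \<in> I" for i using f that by (auto simp: Pi_def Hom_def)
  show "\<exists>!w. w \<in> Hom T (Sg n P) Y \<and> (\<forall>i\<in>I. w \<bullet> Sa n (\<iota> i) = f i)"
  proof (rule ex1I)
    show "Sa n u \<in> Hom T (Sg n P) Y \<and> (\<forall>i\<in>I. Sa n u \<bullet> Sa n (\<iota> i) = f i)"
    proof (intro conjI ballI)
      show "Sa n u \<in> Hom T (Sg n P) Y" using Sa_hom[OF u(1), of n] SY by simp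
      show "Sa n u \<bullet> Sa n (\<iota> i) = f i" if "i \<in> I" for i
        using Sa_cmp[OF h(3)[OF that] u(1), of n] u(2)[OF that] fi[OF that] by simp
    qed
    fix w assume w: "w \<in> Hom T (Sg n P) Y \<and> (\<forall>i\<in>I. w \<bullet> Sa n (\<iota> i) = f i)"
    then obtain w' where w': "w' \<in> Hom T P (Sg (- n) Y)" "w = Sa n w'"
      using Sa_surj[of w n P "Sg (- n) Y"] h Y SY by auto
    have "w' = u"
    proof (rule coproduct_eqI[OF P w'(1) u(1)])
      fix i assume i: "i \<in> I"
      have a: "w' \<bullet> \<iota> i \<in> arr T" "u \<bullet> \<iota> i \<in> arr T"
        using HomD(1)[OF cmp_hom[OF h(3)[OF i]]] w' u by auto
      have "Sa n (w' \<bullet> \<iota> i) = Sa n (u \<bullet> \<iota> i)"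
        using Sa_cmp[OF h(3)[OF i] w'(1), of n] w w'(2) u(2)[OF i] fi[OF i] i by simp
      then show "w' \<bullet> \<iota> i = u \<bullet> \<iota> i" using Sa_inj a by blast
    qed
    then show "w = Sa n u" using w' by simp
  qed
qed

section \<open>Exact triangles with named vertices, and factorization through them\<close>

definition tri where
  "tri X Y Z f g h \<longleftrightarrow> (f, g, h) \<in> exact_triangles T \<and>
     f \<in> Hom T X Y \<and> g \<in> Hom T Y Z \<and> h \<in> Hom T Z (Sg 1 X)"

lemma exact_tri:
  "(f, g, h) \<in> exact_triangles T \<Longrightarrow> tri (Dom T f) (Dom T g) (Dom T h) f g h"
  using exact_is_triangle[of f g h] by (auto simp: tri_def is_triangle_def Hom_def susp_eq)

lemma triD:
  assumes "tri X Y Z f g h"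
  shows "(f, g, h) \<in> exact_triangles T" "f \<in> Hom T X Y" "g \<in> Hom T Y Z" "h \<in> Hom T Z (Sg 1 X)"
    "X \<in> obj T" "Y \<in> obj T" "Z \<in> obj T"
  using assms Hom_objD unfolding tri_def by blast+

lemma tri_cone:
  assumes "f \<in> Hom T X Y"
  obtains Z g h where "tri X Y Z f g h"
proof -
  obtain g h where "(f, g, h) \<in> exact_triangles T" using TR1_cone[OF HomD(1)[OF assms]] by blast
  then have "tri (Dom T f) (Dom T g) (Dom T h) f g h" by (rule exact_tri)
  moreover have "Dom T f = X" "Dom T g = Y" using assms calculation by (auto simp: tri_def Hom_def)
  ultimately show ?thesis using that by auto
qed

lemma tri_rotate:
  assumes t: "tri X Y Z f g h"
  shows "tri Y Z (Sg 1 X) g h (neg_arr T (Sa 1 f))"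
proof -
  note d = triD[OF t]
  have "(g, h, neg_arr T (Sa 1 f)) \<in> exact_triangles T"
    using d(1) TR2[OF exact_is_triangle[OF d(1)]] by (simp add: susp_eq)
  moreover have "neg_arr T (Sa 1 f) \<in> Hom T (Sg 1 X) (Sg 1 Y)"
    using Sa_hom d(2) neg_hom by blast
  ultimately show ?thesis using d by (simp add: tri_def)
qed

lemma tri_rotate_back:
  assumes t: "tri X Y Z f g h"
  shows "tri (Sg (- 1) Z) X Y (neg_arr T (Sa (- 1) h)) f g"
proof -
  note d = triD[OF t]
  let ?k = "neg_arr T (Sa (- 1) h)"
  have k0: "Sa (- 1) h \<in> Hom T (Sg (- 1) Z) X" using Sa_hom[OF d(4), of "- 1"] d(5) by simp
  then have k: "?k \<in> Hom T (Sg (- 1) Z) X" by (rule neg_hom)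
  have g: "g \<in> Hom T Y (Sg 1 (Sg (- 1) Z))" using d by simp
  have "is_triangle T ?k f g"
    using k d(2) g by (auto simp: is_triangle_def Hom_def susp_eq)
  moreover have "neg_arr T (Sa 1 ?k) = h"
    using Sa_neg[OF k0, of 1] HomD(1)[OF d(4)] neg_neg[OF d(4)] by simp
  ultimately have "(?k, f, g) \<in> exact_triangles T"
    using TR2[of ?k f g] d(1) by (simp add: susp_eq)
  then show ?thesis using k d(2) g by (simp add: tri_def)
qed

lemma tri_morphism:
  assumes t: "tri X Y Z f g h" "tri X' Y' Z' f' g' h'"
    and ab: "a \<in> Hom T X X'" "b \<in> Hom T Y Y'" "b \<bullet> f = f' \<bullet> a"
  obtains c where "c \<in> Hom T Z Z'" "c \<bullet> g = g' \<bullet> b" "Sa 1 a \<bullet> h = h' \<bullet> c"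
proof -
  note d = triD[OF t(1)] triD[OF t(2)]
  have "\<exists>c. triangle_morphism T (f, g, h) (f', g', h') a b c"
    using TR3[OF d(1) d(8)] ab d by (auto simp: Hom_def)
  then show ?thesis using that d by (auto simp: triangle_morphism_def Hom_def susp_eq)
qed

lemma tri_ident:
  assumes X: "X \<in> obj T"
  obtains Z where "zero_obj T Z" "tri X X Z (ident T X) (zero_arr T X Z) (zero_arr T Z (Sg 1 X))"
proof -
  obtain Z where Z: "zero_obj T Z" using ex_zero_obj by blast
  then have "tri X X Z (ident T X) (zero_arr T X Z) (zero_arr T Z (Sg 1 X))"
    using TR1_ident[OF X Z] X zero_objD[OF Z] zero_hom ident_hom by (auto simp: tri_def susp_eq)
  then show ?thesis using that Z by blast
qed

text \<open>Mapping the triangle on \<open>ident T X\<close> to the given one makes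
  \<open>g \<bullet> f\<close> factor through a zero object. The other two composites follow by
  rotation.\<close>

lemma tri_cmp_zero:
  assumes t: "tri X Y Z f g h"
  shows "g \<bullet> f = zero_arr T X Z" "h \<bullet> g = zero_arr T Y (Sg 1 X)" "Sa 1 f \<bullet> h = zero_arr T Z (Sg 1 Y)"
proof -
  have *: "g \<bullet> f = zero_arr T X Z" if t: "tri X Y Z f g h" for X Y Z f g h
  proof -
    note d = triD[OF t]
    obtain N where N: "zero_obj T N"
      "tri X X N (ident T X) (zero_arr T X N) (zero_arr T N (Sg 1 X))" using tri_ident d by blast
    have "f \<bullet> ident T X = f \<bullet> ident T X" ..
    from tri_morphism[OF N(2) t ident_hom[OF d(5)] d(2) this]
    obtain c where "c \<in> Hom T N Z" "c \<bullet> zero_arr T X N = g \<bullet> f" by blast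
    then show ?thesis using cmp_zero_right[of c N Z X] d by simp
  qed
  show "g \<bullet> f = zero_arr T X Z" using * t by blast
  show "h \<bullet> g = zero_arr T Y (Sg 1 X)" using *[OF tri_rotate[OF t]] .
  have "neg_arr T (Sa 1 f) \<bullet> h = zero_arr T Z (Sg 1 Y)" using *[OF tri_rotate[OF tri_rotate[OF t]]] .
  then show "Sa 1 f \<bullet> h = zero_arr T Z (Sg 1 Y)"
    using cmp_neg_left neg_eq_zero cmp_hom Sa_hom triD[OF t] by metis
qed

text \<open>The pair consisting of zero and \<open>w\<close> is a map from \<open>f\<close> to the
  first morphism of the triangle with vertices \<open>0\<close>, \<open>W\<close>, \<open>W\<close>.
  Its completion by TR3 is the factorization.\<close>

lemma tri_factor_right:
  assumes t: "tri X Y Z f g h" and w: "w \<in> Hom T Y W" "w \<bullet> f = zero_arr T X W"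
  obtains v where "v \<in> Hom T Z W" "w = v \<bullet> g"
proof -
  note d = triD[OF t]
  have W: "W \<in> obj T" using w Hom_objD by blast
  obtain N where N: "zero_obj T N"
    "tri W W N (ident T W) (zero_arr T W N) (zero_arr T N (Sg 1 W))" using tri_ident W by blast
  let ?k = "neg_arr T (Sa (- 1) (zero_arr T N (Sg 1 W)))"
  have t': "tri (Sg (- 1) N) W W ?k (ident T W) (zero_arr T W N)" by (rule tri_rotate_back[OF N(2)])
  have z: "zero_arr T X (Sg (- 1) N) \<in> Hom T X (Sg (- 1) N)" using d N zero_objD by blast
  have "?k \<bullet> zero_arr T X (Sg (- 1) N) = zero_arr T X W"
    using cmp_zero_right[OF triD(2)[OF t'] d(5)] .
  then have "w \<bullet> f = ?k \<bullet> zero_arr T X (Sg (- 1) N)" using w by simp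
  from tri_morphism[OF t t' z w(1) this]
  obtain c where c: "c \<in> Hom T Z W" "c \<bullet> g = ident T W \<bullet> w" by blast
  then show ?thesis using that w cmp_ident_left by metis
qed

text \<open>Dual to \<open>tri_factor_right\<close>, but TR3 only completes the third morphism. Both
  triangles are therefore rotated, the completion goes from \<open>Sg 1 W\<close> to
  \<open>Sg 1 X\<close>, and it is desuspended; the two rotation signs cancel.\<close>

lemma tri_factor_left:
  assumes t: "tri X Y Z f g h" and u: "u \<in> Hom T W Y" "g \<bullet> u = zero_arr T W Z"
  obtains v where "v \<in> Hom T W X" "u = f \<bullet> v"
proof -
  note d = triD[OF t]
  have W: "W \<in> obj T" using u Hom_objD by blast
  obtain N where N: "zero_obj T N"
    "tri W W N (ident T W) (zero_arr T W N) (zero_arr T N (Sg 1 W))" using tri_ident W by blast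
  have z: "zero_arr T N Z \<in> Hom T N Z" using d N zero_objD by blast
  have "zero_arr T N Z \<bullet> zero_arr T W N = g \<bullet> u"
    using cmp_zero_right[OF z W] u by simp
  from tri_morphism[OF tri_rotate[OF N(2)] tri_rotate[OF t] u(1) z this]
  obtain c where c: "c \<in> Hom T (Sg 1 W) (Sg 1 X)"
    "Sa 1 u \<bullet> neg_arr T (Sa 1 (ident T W)) = neg_arr T (Sa 1 f) \<bullet> c" by blast
  obtain v where v: "v \<in> Hom T W X" "c = Sa 1 v" using Sa_surj[OF c(1) W d(5)] by blast
  have fv: "f \<bullet> v \<in> Hom T W Y" using d v cmp_hom by blast
  have "neg_arr T (Sa 1 u) = neg_arr T (Sa 1 (f \<bullet> v))"
    using c(2) cmp_neg_right[OF Sa_hom[OF ident_hom[OF W]] Sa_hom[OF u(1)]]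
      cmp_neg_left[OF c(1) Sa_hom[OF d(2)]] Sa_cmp[OF v(1) d(2)] v(2)
      Sa_ident[OF W] cmp_ident_right[OF Sa_hom[OF u(1)]] by simp
  then have "Sa 1 u = Sa 1 (f \<bullet> v)" 
    using neg_neg[OF Sa_hom[OF u(1)], of 1] neg_neg[OF Sa_hom[OF fv], of 1] by metis
  then have "u = f \<bullet> v" using Sa_inj HomD(1)[OF u(1)] HomD(1)[OF fv] by blast
  then show ?thesis using that v by blast
qed

text \<open>A suspended triangle is exact only up to sign, so \<open>u\<close> is desuspended
  instead of suspending the triangle.\<close>

lemma tri_factor_left_pow:
  assumes t: "tri X Y Z f g h" and u: "u \<in> Hom T W (Sg k Y)" "Sa k g \<bullet> u = zero_arr T W (Sg k Z)"
  obtains v where "v \<in> Hom T W (Sg k X)" "u = Sa k f \<bullet> v"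
proof -
  note d = triD[OF t]
  have W: "W \<in> obj T" using u Hom_objD by blast
  have u': "u \<in> Hom T (Sg k (Sg (- k) W)) (Sg k Y)" using u W by simp
  obtain u0 where u0: "u0 \<in> Hom T (Sg (- k) W) Y" "u = Sa k u0"
    using Sa_surj[OF u'] d W by blast
  have "Sa k (g \<bullet> u0) = zero_arr T (Sg k (Sg (- k) W)) (Sg k Z)"
    using Sa_cmp[OF u0(1) d(3), of k] u u0 W by simp
  then have "g \<bullet> u0 = zero_arr T (Sg (- k) W) Z" using Sa_eq_zero cmp_hom[OF u0(1) d(3)] by blast
  then obtain v0 where v0: "v0 \<in> Hom T (Sg (- k) W) X" "u0 = f \<bullet> v0"
    using tri_factor_left[OF t u0(1)] by blast
  have "Sa k v0 \<in> Hom T W (Sg k X)" using Sa_hom[OF v0(1), of k] W by simp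
  moreover have "u = Sa k f \<bullet> Sa k v0" using u0 v0 Sa_cmp[OF v0(1) d(2)] by simp
  ultimately show ?thesis using that by blast
qed

lemma iso_if_cone_zero:
  assumes t: "tri X Y Z f g h" and Z: "zero_obj T Z"
  shows "iso_arr T f"
proof -
  note d = triD[OF t]
  have "g \<bullet> ident T Y = zero_arr T Y Z"
    using zero_obj_hom(1)[OF Z] d(3) cmp_ident_right by metis
  then obtain v where v: "v \<in> Hom T Y X" "ident T Y = f \<bullet> v"
    using tri_factor_left[OF t ident_hom[OF d(6)]] by blast
  \<comment> \<open>\<open>v\<close> is a right inverse. The difference of
    \<open>v \<bullet> f\<close> and the identity is killed by \<open>f\<close>, so it factors
    through the desuspended \<open>h\<close>, which is zero.\<close>
  have fvf: "f \<bullet> (v \<bullet> f) = f \<bullet> ident T X"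
    using v d cmp_assoc[OF d(2) v(1) d(2)] cmp_ident_left[OF d(2)] cmp_ident_right[OF d(2)] by simp
  have vf: "v \<bullet> f \<in> Hom T X X" using v d cmp_hom by blast
  have m: "v \<bullet> f \<boxminus> ident T X \<in> Hom T X X" using vf ident_hom d by blast
  have "f \<bullet> (v \<bullet> f \<boxminus> ident T X) = zero_arr T X Y"
    using cmp_minus_right[OF vf ident_hom[OF d(5)] d(2)] fvf minus_self[OF d(2)] cmp_ident_right[OF d(2)]
    by simp
  then obtain w where w: "w \<in> Hom T X (Sg (- 1) Z)"
    "v \<bullet> f \<boxminus> ident T X = neg_arr T (Sa (- 1) h) \<bullet> w"
    using tri_factor_left[OF tri_rotate_back[OF t] m] by blast
  have "h = zero_arr T Z (Sg 1 X)" using zero_obj_hom(2)[OF Z d(4)] .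
  then have "neg_arr T (Sa (- 1) h) = zero_arr T (Sg (- 1) Z) X"
    using Sa_zero[of Z "Sg 1 X" "- 1"] neg_zero d by simp
  then have "v \<bullet> f \<boxminus> ident T X = zero_arr T X X" using w cmp_zero_left d by metis
  then have "v \<bullet> f = ident T X" using minus_eq_zero vf ident_hom d by blast
  then show ?thesis using iso_arrI d v by metis
qed

text \<open>If \<open>f\<close> is invertible, then \<open>g\<close> and \<open>h\<close> vanish.
  The identity of \<open>Z\<close> is killed by \<open>h\<close>, hence factors through
  \<open>g\<close>, hence is zero.\<close>

lemma cone_zero_if_iso:
  assumes t: "tri X Y Z f g h" and i: "iso_arr T f"
  shows "zero_obj T Z"
proof -
  note d = triD[OF t] and z = tri_cmp_zero[OF t]
  obtain f' where f': "f' \<in> Hom T Y X" "f' \<bullet> f = ident T X" "f \<bullet> f' = ident T Y"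
    using iso_arrE[OF i d(2)] by metis
  have "g = g \<bullet> (f \<bullet> f')" using f' d cmp_ident_right by metis
  also have "\<dots> = zero_arr T Y Z"
    using cmp_assoc[OF f'(1) d(2) d(3)] z cmp_zero_left f' d by metis
  finally have g: "g = zero_arr T Y Z" .
  have "h = Sa 1 (f' \<bullet> f) \<bullet> h" using f' d Sa_ident cmp_ident_left by metis
  also have "\<dots> = Sa 1 f' \<bullet> (Sa 1 f \<bullet> h)"
    using Sa_cmp[OF d(2) f'(1)] cmp_assoc[OF d(4) Sa_hom[OF d(2)] Sa_hom[OF f'(1)]] by simp
  also have "\<dots> = zero_arr T Z (Sg 1 X)" using z cmp_zero_right[OF Sa_hom[OF f'(1)] d(7)] by simp
  finally have "h \<bullet> ident T Z = zero_arr T Z (Sg 1 X)" using cmp_ident_right d by metis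
  then obtain v where "v \<in> Hom T Z Y" "ident T Z = g \<bullet> v"
    using tri_factor_left[OF tri_rotate[OF t] ident_hom[OF d(7)]] by blast
  then show ?thesis using zero_objI d g cmp_zero_left by metis
qed

section \<open>Triangulated subcategories\<close>

lemma zero_Sg: "zero_obj T Z \<Longrightarrow> zero_obj T (Sg n Z)"
  using zero_objI[of "Sg n Z"] zero_objD[of Z] zero_obj_ident[of Z] Sa_ident[of Z n] Sa_zero[of Z Z n]
  by simp

text \<open>Closure under cones implies the other two closure properties: rotate the triangle and
  desuspend.\<close>

lemma triangulated_subcategoryI:
  assumes S: "S \<subseteq> obj T" and zero: "\<And>Z. zero_obj T Z \<Longrightarrow> Z \<in> S"
    and iso: "\<And>X Y. X \<in> S \<Longrightarrow> iso_obj T X Y \<Longrightarrow> Y \<in> S"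
    and susp: "\<And>X n. X \<in> S \<Longrightarrow> Sg n X \<in> S"
    and cone: "\<And>X Y Z f g h. tri X Y Z f g h \<Longrightarrow> X \<in> S \<Longrightarrow> Y \<in> S \<Longrightarrow> Z \<in> S"
  shows "triangulated_subcategory T S"
  unfolding triangulated_subcategory_def
proof (intro conjI allI impI ballI)
  fix X assume X: "X \<in> obj T"
  show "susp_obj T X \<in> S \<longleftrightarrow> X \<in> S"
    using susp[of X 1] susp[of "Sg 1 X" "- 1"] X by (auto simp: susp_eq)
next
  fix t assume t: "t \<in> exact_triangles T"
  obtain f g h where fgh: "t = (f, g, h)" by (cases t)
  let ?X = "Dom T f" and ?Y = "Dom T g" and ?Z = "Dom T h"
  have t0: "tri ?X ?Y ?Z f g h" using t fgh exact_tri by blast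
  have "?X \<in> S" if "?Y \<in> S" "?Z \<in> S"
  proof -
    have "Sg 1 ?X \<in> S" using cone[OF tri_rotate[OF t0]] that by blast
    then show ?thesis using susp[of "Sg 1 ?X" "- 1"] triD[OF t0] by simp
  qed
  moreover have "?Y \<in> S" if "?X \<in> S" "?Z \<in> S"
    using cone[OF tri_rotate_back[OF t0]] susp that by blast
  ultimately show "case t of (f, g, h) \<Rightarrow>
        (Dom T f \<in> S \<and> Dom T g \<in> S \<longrightarrow> Dom T h \<in> S) \<and>
        (Dom T g \<in> S \<and> Dom T h \<in> S \<longrightarrow> Dom T f \<in> S) \<and>
        (Dom T f \<in> S \<and> Dom T h \<in> S \<longrightarrow> Dom T g \<in> S)"
    using cone[OF t0] fgh by auto
qed (use assms in auto)

lemma Sg_mem: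
  assumes sub: "S \<subseteq> obj T" and s: "\<And>X. X \<in> obj T \<Longrightarrow> Sg 1 X \<in> S \<longleftrightarrow> X \<in> S" and X: "X \<in> S"
  shows "Sg n X \<in> S"
proof (induction n rule: int_induct[where k = 0])
  case base
  show ?case using X by simp
next
  case (step1 i)
  then show ?case using s[of "Sg i X"] X sub by (auto simp: add.commute)
next
  case (step2 i)
  have "X \<in> obj T" using X sub by blast
  then show ?case using s[of "Sg (i - 1) X"] step2 by simp
qed

lemma triangulated_subcategoryD:
  assumes S: "triangulated_subcategory T S"
  shows "S \<subseteq> obj T" "zero_obj T Z \<Longrightarrow> Z \<in> S" "X \<in> S \<Longrightarrow> iso_obj T X Y \<Longrightarrow> Y \<in> S"
    "X \<in> S \<Longrightarrow> Sg n X \<in> S" "tri X Y Z f g h \<Longrightarrow> X \<in> S \<Longrightarrow> Y \<in> S \<Longrightarrow> Z \<in> S"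
    "tri X Y Z f g h \<Longrightarrow> Y \<in> S \<Longrightarrow> Z \<in> S \<Longrightarrow> X \<in> S"
    "tri X Y Z f g h \<Longrightarrow> X \<in> S \<Longrightarrow> Z \<in> S \<Longrightarrow> Y \<in> S"
proof -
  note S' = S[unfolded triangulated_subcategory_def]
  show sub: "S \<subseteq> obj T" and "zero_obj T Z \<Longrightarrow> Z \<in> S" "X \<in> S \<Longrightarrow> iso_obj T X Y \<Longrightarrow> Y \<in> S"
    using S' by blast+
  have s: "Sg 1 X \<in> S \<longleftrightarrow> X \<in> S" if "X \<in> obj T" for X
    using S' that by (simp add: susp_eq)
  then show "X \<in> S \<Longrightarrow> Sg n X \<in> S" using Sg_mem[OF sub] by blast
  have c: "(X \<in> S \<and> Y \<in> S \<longrightarrow> Z \<in> S) \<and> (Y \<in> S \<and> Z \<in> S \<longrightarrow> X \<in> S) \<and> (X \<in> S \<and> Z \<in> S \<longrightarrow> Y \<in> S)"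
    if t: "tri X Y Z f g h"
  proof -
    have "X = Dom T f" "Y = Dom T g" "Z = Dom T h" using triD(2-4)[OF t] by (auto simp: Hom_def)
    then show ?thesis using S' triD(1)[OF t] by fast
  qed
  show "tri X Y Z f g h \<Longrightarrow> X \<in> S \<Longrightarrow> Y \<in> S \<Longrightarrow> Z \<in> S"
    "tri X Y Z f g h \<Longrightarrow> Y \<in> S \<Longrightarrow> Z \<in> S \<Longrightarrow> X \<in> S"
    "tri X Y Z f g h \<Longrightarrow> X \<in> S \<Longrightarrow> Z \<in> S \<Longrightarrow> Y \<in> S"
    using c by blast+
qed

lemma triangulated_susp_closed: "triangulated_subcategory T S \<Longrightarrow> susp_closed T S"
  unfolding susp_closed_def using triangulated_subcategoryD(1,4) by blast

section \<open>Orthogonals\<close>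

lemma right_perpD: "Y \<in> right_perp T S \<Longrightarrow> X \<in> S \<Longrightarrow> f \<in> Hom T X Y \<Longrightarrow> f = zero_arr T X Y"
  "Y \<in> right_perp T S \<Longrightarrow> Y \<in> obj T"
  by (auto simp: right_perp_def)

lemma right_perpI:
  assumes "Y \<in> obj T" "\<And>X f. X \<in> S \<Longrightarrow> f \<in> Hom T X Y \<Longrightarrow> f = zero_arr T X Y"
  shows "Y \<in> right_perp T S"
  using assms by (auto simp: right_perp_def)

lemma left_perpD: "X \<in> left_perp T S \<Longrightarrow> Y \<in> S \<Longrightarrow> f \<in> Hom T X Y \<Longrightarrow> f = zero_arr T X Y"
  "X \<in> left_perp T S \<Longrightarrow> X \<in> obj T"
  by (auto simp: left_perp_def)

lemma left_perpI:
  assumes "X \<in> obj T" "\<And>Y f. Y \<in> S \<Longrightarrow> f \<in> Hom T X Y \<Longrightarrow> f = zero_arr T X Y"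
  shows "X \<in> left_perp T S"
  using assms by (auto simp: left_perp_def)

lemma Sg_hom_transpose:
  assumes f: "f \<in> Hom T X (Sg n Y)" and Y: "Y \<in> obj T"
    and z: "\<And>f. f \<in> Hom T (Sg (- n) X) Y \<Longrightarrow> f = zero_arr T (Sg (- n) X) Y"
  shows "f = zero_arr T X (Sg n Y)"
proof -
  have X: "X \<in> obj T" using f Hom_objD by blast
  have f': "f \<in> Hom T (Sg n (Sg (- n) X)) (Sg n Y)" using f X by simp
  obtain f0 where "f0 \<in> Hom T (Sg (- n) X) Y" "f = Sa n f0" using Sa_surj[OF f'] X Y by blast
  then show ?thesis using z[of f0] Sa_zero[of "Sg (- n) X" Y n] X Y by simp
qed

lemma right_perp_triangulated:
  assumes S: "susp_closed T S"
  shows "triangulated_subcategory T (right_perp T S)"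
proof (rule triangulated_subcategoryI)
  show "right_perp T S \<subseteq> obj T" by (auto simp: right_perp_def)
  show "Z \<in> right_perp T S" if "zero_obj T Z" for Z
    using that zero_obj_hom(1) zero_objD by (intro right_perpI) blast+
  show "Y \<in> right_perp T S" if X: "X \<in> right_perp T S" and i: "iso_obj T X Y" for X Y
  proof (rule right_perpI)
    obtain a b where ab: "a \<in> Hom T X Y" "b \<in> Hom T Y X" "a \<bullet> b = ident T Y"
      using i unfolding iso_obj_def by (metis iso_arrE)
    then show "Y \<in> obj T" using Hom_objD by blast
    fix A f assume A: "A \<in> S" "f \<in> Hom T A Y"
    then have "b \<bullet> f = zero_arr T A X" using right_perpD(1)[OF X A(1)] ab cmp_hom by blast
    then show "f = zero_arr T A Y"
      using ab A cmp_assoc[OF A(2) ab(2,1)] cmp_zero_right[OF ab(1)] cmp_ident_left[OF A(2)]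
        Hom_objD[OF A(2)] by simp
  qed
  show "Sg n X \<in> right_perp T S" if X: "X \<in> right_perp T S" for X n
  proof (rule right_perpI)
    have oX: "X \<in> obj T" using X right_perpD by blast
    then show "Sg n X \<in> obj T" by simp
    fix A f assume A: "A \<in> S" "f \<in> Hom T A (Sg n X)"
    then have "Sg (- n) A \<in> S" using S by (auto simp: susp_closed_def)
    then show "f = zero_arr T A (Sg n X)" using Sg_hom_transpose[OF A(2) oX] right_perpD(1)[OF X] by blast
  qed
  show "Z \<in> right_perp T S" if t: "tri X Y Z f g h" and XY: "X \<in> right_perp T S" "Y \<in> right_perp T S"
    for X Y Z f g h
  proof (rule right_perpI)
    note d = triD[OF t]
    show "Z \<in> obj T" by fact
    fix A u assume A: "A \<in> S" "u \<in> Hom T A Z"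
    have "h \<bullet> u \<in> Hom T A (Sg 1 X)" using A d cmp_hom by blast
    moreover have "Sg (- 1) A \<in> S" using S A by (auto simp: susp_closed_def)
    ultimately have "h \<bullet> u = zero_arr T A (Sg 1 X)"
      using Sg_hom_transpose[OF _ d(5)] right_perpD(1)[OF XY(1)] by blast
    then obtain v where v: "v \<in> Hom T A Y" "u = g \<bullet> v"
      using tri_factor_left[OF tri_rotate[OF t] A(2)] by blast
    then have "v = zero_arr T A Y" using right_perpD(1)[OF XY(2) A(1)] by blast
    then show "u = zero_arr T A Z" using v cmp_zero_right[OF d(3)] Hom_objD[OF A(2)] by simp
  qed
qed

text \<open>A morphism out of a coproduct is determined by its restrictions to the summands, which
  is why the left orthogonal of any suspension-closed class is closed under coproducts.\<close>

lemma left_perp_localizing: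
  fixes \<kappa> :: "'k rel"
  assumes S: "susp_closed T S"
  shows "localizing \<kappa> T (left_perp T S)"
  unfolding localizing_def
proof (intro conjI allI impI)
  show "triangulated_subcategory T (left_perp T S)"
  proof (rule triangulated_subcategoryI)
    show "left_perp T S \<subseteq> obj T" by (auto simp: left_perp_def)
    show "Z \<in> left_perp T S" if "zero_obj T Z" for Z
      using that zero_obj_hom(2) zero_objD by (intro left_perpI) blast+
    show "Y \<in> left_perp T S" if X: "X \<in> left_perp T S" and i: "iso_obj T X Y" for X Y
    proof (rule left_perpI)
      obtain a b where ab: "a \<in> Hom T X Y" "b \<in> Hom T Y X" "a \<bullet> b = ident T Y"
        using i unfolding iso_obj_def by (metis iso_arrE)
      then show "Y \<in> obj T" using Hom_objD by blast
      fix A f assume A: "A \<in> S" "f \<in> Hom T Y A"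
      then have "f \<bullet> a = zero_arr T X A" using left_perpD(1)[OF X A(1)] ab cmp_hom by blast
      then show "f = zero_arr T Y A"
        using ab A cmp_assoc[OF ab(2,1) A(2)] cmp_zero_left[OF ab(2)] cmp_ident_right[OF A(2)]
          Hom_objD[OF A(2)] by simp
    qed
    show "Sg n X \<in> left_perp T S" if X: "X \<in> left_perp T S" for X n
    proof (rule left_perpI)
      have oX: "X \<in> obj T" using X left_perpD by blast
      then show "Sg n X \<in> obj T" by simp
      fix A f assume A: "A \<in> S" "f \<in> Hom T (Sg n X) A"
      have oA: "A \<in> obj T" using A Hom_objD by blast
      have "f \<in> Hom T (Sg n X) (Sg n (Sg (- n) A))" using A oA by simp
      then obtain f0 where f0: "f0 \<in> Hom T X (Sg (- n) A)" "f = Sa n f0"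
        using Sa_surj[of f n X "Sg (- n) A"] oX oA by blast
      have "Sg (- n) A \<in> S" using S A by (auto simp: susp_closed_def)
      then have "f0 = zero_arr T X (Sg (- n) A)" using left_perpD(1)[OF X _ f0(1)] by blast
      then show "f = zero_arr T (Sg n X) A" using f0 Sa_zero[of X "Sg (- n) A" n] oX oA by simp
    qed
    show "Z \<in> left_perp T S" if t: "tri X Y Z f g h" and XY: "X \<in> left_perp T S" "Y \<in> left_perp T S"
      for X Y Z f g h
    proof (rule left_perpI)
      note d = triD[OF t]
      show "Z \<in> obj T" by fact
      fix A u assume A: "A \<in> S" "u \<in> Hom T Z A"
      have oA: "A \<in> obj T" using A Hom_objD by blast
      have "u \<bullet> g = zero_arr T Y A" using left_perpD(1)[OF XY(2) A(1)] cmp_hom[OF d(3) A(2)] by blast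
      then obtain v where v: "v \<in> Hom T (Sg 1 X) A" "u = v \<bullet> h"
        using tri_factor_right[OF tri_rotate[OF t] A(2)] by blast
      have "v \<in> Hom T (Sg 1 X) (Sg 1 (Sg (- 1) A))" using v oA by simp
      then obtain v0 where v0: "v0 \<in> Hom T X (Sg (- 1) A)" "v = Sa 1 v0"
        using Sa_surj[of v 1 X "Sg (- 1) A"] d oA by blast
      have "Sg (- 1) A \<in> S" using S A by (auto simp: susp_closed_def)
      then have "v0 = zero_arr T X (Sg (- 1) A)" using left_perpD(1)[OF XY(1) _ v0(1)] by blast
      then have "v = zero_arr T (Sg 1 X) A" using v0 Sa_zero[of X "Sg (- 1) A" 1] oA d by simp
      then show "u = zero_arr T Z A" using v cmp_zero_left[OF d(4) oA] by simp
    qed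
  qed
  fix I :: "'k set" and X P \<iota>
  assume P: "is_coproduct T I X P \<iota>" and X: "\<forall>i\<in>I. X i \<in> left_perp T S"
  show "P \<in> left_perp T S"
  proof (rule left_perpI)
    note h = is_coproduct_hom[OF P]
    show "P \<in> obj T" by fact
    fix A f assume A: "A \<in> S" "f \<in> Hom T P A"
    show "f = zero_arr T P A"
    proof (rule coproduct_eqI[OF P A(2)])
      show "zero_arr T P A \<in> Hom T P A" using h A Hom_objD by blast
      fix i assume i: "i \<in> I"
      have "f \<bullet> \<iota> i = zero_arr T (X i) A" using X i A left_perpD(1) cmp_hom[OF h(3)[OF i] A(2)] by blast
      then show "f \<bullet> \<iota> i = zero_arr T P A \<bullet> \<iota> i"
        using cmp_zero_left[OF h(3)[OF i]] A Hom_objD by metis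
    qed
  qed
qed

section \<open>Localizing subcategories\<close>

lemma localizingD:
  assumes "localizing \<kappa> T S"
  shows "triangulated_subcategory T S" "S \<subseteq> obj T"
  using assms triangulated_subcategoryD(1) unfolding localizing_def by blast+

lemma localizing_Int:
  assumes "localizing \<kappa> T A" "localizing \<kappa> T B"
  shows "localizing \<kappa> T (A \<inter> B)"
  using assms unfolding localizing_def triangulated_subcategory_def by fast

lemma localizing_Inter:
  fixes \<kappa> :: "'k rel"
  assumes "\<A> \<noteq> {}" "\<And>S. S \<in> \<A> \<Longrightarrow> localizing \<kappa> T S"
  shows "localizing \<kappa> T (\<Inter>\<A>)"
proof -
  have t: "triangulated_subcategory T (\<Inter>\<A>)"
  proof (rule triangulated_subcategoryI)
    note d = triangulated_subcategoryD[OF localizingD(1)[OF assms(2)]]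
    show "\<Inter>\<A> \<subseteq> obj T" using assms d(1) by blast
    show "zero_obj T Z \<Longrightarrow> Z \<in> \<Inter>\<A>" for Z using d(2) by blast
    show "X \<in> \<Inter>\<A> \<Longrightarrow> iso_obj T X Y \<Longrightarrow> Y \<in> \<Inter>\<A>" for X Y using d(3) by blast
    show "X \<in> \<Inter>\<A> \<Longrightarrow> Sg n X \<in> \<Inter>\<A>" for X n using d(4) by blast
    show "tri X Y Z f g h \<Longrightarrow> X \<in> \<Inter>\<A> \<Longrightarrow> Y \<in> \<Inter>\<A> \<Longrightarrow> Z \<in> \<Inter>\<A>" for X Y Z f g h using d(5) by blast
  qed
  show ?thesis unfolding localizing_def
  proof (intro conjI allI impI)
    show "P \<in> \<Inter>\<A>" if "small \<kappa> I" "is_coproduct T I X P \<iota>" "\<forall>i\<in>I. X i \<in> \<Inter>\<A>" for I :: "'k set" and X P \<iota>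
    proof
      fix S assume "S \<in> \<A>"
      then show "P \<in> S" using assms(2)[of S] that unfolding localizing_def by blast
    qed
  qed (fact t)
qed

lemma obj_localizing: "localizing \<kappa> T (obj T)"
  unfolding localizing_def
proof (intro conjI allI impI)
  show "triangulated_subcategory T (obj T)"
    using zero_objD triD Hom_objD by (intro triangulated_subcategoryI) (auto simp: iso_obj_def)
qed (auto simp: is_coproduct_def)

lemma Loc_localizing:
  assumes "C \<subseteq> obj T"
  shows "localizing \<kappa> T (Loc \<kappa> T C)"
  unfolding Loc_def using obj_localizing assms by (intro localizing_Inter) auto

lemma Loc_subset: "C \<subseteq> Loc \<kappa> T C"
  unfolding Loc_def by blast

lemma Loc_least: "localizing \<kappa> T S \<Longrightarrow> C \<subseteq> S \<Longrightarrow> Loc \<kappa> T C \<subseteq> S"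
  unfolding Loc_def by blast

text \<open>The left orthogonal of \<open>right_perp T K\<close> is localizing and contains
  \<open>K\<close>, hence it contains \<open>Loc \<kappa> T K\<close>. Orthogonality can thus be
  tested on generators.\<close>

lemma right_perp_Loc:
  assumes K: "susp_closed T K"
  shows "right_perp T (Loc \<kappa> T K) = right_perp T K"
proof
  show "right_perp T (Loc \<kappa> T K) \<subseteq> right_perp T K"
    using Loc_subset by (fastforce simp: right_perp_def)
  have "susp_closed T (right_perp T K)" using K right_perp_triangulated triangulated_susp_closed by blast
  then have "localizing \<kappa> T (left_perp T (right_perp T K))" by (rule left_perp_localizing)
  moreover have "K \<subseteq> left_perp T (right_perp T K)"
    using K by (auto simp: susp_closed_def left_perp_def right_perp_def)
  ultimately have "Loc \<kappa> T K \<subseteq> left_perp T (right_perp T K)" by (rule Loc_least)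
  then show "right_perp T K \<subseteq> right_perp T (Loc \<kappa> T K)"
    by (fastforce simp: right_perp_def left_perp_def)
qed

lemma in_perp_zero: "X \<in> S \<Longrightarrow> X \<in> right_perp T S \<Longrightarrow> zero_obj T X"
  using right_perpD ident_hom zero_objI by metis

end

section \<open>Localization functors\<close>

context triangulated_category
begin

lemma tri_iso:
  assumes t: "tri X Y Z f g h"
    and abc: "a \<in> Hom T X X'" "b \<in> Hom T Y Y'" "c \<in> Hom T Z Z'"
    and i: "iso_arr T a" "iso_arr T b" "iso_arr T c"
    and h: "f' \<in> Hom T X' Y'" "g' \<in> Hom T Y' Z'" "h' \<in> Hom T Z' (Sg 1 X')"
    and e: "b \<bullet> f = f' \<bullet> a" "c \<bullet> g = g' \<bullet> b" "Sa 1 a \<bullet> h = h' \<bullet> c"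
  shows "tri X' Y' Z' f' g' h'"
proof -
  note d = triD[OF t]
  have "is_triangle T f' g' h'" using h by (auto simp: is_triangle_def Hom_def susp_eq)
  moreover have "triangle_morphism T (f, g, h) (f', g', h') a b c"
    using abc h e d by (auto simp: triangle_morphism_def Hom_def susp_eq)
  ultimately have "(f', g', h') \<in> exact_triangles T" using TR1_iso[OF d(1) _ _ i] by blast
  then show ?thesis using h by (simp add: tri_def)
qed

lemma iso_neg_ident:
  assumes X: "X \<in> obj T"
  shows "iso_arr T (neg_arr T (ident T X))"
proof -
  note i = ident_hom[OF X]
  have "neg_arr T (ident T X) \<bullet> neg_arr T (ident T X) = ident T X"
    using cmp_neg_left[OF neg_hom[OF i] i] cmp_ident_left[OF neg_hom[OF i]] neg_neg[OF i] by simp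
  then show ?thesis using iso_arrI neg_hom[OF i] by blast
qed

text \<open>Multiply the middle vertex by minus the identity.\<close>

lemma tri_neg12:
  assumes t: "tri X Y Z f g h"
  shows "tri X Y Z (neg_arr T f) (neg_arr T g) h"
proof -
  note d = triD[OF t] and i = ident_hom[OF triD(6)[OF t]]
  show ?thesis
  proof (rule tri_iso[OF t ident_hom[OF d(5)] neg_hom[OF i] ident_hom[OF d(7)]])
    show "neg_arr T (ident T Y) \<bullet> f = neg_arr T f \<bullet> ident T X"
      using cmp_neg_left[OF d(2) i] cmp_ident_left[OF d(2)] cmp_ident_right[OF neg_hom[OF d(2)]] by simp
    show "ident T Z \<bullet> g = neg_arr T g \<bullet> neg_arr T (ident T Y)"
      using cmp_neg_left[OF neg_hom[OF i] d(3)] cmp_neg_right[OF i d(3)] cmp_ident_left[OF d(3)]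
        cmp_ident_right[OF d(3)] neg_neg[OF d(3)] by simp
    show "Sa 1 (ident T X) \<bullet> h = h \<bullet> ident T Z"
      using Sa_ident[OF d(5), of 1] cmp_ident_left[OF d(4)] cmp_ident_right[OF d(4)] by simp
  qed (use d iso_arr_ident iso_neg_ident neg_hom in auto)
qed

text \<open>Three rotations negate all three morphisms; \<open>tri_neg12\<close> removes two of the
  signs and the third remains.\<close>

lemma tri_Sg: "tri X Y Z f g h \<Longrightarrow> tri (Sg 1 X) (Sg 1 Y) (Sg 1 Z) (Sa 1 f) (Sa 1 g) (neg_arr T (Sa 1 h))"
  using tri_neg12[OF tri_rotate[OF tri_rotate[OF tri_rotate[of X Y Z f g h]]]]
    neg_neg[OF Sa_hom, of f X Y 1] neg_neg[OF Sa_hom, of g Y Z 1] triD[of X Y Z f g h] by simp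

lemma zero_objects_triangulated: "triangulated_subcategory T {Z. zero_obj T Z}"
proof (rule triangulated_subcategoryI)
  show "Z \<in> {Z. zero_obj T Z}"
    if "tri X Y Z f g h" "X \<in> {Z. zero_obj T Z}" "Y \<in> {Z. zero_obj T Z}" for X Y Z f g h
  proof -
    note d = triD[OF that(1)]
    have z: "zero_arr T Y X \<in> Hom T Y X" using d by blast
    have "zero_arr T Y X \<bullet> f = ident T X" "f \<bullet> zero_arr T Y X = ident T Y"
      using cmp_zero_left[OF d(2) d(5)] cmp_zero_right[OF d(2) d(6)] zero_obj_ident that by auto
    then have "iso_arr T f" using iso_arrI d z by blast
    then show ?thesis using cone_zero_if_iso that by blast
  qed
qed (use zero_objD iso_zero_obj zero_Sg in auto)

text \<open>This is a Bousfield triangle over \<open>X\<close>. Its other two morphisms are hidden,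
  since \<open>g\<close> alone carries the universal property.\<close>

definition reflection where
  "reflection S X Y g \<longleftrightarrow> (\<exists>U f h. tri U X Y f g h \<and> U \<in> S) \<and> Y \<in> right_perp T S"

lemma reflectionE:
  assumes "reflection S X Y g"
  obtains U f h where "tri U X Y f g h" "U \<in> S" "Y \<in> right_perp T S"
  using assms unfolding reflection_def by blast

lemma reflection_hom:
  assumes "reflection S X Y g"
  shows "g \<in> Hom T X Y" "X \<in> obj T" "Y \<in> obj T" "Y \<in> right_perp T S"
proof -
  obtain U f h where "tri U X Y f g h" "Y \<in> right_perp T S" using assms reflectionE by blast
  then show "g \<in> Hom T X Y" "X \<in> obj T" "Y \<in> obj T" "Y \<in> right_perp T S"
    using triD(3,6,7) by simp_all
qed

lemma reflection_lift:
  assumes r: "reflection S X Y g" and W: "W \<in> right_perp T S" and v: "v \<in> Hom T X W"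
  obtains w where "w \<in> Hom T Y W" "w \<bullet> g = v"
proof -
  obtain U f h where t: "tri U X Y f g h" "U \<in> S" using r reflectionE by blast
  have "v \<bullet> f = zero_arr T U W" using right_perpD(1)[OF W t(2)] cmp_hom[OF triD(2)[OF t(1)] v] by blast
  then show ?thesis using tri_factor_right[OF t(1) v] that by metis
qed

text \<open>A morphism that vanishes after \<open>g\<close> factors through \<open>h\<close>, that
  is, through the suspension of an object of \<open>S\<close>, and from there nothing reaches
  \<open>W\<close>.\<close>

lemma reflection_zeroI:
  assumes S: "susp_closed T S" and r: "reflection S X Y g" and W: "W \<in> right_perp T S"
    and w: "w \<in> Hom T Y W" "w \<bullet> g = zero_arr T X W"
  shows "w = zero_arr T Y W"
proof -
  obtain U f h where t: "tri U X Y f g h" "U \<in> S" using r reflectionE by blast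
  obtain v where v: "v \<in> Hom T (Sg 1 U) W" "w = v \<bullet> h"
    using tri_factor_right[OF tri_rotate[OF t(1)] w] by blast
  have "Sg 1 U \<in> S" using S t by (auto simp: susp_closed_def)
  then have "v = zero_arr T (Sg 1 U) W" using right_perpD(1)[OF W] v by blast
  then show ?thesis using v cmp_zero_left[OF triD(4)[OF t(1)]] Hom_objD[OF w(1)] by simp
qed

lemma reflection_eqI:
  assumes S: "susp_closed T S" and r: "reflection S X Y g" and W: "W \<in> right_perp T S"
    and w: "w \<in> Hom T Y W" "w' \<in> Hom T Y W" "w \<bullet> g = w' \<bullet> g"
  shows "w = w'"
proof -
  note g = reflection_hom(1)[OF r]
  have "(w \<boxminus> w') \<bullet> g = zero_arr T X W"
    using cmp_minus_left[OF g w(1,2)] w(3) minus_self[OF cmp_hom[OF g w(2)]] by simp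
  then show ?thesis
    using reflection_zeroI[OF S r W minus_hom[OF w(1,2)]] minus_eq_zero[OF w(1,2)] by simp
qed

lemma reflection_unique:
  assumes S: "susp_closed T S" and r: "reflection S X Y g" "reflection S X Y' g'"
    and w: "w \<in> Hom T Y Y'" "w \<bullet> g = g'"
  shows "iso_arr T w"
proof -
  note h = reflection_hom[OF r(1)] and h' = reflection_hom[OF r(2)]
  obtain v where v: "v \<in> Hom T Y' Y" "v \<bullet> g' = g" using reflection_lift[OF r(2) h(4,1)] by blast
  have vw: "v \<bullet> w \<in> Hom T Y Y" "w \<bullet> v \<in> Hom T Y' Y'" using v w cmp_hom by blast+
  have "v \<bullet> w = ident T Y"
  proof (rule reflection_eqI[OF S r(1) h(4) vw(1) ident_hom[OF h(3)]])
    show "(v \<bullet> w) \<bullet> g = ident T Y \<bullet> g"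
      using cmp_assoc[OF h(1) w(1) v(1)] v w cmp_ident_left[OF h(1)] by simp
  qed
  moreover have "w \<bullet> v = ident T Y'"
  proof (rule reflection_eqI[OF S r(2) h'(4) vw(2) ident_hom[OF h'(3)]])
    show "(w \<bullet> v) \<bullet> g' = ident T Y' \<bullet> g'"
      using cmp_assoc[OF h'(1) v(1) w(1)] v w cmp_ident_left[OF h'(1)] by simp
  qed
  ultimately show ?thesis using iso_arrI v w by blast
qed

lemma reflection_Sg:
  assumes S: "susp_closed T S" and r: "reflection S X Y g"
  shows "reflection S (Sg 1 X) (Sg 1 Y) (Sa 1 g)"
proof -
  obtain U f h where t: "tri U X Y f g h" "U \<in> S" "Y \<in> right_perp T S" using r reflectionE by blast
  have "Sg 1 U \<in> S" using S t by (auto simp: susp_closed_def)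
  moreover have "Sg 1 Y \<in> right_perp T S"
    using triangulated_subcategoryD(4)[OF right_perp_triangulated[OF S]] t by blast
  ultimately show ?thesis using tri_Sg[OF t(1)] unfolding reflection_def by blast
qed

lemma reflection_iso_if_perp:
  assumes S: "susp_closed T S" and r: "reflection S X Y g" and X: "X \<in> right_perp T S"
  shows "iso_arr T g"
proof -
  obtain U f h where t: "tri U X Y f g h" "U \<in> S" "Y \<in> right_perp T S" using r reflectionE by blast
  have "U \<in> right_perp T S"
    using triangulated_subcategoryD(6)[OF right_perp_triangulated[OF S] t(1) X t(3)] .
  then have "zero_obj T U" using in_perp_zero t by blast
  then show ?thesis using iso_if_cone_zero[OF tri_rotate[OF t(1)]] zero_Sg by blast
qed

lemma reflection_zero_iff:
  assumes S: "triangulated_subcategory T S" and r: "reflection S X Y g"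
  shows "zero_obj T Y \<longleftrightarrow> X \<in> S"
proof -
  obtain U f h where t: "tri U X Y f g h" "U \<in> S" "Y \<in> right_perp T S" using r reflectionE by blast
  show ?thesis
  proof
    assume "zero_obj T Y"
    then have "iso_arr T f" using iso_if_cone_zero t by blast
    then have "iso_obj T U X" using triD(2)[OF t(1)] iso_objI by blast
    then show "X \<in> S" using triangulated_subcategoryD(3)[OF S t(2)] by blast
  next
    assume "X \<in> S"
    then have "Y \<in> S" using triangulated_subcategoryD(5)[OF S t(1,2)] by blast
    then show "zero_obj T Y" using in_perp_zero t by blast
  qed
qed

text \<open>
  The exactness of the reflection functor rests on the five lemma for \<open>Hom(-, W)\<close> with \<open>W\<close>
  right orthogonal to \<open>S\<close>: it shows that the cone of a reflected morphism represents the same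
  functor on the orthogonal as the reflection of the cone.
\<close>

lemma reflection_cone:
  assumes S: "susp_closed T S"
    and t: "tri X Y Z f g h" and t': "tri X' Y' Z' f' g' h'"
    and a: "reflection S X X' a" and b: "reflection S Y Y' b" and bf: "b \<bullet> f = f' \<bullet> a"
    and c: "c \<in> Hom T Z Z'" and cg: "c \<bullet> g = g' \<bullet> b" and ah: "Sa 1 a \<bullet> h = h' \<bullet> c"
    and W: "W \<in> right_perp T S"
  shows "bij_betw (\<lambda>w. w \<bullet> c) (Hom T Z' W) (Hom T Z W)"
proof -
  note d = triD[OF t] and d' = triD[OF t'] and ah' = reflection_hom(1)[OF a] and bh = reflection_hom(1)[OF b]
  have W': "W \<in> obj T" using right_perpD(2)[OF W] .
  note a1 = reflection_Sg[OF S a] and b1 = reflection_Sg[OF S b]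
  \<comment> \<open>Injective half of the five lemma: \<open>w\<close> comes from \<open>k\<close>
    on \<open>Sg 1 X'\<close>, and the vanishing of \<open>w \<bullet> c\<close> shows that
    \<open>k\<close> extends over the suspended \<open>f'\<close>. This kills
    \<open>k \<bullet> h'\<close>.\<close>
  have inj: "w = zero_arr T Z' W" if w: "w \<in> Hom T Z' W" "w \<bullet> c = zero_arr T Z W" for w
  proof -
    have wg: "w \<bullet> g' \<in> Hom T Y' W" using cmp_hom[OF d'(3) w(1)] .
    have "(w \<bullet> g') \<bullet> b = (w \<bullet> c) \<bullet> g"
      using cmp_assoc[OF bh d'(3) w(1)] cmp_assoc[OF d(3) c w(1)] cg by simp
    also have "\<dots> = zero_arr T Y W" using w cmp_zero_left[OF d(3) W'] by simp
    finally have "w \<bullet> g' = zero_arr T Y' W" using reflection_zeroI[OF S b W wg] by blast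
    then obtain k where k: "k \<in> Hom T (Sg 1 X') W" "w = k \<bullet> h'"
      using tri_factor_right[OF tri_rotate[OF t'] w(1)] by blast
    have ka: "k \<bullet> Sa 1 a \<in> Hom T (Sg 1 X) W" using cmp_hom[OF Sa_hom[OF ah'] k(1)] .
    have "(k \<bullet> Sa 1 a) \<bullet> h = w \<bullet> c"
      using cmp_assoc[OF d(4) Sa_hom[OF ah'] k(1)] cmp_assoc[OF c d'(4) k(1)] ah k(2) by simp
    then obtain l where l: "l \<in> Hom T (Sg 1 Y) W" "k \<bullet> Sa 1 a = l \<bullet> neg_arr T (Sa 1 f)"
      using tri_factor_right[OF tri_rotate[OF tri_rotate[OF t]] ka] w by metis
    obtain l' where l': "l' \<in> Hom T (Sg 1 Y') W" "l' \<bullet> Sa 1 b = l"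
      using reflection_lift[OF b1 W l(1)] by blast
    note S1 = Sa_hom[OF ah', of 1] Sa_hom[OF bh, of 1] Sa_hom[OF d(2), of 1] Sa_hom[OF d'(2), of 1]
    have lf: "l' \<bullet> Sa 1 f' \<in> Hom T (Sg 1 X') W" using cmp_hom[OF S1(4) l'(1)] .
    have "k \<bullet> Sa 1 a = neg_arr T (l \<bullet> Sa 1 f)" using l cmp_neg_right[OF S1(3) l(1)] by simp
    also have "l \<bullet> Sa 1 f = l' \<bullet> (Sa 1 b \<bullet> Sa 1 f)" using cmp_assoc[OF S1(3,2) l'(1)] l'(2) by simp
    also have "Sa 1 b \<bullet> Sa 1 f = Sa 1 f' \<bullet> Sa 1 a"
      using Sa_cmp[OF d(2) bh] Sa_cmp[OF ah' d'(2)] bf by metis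
    also have "l' \<bullet> (Sa 1 f' \<bullet> Sa 1 a) = (l' \<bullet> Sa 1 f') \<bullet> Sa 1 a" using cmp_assoc[OF S1(1,4) l'(1)] by simp
    also have "neg_arr T \<dots> = neg_arr T (l' \<bullet> Sa 1 f') \<bullet> Sa 1 a" using cmp_neg_left[OF S1(1) lf] by simp
    finally have "k = neg_arr T (l' \<bullet> Sa 1 f')"
      using reflection_eqI[OF S a1 W k(1) neg_hom[OF lf]] by blast
    then have "w = neg_arr T ((l' \<bullet> Sa 1 f') \<bullet> h')" using k cmp_neg_left[OF d'(4) lf] by simp
    also have "(l' \<bullet> Sa 1 f') \<bullet> h' = zero_arr T Z' W"
      using cmp_assoc[OF d'(4) S1(4) l'(1)] tri_cmp_zero(3)[OF t'] cmp_zero_right[OF l'(1) d'(7)] by simp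
    finally show ?thesis using neg_zero d' W' by simp
  qed
  \<comment> \<open>Surjective half: a first candidate \<open>w'\<close> agrees with
    \<open>w\<close> after \<open>g\<close>. The difference comes from \<open>Sg 1 X\<close>, lifts
    to \<open>Sg 1 X'\<close>, and is used to correct \<open>w'\<close>.\<close>
  have surj: "\<exists>w'. w' \<in> Hom T Z' W \<and> w' \<bullet> c = w" if w: "w \<in> Hom T Z W" for w
  proof -
    have wg: "w \<bullet> g \<in> Hom T Y W" using cmp_hom[OF d(3) w] .
    obtain v where v: "v \<in> Hom T Y' W" "v \<bullet> b = w \<bullet> g" using reflection_lift[OF b W wg] by blast
    have vf: "v \<bullet> f' \<in> Hom T X' W" using cmp_hom[OF d'(2) v(1)] .
    have "(v \<bullet> f') \<bullet> a = (v \<bullet> b) \<bullet> f"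
      using cmp_assoc[OF ah' d'(2) v(1)] cmp_assoc[OF d(2) bh v(1)] bf by simp
    also have "\<dots> = zero_arr T X W"
      using v cmp_assoc[OF d(2,3) w] tri_cmp_zero(1)[OF t] cmp_zero_right[OF w d(5)] by simp
    finally have "v \<bullet> f' = zero_arr T X' W" using reflection_zeroI[OF S a W vf] by blast
    then obtain w' where w': "w' \<in> Hom T Z' W" "v = w' \<bullet> g'"
      using tri_factor_right[OF t' v(1)] by blast
    have wc: "w' \<bullet> c \<in> Hom T Z W" using cmp_hom[OF c w'(1)] .
    have "(w' \<bullet> c) \<bullet> g = w \<bullet> g"
      using cmp_assoc[OF d(3) c w'(1)] cmp_assoc[OF bh d'(3) w'(1)] cg w' v by simp
    then have "(w \<boxminus> w' \<bullet> c) \<bullet> g = zero_arr T Y W"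
      using cmp_minus_left[OF d(3) w wc] minus_self[OF wg] by simp
    then obtain k where k: "k \<in> Hom T (Sg 1 X) W" "w \<boxminus> w' \<bullet> c = k \<bullet> h"
      using tri_factor_right[OF tri_rotate[OF t] minus_hom[OF w wc]] by blast
    obtain k' where k': "k' \<in> Hom T (Sg 1 X') W" "k' \<bullet> Sa 1 a = k"
      using reflection_lift[OF a1 W k(1)] by blast
    have kh: "k' \<bullet> h' \<in> Hom T Z' W" using cmp_hom[OF d'(4) k'(1)] .
    have "(k' \<bullet> h') \<bullet> c = k \<bullet> h"
      using cmp_assoc[OF c d'(4) k'(1)] cmp_assoc[OF d(4) Sa_hom[OF ah'] k'(1)] ah k' by simp
    then have "(k' \<bullet> h' \<boxplus> w') \<bullet> c = w"
      using cmp_plus_left[OF c kh w'(1)] k minus_plus[OF w wc] by simp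
    then show ?thesis using plus_hom[OF kh w'(1)] by blast
  qed
  have "inj_on (\<lambda>w. w \<bullet> c) (Hom T Z' W)"
  proof (rule inj_onI)
    fix w w' assume w: "w \<in> Hom T Z' W" "w' \<in> Hom T Z' W" "w \<bullet> c = w' \<bullet> c"
    then have "(w \<boxminus> w') \<bullet> c = zero_arr T Z W"
      using cmp_minus_left[OF c w(1,2)] minus_self[OF cmp_hom[OF c w(2)]] by simp
    then show "w = w'" using inj minus_hom[OF w(1,2)] minus_eq_zero[OF w(1,2)] by blast
  qed
  moreover have "(\<lambda>w. w \<bullet> c) ` Hom T Z' W = Hom T Z W"
    using surj cmp_hom[OF c] by (auto simp: image_iff)
  ultimately show ?thesis by (simp add: bij_betw_def)
qed

text \<open>Reflections chosen object by object assemble to a functor, because morphisms out of a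
  reflection into the orthogonal are determined by their composite with the unit. The same
  uniqueness gives naturality and additivity.\<close>

lemma localization_functor_exists:
  assumes S: "triangulated_subcategory T S"
    and r: "\<And>X. X \<in> obj T \<Longrightarrow> \<exists>Y g. reflection S X Y g"
  shows "\<exists>Lo La \<eta>. localization_functor T Lo La \<eta> \<and> Ker T Lo = S"
proof -
  have Sc: "susp_closed T S" using S triangulated_susp_closed by blast
  note perp = triangulated_subcategoryD[OF right_perp_triangulated[OF Sc]]
  obtain Lo \<eta> where R: "\<And>X. X \<in> obj T \<Longrightarrow> reflection S X (Lo X) (\<eta> X)" using r by metis
  note Lh = reflection_hom(1)[OF R] and Lobj = reflection_hom(3)[OF R] and Lp = reflection_hom(4)[OF R]
  define La where "La f = (SOME l. l \<in> Hom T (Lo (Dom T f)) (Lo (Cod T f)) \<and>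
    l \<bullet> \<eta> (Dom T f) = \<eta> (Cod T f) \<bullet> f)" for f
  have La: "La f \<in> Hom T (Lo X) (Lo Y)" "La f \<bullet> \<eta> X = \<eta> Y \<bullet> f" if f: "f \<in> Hom T X Y" for f X Y
  proof -
    note o = Hom_objD[OF f]
    obtain l where "l \<in> Hom T (Lo X) (Lo Y)" "l \<bullet> \<eta> X = \<eta> Y \<bullet> f"
      using reflection_lift[OF R[OF o(1)] Lp[OF o(2)] cmp_hom[OF f Lh[OF o(2)]]] by blast
    then have "\<exists>l. l \<in> Hom T (Lo (Dom T f)) (Lo (Cod T f)) \<and> l \<bullet> \<eta> (Dom T f) = \<eta> (Cod T f) \<bullet> f"
      using f by (auto simp: Hom_def)
    from someI_ex[OF this] show "La f \<in> Hom T (Lo X) (Lo Y)" "La f \<bullet> \<eta> X = \<eta> Y \<bullet> f"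
      using f unfolding La_def by (auto simp: HomD)
  qed
  have Lu: "l = La f" if "f \<in> Hom T X Y" "l \<in> Hom T (Lo X) (Lo Y)" "l \<bullet> \<eta> X = \<eta> Y \<bullet> f" for l f X Y
    using reflection_eqI[OF Sc R Lp that(2) La(1)[OF that(1)]] La(2)[OF that(1)] that Hom_objD[OF that(1)]
    by simp
  have add: "additive_endofunctor T Lo La"
  proof (rule additive_endofunctorI)
    show "Lo X \<in> obj T" if "X \<in> obj T" for X using Lobj that .
    show "La f \<in> Hom T (Lo X) (Lo Y)" if "f \<in> Hom T X Y" for f X Y using La that by blast
    show "La (ident T X) = ident T (Lo X)" if X: "X \<in> obj T" for X
      using Lu[OF ident_hom[OF X] ident_hom[OF Lobj[OF X]]] cmp_ident_left[OF Lh[OF X]]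
        cmp_ident_right[OF Lh[OF X]] by simp
    show "La (g \<bullet> f) = La g \<bullet> La f" if fg: "f \<in> Hom T X Y" "g \<in> Hom T Y Z" for f g X Y Z
    proof (rule sym, rule Lu[OF cmp_hom[OF fg] cmp_hom[OF La(1)[OF fg(1)] La(1)[OF fg(2)]]])
      note o = Hom_objD[OF fg(1)] Hom_objD[OF fg(2)]
      have "(La g \<bullet> La f) \<bullet> \<eta> X = La g \<bullet> (\<eta> Y \<bullet> f)"
        using cmp_assoc[OF Lh[OF o(1)] La(1)[OF fg(1)] La(1)[OF fg(2)]] La(2)[OF fg(1)] by simp
      also have "\<dots> = (\<eta> Z \<bullet> g) \<bullet> f"
        using cmp_assoc[OF fg(1) Lh[OF o(2)] La(1)[OF fg(2)]] La(2)[OF fg(2)] by simp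
      also have "\<dots> = \<eta> Z \<bullet> (g \<bullet> f)" using cmp_assoc[OF fg Lh[OF o(4)]] .
      finally show "(La g \<bullet> La f) \<bullet> \<eta> X = \<eta> Z \<bullet> (g \<bullet> f)" .
    qed
    show "La (f \<boxplus> g) = La f \<boxplus> La g" if fg: "f \<in> Hom T X Y" "g \<in> Hom T X Y" for f g X Y
    proof (rule sym, rule Lu[OF plus_hom[OF fg] plus_hom[OF La(1)[OF fg(1)] La(1)[OF fg(2)]]])
      note o = Hom_objD[OF fg(1)]
      show "(La f \<boxplus> La g) \<bullet> \<eta> X = \<eta> Y \<bullet> (f \<boxplus> g)"
        using cmp_plus_left[OF Lh[OF o(1)] La(1)[OF fg(1)] La(1)[OF fg(2)]]
          cmp_plus_right[OF fg Lh[OF o(2)]] La(2)[OF fg(1)] La(2)[OF fg(2)] by simp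
    qed
  qed
  \<comment> \<open>The suspended unit is also a reflection of \<open>Sg 1 X\<close>; comparing it
    with the chosen one yields the commutation isomorphism required of an exact functor.\<close>
  have "\<exists>t. t \<in> Hom T (Lo (Sg 1 X)) (Sg 1 (Lo X)) \<and> t \<bullet> \<eta> (Sg 1 X) = Sa 1 (\<eta> X)" if X: "X \<in> obj T" for X
  proof -
    have "Sg 1 (Lo X) \<in> right_perp T S" using perp(4)[OF Lp[OF X]] .
    then show ?thesis
      using reflection_lift[OF R[OF Sg_obj[OF X, of 1]] _ Sa_hom[OF Lh[OF X]]] by metis
  qed
  then obtain \<theta> where \<theta>: "\<And>X. X \<in> obj T \<Longrightarrow> \<theta> X \<in> Hom T (Lo (Sg 1 X)) (Sg 1 (Lo X))"
    "\<And>X. X \<in> obj T \<Longrightarrow> \<theta> X \<bullet> \<eta> (Sg 1 X) = Sa 1 (\<eta> X)" by metis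
  have \<theta>iso: "iso_arr T (\<theta> X)" if X: "X \<in> obj T" for X
    using reflection_unique[OF Sc R[OF Sg_obj[OF X, of 1]] reflection_Sg[OF Sc R[OF X]]] \<theta>[OF X] by blast
  have \<theta>nat: "Sa 1 (La f) \<bullet> \<theta> X = \<theta> Y \<bullet> La (Sa 1 f)" if f: "f \<in> Hom T X Y" for f X Y
  proof -
    note o = Hom_objD[OF f] and f1 = Sa_hom[OF f, of 1]
    note o1 = Sg_obj[OF o(1), of 1] Sg_obj[OF o(2), of 1]
    have p: "Sg 1 (Lo Y) \<in> right_perp T S" using perp(4)[OF Lp[OF o(2)]] .
    show ?thesis
    proof (rule reflection_eqI[OF Sc R[OF o1(1)] p])
      show "Sa 1 (La f) \<bullet> \<theta> X \<in> Hom T (Lo (Sg 1 X)) (Sg 1 (Lo Y))"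
        using cmp_hom[OF \<theta>(1)[OF o(1)] Sa_hom[OF La(1)[OF f]]] .
      show "\<theta> Y \<bullet> La (Sa 1 f) \<in> Hom T (Lo (Sg 1 X)) (Sg 1 (Lo Y))"
        using cmp_hom[OF La(1)[OF f1] \<theta>(1)[OF o(2)]] .
      have "(Sa 1 (La f) \<bullet> \<theta> X) \<bullet> \<eta> (Sg 1 X) = Sa 1 (La f) \<bullet> Sa 1 (\<eta> X)"
        using cmp_assoc[OF Lh[OF o1(1)] \<theta>(1)[OF o(1)] Sa_hom[OF La(1)[OF f]]] \<theta>(2)[OF o(1)] by simp
      also have "\<dots> = Sa 1 (\<eta> Y) \<bullet> Sa 1 f"
        using Sa_cmp[OF Lh[OF o(1)] La(1)[OF f], of 1] Sa_cmp[OF f Lh[OF o(2)], of 1] La(2)[OF f] by metis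
      also have "\<dots> = \<theta> Y \<bullet> (\<eta> (Sg 1 Y) \<bullet> Sa 1 f)"
        using cmp_assoc[OF f1 Lh[OF o1(2)] \<theta>(1)[OF o(2)]] \<theta>(2)[OF o(2)] by simp
      also have "\<dots> = (\<theta> Y \<bullet> La (Sa 1 f)) \<bullet> \<eta> (Sg 1 X)"
        using cmp_assoc[OF Lh[OF o1(1)] La(1)[OF f1] \<theta>(1)[OF o(2)]] La(2)[OF f1] by simp
      finally show "(Sa 1 (La f) \<bullet> \<theta> X) \<bullet> \<eta> (Sg 1 X) = (\<theta> Y \<bullet> La (Sa 1 f)) \<bullet> \<eta> (Sg 1 X)" .
    qed
  qed
  \<comment> \<open>A cone \<open>Z'\<close> of \<open>La f\<close> is orthogonal to
    \<open>S\<close>. It is compared with \<open>Lo Z\<close> by a morphism \<open>e\<close>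
    compatible with the units, and the exact triangle on \<open>La f\<close> is transported along
    \<open>e\<close>.\<close>
  have ex: "tri (Lo X) (Lo Y) (Lo Z) (La f) (La g) (\<theta> X \<bullet> La h)" if t: "tri X Y Z f g h" for X Y Z f g h
  proof -
    note d = triD[OF t]
    note Lf = La[OF d(2)] and Lg = La[OF d(3)] and Lhh = La[OF d(4)]
    obtain Z' g' h' where t': "tri (Lo X) (Lo Y) Z' (La f) g' h'" using tri_cone[OF Lf(1)] by blast
    note d' = triD[OF t']
    have Z': "Z' \<in> right_perp T S" using perp(5)[OF t' Lp[OF d(5)] Lp[OF d(6)]] .
    obtain c where c: "c \<in> Hom T Z Z'" "c \<bullet> g = g' \<bullet> \<eta> Y" "Sa 1 (\<eta> X) \<bullet> h = h' \<bullet> c"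
      using tri_morphism[OF t t' Lh[OF d(5)] Lh[OF d(6)]] Lf(2) by metis
    obtain e where e: "e \<in> Hom T (Lo Z) Z'" "e \<bullet> \<eta> Z = c"
      using reflection_lift[OF R[OF d(7)] Z' c(1)] by blast
    \<comment> \<open>Both \<open>Z'\<close> (by \<open>reflection_cone\<close>) and
      \<open>Lo Z\<close> represent the morphisms from \<open>Z\<close> into the orthogonal, and
      both lie in it, so \<open>e\<close> is invertible.\<close>
    have "bij_betw (\<lambda>w. w \<bullet> e) (Hom T Z' W) (Hom T (Lo Z) W)" if W: "W \<in> right_perp T S" for W
    proof -
      have b: "bij_betw (\<lambda>w. w \<bullet> c) (Hom T Z' W) (Hom T Z W)"
        by (rule reflection_cone[OF Sc t t' R[OF d(5)] R[OF d(6)] Lf(2)[symmetric] c W])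
      have ec: "(w \<bullet> e) \<bullet> \<eta> Z = w \<bullet> c" if "w \<in> Hom T Z' W" for w
        using cmp_assoc[OF Lh[OF d(7)] e(1) that] e(2) by simp
      have "inj_on (\<lambda>w. w \<bullet> e) (Hom T Z' W)"
        using b ec unfolding bij_betw_def inj_on_def by metis
      moreover have "v \<in> (\<lambda>w. w \<bullet> e) ` Hom T Z' W" if v: "v \<in> Hom T (Lo Z) W" for v
      proof -
        have "v \<bullet> \<eta> Z \<in> (\<lambda>w. w \<bullet> c) ` Hom T Z' W"
          using b cmp_hom[OF Lh[OF d(7)] v] by (simp add: bij_betw_def)
        then obtain w where w: "w \<in> Hom T Z' W" "v \<bullet> \<eta> Z = w \<bullet> c" by blast
        then have "v = w \<bullet> e"
          using reflection_eqI[OF Sc R[OF d(7)] W v cmp_hom[OF e(1) w(1)]] ec by simp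
        then show ?thesis using w by blast
      qed
      moreover have "w \<bullet> e \<in> Hom T (Lo Z) W" if "w \<in> Hom T Z' W" for w using cmp_hom[OF e(1) that] .
      ultimately show ?thesis unfolding bij_betw_def by blast
    qed
    then have ei: "iso_arr T e"
      using iso_arr_if_bij_precomp[OF e(1)] Z' Lp[OF d(7)] by blast
    obtain e' where e': "e' \<in> Hom T Z' (Lo Z)" "e' \<bullet> e = ident T (Lo Z)" "e \<bullet> e' = ident T Z'"
      using iso_arrE[OF ei e(1)] by blast
    have e'i: "iso_arr T e'" using iso_arrI e e' by blast
    note o1 = Sg_obj[OF d(5), of 1]
    have th: "\<theta> X \<bullet> La h \<in> Hom T (Lo Z) (Sg 1 (Lo X))" using cmp_hom[OF Lhh(1) \<theta>(1)[OF d(5)]] .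
    have eg: "e \<bullet> La g = g'"
    proof (rule reflection_eqI[OF Sc R[OF d(6)] Z' cmp_hom[OF Lg(1) e(1)] d'(3)])
      show "(e \<bullet> La g) \<bullet> \<eta> Y = g' \<bullet> \<eta> Y"
        using cmp_assoc[OF Lh[OF d(6)] Lg(1) e(1)] cmp_assoc[OF d(3) Lh[OF d(7)] e(1)] Lg(2) e(2) c(2)
        by simp
    qed
    have he: "h' \<bullet> e = \<theta> X \<bullet> La h"
    proof (rule reflection_eqI[OF Sc R[OF d(7)] _ cmp_hom[OF e(1) d'(4)] th])
      show "Sg 1 (Lo X) \<in> right_perp T S" using perp(4)[OF Lp[OF d(5)]] .
      have "(\<theta> X \<bullet> La h) \<bullet> \<eta> Z = \<theta> X \<bullet> (\<eta> (Sg 1 X) \<bullet> h)"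
        using cmp_assoc[OF Lh[OF d(7)] Lhh(1) \<theta>(1)[OF d(5)]] Lhh(2) by simp
      also have "\<dots> = Sa 1 (\<eta> X) \<bullet> h"
        using cmp_assoc[OF d(4) Lh[OF o1] \<theta>(1)[OF d(5)]] \<theta>(2)[OF d(5)] by simp
      also have "\<dots> = (h' \<bullet> e) \<bullet> \<eta> Z" using cmp_assoc[OF Lh[OF d(7)] e(1) d'(4)] e(2) c(3) by simp
      finally show "(h' \<bullet> e) \<bullet> \<eta> Z = (\<theta> X \<bullet> La h) \<bullet> \<eta> Z" by simp
    qed
    show ?thesis
    proof (rule tri_iso[OF t' ident_hom[OF Lobj[OF d(5)]] ident_hom[OF Lobj[OF d(6)]] e'(1)])
      show "ident T (Lo Y) \<bullet> La f = La f \<bullet> ident T (Lo X)"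
        using cmp_ident_left[OF Lf(1)] cmp_ident_right[OF Lf(1)] by simp
      show "e' \<bullet> g' = La g \<bullet> ident T (Lo Y)"
        using cmp_assoc[OF Lg(1) e(1) e'(1)] e' eg cmp_ident_left[OF Lg(1)] cmp_ident_right[OF Lg(1)]
        by simp
      show "Sa 1 (ident T (Lo X)) \<bullet> h' = (\<theta> X \<bullet> La h) \<bullet> e'"
        using Sa_ident[OF Lobj[OF d(5)], of 1] cmp_ident_left[OF d'(4)]
          cmp_assoc[OF e'(1) e(1) d'(4)] he e' cmp_ident_right[OF d'(4)] by simp
    qed (use iso_arr_ident Lobj d e'i Lf Lg th in auto)
  qed
  have "exact_functor_via T Lo La \<theta>"
    unfolding exact_functor_via_def natural_transformation_def
  proof (intro conjI ballI)
    show "\<theta> X \<in> Hom T (Lo (susp_obj T X)) (susp_obj T (Lo X))" if "X \<in> obj T" for X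
      using \<theta>(1)[OF that] by (simp add: susp_eq)
    show "susp_arr T (La f) \<bullet> \<theta> (Dom T f) = \<theta> (Cod T f) \<bullet> La (susp_arr T f)" if "f \<in> arr T" for f
      using \<theta>nat[of f "Dom T f" "Cod T f"] that by (simp add: susp_eq Hom_def)
    fix t assume "t \<in> exact_triangles T"
    moreover obtain f g h where "t = (f, g, h)" by (cases t)
    ultimately show "case t of (f, g, h) \<Rightarrow> (La f, La g, \<theta> (Dom T f) \<bullet> La h) \<in> exact_triangles T"
      using triD(1)[OF ex[OF exact_tri[of f g h]]] by simp
  qed (use add \<theta>iso in auto)
  moreover have "natural_transformation T (\<lambda>X. X) (\<lambda>f. f) Lo La \<eta>"
    unfolding natural_transformation_def using Lh La(2) by (auto simp: Hom_def)
  moreover have "iso_arr T (La (\<eta> X)) \<and> La (\<eta> X) = \<eta> (Lo X)" if X: "X \<in> obj T" for X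
  proof -
    have "\<eta> (Lo X) = La (\<eta> X)" by (rule Lu[OF Lh[OF X] Lh[OF Lobj[OF X]]]) simp
    moreover have "iso_arr T (\<eta> (Lo X))" using reflection_iso_if_perp[OF Sc R[OF Lobj[OF X]] Lp[OF X]] .
    ultimately show ?thesis by simp
  qed
  moreover have "Ker T Lo = S"
    using reflection_zero_iff[OF S R] triangulated_subcategoryD(1)[OF S] by (auto simp: Ker_def)
  ultimately show ?thesis unfolding localization_functor_def exact_functor_def by blast
qed

end

section \<open>Kernel and image of a given localization functor\<close>

locale bousfield_localization = triangulated_category T for T :: "('o, 'm, 'z) triangulated_category_scheme" (structure) +
  fixes Lo La \<eta>
  assumes loc: "localization_functor T Lo La \<eta>"
begin

lemma L_additive: "additive_endofunctor T Lo La"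
  using loc by (auto simp: localization_functor_def exact_functor_def exact_functor_via_def)

lemmas L_hom = additive_functor_hom[OF L_additive]
lemmas L_obj = additive_functor_ident(2)[OF L_additive]
lemmas L_ident = additive_functor_ident(1)[OF L_additive]
lemmas L_zero = additive_functor_zero[OF L_additive]
lemmas L_cmp = additive_functor_cmp[OF L_additive]

lemma unit_hom: "X \<in> obj T \<Longrightarrow> \<eta> X \<in> Hom T X (Lo X)"
  using loc by (auto simp: localization_functor_def natural_transformation_def)

lemma unit_natural: "f \<in> Hom T X Y \<Longrightarrow> La f \<bullet> \<eta> X = \<eta> Y \<bullet> f"
  using loc by (auto simp: localization_functor_def natural_transformation_def Hom_def)

lemma L_unit:
  assumes "X \<in> obj T"
  shows "iso_arr T (La (\<eta> X))" "La (\<eta> X) = \<eta> (Lo X)"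
  using loc assms by (auto simp: localization_functor_def)

lemma L_tri:
  assumes t: "tri X Y Z f g h"
  obtains h' where "tri (Lo X) (Lo Y) (Lo Z) (La f) (La g) h'"
proof -
  obtain \<theta> where \<theta>: "exact_functor_via T Lo La \<theta>"
    using loc by (auto simp: localization_functor_def exact_functor_def)
  note d = triD[OF t]
  have \<theta>h: "\<theta> X \<in> Hom T (Lo (Sg 1 X)) (Sg 1 (Lo X))"
    using \<theta> d by (auto simp: exact_functor_via_def natural_transformation_def susp_eq)
  have "(La f, La g, \<theta> (Dom T f) \<bullet> La h) \<in> exact_triangles T"
    using \<theta> d(1) by (auto simp: exact_functor_via_def)
  then have "(La f, La g, \<theta> X \<bullet> La h) \<in> exact_triangles T" using d(2) by (simp add: HomD)
  then have "tri (Lo X) (Lo Y) (Lo Z) (La f) (La g) (\<theta> X \<bullet> La h)"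
    using d L_hom cmp_hom[OF L_hom[OF d(4)] \<theta>h] by (simp add: tri_def)
  then show ?thesis using that by blast
qed

lemma L_iso:
  assumes f: "iso_arr T f" "f \<in> Hom T X Y"
  shows "iso_arr T (La f)"
proof -
  obtain g where g: "g \<in> Hom T Y X" "g \<bullet> f = ident T X" "f \<bullet> g = ident T Y"
    using iso_arrE[OF f] by blast
  show ?thesis
    using iso_arrI[OF L_hom[OF f(2)] L_hom[OF g(1)]] L_cmp[OF f(2) g(1)] L_cmp[OF g(1) f(2)] g
      L_ident Hom_objD[OF g(1)] by simp
qed

lemma L_susp_zero_iff:
  assumes X: "X \<in> obj T"
  shows "zero_obj T (Lo (Sg 1 X)) \<longleftrightarrow> zero_obj T (Lo X)"
proof -
  obtain \<theta> where \<theta>: "exact_functor_via T Lo La \<theta>"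
    using loc by (auto simp: localization_functor_def exact_functor_def)
  have "\<theta> X \<in> Hom T (Lo (Sg 1 X)) (Sg 1 (Lo X))" "iso_arr T (\<theta> X)"
    using \<theta> X by (auto simp: exact_functor_via_def natural_transformation_def susp_eq)
  then have "iso_obj T (Lo (Sg 1 X)) (Sg 1 (Lo X))" by (rule iso_objI)
  then have "zero_obj T (Lo (Sg 1 X)) \<longleftrightarrow> zero_obj T (Sg 1 (Lo X))"
    using iso_zero_obj iso_obj_sym by blast
  then show ?thesis using zero_Sg[of "Lo X" 1] zero_Sg[of "Sg 1 (Lo X)" "- 1"] L_obj[OF X] by auto
qed

text \<open>By naturality \<open>\<eta> (Lo X) \<bullet> f\<close> passes through
  \<open>Lo Z\<close>, which is zero, and \<open>\<eta> (Lo X)\<close> is invertible.\<close>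

lemma Ker_hom_zero:
  assumes Z: "Z \<in> Ker T Lo" and X: "X \<in> obj T" and f: "f \<in> Hom T Z (Lo X)"
  shows "f = zero_arr T Z (Lo X)"
proof -
  have Z': "Z \<in> obj T" "zero_obj T (Lo Z)" using Z by (auto simp: Ker_def)
  note u = unit_hom[OF L_obj[OF X]]
  have iso: "iso_arr T (\<eta> (Lo X))" using L_unit[OF X] by simp
  obtain g where g: "g \<in> Hom T (Lo (Lo X)) (Lo X)" "g \<bullet> \<eta> (Lo X) = ident T (Lo X)"
    using iso_arrE[OF iso u] by blast
  have "\<eta> (Lo X) \<bullet> f = La f \<bullet> \<eta> Z" using unit_natural[OF f] by simp
  also have "\<dots> = zero_arr T Z (Lo (Lo X))"
    using zero_obj_hom(2)[OF Z'(2) L_hom[OF f]] cmp_zero_left[OF unit_hom[OF Z'(1)]] L_obj X by simp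
  finally have "g \<bullet> (\<eta> (Lo X) \<bullet> f) = zero_arr T Z (Lo X)" using cmp_zero_right[OF g(1) Z'(1)] by simp
  then show ?thesis using cmp_assoc[OF f u g(1)] g cmp_ident_left[OF f] by simp
qed

text \<open>If the unit vanishes, then \<open>La (\<eta> X)\<close> is both zero and invertible.
  This turns membership in the kernel into an equation of morphisms, which can be tested on the
  summands of a coproduct.\<close>

lemma Ker_iff_unit_zero:
  assumes X: "X \<in> obj T"
  shows "X \<in> Ker T Lo \<longleftrightarrow> \<eta> X = zero_arr T X (Lo X)"
proof
  assume "X \<in> Ker T Lo"
  then show "\<eta> X = zero_arr T X (Lo X)" using Ker_hom_zero X unit_hom by blast
next
  assume "\<eta> X = zero_arr T X (Lo X)"
  then have "La (\<eta> X) = zero_arr T (Lo X) (Lo (Lo X))" using L_zero[OF X L_obj[OF X]] by simp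
  then have "zero_obj T (Lo X)" using zero_arr_iso_zero_obj L_unit(1)[OF X] L_obj X by metis
  then show "X \<in> Ker T Lo" using X by (simp add: Ker_def)
qed

lemma Ker_localizing: "localizing \<kappa> T (Ker T Lo)"
  for \<kappa> :: "'k rel"
  unfolding localizing_def
proof (intro conjI allI impI)
  have sub: "Ker T Lo \<subseteq> obj T" by (auto simp: Ker_def)
  show "triangulated_subcategory T (Ker T Lo)"
  proof (rule triangulated_subcategoryI)
    show "Ker T Lo \<subseteq> obj T" by fact
    show "Z \<in> Ker T Lo" if Z: "zero_obj T Z" for Z
    proof -
      note Z' = zero_objD[OF Z]
      have "zero_obj T (Lo Z)"
        using L_ident[OF Z'] zero_obj_ident[OF Z] L_zero[OF Z' Z'] zero_objI[OF L_obj[OF Z']] by simp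
      then show ?thesis using Z' by (simp add: Ker_def)
    qed
    show "Y \<in> Ker T Lo" if X: "X \<in> Ker T Lo" and i: "iso_obj T X Y" for X Y
    proof -
      obtain f where f: "f \<in> Hom T X Y" "iso_arr T f" using i by (auto simp: iso_obj_def)
      have "iso_obj T (Lo X) (Lo Y)" using iso_objI[OF L_hom[OF f(1)] L_iso[OF f(2,1)]] .
      then show ?thesis using X iso_zero_obj Hom_objD[OF f(1)] by (auto simp: Ker_def)
    qed
    show "Sg n X \<in> Ker T Lo" if X: "X \<in> Ker T Lo" for X n
      by (rule Sg_mem[OF sub _ X]) (auto simp: Ker_def L_susp_zero_iff)
    show "Z \<in> Ker T Lo" if t: "tri X Y Z f g h" and XY: "X \<in> Ker T Lo" "Y \<in> Ker T Lo" for X Y Z f g h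
    proof -
      obtain h' where "tri (Lo X) (Lo Y) (Lo Z) (La f) (La g) h'" using L_tri[OF t] by blast
      then have "zero_obj T (Lo Z)"
        using triangulated_subcategoryD(5)[OF zero_objects_triangulated] XY by (auto simp: Ker_def)
      then show ?thesis using triD(7)[OF t] by (simp add: Ker_def)
    qed
  qed
  fix I :: "'k set" and X P \<iota>
  assume P: "is_coproduct T I X P \<iota>" and X: "\<forall>i\<in>I. X i \<in> Ker T Lo"
  note h = is_coproduct_hom[OF P]
  have "\<eta> P = zero_arr T P (Lo P)"
  proof (rule coproduct_eqI[OF P unit_hom[OF h(1)]])
    show "zero_arr T P (Lo P) \<in> Hom T P (Lo P)" using h L_obj by blast
    fix i assume i: "i \<in> I"
    show "\<eta> P \<bullet> \<iota> i = zero_arr T P (Lo P) \<bullet> \<iota> i"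
      using Ker_hom_zero[OF X[rule_format, OF i] h(1) cmp_hom[OF h(3)[OF i] unit_hom[OF h(1)]]]
        cmp_zero_left[OF h(3)[OF i] L_obj[OF h(1)]] by simp
  qed
  then show "P \<in> Ker T Lo" using Ker_iff_unit_zero h by blast
qed

lemma Ker_triangulated: "triangulated_subcategory T (Ker T Lo)"
  using localizingD(1)[OF Ker_localizing] .

lemma L_right_perp: "X \<in> obj T \<Longrightarrow> Lo X \<in> right_perp T (Ker T Lo)"
  using Ker_hom_zero L_obj by (intro right_perpI) auto

text \<open>\<open>Lo\<close> maps the triangle to one in which \<open>La (\<eta> X)\<close> is
  invertible, so the remaining vertex becomes zero.\<close>

lemma unit_fibre_Ker:
  assumes X: "X \<in> obj T" and t: "tri U X (Lo X) f (\<eta> X) h"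
  shows "U \<in> Ker T Lo"
proof -
  obtain h' where "tri (Lo U) (Lo X) (Lo (Lo X)) (La f) (La (\<eta> X)) h'" using L_tri[OF t] by blast
  then have "zero_obj T (Sg 1 (Lo U))" using cone_zero_if_iso tri_rotate L_unit(1)[OF X] by blast
  then have "zero_obj T (Lo U)" using zero_Sg[of "Sg 1 (Lo U)" "- 1"] L_obj triD(5)[OF t] by simp
  then show ?thesis using triD(5)[OF t] by (simp add: Ker_def)
qed

lemma unit_reflection:
  assumes X: "X \<in> obj T"
  shows "reflection (Ker T Lo) X (Lo X) (\<eta> X)"
proof -
  obtain Z g h where "tri X (Lo X) Z (\<eta> X) g h" using tri_cone[OF unit_hom[OF X]] by blast
  then have "tri (Sg (- 1) Z) X (Lo X) (neg_arr T (Sa (- 1) h)) (\<eta> X) g" by (rule tri_rotate_back)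
  then show ?thesis using unit_fibre_Ker[OF X] L_right_perp[OF X] unfolding reflection_def by blast
qed

lemma right_perp_iff_unit_iso:
  assumes X: "X \<in> obj T"
  shows "X \<in> right_perp T (Ker T Lo) \<longleftrightarrow> iso_arr T (\<eta> X)"
proof
  have sc: "susp_closed T (Ker T Lo)" using Ker_triangulated triangulated_susp_closed by blast
  show "X \<in> right_perp T (Ker T Lo) \<Longrightarrow> iso_arr T (\<eta> X)"
    using reflection_iso_if_perp[OF sc unit_reflection[OF X]] .
  assume "iso_arr T (\<eta> X)"
  then have "iso_obj T (Lo X) X" using iso_objI[OF unit_hom[OF X]] iso_obj_sym by blast
  then show "X \<in> right_perp T (Ker T Lo)"
    using triangulated_subcategoryD(3)[OF right_perp_triangulated[OF sc] L_right_perp[OF X]] by blast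
qed

text \<open>Here preservation of coproducts enters: \<open>Lo P\<close> is the coproduct of the
  \<open>Lo (X i)\<close>, so the inverses of the units of the \<open>X i\<close> assemble to an
  inverse of the unit of \<open>P\<close>.\<close>

lemma right_perp_Ker_localizing:
  fixes \<kappa> :: "'k rel"
  assumes pc: "preserves_coproducts \<kappa> T Lo La"
  shows "localizing \<kappa> T (right_perp T (Ker T Lo))"
  unfolding localizing_def
proof (intro conjI allI impI)
  have sc: "susp_closed T (Ker T Lo)" using Ker_triangulated triangulated_susp_closed by blast
  then show "triangulated_subcategory T (right_perp T (Ker T Lo))" by (rule right_perp_triangulated)
  fix I :: "'k set" and X P \<iota>
  assume I: "small \<kappa> I" and P: "is_coproduct T I X P \<iota>" and X: "\<forall>i\<in>I. X i \<in> right_perp T (Ker T Lo)"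
  note h = is_coproduct_hom[OF P]
  have LP: "is_coproduct T I (\<lambda>i. Lo (X i)) (Lo P) (\<lambda>i. La (\<iota> i))"
    using pc I P by (auto simp: preserves_coproducts_def)
  note h' = is_coproduct_hom[OF LP]
  have u: "iso_arr T (\<eta> (X i))" if "i \<in> I" for i using right_perp_iff_unit_iso h(2) X that by blast
  have "\<exists>g. g \<in> Hom T (Lo (X i)) (X i) \<and> g \<bullet> \<eta> (X i) = ident T (X i) \<and> \<eta> (X i) \<bullet> g = ident T (Lo (X i))"
    if i: "i \<in> I" for i
    using iso_arrE[OF u[OF i] unit_hom[OF h(2)[OF i]]] by blast
  then obtain v where v: "\<And>i. i \<in> I \<Longrightarrow> v i \<in> Hom T (Lo (X i)) (X i)"
    "\<And>i. i \<in> I \<Longrightarrow> v i \<bullet> \<eta> (X i) = ident T (X i)"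
    "\<And>i. i \<in> I \<Longrightarrow> \<eta> (X i) \<bullet> v i = ident T (Lo (X i))" by metis
  have vi: "\<iota> i \<bullet> v i \<in> Hom T (Lo (X i)) P" if "i \<in> I" for i using cmp_hom[OF v(1) h(3)] that by blast
  obtain w where w: "w \<in> Hom T (Lo P) P" "\<And>i. i \<in> I \<Longrightarrow> w \<bullet> La (\<iota> i) = \<iota> i \<bullet> v i"
    using coproduct_map[where f="\<lambda>i. \<iota> i \<bullet> v i", OF LP h(1) vi] by blast
  note uP = unit_hom[OF h(1)]
  have wu: "w \<bullet> \<eta> P = ident T P"
  proof (rule coproduct_eqI[OF P cmp_hom[OF uP w(1)] ident_hom[OF h(1)]])
    fix i assume i: "i \<in> I"
    note uX = unit_hom[OF h(2)[OF i]]
    have "(w \<bullet> \<eta> P) \<bullet> \<iota> i = w \<bullet> (La (\<iota> i) \<bullet> \<eta> (X i))"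
      using cmp_assoc[OF h(3)[OF i] uP w(1)] unit_natural[OF h(3)[OF i]] by simp
    also have "\<dots> = (\<iota> i \<bullet> v i) \<bullet> \<eta> (X i)" using cmp_assoc[OF uX h'(3)[OF i] w(1)] w(2)[OF i] by simp
    also have "\<dots> = \<iota> i"
      using cmp_assoc[OF uX v(1)[OF i] h(3)[OF i]] v(2)[OF i] cmp_ident_right[OF h(3)[OF i]] by simp
    finally show "(w \<bullet> \<eta> P) \<bullet> \<iota> i = ident T P \<bullet> \<iota> i" using cmp_ident_left[OF h(3)[OF i]] by simp
  qed
  have uw: "\<eta> P \<bullet> w = ident T (Lo P)"
  proof (rule coproduct_eqI[OF LP cmp_hom[OF w(1) uP] ident_hom[OF h'(1)]])
    fix i assume i: "i \<in> I"
    have "(\<eta> P \<bullet> w) \<bullet> La (\<iota> i) = \<eta> P \<bullet> (\<iota> i \<bullet> v i)"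
      using cmp_assoc[OF h'(3)[OF i] w(1) uP] w(2)[OF i] by simp
    also have "\<dots> = (La (\<iota> i) \<bullet> \<eta> (X i)) \<bullet> v i"
      using cmp_assoc[OF v(1)[OF i] h(3)[OF i] uP] unit_natural[OF h(3)[OF i]] by simp
    also have "\<dots> = La (\<iota> i)"
      using cmp_assoc[OF v(1)[OF i] unit_hom[OF h(2)[OF i]] h'(3)[OF i]] v(3)[OF i]
        cmp_ident_right[OF h'(3)[OF i]] by simp
    finally show "(\<eta> P \<bullet> w) \<bullet> La (\<iota> i) = ident T (Lo P) \<bullet> La (\<iota> i)"
      using cmp_ident_left[OF h'(3)[OF i]] by simp
  qed
  have "iso_arr T (\<eta> P)" using iso_arrI[OF uP w(1) wu uw] .
  then show "P \<in> right_perp T (Ker T Lo)" using right_perp_iff_unit_iso h by blast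
qed

end

section \<open>Compact objects and approximation\<close>

context
  includes cardinal_syntax
begin

lemma size_cardinal_Cinfinite:
  assumes "size_cardinal \<kappa>"
  shows "Card_order \<kappa>" "Cinfinite \<kappa>" "regularCard \<kappa>" "\<not> finite (Field \<kappa>)"
proof -
  show c: "Card_order \<kappa>" and "regularCard \<kappa>" using assms by (auto simp: size_cardinal_def)
  have "natLeq \<le>o \<kappa>" using assms by (auto simp: size_cardinal_def ordLess_imp_ordLeq)
  then show inf: "\<not> finite (Field \<kappa>)"
    using cinfinite_mono[OF _ natLeq_cinfinite] by (auto simp: cinfinite_def)
  then show "Cinfinite \<kappa>" using c by (auto simp: cinfinite_def)
qed

lemma small_image: "small \<kappa> A \<Longrightarrow> small \<kappa> (f ` A)"
  unfolding small_def using card_of_image ordLeq_ordLess_trans by blast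

lemma small_subset: "small \<kappa> A \<Longrightarrow> B \<subseteq> A \<Longrightarrow> small \<kappa> B"
  unfolding small_def using card_of_mono1 ordLeq_ordLess_trans by blast

lemma small_UN:
  assumes "size_cardinal \<kappa>" "small \<kappa> I" "\<And>i. i \<in> I \<Longrightarrow> small \<kappa> (A i)"
  shows "small \<kappa> (\<Union>i\<in>I. A i)"
  using card_of_UNION_ordLess_infinite_Field_regularCard[OF size_cardinal_Cinfinite(3,2)[OF assms(1)]] assms
  unfolding small_def by blast

lemma small_countable:
  assumes "size_cardinal \<kappa>"
  shows "small \<kappa> (UNIV :: 'a :: countable set)"
proof -
  have "|UNIV :: 'a set| \<le>o |UNIV :: nat set|"
    by (rule card_of_ordLeqI[of to_nat]) (auto intro: inj_onI)
  moreover have "|UNIV :: nat set| <o \<kappa>"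
    using assms card_of_nat ordIso_ordLess_trans by (auto simp: size_cardinal_def)
  ultimately show ?thesis unfolding small_def by (rule ordLeq_ordLess_trans)
qed

lemma small_Times:
  fixes A :: "'b set"
  assumes "size_cardinal \<kappa>" "small \<kappa> A" "small \<kappa> B"
  shows "small \<kappa> (A \<times> B)"
proof -
  have "A \<times> B = (\<Union>a\<in>A. Pair a ` B)" by auto
  moreover have "small \<kappa> (Pair a ` B)" for a :: 'b by (rule small_image[OF assms(3)])
  ultimately show ?thesis using small_UN[OF assms(1,2), of "\<lambda>a. Pair a ` B"] by simp
qed

text \<open>Moves small index sets of other types, such as the natural numbers or sets of morphisms,
  into the type of \<open>\<kappa>\<close>.\<close>

lemma small_index:
  fixes \<kappa> :: "'k rel"
  assumes "size_cardinal \<kappa>" "small \<kappa> J"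
  obtains I :: "'k set" and e where "bij_betw e J I" "small \<kappa> I"
proof -
  have c: "Card_order \<kappa>" using size_cardinal_Cinfinite assms by blast
  have "|J| \<le>o |Field \<kappa>|"
    using assms(2) c unfolding small_def
    by (meson card_of_Field_ordIso ordIso_symmetric ordLeq_ordIso_trans ordLess_imp_ordLeq)
  then obtain e where e: "inj_on e J" "e ` J \<subseteq> Field \<kappa>" using card_of_ordLeq[of J "Field \<kappa>"] by blast
  have "bij_betw e J (e ` J)" using e by (auto simp: bij_betw_def)
  moreover have "small \<kappa> (e ` J)" using assms small_image by blast
  ultimately show ?thesis using that by blast
qed

end

context additive_category
begin

section \<open>Finite sums of morphisms and compactness by finite support\<close>

lemma hom_group_monoid: "X \<in> obj T \<Longrightarrow> Y \<in> obj T \<Longrightarrow> comm_monoid (hom_group T X Y)"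
  using hom_group comm_group.axioms(1) by blast

lemma finprod_hom:
  assumes "X \<in> obj T" "Y \<in> obj T" "\<And>i. i \<in> F \<Longrightarrow> a i \<in> Hom T X Y"
  shows "finprod (hom_group T X Y) a F \<in> Hom T X Y"
  using comm_monoid.finprod_closed[OF hom_group_monoid[OF assms(1,2)], of a F] assms(3) by auto

lemma finprod_insert_hom:
  assumes "X \<in> obj T" "Y \<in> obj T" "finite F" "j \<notin> F" "\<And>i. i \<in> insert j F \<Longrightarrow> a i \<in> Hom T X Y"
  shows "finprod (hom_group T X Y) a (insert j F) = a j \<boxplus> finprod (hom_group T X Y) a F"
  using comm_monoid.finprod_insert[OF hom_group_monoid[OF assms(1,2)] assms(3,4), of a] assms(5) by auto

lemma finprod_empty_hom: "finprod (hom_group T X Y) a {} = zero_arr T X Y"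
  if "X \<in> obj T" "Y \<in> obj T"
  using comm_monoid.finprod_empty[OF hom_group_monoid[OF that]] by simp

lemma cmp_finprod:
  assumes u: "u \<in> Hom T Y Z" and X: "X \<in> obj T" and "finite F" "\<And>i. i \<in> F \<Longrightarrow> a i \<in> Hom T X Y"
  shows "u \<bullet> finprod (hom_group T X Y) a F = finprod (hom_group T X Z) (\<lambda>i. u \<bullet> a i) F"
  using assms(3,4)
proof (induction F)
  case empty
  show ?case using X Hom_objD[OF u] cmp_zero_right[OF u X] by (simp add: finprod_empty_hom)
next
  case (insert j F)
  note o = Hom_objD[OF u]
  have a: "a j \<in> Hom T X Y" "finprod (hom_group T X Y) a F \<in> Hom T X Y"
    using insert(4) by (auto intro!: finprod_hom X o)
  have "u \<bullet> finprod (hom_group T X Y) a (insert j F) = u \<bullet> a j \<boxplus> u \<bullet> finprod (hom_group T X Y) a F"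
    using finprod_insert_hom[OF X o(1) insert(1,2,4)] cmp_plus_right[OF a u] by simp
  also have "\<dots> = finprod (hom_group T X Z) (\<lambda>i. u \<bullet> a i) (insert j F)"
    using insert finprod_insert_hom[OF X o(2) insert(1,2), of "\<lambda>i. u \<bullet> a i"] cmp_hom[OF _ u] by auto
  finally show ?case .
qed

lemma finprod_cmp:
  assumes u: "u \<in> Hom T W X" and Y: "Y \<in> obj T" and "finite F" "\<And>i. i \<in> F \<Longrightarrow> a i \<in> Hom T X Y"
  shows "finprod (hom_group T X Y) a F \<bullet> u = finprod (hom_group T W Y) (\<lambda>i. a i \<bullet> u) F"
  using assms(3,4)
proof (induction F)
  case empty
  show ?case using Y Hom_objD[OF u] cmp_zero_left[OF u Y] by (simp add: finprod_empty_hom)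
next
  case (insert j F)
  note o = Hom_objD[OF u]
  have a: "a j \<in> Hom T X Y" "finprod (hom_group T X Y) a F \<in> Hom T X Y"
    using insert(4) by (auto intro!: finprod_hom Y o)
  have "finprod (hom_group T X Y) a (insert j F) \<bullet> u = a j \<bullet> u \<boxplus> finprod (hom_group T X Y) a F \<bullet> u"
    using finprod_insert_hom[OF o(2) Y insert(1,2,4)] cmp_plus_left[OF u a] by simp
  also have "\<dots> = finprod (hom_group T W Y) (\<lambda>i. a i \<bullet> u) (insert j F)"
    using insert finprod_insert_hom[OF o(1) Y insert(1,2), of "\<lambda>i. a i \<bullet> u"] cmp_hom[OF u] by auto
  finally show ?case .
qed

lemma finprod_zero:
  assumes "X \<in> obj T" "Y \<in> obj T" "\<And>i. i \<in> F \<Longrightarrow> a i = zero_arr T X Y"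
  shows "finprod (hom_group T X Y) a F = zero_arr T X Y"
  using comm_monoid.finprod_one_eqI[OF hom_group_monoid[OF assms(1,2)], of F a] assms(3) by simp

lemma finprod_single:
  assumes X: "X \<in> obj T" "Y \<in> obj T" and F: "finite F" "j \<in> F" "\<And>i. i \<in> F \<Longrightarrow> a i \<in> Hom T X Y"
    and z: "\<And>i. i \<in> F \<Longrightarrow> i \<noteq> j \<Longrightarrow> a i = zero_arr T X Y"
  shows "finprod (hom_group T X Y) a F = a j"
proof -
  have "F = insert j (F - {j})" using F by auto
  then have "finprod (hom_group T X Y) a F = a j \<boxplus> finprod (hom_group T X Y) a (F - {j})"
    using finprod_insert_hom[OF X, of "F - {j}" j a] F by auto
  then show ?thesis using finprod_zero[OF X, of "F - {j}" a] z plus_zero(2) F by auto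
qed

definition coproduct_proj where
  "coproduct_proj I X P \<iota> i \<pi> \<longleftrightarrow> \<pi> \<in> Hom T P (X i) \<and> \<pi> \<bullet> \<iota> i = ident T (X i) \<and>
     (\<forall>j\<in>I. j \<noteq> i \<longrightarrow> \<pi> \<bullet> \<iota> j = zero_arr T (X j) (X i))"

lemma coproduct_projE:
  assumes "is_coproduct T I X P \<iota>"
  obtains \<pi> where "\<And>i. i \<in> I \<Longrightarrow> coproduct_proj I X P \<iota> i (\<pi> i)"
proof -
  have "\<forall>i\<in>I. \<exists>\<pi>. coproduct_proj I X P \<iota> i \<pi>"
    using coproduct_projection[OF assms] unfolding coproduct_proj_def by metis
  then show ?thesis using that by metis
qed

text \<open>
  A morphism into a coproduct is supported on \<open>F\<close> if it factors through the subcoproduct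
  indexed by \<open>F\<close>. The dual formulation below avoids forming sums.
\<close>

definition supported where
  "supported X P \<iota> C F g \<longleftrightarrow> (\<forall>Y. \<forall>u \<in> Hom T P Y.
     (\<forall>i\<in>F. u \<bullet> \<iota> i = zero_arr T (X i) Y) \<longrightarrow> u \<bullet> g = zero_arr T C Y)"

lemma supportedD:
  "supported X P \<iota> C F g \<Longrightarrow> u \<in> Hom T P Y \<Longrightarrow> (\<And>i. i \<in> F \<Longrightarrow> u \<bullet> \<iota> i = zero_arr T (X i) Y)
     \<Longrightarrow> u \<bullet> g = zero_arr T C Y"
  unfolding supported_def by blast

text \<open>A finitely supported morphism is the sum of its components. As an induction principle
  this proves additive properties of it without writing the sum.\<close>

lemma supported_induct:
  assumes P: "is_coproduct T I X P \<iota>" and F: "finite F" "F \<subseteq> I" "supported X P \<iota> C F g"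
    and g: "g \<in> Hom T C P"
    and zero: "Q (zero_arr T C P)"
    and plus: "\<And>f f'. f \<in> Hom T C P \<Longrightarrow> f' \<in> Hom T C P \<Longrightarrow> Q f \<Longrightarrow> Q f' \<Longrightarrow> Q (f \<boxplus> f')"
    and inj: "\<And>i \<pi>. i \<in> I \<Longrightarrow> coproduct_proj I X P \<iota> i \<pi> \<Longrightarrow> Q (\<iota> i \<bullet> (\<pi> \<bullet> g))"
  shows "Q g"
proof -
  note h = is_coproduct_hom[OF P]
  obtain \<pi> where \<pi>: "\<And>i. i \<in> I \<Longrightarrow> coproduct_proj I X P \<iota> i (\<pi> i)" using coproduct_projE[OF P] by blast
  have \<pi>h: "\<pi> i \<in> Hom T P (X i)" "\<pi> i \<bullet> \<iota> i = ident T (X i)" if "i \<in> I" for i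
    using \<pi>[OF that] by (auto simp: coproduct_proj_def)
  have \<pi>0: "\<pi> i \<bullet> \<iota> j = zero_arr T (X j) (X i)" if "i \<in> I" "j \<in> I" "i \<noteq> j" for i j
    using \<pi>[OF that(1)] that by (auto simp: coproduct_proj_def)
  have C: "C \<in> obj T" using g Hom_objD by blast
  \<comment> \<open>Generalized over \<open>g\<close>: the step passes to \<open>g\<close> minus its
    component at \<open>j\<close>, whose components at \<open>F\<close> are those of
    \<open>g\<close>.\<close>
  have "\<And>g. g \<in> Hom T C P \<Longrightarrow> supported X P \<iota> C F g \<Longrightarrow> (\<And>i. i \<in> F \<Longrightarrow> Q (\<iota> i \<bullet> (\<pi> i \<bullet> g))) \<Longrightarrow> Q g"
    using F(1,2)
  proof (induction F)
    case empty
    have "ident T P \<bullet> g = zero_arr T C P"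
      by (rule supportedD[OF empty(2) ident_hom[OF h(1)]]) auto
    then show ?case using zero cmp_ident_left[OF empty(1)] by simp
  next
    case (insert j F)
    have j: "j \<in> I" using insert by auto
    note g = insert(4)
    note \<iota>j = h(3)[OF j] and \<pi>j = \<pi>h[OF j]
    have pg: "\<pi> j \<bullet> g \<in> Hom T C (X j)" using cmp_hom[OF g \<pi>j(1)] .
    let ?e = "\<iota> j \<bullet> \<pi> j"
    have e: "?e \<in> Hom T P P" using cmp_hom[OF \<pi>j(1) \<iota>j] .
    have eg: "?e \<bullet> g = \<iota> j \<bullet> (\<pi> j \<bullet> g)" using cmp_assoc[OF g \<pi>j(1) \<iota>j] .
    have ig: "\<iota> j \<bullet> (\<pi> j \<bullet> g) \<in> Hom T C P" using cmp_hom[OF pg \<iota>j] .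
    let ?g = "g \<boxminus> \<iota> j \<bullet> (\<pi> j \<bullet> g)"
    have g': "?g \<in> Hom T C P" using minus_hom[OF g ig] .
    have "Q ?g"
    proof (rule insert(3)[OF g'])
      show "F \<subseteq> I" using insert by auto
      \<comment> \<open>A test morphism \<open>u\<close> vanishing on \<open>F\<close> may be
        nonzero on the summand \<open>j\<close>. Subtracting \<open>u \<bullet> ?e\<close> repairs
        this, and the result takes on \<open>g\<close> the value that \<open>u\<close> takes on
        \<open>?g\<close>.\<close>
      show "supported X P \<iota> C F ?g"
        unfolding supported_def
      proof (intro allI ballI impI)
        fix Y u assume u: "u \<in> Hom T P Y" and z: "\<forall>i\<in>F. u \<bullet> \<iota> i = zero_arr T (X i) Y"
        have Y: "Y \<in> obj T" using u Hom_objD by blast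
        have ue: "u \<bullet> ?e \<in> Hom T P Y" using cmp_hom[OF e u] .
        have u': "u \<boxminus> u \<bullet> ?e \<in> Hom T P Y" using minus_hom[OF u ue] .
        have "(u \<boxminus> u \<bullet> ?e) \<bullet> \<iota> i = zero_arr T (X i) Y" if i: "i \<in> insert j F" for i
        proof -
          have iI: "i \<in> I" using i insert by auto
          note \<iota>i = h(3)[OF iI]
          have *: "(u \<boxminus> u \<bullet> ?e) \<bullet> \<iota> i = u \<bullet> \<iota> i \<boxminus> u \<bullet> (\<iota> j \<bullet> (\<pi> j \<bullet> \<iota> i))"
            using cmp_minus_left[OF \<iota>i u ue] cmp_assoc[OF \<iota>i e u] cmp_assoc[OF \<iota>i \<pi>j(1) \<iota>j] by simp
          show ?thesis
          proof (cases "i = j")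
            case True
            then show ?thesis using * \<pi>j(2) cmp_ident_right[OF \<iota>i] minus_self[OF cmp_hom[OF \<iota>i u]] by simp
          next
            case False
            then have "\<pi> j \<bullet> \<iota> i = zero_arr T (X i) (X j)" using \<pi>0 j iI by blast
            then have "u \<bullet> (\<iota> j \<bullet> (\<pi> j \<bullet> \<iota> i)) = zero_arr T (X i) Y"
              using cmp_zero_right[OF \<iota>j h(2)[OF iI]] cmp_zero_right[OF u h(2)[OF iI]] by simp
            then show ?thesis using * z i False minus_self[OF zero_hom[OF h(2)[OF iI] Y]] by simp
          qed
        qed
        then have "(u \<boxminus> u \<bullet> ?e) \<bullet> g = zero_arr T C Y" using supportedD[OF insert(5) u'] by blast
        moreover have "(u \<boxminus> u \<bullet> ?e) \<bullet> g = u \<bullet> ?g"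
          using cmp_minus_left[OF g u ue] cmp_minus_right[OF g ig u] cmp_assoc[OF g e u] eg by simp
        ultimately show "u \<bullet> ?g = zero_arr T C Y" by simp
      qed
      fix i assume i: "i \<in> F"
      then have iI: "i \<in> I" "i \<noteq> j" using insert by auto
      have "\<pi> i \<bullet> (\<iota> j \<bullet> (\<pi> j \<bullet> g)) = zero_arr T C (X i)"
        using cmp_assoc[OF pg \<iota>j \<pi>h(1)[OF iI(1)]] \<pi>0[OF iI(1) j iI(2)] cmp_zero_left[OF pg h(2)[OF iI(1)]]
        by simp
      then have "\<pi> i \<bullet> ?g = \<pi> i \<bullet> g"
        using cmp_minus_right[OF g ig \<pi>h(1)[OF iI(1)]] minus_zero[OF cmp_hom[OF g \<pi>h(1)[OF iI(1)]]] by simp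
      then show "Q (\<iota> i \<bullet> (\<pi> i \<bullet> ?g))" using insert(6)[of i] i by simp
    qed
    then have "Q (?g \<boxplus> \<iota> j \<bullet> (\<pi> j \<bullet> g))" using plus[OF g' ig] insert(6)[of j] by simp
    then show ?case using minus_plus[OF g ig] by simp
  qed
  then show ?thesis using g F(3) inj \<pi> F(2) by blast
qed

text \<open>The projections recover the components of a family, so injectivity in
  \<open>compact_obj\<close> is automatic. What remains is surjectivity, which says that every
  morphism into a coproduct is finitely supported.\<close>

lemma compact_obj_iff_supported:
  fixes \<kappa> :: "'k rel"
  shows "compact_obj \<kappa> T C \<longleftrightarrow> C \<in> obj T \<and>
     (\<forall>(I :: 'k set) X P \<iota>. small \<kappa> I \<longrightarrow> is_coproduct T I X P \<iota> \<longrightarrow>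
        (\<forall>g \<in> Hom T C P. \<exists>F. finite F \<and> F \<subseteq> I \<and> supported X P \<iota> C F g))"
    (is "?L \<longleftrightarrow> C \<in> obj T \<and> ?R")
proof (intro iffI conjI allI impI ballI)
  assume L: ?L
  then show C: "C \<in> obj T" by (simp add: compact_obj_def)
  fix I :: "'k set" and X P \<iota> g
  assume I: "small \<kappa> I" and P: "is_coproduct T I X P \<iota>" and g: "g \<in> Hom T C P"
  note h = is_coproduct_hom[OF P]
  have "g \<in> (\<lambda>f. finprod (hom_group T C P) (\<lambda>i. \<iota> i \<bullet> f i) {i \<in> I. f i \<noteq> zero_arr T C (X i)}) `
      {f \<in> (\<Pi>\<^sub>E i\<in>I. Hom T C (X i)). finite {i \<in> I. f i \<noteq> zero_arr T C (X i)}}"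
    using L I P g by (auto simp: compact_obj_def bij_betw_def)
  then obtain f where f: "f \<in> (\<Pi>\<^sub>E i\<in>I. Hom T C (X i))" "finite {i \<in> I. f i \<noteq> zero_arr T C (X i)}"
    "g = finprod (hom_group T C P) (\<lambda>i. \<iota> i \<bullet> f i) {i \<in> I. f i \<noteq> zero_arr T C (X i)}" by blast
  let ?F = "{i \<in> I. f i \<noteq> zero_arr T C (X i)}"
  have fi: "f i \<in> Hom T C (X i)" if "i \<in> I" for i using f(1) that by auto
  have "supported X P \<iota> C ?F g"
    unfolding supported_def
  proof (intro allI ballI impI)
    fix Y u assume u: "u \<in> Hom T P Y" and z: "\<forall>i\<in>?F. u \<bullet> \<iota> i = zero_arr T (X i) Y"
    have Y: "Y \<in> obj T" using u Hom_objD by blast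
    have "u \<bullet> g = finprod (hom_group T C Y) (\<lambda>i. u \<bullet> (\<iota> i \<bullet> f i)) ?F"
      unfolding f(3) using cmp_finprod[OF u C f(2)] cmp_hom[OF fi h(3)] by simp
    also have "\<dots> = zero_arr T C Y"
    proof (rule finprod_zero[OF C Y])
      fix i assume i: "i \<in> ?F"
      then have iI: "i \<in> I" by simp
      show "u \<bullet> (\<iota> i \<bullet> f i) = zero_arr T C Y"
        using cmp_assoc[OF fi[OF iI] h(3)[OF iI] u] z i cmp_zero_left[OF fi[OF iI] Y] by simp
    qed
    finally show "u \<bullet> g = zero_arr T C Y" .
  qed
  then show "\<exists>F. finite F \<and> F \<subseteq> I \<and> supported X P \<iota> C F g" using f(2) by blast
next
  assume R: "C \<in> obj T \<and> ?R"
  then have C: "C \<in> obj T" by blast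
  show ?L
    unfolding compact_obj_def
  proof (intro conjI allI impI C)
    fix I :: "'k set" and X P \<iota>
    assume I: "small \<kappa> I" and P: "is_coproduct T I X P \<iota>"
    note h = is_coproduct_hom[OF P]
    obtain \<pi> where "\<And>i. i \<in> I \<Longrightarrow> coproduct_proj I X P \<iota> i (\<pi> i)" using coproduct_projE[OF P] by blast
    then have \<pi>: "\<pi> i \<in> Hom T P (X i)" "\<pi> i \<bullet> \<iota> i = ident T (X i)"
      "\<And>j. j \<in> I \<Longrightarrow> j \<noteq> i \<Longrightarrow> \<pi> i \<bullet> \<iota> j = zero_arr T (X j) (X i)" if "i \<in> I" for i
      using that by (auto simp: coproduct_proj_def)
    define supp where "supp f = {i \<in> I. f i \<noteq> zero_arr T C (X i)}" for f
    define S where "S f = finprod (hom_group T C P) (\<lambda>i. \<iota> i \<bullet> f i) (supp f)" for f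
    define A where "A = {f \<in> (\<Pi>\<^sub>E i\<in>I. Hom T C (X i)). finite (supp f)}"
    have fi: "f i \<in> Hom T C (X i)" if "f \<in> A" "i \<in> I" for f i using that by (auto simp: A_def)
    have ii: "\<iota> i \<bullet> f i \<in> Hom T C P" if "f \<in> A" "i \<in> I" for f i using cmp_hom[OF fi h(3)] that by blast
    have S: "S f \<in> Hom T C P" if "f \<in> A" for f
      unfolding S_def by (rule finprod_hom[OF C h(1)]) (use ii[OF that] in \<open>auto simp: supp_def\<close>)
    have pS: "\<pi> j \<bullet> S f = f j" if f: "f \<in> A" and j: "j \<in> I" for f j
    proof -
      have fin: "finite (supp f)" using f by (simp add: A_def)
      have *: "\<pi> j \<bullet> (\<iota> i \<bullet> f i) = (if i = j then f j else zero_arr T C (X j))" if i: "i \<in> I" for i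
        using cmp_assoc[OF fi[OF f i] h(3)[OF i] \<pi>(1)[OF j]] \<pi>(2)[OF j] \<pi>(3)[OF j i]
          cmp_ident_left[OF fi[OF f j]] cmp_zero_left[OF fi[OF f i] h(2)[OF j]] by (cases "i = j") auto
      have "\<pi> j \<bullet> S f = finprod (hom_group T C (X j)) (\<lambda>i. \<pi> j \<bullet> (\<iota> i \<bullet> f i)) (supp f)"
        unfolding S_def by (rule cmp_finprod[OF \<pi>(1)[OF j] C fin]) (use ii[OF f] in \<open>auto simp: supp_def\<close>)
      also have "\<dots> = f j"
      proof (cases "j \<in> supp f")
        case True
        have "finprod (hom_group T C (X j)) (\<lambda>i. \<pi> j \<bullet> (\<iota> i \<bullet> f i)) (supp f) = \<pi> j \<bullet> (\<iota> j \<bullet> f j)"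
          by (rule finprod_single[OF C h(2)[OF j] fin True])
             (use * cmp_hom[OF ii[OF f] \<pi>(1)[OF j]] in \<open>auto simp: supp_def\<close>)
        then show ?thesis using *[OF j] by simp
      next
        case False
        then have "finprod (hom_group T C (X j)) (\<lambda>i. \<pi> j \<bullet> (\<iota> i \<bullet> f i)) (supp f) = zero_arr T C (X j)"
          using * by (intro finprod_zero[OF C h(2)[OF j]]) (auto simp: supp_def)
        then show ?thesis using False j by (simp add: supp_def)
      qed
      finally show ?thesis .
    qed
    have "inj_on S A"
    proof (rule inj_onI)
      fix f f' assume f: "f \<in> A" "f' \<in> A" "S f = S f'"
      then have "\<forall>j\<in>I. f j = f' j" using pS by metis
      then show "f = f'" using f unfolding A_def by (intro PiE_ext[of f I _ f']) auto
    qed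
    moreover have "g \<in> S ` A" if g: "g \<in> Hom T C P" for g
    proof -
      obtain F where F: "finite F" "F \<subseteq> I" "supported X P \<iota> C F g" using R I P g by blast
      define f where "f = (\<lambda>i\<in>I. \<pi> i \<bullet> g)"
      have fh: "f \<in> (\<Pi>\<^sub>E i\<in>I. Hom T C (X i))" using cmp_hom[OF g \<pi>(1)] by (auto simp: f_def)
      \<comment> \<open>For \<open>i\<close> outside \<open>F\<close> the projection
        \<open>\<pi> i\<close> vanishes on all summands in \<open>F\<close>, hence on
        \<open>g\<close>.\<close>
      have sub: "supp f \<subseteq> F"
      proof
        fix i assume i: "i \<in> supp f"
        show "i \<in> F"
        proof (rule ccontr)
          assume iF: "i \<notin> F"
          have iI: "i \<in> I" using i by (simp add: supp_def)
          have "\<pi> i \<bullet> g = zero_arr T C (X i)"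
            by (rule supportedD[OF F(3) \<pi>(1)[OF iI]]) (use iF F \<pi>(3)[OF iI] in auto)
          then show False using i iI by (simp add: supp_def f_def)
        qed
      qed
      have fA: "f \<in> A" using fh finite_subset[OF sub F(1)] by (simp add: A_def)
      \<comment> \<open>\<open>?e\<close> projects \<open>P\<close> onto the summands in
        \<open>F\<close>. The identity minus \<open>?e\<close> vanishes on them, hence on
        \<open>g\<close>, which makes \<open>g\<close> the sum of its components.\<close>
      let ?a = "\<lambda>i. \<iota> i \<bullet> \<pi> i"
      have a: "?a i \<in> Hom T P P" if "i \<in> F" for i using cmp_hom[OF \<pi>(1) h(3)] that F by blast
      let ?e = "finprod (hom_group T P P) ?a F"
      have e: "?e \<in> Hom T P P" by (rule finprod_hom[OF h(1,1) a])
      have ej: "?e \<bullet> \<iota> j = \<iota> j" if j: "j \<in> F" for j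
      proof -
        have jI: "j \<in> I" using j F by blast
        note \<iota>j = h(3)[OF jI]
        have *: "?a i \<bullet> \<iota> j = (if i = j then \<iota> j else zero_arr T (X j) P)" if i: "i \<in> F" for i
        proof -
          have iI: "i \<in> I" using i F by blast
          show ?thesis
            using cmp_assoc[OF \<iota>j \<pi>(1)[OF iI] h(3)[OF iI]] \<pi>(2)[OF jI] \<pi>(3)[OF iI jI]
              cmp_ident_right[OF \<iota>j] cmp_zero_right[OF h(3)[OF iI] h(2)[OF jI]] by auto
        qed
        have "?e \<bullet> \<iota> j = finprod (hom_group T (X j) P) (\<lambda>i. ?a i \<bullet> \<iota> j) F"
          by (rule finprod_cmp[OF \<iota>j h(1) F(1) a])
        also have "\<dots> = ?a j \<bullet> \<iota> j"
          by (rule finprod_single[OF h(2)[OF jI] h(1) F(1) j]) (use * cmp_hom[OF \<iota>j a] in auto)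
        finally show ?thesis using *[OF j] by simp
      qed
      have "(ident T P \<boxminus> ?e) \<bullet> g = zero_arr T C P"
      proof (rule supportedD[OF F(3) minus_hom[OF ident_hom[OF h(1)] e]])
        fix i assume i: "i \<in> F"
        then have \<iota>i: "\<iota> i \<in> Hom T (X i) P" using h F by blast
        show "(ident T P \<boxminus> ?e) \<bullet> \<iota> i = zero_arr T (X i) P"
          using cmp_minus_left[OF \<iota>i ident_hom[OF h(1)] e] ej[OF i] cmp_ident_left[OF \<iota>i] minus_self[OF \<iota>i]
          by simp
      qed
      then have "g = ?e \<bullet> g"
        using cmp_minus_left[OF g ident_hom[OF h(1)] e] cmp_ident_left[OF g]
          minus_eq_zero[OF g cmp_hom[OF g e]] by simp
      also have "\<dots> = finprod (hom_group T C P) (\<lambda>i. ?a i \<bullet> g) F" by (rule finprod_cmp[OF g h(1) F(1) a])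
      also have "\<dots> = finprod (hom_group T C P) (\<lambda>i. \<iota> i \<bullet> f i) (supp f)"
      proof (rule comm_monoid.finprod_mono_neutral_cong_right[OF hom_group_monoid[OF C h(1)] F(1) sub])
        have *: "?a i \<bullet> g = \<iota> i \<bullet> f i" if "i \<in> I" for i
          using cmp_assoc[OF g \<pi>(1)[OF that] h(3)[OF that]] that by (simp add: f_def)
        show "?a i \<bullet> g = \<one>\<^bsub>hom_group T C P\<^esub>" if "i \<in> F - supp f" for i
        proof -
          have "i \<in> I" "f i = zero_arr T C (X i)" using that F by (auto simp: supp_def)
          then show ?thesis using * cmp_zero_right[OF h(3) C] by simp
        qed
        show "?a i \<bullet> g = \<iota> i \<bullet> f i" if "i \<in> supp f" for i using * that by (simp add: supp_def)
        show "(\<lambda>i. ?a i \<bullet> g) \<in> F \<rightarrow> carrier (hom_group T C P)" using cmp_hom[OF g a] by auto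
      qed
      finally show ?thesis using fA by (simp add: S_def image_iff) blast
    qed
    ultimately have "bij_betw S A (Hom T C P)" using S by (auto simp: bij_betw_def)
    then show "bij_betw
          (\<lambda>f. finprod (hom_group T C P) (\<lambda>i. \<iota> i \<bullet> f i) {i \<in> I. f i \<noteq> zero_arr T C (X i)})
          {f \<in> (\<Pi>\<^sub>E i\<in>I. Hom T C (X i)). finite {i \<in> I. f i \<noteq> zero_arr T C (X i)}}
          (Hom T C P)"
      unfolding S_def A_def supp_def .
  qed
qed

end

context triangulated_category
begin

section \<open>The subcategory of compact objects\<close>

lemma compactsI:
  fixes \<kappa> :: "'k rel"
  assumes "C \<in> obj T"
    and "\<And>(I :: 'k set) X P \<iota> g. small \<kappa> I \<Longrightarrow> is_coproduct T I X P \<iota> \<Longrightarrow> g \<in> Hom T C P \<Longrightarrow>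
      \<exists>F. finite F \<and> F \<subseteq> I \<and> supported X P \<iota> C F g"
  shows "C \<in> compacts \<kappa> T"
proof -
  have "compact_obj \<kappa> T C"
    by (rule iffD2[OF compact_obj_iff_supported]) (intro conjI allI impI ballI assms)
  then show ?thesis by (simp add: compacts_def)
qed

lemma compactsD:
  fixes \<kappa> :: "'k rel"
  assumes "C \<in> compacts \<kappa> T"
  shows "C \<in> obj T"
    and "\<And>(I :: 'k set) X P \<iota> g. small \<kappa> I \<Longrightarrow> is_coproduct T I X P \<iota> \<Longrightarrow> g \<in> Hom T C P \<Longrightarrow>
      \<exists>F. finite F \<and> F \<subseteq> I \<and> supported X P \<iota> C F g"
proof -
  have "compact_obj \<kappa> T C" using assms by (simp add: compacts_def)
  note a = iffD1[OF compact_obj_iff_supported this]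
  show "C \<in> obj T" using a by simp
  show "\<exists>F. finite F \<and> F \<subseteq> I \<and> supported X P \<iota> C F g"
    if "small \<kappa> I" "is_coproduct T I X P \<iota>" "g \<in> Hom T C P" for I :: "'k set" and X P \<iota> g
    by (rule a[THEN conjunct2, rule_format, OF that])
qed

lemma compact_supported:
  fixes \<kappa> :: "'k rel"
  assumes \<kappa>: "size_cardinal \<kappa>" and C: "C \<in> compacts \<kappa> T" and J: "small \<kappa> J"
    and P: "is_coproduct T J X P \<iota>" and g: "g \<in> Hom T C P"
  obtains F where "finite F" "F \<subseteq> J" "supported X P \<iota> C F g"
proof -
  obtain I :: "'k set" and e where e: "bij_betw e J I" "small \<kappa> I" using small_index[OF \<kappa> J] by blast
  let ?d = "inv_into J e"
  have d: "bij_betw ?d I J" using e bij_betw_inv_into by blast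
  have "is_coproduct T I (\<lambda>i. X (?d i)) P (\<lambda>i. \<iota> (?d i))" by (rule coproduct_reindex[OF P d])
  from compactsD(2)[OF C e(2) this g]
  obtain F where F: "finite F" "F \<subseteq> I" "supported (\<lambda>i. X (?d i)) P (\<lambda>i. \<iota> (?d i)) C F g" by blast
  have "supported X P \<iota> C (?d ` F) g" using F(3) by (auto simp: supported_def)
  moreover have "?d ` F \<subseteq> J" using F d by (auto simp: bij_betw_def)
  ultimately show ?thesis using that[of "?d ` F"] F by simp
qed

lemma localizing_coproduct:
  fixes \<kappa> :: "'k rel"
  assumes \<kappa>: "size_cardinal \<kappa>" and S: "localizing \<kappa> T S" and J: "small \<kappa> J"
    and P: "is_coproduct T J X P \<iota>" and X: "\<And>j. j \<in> J \<Longrightarrow> X j \<in> S"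
  shows "P \<in> S"
proof -
  obtain I :: "'k set" and e where e: "bij_betw e J I" "small \<kappa> I" using small_index[OF \<kappa> J] by blast
  let ?d = "inv_into J e"
  have d: "bij_betw ?d I J" using e bij_betw_inv_into by blast
  have "is_coproduct T I (\<lambda>i. X (?d i)) P (\<lambda>i. \<iota> (?d i))" by (rule coproduct_reindex[OF P d])
  moreover have "\<forall>i\<in>I. X (?d i) \<in> S" using X d by (auto simp: bij_betw_def)
  ultimately show ?thesis using S e(2) unfolding localizing_def by blast
qed

lemma small_coproduct:
  fixes \<kappa> :: "'k rel"
  assumes \<kappa>: "size_cardinal \<kappa>" and T: "has_coproducts \<kappa> T" and J: "small \<kappa> J"
    and X: "\<And>j. j \<in> J \<Longrightarrow> X j \<in> obj T"
  obtains P \<iota> where "is_coproduct T J X P \<iota>"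
proof -
  obtain I :: "'k set" and e where e: "bij_betw e J I" "small \<kappa> I" using small_index[OF \<kappa> J] by blast
  let ?d = "inv_into J e"
  have "\<forall>i\<in>I. X (?d i) \<in> obj T" using X bij_betw_inv_into[OF e(1)] by (auto simp: bij_betw_def)
  then obtain P \<iota> where P: "is_coproduct T I (\<lambda>i. X (?d i)) P \<iota>"
    using T e(2) unfolding has_coproducts_def by metis
  have "is_coproduct T J X P (\<lambda>j. \<iota> (e j))"
    by (rule coproduct_cong[OF coproduct_reindex[OF P e(1)]])
       (use e in \<open>auto simp: bij_betw_def\<close>)
  then show ?thesis using that by blast
qed

lemma compacts_triangulated:
  fixes \<kappa> :: "'k rel"
  shows "triangulated_subcategory T (compacts \<kappa> T)"
proof (rule triangulated_subcategoryI)
  show "compacts \<kappa> T \<subseteq> obj T" using compactsD(1) by blast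
  show "Z \<in> compacts \<kappa> T" if Z: "zero_obj T Z" for Z
  proof (rule compactsI)
    show "Z \<in> obj T" using Z zero_objD by blast
    fix I :: "'k set" and X P \<iota> g
    assume "small \<kappa> I" "is_coproduct T I X P \<iota>" and g: "g \<in> Hom T Z P"
    have "supported X P \<iota> Z {} g"
      unfolding supported_def using zero_obj_hom(2)[OF Z] cmp_hom[OF g] by blast
    then show "\<exists>F. finite F \<and> F \<subseteq> I \<and> supported X P \<iota> Z F g" by blast
  qed
  show "D \<in> compacts \<kappa> T" if C: "C \<in> compacts \<kappa> T" and i: "iso_obj T C D" for C D
  proof (rule compactsI)
    obtain a b where ab: "a \<in> Hom T C D" "b \<in> Hom T D C" "a \<bullet> b = ident T D"
      using i unfolding iso_obj_def by (metis iso_arrE)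
    show "D \<in> obj T" using ab Hom_objD by blast
    fix I :: "'k set" and X P \<iota> g
    assume I: "small \<kappa> I" and P: "is_coproduct T I X P \<iota>" and g: "g \<in> Hom T D P"
    obtain F where F: "finite F" "F \<subseteq> I" "supported X P \<iota> C F (g \<bullet> a)"
      using compactsD(2)[OF C I P cmp_hom[OF ab(1) g]] by blast
    have "supported X P \<iota> D F g"
      unfolding supported_def
    proof (intro allI ballI impI)
      fix Y u assume u: "u \<in> Hom T P Y" and "\<forall>i\<in>F. u \<bullet> \<iota> i = zero_arr T (X i) Y"
      then have "u \<bullet> (g \<bullet> a) = zero_arr T C Y" using supportedD[OF F(3) u] by blast
      then have "(u \<bullet> (g \<bullet> a)) \<bullet> b = zero_arr T D Y" using cmp_zero_left[OF ab(2)] Hom_objD[OF u] by simp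
      moreover have "(u \<bullet> (g \<bullet> a)) \<bullet> b = u \<bullet> g"
        using cmp_assoc[OF ab(2) cmp_hom[OF ab(1) g] u] cmp_assoc[OF ab(2,1) g] ab cmp_ident_right[OF g]
        by simp
      ultimately show "u \<bullet> g = zero_arr T D Y" by simp
    qed
    then show "\<exists>F. finite F \<and> F \<subseteq> I \<and> supported X P \<iota> D F g" using F by blast
  qed
  show SC: "Sg n C \<in> compacts \<kappa> T" if C: "C \<in> compacts \<kappa> T" for C n
  proof (rule compactsI)
    have oC: "C \<in> obj T" using C compactsD by blast
    then show "Sg n C \<in> obj T" by simp
    fix I :: "'k set" and X P \<iota> g
    assume I: "small \<kappa> I" and P: "is_coproduct T I X P \<iota>" and g: "g \<in> Hom T (Sg n C) P"
    note h = is_coproduct_hom[OF P]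
    have P': "is_coproduct T I (\<lambda>i. Sg (- n) (X i)) (Sg (- n) P) (\<lambda>i. Sa (- n) (\<iota> i))"
      by (rule Sa_coproduct[OF P])
    have g': "Sa (- n) g \<in> Hom T C (Sg (- n) P)" using Sa_hom[OF g, of "- n"] oC by simp
    obtain F where F: "finite F" "F \<subseteq> I"
      "supported (\<lambda>i. Sg (- n) (X i)) (Sg (- n) P) (\<lambda>i. Sa (- n) (\<iota> i)) C F (Sa (- n) g)"
      using compactsD(2)[OF C I P' g'] by blast
    have "supported X P \<iota> (Sg n C) F g"
      unfolding supported_def
    proof (intro allI ballI impI)
      fix Y u assume u: "u \<in> Hom T P Y" and z: "\<forall>i\<in>F. u \<bullet> \<iota> i = zero_arr T (X i) Y"
      have Y: "Y \<in> obj T" using u Hom_objD by blast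
      have "Sa (- n) u \<bullet> Sa (- n) g = zero_arr T C (Sg (- n) Y)"
      proof (rule supportedD[OF F(3) Sa_hom[OF u]])
        fix i assume i: "i \<in> F"
        then have iI: "i \<in> I" using F by blast
        show "Sa (- n) u \<bullet> Sa (- n) (\<iota> i) = zero_arr T (Sg (- n) (X i)) (Sg (- n) Y)"
          using Sa_cmp[OF h(3)[OF iI] u, of "- n"] z i Sa_zero[OF h(2)[OF iI] Y] by simp
      qed
      then have "Sa (- n) (u \<bullet> g) = zero_arr T (Sg (- n) (Sg n C)) (Sg (- n) Y)"
        using Sa_cmp[OF g u] oC by simp
      then show "u \<bullet> g = zero_arr T (Sg n C) Y" using Sa_eq_zero cmp_hom[OF g u] by blast
    qed
    then show "\<exists>F. finite F \<and> F \<subseteq> I \<and> supported X P \<iota> (Sg n C) F g" using F by blast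
  qed
  show "E \<in> compacts \<kappa> T" if t: "tri C D E a b c" and CD: "C \<in> compacts \<kappa> T" "D \<in> compacts \<kappa> T"
    for C D E a b c
  proof (rule compactsI)
    note d = triD[OF t]
    show "E \<in> obj T" by fact
    fix I :: "'k set" and X P \<iota> g
    assume I: "small \<kappa> I" and P: "is_coproduct T I X P \<iota>" and g: "g \<in> Hom T E P"
    note h = is_coproduct_hom[OF P]
    obtain F where F: "finite F" "F \<subseteq> I" "supported X P \<iota> D F (g \<bullet> b)"
      using compactsD(2)[OF CD(2) I P cmp_hom[OF d(3) g]] by blast
    \<comment> \<open>The induced endomorphism \<open>e\<close> of \<open>P\<close> deletes the
      summands in \<open>F\<close>. Then \<open>e \<bullet> g\<close> vanishes on \<open>D\<close>
      and comes from the suspension of \<open>C\<close>, which contributes a second finite set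
      \<open>F'\<close>.\<close>
    define m where "m i = (if i \<in> F then zero_arr T (X i) P else \<iota> i)" for i
    have m: "m i \<in> Hom T (X i) P" if "i \<in> I" for i using h that by (auto simp: m_def)
    obtain e where e: "e \<in> Hom T P P" "\<And>i. i \<in> I \<Longrightarrow> e \<bullet> \<iota> i = m i"
      using coproduct_map[where f=m, OF P h(1) m] by blast
    have eg: "e \<bullet> g \<in> Hom T E P" using cmp_hom[OF g e(1)] .
    have "e \<bullet> (g \<bullet> b) = zero_arr T D P"
      by (rule supportedD[OF F(3) e(1)]) (use e F in \<open>auto simp: m_def\<close>)
    then have "(e \<bullet> g) \<bullet> b = zero_arr T D P" using cmp_assoc[OF d(3) g e(1)] by simp
    then obtain k where k: "k \<in> Hom T (Sg 1 C) P" "e \<bullet> g = k \<bullet> c"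
      using tri_factor_right[OF tri_rotate[OF t] eg] by blast
    obtain F' where F': "finite F'" "F' \<subseteq> I" "supported X P \<iota> (Sg 1 C) F' k"
      using compactsD(2)[OF SC[OF CD(1)] I P k(1)] by blast
    have "supported X P \<iota> E (F \<union> F') g"
      unfolding supported_def
    proof (intro allI ballI impI)
      fix Y u assume u: "u \<in> Hom T P Y" and z: "\<forall>i\<in>F \<union> F'. u \<bullet> \<iota> i = zero_arr T (X i) Y"
      have Y: "Y \<in> obj T" using u Hom_objD by blast
      have "u \<bullet> e = u"
      proof (rule coproduct_eqI[OF P cmp_hom[OF e(1) u] u])
        fix i assume i: "i \<in> I"
        show "(u \<bullet> e) \<bullet> \<iota> i = u \<bullet> \<iota> i"
          using cmp_assoc[OF h(3)[OF i] e(1) u] e(2)[OF i] z cmp_zero_right[OF u h(2)[OF i]]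
          by (auto simp: m_def)
      qed
      then have "u \<bullet> g = u \<bullet> (k \<bullet> c)" using cmp_assoc[OF g e(1) u] k by simp
      also have "u \<bullet> k = zero_arr T (Sg 1 C) Y" using supportedD[OF F'(3) u] z by blast
      then have "u \<bullet> (k \<bullet> c) = zero_arr T E Y" using cmp_assoc[OF d(4) k(1) u] cmp_zero_left[OF d(4) Y] by simp
      finally show "u \<bullet> g = zero_arr T E Y" .
    qed
    then show "\<exists>F. finite F \<and> F \<subseteq> I \<and> supported X P \<iota> E F g" using F F' by (intro exI[of _ "F \<union> F'"]) auto
  qed
qed

text \<open>A morphism from a compact object to a coproduct is built from finitely many components,
  each of which vanishes by orthogonality.\<close>

lemma right_perp_compacts_localizing:
  fixes \<kappa> :: "'k rel"
  assumes K: "susp_closed T K" and sub: "K \<subseteq> compacts \<kappa> T"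
  shows "localizing \<kappa> T (right_perp T K)"
  unfolding localizing_def
proof (intro conjI allI impI)
  show "triangulated_subcategory T (right_perp T K)" by (rule right_perp_triangulated[OF K])
  fix I :: "'k set" and X P \<iota>
  assume I: "small \<kappa> I" and P: "is_coproduct T I X P \<iota>" and X: "\<forall>i\<in>I. X i \<in> right_perp T K"
  note h = is_coproduct_hom[OF P]
  show "P \<in> right_perp T K"
  proof (rule right_perpI)
    fix C g assume C: "C \<in> K" and g: "g \<in> Hom T C P"
    have oC: "C \<in> obj T" using g Hom_objD by blast
    obtain F where F: "finite F" "F \<subseteq> I" "supported X P \<iota> C F g"
      using compactsD(2)[OF _ I P g] C sub by blast
    show "g = zero_arr T C P"
    proof (rule supported_induct[where Q="\<lambda>g. g = zero_arr T C P", OF P F g])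
      show "zero_arr T C P = zero_arr T C P" ..
      show "f \<boxplus> f' = zero_arr T C P" if "f = zero_arr T C P" "f' = zero_arr T C P" for f f'
        using that plus_zero zero_hom oC h by simp
      show "\<iota> i \<bullet> (\<pi> \<bullet> g) = zero_arr T C P" if i: "i \<in> I" and "coproduct_proj I X P \<iota> i \<pi>" for i \<pi>
      proof -
        have "\<pi> \<bullet> g \<in> Hom T C (X i)" using that cmp_hom[OF g] by (simp add: coproduct_proj_def)
        then have "\<pi> \<bullet> g = zero_arr T C (X i)" using right_perpD(1) X i C by blast
        then show ?thesis using cmp_zero_right[OF h(3)[OF i] oC] by simp
      qed
    qed
  qed (fact h(1))
qed

text \<open>
  The approximation of \<open>X\<close> by \<open>Loc K\<close> is the homotopy colimit of a sequence over \<open>X\<close> in which the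
  morphisms from \<open>K\<close> that vanish in \<open>X\<close> are killed step by step.
\<close>

lemma compact_approximation:
  fixes \<kappa> :: "'k rel"
  assumes \<kappa>: "size_cardinal \<kappa>" and T: "has_coproducts \<kappa> T" "locally_small \<kappa> T"
    and K: "susp_closed T K" "K \<subseteq> compacts \<kappa> T" "small \<kappa> K" and X: "X \<in> obj T"
  shows "\<exists>Y g. reflection (Loc \<kappa> T K) X Y g"
proof -
  let ?S = "Loc \<kappa> T K"
  have Kobj: "K \<subseteq> obj T" using K(1) by (auto simp: susp_closed_def)
  have loc: "localizing \<kappa> T ?S" by (rule Loc_localizing[OF Kobj])
  note tr = localizingD(1)[OF loc]
  have KS: "K \<subseteq> ?S" by (rule Loc_subset)
  have Sobj: "U \<in> ?S \<Longrightarrow> U \<in> obj T" for U using localizingD(2)[OF loc] by blast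
  have sm: "small \<kappa> {c \<in> arr T. Dom T c \<in> K \<and> Cod T c = U \<and> Q c}" if U: "U \<in> obj T" for U Q
  proof -
    have "small \<kappa> (\<Union>C\<in>K. Hom T C U)"
      using small_UN[OF \<kappa> K(3), of "\<lambda>C. Hom T C U"] T(2) Kobj U by (auto simp: locally_small_def)
    then show ?thesis by (rule small_subset) (auto simp: Hom_def)
  qed
  \<comment> \<open>\<open>U\<close> is the coproduct over all morphisms from \<open>K\<close> to
    \<open>X\<close>, so that each of them lifts to \<open>U\<close>.\<close>
  have start: "\<exists>U p. U \<in> ?S \<and> p \<in> Hom T U X \<and>
    (\<forall>C\<in>K. \<forall>c\<in>Hom T C X. \<exists>f\<in>Hom T C U. c = p \<bullet> f)"
  proof -
    let ?J = "{c \<in> arr T. Dom T c \<in> K \<and> Cod T c = X \<and> True}"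
    have J: "\<And>c. c \<in> ?J \<Longrightarrow> Dom T c \<in> obj T" by auto
    obtain U \<iota> where U: "is_coproduct T ?J (Dom T) U \<iota>"
      by (rule small_coproduct[where X="Dom T", OF \<kappa> T(1) sm[OF X] J])
    have cJ: "\<And>c. c \<in> ?J \<Longrightarrow> c \<in> Hom T (Dom T c) X" by (auto simp: Hom_def)
    obtain p where p: "p \<in> Hom T U X" "\<And>c. c \<in> ?J \<Longrightarrow> p \<bullet> \<iota> c = c"
      by (rule coproduct_map[where f="\<lambda>c. c", OF U X cJ]) (assumption, rule that, assumption, simp)
    have "U \<in> ?S" by (rule localizing_coproduct[OF \<kappa> loc sm[OF X] U]) (use KS in auto)
    moreover have "\<exists>f\<in>Hom T C U. c = p \<bullet> f" if "C \<in> K" "c \<in> Hom T C X" for C c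
    proof -
      have c: "c \<in> ?J" "Dom T c = C" using that by (auto simp: Hom_def)
      then have "\<iota> c \<in> Hom T C U" using is_coproduct_hom(3)[OF U c(1)] by simp
      then show ?thesis using p(2)[OF c(1)] by metis
    qed
    ultimately show ?thesis using p by blast
  qed
  \<comment> \<open>\<open>U'\<close> is the cone of the coproduct of all morphisms from
    \<open>K\<close> to \<open>U\<close> that vanish in \<open>X\<close>; as \<open>p\<close> kills
    each of them, it extends to \<open>U'\<close>.\<close>
  have step: "\<exists>U' p' s. U' \<in> ?S \<and> p' \<in> Hom T U' X \<and> s \<in> Hom T U U' \<and> p' \<bullet> s = p \<and>
    (\<forall>C\<in>K. \<forall>c\<in>Hom T C U. p \<bullet> c = zero_arr T C X \<longrightarrow> s \<bullet> c = zero_arr T C U')"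
    if U: "U \<in> ?S" and p: "p \<in> Hom T U X" for U p
  proof -
    let ?Q = "\<lambda>c. p \<bullet> c = zero_arr T (Dom T c) X"
    let ?J = "{c \<in> arr T. Dom T c \<in> K \<and> Cod T c = U \<and> ?Q c}"
    have Uo: "U \<in> obj T" using U Sobj by blast
    have J: "\<And>c. c \<in> ?J \<Longrightarrow> Dom T c \<in> obj T" by auto
    obtain N \<iota> where N: "is_coproduct T ?J (Dom T) N \<iota>"
      by (rule small_coproduct[where X="Dom T", OF \<kappa> T(1) sm[OF Uo] J])
    note h = is_coproduct_hom[OF N]
    have cJ: "\<And>c. c \<in> ?J \<Longrightarrow> c \<in> Hom T (Dom T c) U" by (auto simp: Hom_def)
    obtain k where k: "k \<in> Hom T N U" "\<And>c. c \<in> ?J \<Longrightarrow> k \<bullet> \<iota> c = c"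
      by (rule coproduct_map[where f="\<lambda>c. c", OF N Uo cJ]) (assumption, rule that, assumption, simp)
    have NS: "N \<in> ?S" by (rule localizing_coproduct[OF \<kappa> loc sm[OF Uo] N]) (use KS in auto)
    obtain U' s w where t: "tri N U U' k s w" using tri_cone[OF k(1)] by blast
    note d = triD[OF t]
    have "p \<bullet> k = zero_arr T N X"
    proof (rule coproduct_eqI[OF N cmp_hom[OF k(1) p] zero_hom[OF d(5) X]])
      fix c assume c: "c \<in> ?J"
      show "(p \<bullet> k) \<bullet> \<iota> c = zero_arr T N X \<bullet> \<iota> c"
        using cmp_assoc[OF h(3)[OF c] k(1) p] k(2)[OF c] c cmp_zero_left[OF h(3)[OF c] X] by simp
    qed
    then obtain p' where p': "p' \<in> Hom T U' X" "p = p' \<bullet> s" using tri_factor_right[OF t p] by blast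
    have "U' \<in> ?S" using triangulated_subcategoryD(5)[OF tr t NS U] .
    moreover have "s \<bullet> c = zero_arr T C U'"
      if C: "C \<in> K" and c: "c \<in> Hom T C U" and z: "p \<bullet> c = zero_arr T C X" for C c
    proof -
      have cJ: "c \<in> ?J" "Dom T c = C" using C c z by (auto simp: Hom_def)
      have \<iota>c: "\<iota> c \<in> Hom T C N" using h(3)[OF cJ(1)] cJ(2) by simp
      have "s \<bullet> c = (s \<bullet> k) \<bullet> \<iota> c" using cmp_assoc[OF \<iota>c k(1) d(3)] k(2)[OF cJ(1)] by simp
      then show ?thesis using tri_cmp_zero(1)[OF t] cmp_zero_left[OF \<iota>c d(7)] by simp
    qed
    ultimately show ?thesis using p' d(3) by blast
  qed
  obtain U0 p0 where U0: "U0 \<in> ?S" "p0 \<in> Hom T U0 X"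
    "\<And>C c. C \<in> K \<Longrightarrow> c \<in> Hom T C X \<Longrightarrow> \<exists>f\<in>Hom T C U0. c = p0 \<bullet> f" using start by blast
  define St where "St = {(U, p). U \<in> ?S \<and> p \<in> Hom T U X}"
  define R where "R a b \<longleftrightarrow> (\<exists>s. s \<in> Hom T (fst a) (fst b) \<and> snd b \<bullet> s = snd a \<and>
    (\<forall>C\<in>K. \<forall>c\<in>Hom T C (fst a). snd a \<bullet> c = zero_arr T C X \<longrightarrow> s \<bullet> c = zero_arr T C (fst b)))" for a b
  \<comment> \<open>The clause for \<open>n = 0\<close> anchors the sequence at \<open>U0\<close>,
    whose lifting property is used at the end.\<close>
  have "\<exists>f. \<forall>n. (f n \<in> St \<and> (n = 0 \<longrightarrow> f n = (U0, p0))) \<and> R (f n) (f (Suc n))"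
  proof (rule dependent_nat_choice)
    show "\<exists>x. x \<in> St \<and> ((0::nat) = 0 \<longrightarrow> x = (U0, p0))" using U0 by (auto simp: St_def)
    fix x and n :: nat assume "x \<in> St \<and> (n = 0 \<longrightarrow> x = (U0, p0))"
    then have x: "fst x \<in> ?S" "snd x \<in> Hom T (fst x) X" by (auto simp: St_def)
    obtain U' p' s where "U' \<in> ?S" "p' \<in> Hom T U' X" "s \<in> Hom T (fst x) U'" "p' \<bullet> s = snd x"
      "\<forall>C\<in>K. \<forall>c\<in>Hom T C (fst x). snd x \<bullet> c = zero_arr T C X \<longrightarrow> s \<bullet> c = zero_arr T C U'"
      using step[OF x] by blast
    then have "(U', p') \<in> St" "R x (U', p')" by (auto simp: St_def R_def)
    then show "\<exists>y. (y \<in> St \<and> (Suc n = 0 \<longrightarrow> y = (U0, p0))) \<and> R x y" by blast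
  qed
  then obtain q where q: "\<And>n. q n \<in> St" "q 0 = (U0, p0)" "\<And>n. R (q n) (q (Suc n))" by blast
  define U p where "U n = fst (q n)" and "p n = snd (q n)" for n
  have U: "U n \<in> ?S" "p n \<in> Hom T (U n) X" for n using q(1)[of n] by (auto simp: St_def U_def p_def)
  have zero: "U 0 = U0" "p 0 = p0" using q(2) by (auto simp: U_def p_def)
  have "\<forall>n. \<exists>s. s \<in> Hom T (U n) (U (Suc n)) \<and> p (Suc n) \<bullet> s = p n \<and>
    (\<forall>C\<in>K. \<forall>c\<in>Hom T C (U n). p n \<bullet> c = zero_arr T C X \<longrightarrow> s \<bullet> c = zero_arr T C (U (Suc n)))"
    using q(3) by (simp add: R_def U_def p_def)
  then obtain s where s: "\<And>n. s n \<in> Hom T (U n) (U (Suc n))" "\<And>n. p (Suc n) \<bullet> s n = p n"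
    "\<And>n C c. C \<in> K \<Longrightarrow> c \<in> Hom T C (U n) \<Longrightarrow> p n \<bullet> c = zero_arr T C X
       \<Longrightarrow> s n \<bullet> c = zero_arr T C (U (Suc n))" by metis
  have Uo: "U n \<in> obj T" for n using U Sobj by blast
  have nat: "small \<kappa> (UNIV :: nat set)" by (rule small_countable[OF \<kappa>])
  obtain P \<iota> where P: "is_coproduct T (UNIV :: nat set) U P \<iota>"
    using small_coproduct[where X=U, OF \<kappa> T(1) nat Uo] by blast
  have Po: "P \<in> obj T" and \<iota>: "\<iota> n \<in> Hom T (U n) P" for n using is_coproduct_hom[OF P] by auto
  have PS: "P \<in> ?S" by (rule localizing_coproduct[OF \<kappa> loc nat P U(1)])
  have \<iota>s: "\<iota> (Suc n) \<bullet> s n \<in> Hom T (U n) P" for n using cmp_hom[OF s(1) \<iota>] .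
  obtain sh where sh: "sh \<in> Hom T P P" "\<And>n. sh \<bullet> \<iota> n = \<iota> (Suc n) \<bullet> s n"
    by (rule coproduct_map[where f="\<lambda>n. \<iota> (Suc n) \<bullet> s n", OF P Po \<iota>s]) (rule that, assumption, simp)
  \<comment> \<open>Identity minus shift; its cone \<open>H\<close> is the homotopy colimit of the
    sequence.\<close>
  let ?\<phi> = "ident T P \<boxminus> sh"
  note idP = ident_hom[OF Po]
  have \<phi>: "?\<phi> \<in> Hom T P P" using minus_hom[OF idP sh(1)] .
  have \<phi>g: "?\<phi> \<bullet> g = g \<boxminus> sh \<bullet> g" if "g \<in> Hom T W P" for g W
    using cmp_minus_left[OF that idP sh(1)] cmp_ident_left[OF that] by simp
  obtain H J h where t: "tri P P H ?\<phi> J h" using tri_cone[OF \<phi>] by blast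
  note d = triD[OF t]
  have HS: "H \<in> ?S" using triangulated_subcategoryD(5)[OF tr t PS PS] .
  define j where "j n = J \<bullet> \<iota> n" for n
  have j: "j n \<in> Hom T (U n) H" for n unfolding j_def using cmp_hom[OF \<iota> d(3)] .
  have js: "j (Suc n) \<bullet> s n = j n" for n
  proof -
    have "J \<bullet> (?\<phi> \<bullet> \<iota> n) = zero_arr T (U n) H"
      using cmp_assoc[OF \<iota> \<phi> d(3)] tri_cmp_zero(1)[OF t] cmp_zero_left[OF \<iota> d(7)] by simp
    then have "j n \<boxminus> J \<bullet> (\<iota> (Suc n) \<bullet> s n) = zero_arr T (U n) H"
      using \<phi>g[OF \<iota>] sh(2) cmp_minus_right[OF \<iota> \<iota>s d(3)] by (simp add: j_def)
    then have "j n = J \<bullet> (\<iota> (Suc n) \<bullet> s n)"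
      using minus_eq_zero[OF j cmp_hom[OF \<iota>s d(3)]] by blast
    then show ?thesis using cmp_assoc[OF s(1) \<iota> d(3)] by (simp add: j_def)
  qed
  obtain r where r: "r \<in> Hom T P X" "\<And>n. r \<bullet> \<iota> n = p n"
    by (rule coproduct_map[where f=p, OF P X U(2)]) (rule that, assumption, simp)
  have "r \<bullet> ?\<phi> = zero_arr T P X"
  proof (rule coproduct_eqI[OF P cmp_hom[OF \<phi> r(1)] zero_hom[OF Po X]])
    fix n
    have "(r \<bullet> ?\<phi>) \<bullet> \<iota> n = p n \<boxminus> r \<bullet> (\<iota> (Suc n) \<bullet> s n)"
      using cmp_assoc[OF \<iota> \<phi> r(1)] \<phi>g[OF \<iota>] sh(2) cmp_minus_right[OF \<iota> \<iota>s r(1)] r(2) by simp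
    also have "r \<bullet> (\<iota> (Suc n) \<bullet> s n) = p n" using cmp_assoc[OF s(1) \<iota> r(1)] r(2) s(2) by simp
    finally show "(r \<bullet> ?\<phi>) \<bullet> \<iota> n = zero_arr T P X \<bullet> \<iota> n"
      using minus_self[OF U(2)] cmp_zero_left[OF \<iota> X] by simp
  qed
  then obtain f where f: "f \<in> Hom T H X" "r = f \<bullet> J" using tri_factor_right[OF t r(1)] by blast
  have fj: "f \<bullet> j n = p n" for n
    unfolding j_def using cmp_assoc[OF \<iota> d(3) f(1)] f(2) r(2) by simp
  \<comment> \<open>If \<open>g = sh \<bullet> g\<close>, then all components vanish by induction:
    the shift misses the summand \<open>0\<close>, and the component at \<open>Suc n\<close> is
    \<open>s n\<close> after that at \<open>n\<close>. Compactness then gives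
    \<open>g = 0\<close>.\<close>
  have \<phi>inj: "g = zero_arr T C P" if C: "C \<in> K" and g: "g \<in> Hom T C P" "?\<phi> \<bullet> g = zero_arr T C P" for C g
  proof -
    have Co: "C \<in> obj T" using C Kobj by blast
    have gsh: "g = sh \<bullet> g" using \<phi>g[OF g(1)] g minus_eq_zero[OF g(1) cmp_hom[OF g(1) sh(1)]] by simp
    obtain \<pi> where \<pi>: "\<And>i. i \<in> UNIV \<Longrightarrow> coproduct_proj UNIV U P \<iota> i (\<pi> i)" using coproduct_projE[OF P] by blast
    have \<pi>z: "\<pi> \<bullet> g = zero_arr T C (U n)" if "coproduct_proj UNIV U P \<iota> n \<pi>" for n \<pi>
      using that
    proof (induction n arbitrary: \<pi>)
      case 0
      then have \<pi>: "\<pi> \<in> Hom T P (U 0)" "\<And>m. m \<noteq> 0 \<Longrightarrow> \<pi> \<bullet> \<iota> m = zero_arr T (U m) (U 0)"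
        by (auto simp: coproduct_proj_def)
      have "\<pi> \<bullet> sh = zero_arr T P (U 0)"
      proof (rule coproduct_eqI[OF P cmp_hom[OF sh(1) \<pi>(1)] zero_hom[OF Po Uo]])
        fix n
        show "(\<pi> \<bullet> sh) \<bullet> \<iota> n = zero_arr T P (U 0) \<bullet> \<iota> n"
          using cmp_assoc[OF \<iota> sh(1) \<pi>(1)] sh(2) cmp_assoc[OF s(1) \<iota> \<pi>(1)] \<pi>(2)
            cmp_zero_left[OF s(1) Uo] cmp_zero_left[OF \<iota> Uo] by simp
      qed
      then have "\<pi> \<bullet> (sh \<bullet> g) = zero_arr T C (U 0)"
        using cmp_assoc[OF g(1) sh(1) \<pi>(1)] cmp_zero_left[OF g(1) Uo] by simp
      then show ?case using gsh by simp
    next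
      case (Suc n)
      then have \<pi>': "\<pi> \<in> Hom T P (U (Suc n))" "\<pi> \<bullet> \<iota> (Suc n) = ident T (U (Suc n))"
        "\<And>m. m \<noteq> Suc n \<Longrightarrow> \<pi> \<bullet> \<iota> m = zero_arr T (U m) (U (Suc n))"
        by (auto simp: coproduct_proj_def)
      obtain \<rho> where \<rho>: "coproduct_proj UNIV U P \<iota> n \<rho>" using \<pi> by blast
      then have \<rho>': "\<rho> \<in> Hom T P (U n)" "\<rho> \<bullet> \<iota> n = ident T (U n)"
        "\<And>m. m \<noteq> n \<Longrightarrow> \<rho> \<bullet> \<iota> m = zero_arr T (U m) (U n)"
        by (auto simp: coproduct_proj_def)
      have s\<rho>: "s n \<bullet> \<rho> \<in> Hom T P (U (Suc n))" using cmp_hom[OF \<rho>'(1) s(1)] .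
      have "\<pi> \<bullet> sh = s n \<bullet> \<rho>"
      proof (rule coproduct_eqI[OF P cmp_hom[OF sh(1) \<pi>'(1)] s\<rho>])
        fix m
        have "(\<pi> \<bullet> sh) \<bullet> \<iota> m = (\<pi> \<bullet> \<iota> (Suc m)) \<bullet> s m"
          using cmp_assoc[OF \<iota> sh(1) \<pi>'(1)] sh(2) cmp_assoc[OF s(1) \<iota> \<pi>'(1)] by simp
        also have "\<dots> = s n \<bullet> (\<rho> \<bullet> \<iota> m)"
        proof (cases "m = n")
          case True
          then show ?thesis using \<pi>'(2) \<rho>'(2) cmp_ident_left[OF s(1)] cmp_ident_right[OF s(1)] by simp
        next
          case False
          then show ?thesis using \<pi>'(3)[of "Suc m"] \<rho>'(3)[of m] cmp_zero_left[OF s(1) Uo]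
              cmp_zero_right[OF s(1) Uo] by simp
        qed
        finally show "(\<pi> \<bullet> sh) \<bullet> \<iota> m = (s n \<bullet> \<rho>) \<bullet> \<iota> m" using cmp_assoc[OF \<iota> \<rho>'(1) s(1)] by simp
      qed
      then have "\<pi> \<bullet> (sh \<bullet> g) = s n \<bullet> (\<rho> \<bullet> g)"
        using cmp_assoc[OF g(1) sh(1) \<pi>'(1)] cmp_assoc[OF g(1) \<rho>'(1) s(1)] by simp
      then show ?case using gsh Suc.IH[OF \<rho>] cmp_zero_right[OF s(1) Co] by simp
    qed
    have "C \<in> compacts \<kappa> T" using C K by blast
    from compact_supported[OF \<kappa> this nat P g(1)]
    obtain F where F: "finite F" "F \<subseteq> UNIV" "supported U P \<iota> C F g" by blast
    show "g = zero_arr T C P"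
    proof (rule supported_induct[where Q="\<lambda>g. g = zero_arr T C P", OF P F g(1)])
      show "f \<boxplus> f' = zero_arr T C P" if "f = zero_arr T C P" "f' = zero_arr T C P" for f f'
        using that plus_zero zero_hom Co Po by simp
      show "\<iota> i \<bullet> (\<pi> \<bullet> g) = zero_arr T C P" if "coproduct_proj UNIV U P \<iota> i \<pi>" for i \<pi>
        using \<pi>z[OF that] cmp_zero_right[OF \<iota> Co] by simp
    qed simp
  qed
  have up: "\<exists>a'\<in>Hom T C (U (n + k)). j n \<bullet> a = j (n + k) \<bullet> a'" if a: "a \<in> Hom T C (U n)" for C n a k
  proof (induction k)
    case 0
    show ?case using a by auto
  next
    case (Suc k)
    then obtain a' where a': "a' \<in> Hom T C (U (n + k))" "j n \<bullet> a = j (n + k) \<bullet> a'" by blast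
    then have "s (n + k) \<bullet> a' \<in> Hom T C (U (n + Suc k))" using cmp_hom[OF a'(1) s(1)] by simp
    moreover have "j n \<bullet> a = j (n + Suc k) \<bullet> (s (n + k) \<bullet> a')"
      using a' js[of "n + k"] cmp_assoc[OF a'(1) s(1) j] by simp
    ultimately show ?case by blast
  qed
  \<comment> \<open>The suspended \<open>?\<phi>\<close> kills \<open>h \<bullet> c\<close>, so
    \<open>h \<bullet> c\<close> is zero by \<open>\<phi>inj\<close> and \<open>c\<close> comes from
    \<open>P\<close>. Finitely many components can be pushed to a common stage.\<close>
  have lift: "\<exists>n. \<exists>a\<in>Hom T C (U n). c = j n \<bullet> a" if C: "C \<in> K" and c: "c \<in> Hom T C H" for C c
  proof -
    have Co: "C \<in> obj T" using C Kobj by blast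
    have hc: "h \<bullet> c \<in> Hom T C (Sg 1 P)" using cmp_hom[OF c d(4)] .
    have "h \<bullet> c \<in> Hom T (Sg 1 (Sg (- 1) C)) (Sg 1 P)" using hc Co by simp
    then obtain e where e: "e \<in> Hom T (Sg (- 1) C) P" "h \<bullet> c = Sa 1 e"
      using Sa_surj[of "h \<bullet> c" 1 "Sg (- 1) C" P] Co Po by blast
    have "Sa 1 (?\<phi> \<bullet> e) = Sa 1 ?\<phi> \<bullet> (h \<bullet> c)" using Sa_cmp[OF e(1) \<phi>] e(2) by simp
    also have "\<dots> = zero_arr T C (Sg 1 P)"
      using cmp_assoc[OF c d(4) Sa_hom[OF \<phi>]] tri_cmp_zero(3)[OF t] cmp_zero_left[OF c] Po by simp
    finally have "?\<phi> \<bullet> e = zero_arr T (Sg (- 1) C) P"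
      using Sa_eq_zero[of 1 "?\<phi> \<bullet> e" "Sg (- 1) C" P] cmp_hom[OF e(1) \<phi>] Co by simp
    moreover have "Sg (- 1) C \<in> K" using C K(1) by (auto simp: susp_closed_def)
    ultimately have "e = zero_arr T (Sg (- 1) C) P" using \<phi>inj e(1) by blast
    then have "h \<bullet> c = zero_arr T C (Sg 1 P)" using e(2) Sa_zero[of "Sg (- 1) C" P 1] Co Po by simp
    then obtain b where b: "b \<in> Hom T C P" "c = J \<bullet> b" using tri_factor_left[OF tri_rotate[OF t] c] by blast
    have "C \<in> compacts \<kappa> T" using C K by blast
    from compact_supported[OF \<kappa> this nat P b(1)]
    obtain F where F: "finite F" "F \<subseteq> UNIV" "supported U P \<iota> C F b" by blast
    have "\<exists>n. \<exists>a\<in>Hom T C (U n). J \<bullet> b = j n \<bullet> a"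
    proof (rule supported_induct[where Q="\<lambda>b. \<exists>n. \<exists>a\<in>Hom T C (U n). J \<bullet> b = j n \<bullet> a", OF P F b(1)])
      show "\<exists>n. \<exists>a\<in>Hom T C (U n). J \<bullet> zero_arr T C P = j n \<bullet> a"
        using cmp_zero_right[OF d(3) Co] cmp_zero_right[OF j Co] zero_hom[OF Co Uo] by metis
      show "\<exists>n. \<exists>a\<in>Hom T C (U n). J \<bullet> (b \<boxplus> b') = j n \<bullet> a"
        if bb: "b \<in> Hom T C P" "b' \<in> Hom T C P"
          and ex: "\<exists>n. \<exists>a\<in>Hom T C (U n). J \<bullet> b = j n \<bullet> a" "\<exists>n. \<exists>a\<in>Hom T C (U n). J \<bullet> b' = j n \<bullet> a" for b b'
      proof -
        obtain n a n' a' where a: "a \<in> Hom T C (U n)" "J \<bullet> b = j n \<bullet> a"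
          "a' \<in> Hom T C (U n')" "J \<bullet> b' = j n' \<bullet> a'" using ex by blast
        obtain e where e: "e \<in> Hom T C (U (n + n'))" "j n \<bullet> a = j (n + n') \<bullet> e" using up[OF a(1)] by blast
        obtain e' where e': "e' \<in> Hom T C (U (n + n'))" "j n' \<bullet> a' = j (n + n') \<bullet> e'"
          using up[OF a(3), of n] by (auto simp: add.commute)
        have "J \<bullet> (b \<boxplus> b') = j (n + n') \<bullet> (e \<boxplus> e')"
          using cmp_plus_right[OF bb d(3)] cmp_plus_right[OF e(1) e'(1) j] a e e' by simp
        then show ?thesis using plus_hom[OF e(1) e'(1)] by blast
      qed
      show "\<exists>n. \<exists>a\<in>Hom T C (U n). J \<bullet> (\<iota> i \<bullet> (\<pi> \<bullet> b)) = j n \<bullet> a"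
        if "coproduct_proj UNIV U P \<iota> i \<pi>" for i \<pi>
      proof -
        have pb: "\<pi> \<bullet> b \<in> Hom T C (U i)" using that cmp_hom[OF b(1)] by (simp add: coproduct_proj_def)
        show ?thesis
          unfolding j_def
          by (intro exI[of _ i] bexI[OF _ pb]) (rule cmp_assoc[OF pb \<iota> d(3), symmetric])
      qed
    qed
    then show ?thesis using b(2) by simp
  qed
  \<comment> \<open>A representative of \<open>c\<close> at stage \<open>n\<close> vanishes in
    \<open>X\<close> and is therefore killed at stage \<open>Suc n\<close>.\<close>
  have finj: "c = zero_arr T C H" if C: "C \<in> K" and c: "c \<in> Hom T C H" "f \<bullet> c = zero_arr T C X" for C c
  proof -
    obtain n a where a: "a \<in> Hom T C (U n)" "c = j n \<bullet> a" using lift[OF C c(1)] by blast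
    have "p n \<bullet> a = zero_arr T C X" using c a cmp_assoc[OF a(1) j f(1)] fj by simp
    then have "s n \<bullet> a = zero_arr T C (U (Suc n))" using s(3)[OF C a(1)] by blast
    then have "j (Suc n) \<bullet> (s n \<bullet> a) = zero_arr T C H" using cmp_zero_right[OF j] Kobj C by auto
    then show ?thesis using cmp_assoc[OF a(1) s(1) j] js a by simp
  qed
  obtain Y g w where Y: "tri H X Y f g w" using tri_cone[OF f(1)] by blast
  note y = triD[OF Y]
  \<comment> \<open>By \<open>finj\<close> the composite with \<open>w\<close> vanishes, so
    \<open>v\<close> lifts to some \<open>x\<close> into \<open>X\<close>. Every such
    \<open>x\<close> factors through \<open>U0\<close>, hence through \<open>f\<close>, and
    \<open>g \<bullet> f\<close> is zero.\<close>
  have "Y \<in> right_perp T K"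
  proof (rule right_perpI)
    fix C v assume C: "C \<in> K" and v: "v \<in> Hom T C Y"
    have Co: "C \<in> obj T" using C Kobj by blast
    have wv: "w \<bullet> v \<in> Hom T C (Sg 1 H)" using cmp_hom[OF v y(4)] .
    have "w \<bullet> v \<in> Hom T (Sg 1 (Sg (- 1) C)) (Sg 1 H)" using wv Co by simp
    then obtain e where e: "e \<in> Hom T (Sg (- 1) C) H" "w \<bullet> v = Sa 1 e"
      using Sa_surj[of "w \<bullet> v" 1 "Sg (- 1) C" H] Co y by blast
    have "Sa 1 (f \<bullet> e) = Sa 1 f \<bullet> (w \<bullet> v)" using Sa_cmp[OF e(1) f(1)] e(2) by simp
    also have "\<dots> = zero_arr T C (Sg 1 X)"
      using cmp_assoc[OF v y(4) Sa_hom[OF f(1)]] tri_cmp_zero(3)[OF Y] cmp_zero_left[OF v] X by simp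
    finally have "f \<bullet> e = zero_arr T (Sg (- 1) C) X"
      using Sa_eq_zero[of 1 "f \<bullet> e" "Sg (- 1) C" X] cmp_hom[OF e(1) f(1)] Co by simp
    moreover have "Sg (- 1) C \<in> K" using C K(1) by (auto simp: susp_closed_def)
    ultimately have "e = zero_arr T (Sg (- 1) C) H" using finj e(1) by blast
    then have "w \<bullet> v = zero_arr T C (Sg 1 H)" using e(2) Sa_zero[of "Sg (- 1) C" H 1] Co y by simp
    then obtain x where x: "x \<in> Hom T C X" "v = g \<bullet> x" using tri_factor_left[OF tri_rotate[OF Y] v] by blast
    obtain a where a: "a \<in> Hom T C U0" "x = p0 \<bullet> a" using U0(3)[OF C x(1)] by blast
    have j0: "j 0 \<in> Hom T U0 H" "f \<bullet> j 0 = p0" using j[of 0] fj[of 0] zero by auto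
    have ja: "j 0 \<bullet> a \<in> Hom T C H" using cmp_hom[OF a(1) j0(1)] .
    have "x = f \<bullet> (j 0 \<bullet> a)" using a j0 cmp_assoc[OF a(1) j0(1) f(1)] by simp
    then have "v = (g \<bullet> f) \<bullet> (j 0 \<bullet> a)" using x cmp_assoc[OF ja f(1) y(3)] by simp
    then show "v = zero_arr T C Y" using tri_cmp_zero(1)[OF Y] cmp_zero_left[OF ja y(7)] by simp
  qed (fact y(7))
  then have "Y \<in> right_perp T ?S" using right_perp_Loc[OF K(1)] by blast
  then show ?thesis using Y HS unfolding reflection_def by blast
qed

end

section \<open>Graded-commutative noetherian rings\<close>

context graded_commutative_ring
begin

section \<open>Homogeneous components\<close>

lemma grade_closed [simp, intro]: "x \<in> grade R n \<Longrightarrow> x \<in> carrier R"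
  using additive_subgroup.a_subset[OF grade_subgroup] by blast

lemma grade_zero [simp, intro]: "\<zero> \<in> grade R n"
  using additive_subgroup.zero_closed[OF grade_subgroup] by blast

lemma grade_add: "x \<in> grade R n \<Longrightarrow> y \<in> grade R n \<Longrightarrow> x \<oplus> y \<in> grade R n"
  using additive_subgroup.a_closed[OF grade_subgroup] by blast

lemma grade_neg: "x \<in> grade R n \<Longrightarrow> \<ominus> x \<in> grade R n"
  using additive_subgroup.a_inv_closed[OF grade_subgroup] by blast

lemma grade_commute:
  assumes "a \<in> grade R m" "b \<in> grade R n"
  shows "a \<otimes> b = b \<otimes> a \<or> a \<otimes> b = \<ominus> (b \<otimes> a)"
  using graded_commute[OF assms] by metis

lemma finsum_in_subgroup:
  assumes I: "additive_subgroup I R" and "finite F" "\<And>i. i \<in> F \<Longrightarrow> f i \<in> I"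
  shows "(\<Oplus>i\<in>F. f i) \<in> I"
  using assms(2,3)
proof (induction F)
  case empty
  then show ?case using additive_subgroup.zero_closed[OF I] by simp
next
  case (insert j F)
  have "f \<in> insert j F \<rightarrow> carrier R" using insert(4) additive_subgroup.a_subset[OF I] by blast
  then have "(\<Oplus>i\<in>insert j F. f i) = f j \<oplus> (\<Oplus>i\<in>F. f i)" using insert(1,2) by (intro finsum_insert) auto
  then show ?case using insert additive_subgroup.a_closed[OF I] by simp
qed

definition component :: "'r \<Rightarrow> int \<Rightarrow> 'r" where
  "component x = (THE c. (\<forall>n. c n \<in> grade R n) \<and> finite {n. c n \<noteq> \<zero>} \<and> x = (\<Oplus>n\<in>{n. c n \<noteq> \<zero>}. c n))"

lemma component:
  assumes "x \<in> carrier R"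
  shows "component x n \<in> grade R n" "finite {n. component x n \<noteq> \<zero>}"
    "x = (\<Oplus>n\<in>{n. component x n \<noteq> \<zero>}. component x n)"
  using theI'[OF grade_decomposition[OF assms]] unfolding component_def by blast+

lemma component_unique:
  assumes F: "finite F" and c: "\<And>n. c n \<in> grade R n" "\<And>n. n \<notin> F \<Longrightarrow> c n = \<zero>" and x: "x = (\<Oplus>n\<in>F. c n)"
  shows "component x = c"
proof -
  have sub: "{n. c n \<noteq> \<zero>} \<subseteq> F" using c(2) by auto
  have "(\<Oplus>n\<in>{n. c n \<noteq> \<zero>}. c n) = (\<Oplus>n\<in>F. c n)"
    by (rule add.finprod_mono_neutral_cong_left) (use F sub c in auto)
  then have c': "(\<forall>n. c n \<in> grade R n) \<and> finite {n. c n \<noteq> \<zero>} \<and> x = (\<Oplus>n\<in>{n. c n \<noteq> \<zero>}. c n)"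
    using c x finite_subset[OF sub F] by simp
  have "x \<in> carrier R" unfolding x using c by (intro finsum_closed) auto
  then show ?thesis using grade_decomposition[of x] c' unfolding component_def by (intro the1_equality) auto
qed

lemma component_sum:
  assumes x: "x \<in> carrier R" and F: "finite F" "{n. component x n \<noteq> \<zero>} \<subseteq> F"
  shows "x = (\<Oplus>n\<in>F. component x n)"
proof -
  have "(\<Oplus>n\<in>{n. component x n \<noteq> \<zero>}. component x n) = (\<Oplus>n\<in>F. component x n)"
    by (rule add.finprod_mono_neutral_cong_left) (use F component(1)[OF x] in auto)
  then show ?thesis using component(3)[OF x] by simp
qed

lemma component_grade:
  assumes "x \<in> grade R m"
  shows "component x n = (if n = m then x else \<zero>)"
proof -
  have "component x = (\<lambda>n. if n = m then x else \<zero>)"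
    by (rule component_unique[of "{m}"]) (use assms in auto)
  then show ?thesis by simp
qed

lemma component_add:
  assumes x: "x \<in> carrier R" and y: "y \<in> carrier R"
  shows "component (x \<oplus> y) n = component x n \<oplus> component y n"
proof -
  let ?F = "{n. component x n \<noteq> \<zero>} \<union> {n. component y n \<noteq> \<zero>}"
  have F: "finite ?F" using component(2)[OF x] component(2)[OF y] by simp
  have "x \<oplus> y = (\<Oplus>n\<in>?F. component x n) \<oplus> (\<Oplus>n\<in>?F. component y n)"
    using component_sum[OF x F] component_sum[OF y F] by auto
  also have "\<dots> = (\<Oplus>n\<in>?F. component x n \<oplus> component y n)"
    by (rule finsum_addf[symmetric]) (use component(1)[OF x] component(1)[OF y] in auto)
  finally have "component (x \<oplus> y) = (\<lambda>n. component x n \<oplus> component y n)"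
    by (intro component_unique[OF F]) (use grade_add component(1)[OF x] component(1)[OF y] in auto)
  then show ?thesis by simp
qed

lemma component_zero [simp]: "component \<zero> n = \<zero>"
  using component_grade[of \<zero> 0 n] by simp

lemma component_finsum:
  assumes "finite F" "\<And>i. i \<in> F \<Longrightarrow> f i \<in> carrier R"
  shows "component (\<Oplus>i\<in>F. f i) n = (\<Oplus>i\<in>F. component (f i) n)"
  using assms
proof (induction F)
  case (insert j F)
  have f: "f \<in> F \<rightarrow> carrier R" "f j \<in> carrier R" using insert(4) by auto
  then have c: "(\<lambda>i. component (f i) n) \<in> F \<rightarrow> carrier R" "component (f j) n \<in> carrier R"
    using component(1) by blast+
  have "component (\<Oplus>i\<in>insert j F. f i) n = component (f j \<oplus> (\<Oplus>i\<in>F. f i)) n"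
    using finsum_insert[OF insert(1,2) f] by simp
  also have "\<dots> = component (f j) n \<oplus> component (\<Oplus>i\<in>F. f i) n"
    by (rule component_add) (use f finsum_closed in auto)
  also have "\<dots> = (\<Oplus>i\<in>insert j F. component (f i) n)"
    using finsum_insert[OF insert(1,2) c] insert by simp
  finally show ?case .
qed simp

lemma component_mult_left:
  assumes a: "a \<in> grade R m" and x: "x \<in> carrier R"
  shows "component (a \<otimes> x) n = a \<otimes> component x (n - m)"
proof -
  let ?F = "{n. component x n \<noteq> \<zero>}"
  note F = component(2)[OF x] and c = component(1)[OF x]
  have "a \<otimes> x = (\<Oplus>k\<in>?F. a \<otimes> component x k)"
    using component(3)[OF x] finsum_rdistr[OF F, of a "component x"] a c by auto
  then have "component (a \<otimes> x) n = (\<Oplus>k\<in>?F. component (a \<otimes> component x k) n)"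
    using component_finsum[OF F, of "\<lambda>k. a \<otimes> component x k" n] a c by auto
  also have "\<dots> = (\<Oplus>k\<in>?F. if k = n - m then a \<otimes> component x (n - m) else \<zero>)"
  proof (rule finsum_cong')
    show "component (a \<otimes> component x k) n = (if k = n - m then a \<otimes> component x (n - m) else \<zero>)" for k
      using component_grade[OF grade_mult[OF a c[of k]], of n] by auto
  qed (use grade_closed[OF a] grade_closed[OF c] in auto)
  also have "\<dots> = a \<otimes> component x (n - m)"
  proof (cases "n - m \<in> ?F")
    case True
    have "(\<Oplus>k\<in>?F. if n - m = k then a \<otimes> component x k else \<zero>) = a \<otimes> component x (n - m)"
      using finsum_singleton[OF True F, of "\<lambda>k. a \<otimes> component x k"] a c by auto
    moreover have "(\<Oplus>k\<in>?F. if k = n - m then a \<otimes> component x (n - m) else \<zero>)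
      = (\<Oplus>k\<in>?F. if n - m = k then a \<otimes> component x k else \<zero>)"
      by (rule finsum_cong') (use grade_closed[OF a] grade_closed[OF c] in auto)
    ultimately show ?thesis by simp
  next
    case False
    then have "(\<Oplus>k\<in>?F. if k = n - m then a \<otimes> component x (n - m) else \<zero>) = (\<Oplus>k\<in>?F. \<zero>)"
      by (intro finsum_cong') auto
    then show ?thesis using False a by simp
  qed
  finally show ?thesis .
qed

end

text \<open>An ideal given by its homogeneous pieces. Annihilators of morphisms come in this form,
  because only homogeneous elements act; \<open>total\<close> then provides an ideal to which the
  chain condition of \<open>R\<close> applies.\<close>

locale graded_ideal = graded_commutative_ring R for R :: "('r, 'z) graded_ring_scheme" (structure) +
  fixes I :: "int \<Rightarrow> 'r set"
  assumes piece_grade: "I n \<subseteq> grade R n"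
    and piece_zero: "\<zero> \<in> I n"
    and piece_add: "x \<in> I n \<Longrightarrow> y \<in> I n \<Longrightarrow> x \<oplus> y \<in> I n"
    and piece_mult: "a \<in> grade R m \<Longrightarrow> x \<in> I n \<Longrightarrow> a \<otimes> x \<in> I (m + n)"
begin

definition total :: "'r set" where "total = {x \<in> carrier R. \<forall>n. component x n \<in> I n}"

lemma piece_neg:
  assumes x: "x \<in> I n"
  shows "\<ominus> x \<in> I n"
proof -
  have "x \<in> carrier R" using x piece_grade by blast
  then have "\<ominus> x = (\<ominus> \<one>) \<otimes> x" using l_minus[of \<one> x] by simp
  then show ?thesis using piece_mult[OF grade_neg[OF grade_one] x] by simp
qed

text \<open>By graded commutativity the two products differ at most by a sign, which the pieces
  absorb.\<close>

lemma piece_mult_right: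
  assumes "a \<in> grade R m" "x \<in> I n"
  shows "x \<otimes> a \<in> I (m + n)"
  using grade_commute[of x n a m] assms piece_grade piece_mult piece_neg by fastforce

lemma total_grade:
  assumes "x \<in> grade R n"
  shows "x \<in> total \<longleftrightarrow> x \<in> I n"
  using component_grade[OF assms] assms piece_zero by (auto simp: total_def)

lemma total_additive: "additive_subgroup total R"
proof (unfold_locales)
  show "total \<subseteq> carrier (add_monoid R)" by (auto simp: total_def)
  show "x \<otimes>\<^bsub>add_monoid R\<^esub> y \<in> total" if "x \<in> total" "y \<in> total" for x y
    using that component_add piece_add by (auto simp: total_def)
  show "\<one>\<^bsub>add_monoid R\<^esub> \<in> total" using total_grade[of \<zero> 0] piece_zero by simp
  show "inv\<^bsub>add_monoid R\<^esub> x \<in> total" if x: "x \<in> total" for x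
  proof -
    have xc: "x \<in> carrier R" using x by (simp add: total_def)
    have "\<ominus> x = (\<ominus> \<one>) \<otimes> x" using l_minus[of \<one> x] xc by simp
    then have "component (\<ominus> x) n = \<ominus> component x n" for n
      using component_mult_left[OF grade_neg[OF grade_one] xc, of n] component(1)[OF xc, of n]
        l_minus[of \<one> "component x n"] by auto
    then have "\<ominus> x \<in> total" using x piece_neg by (auto simp: total_def)
    then show ?thesis by (simp add: a_inv_def)
  qed
qed

lemma total_ideal: "ideal total R"
proof (rule idealI)
  show "ring R" by unfold_locales
  show "subgroup total (add_monoid R)" using total_additive by (simp add: additive_subgroup_def)
  fix x a assume x: "x \<in> total" and a: "a \<in> carrier R"
  note F = component(2)[OF a] and c = component(1)[OF a]
  have xc: "x \<in> carrier R" using x by (simp add: total_def)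
  note G = component(2)[OF xc] and e = component(1)[OF xc]
  have e': "component x k \<in> I k" for k using x by (simp add: total_def)
  have in_I: "component a m \<otimes> component x k \<in> total" "component x k \<otimes> component a m \<in> total" for m k
    using total_grade[OF grade_mult[OF c e]] piece_mult[OF c e']
      total_grade[OF grade_mult[OF e c]] piece_mult_right[OF c e'] by (simp_all add: add.commute)
  have "a \<otimes> x = (\<Oplus>m\<in>{n. component a n \<noteq> \<zero>}. component a m \<otimes> x)"
    using component(3)[OF a] finsum_ldistr[OF F xc, of "component a"] c by auto
  moreover have "component a m \<otimes> x \<in> total" for m
  proof -
    have "component a m \<otimes> x = (\<Oplus>k\<in>{n. component x n \<noteq> \<zero>}. component a m \<otimes> component x k)"
      using component(3)[OF xc] finsum_rdistr[OF G, of "component a m" "component x"] c e by auto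
    then show ?thesis using finsum_in_subgroup[OF total_additive G] in_I by simp
  qed
  ultimately show "a \<otimes> x \<in> total" using finsum_in_subgroup[OF total_additive F] by simp
  have "x \<otimes> a = (\<Oplus>m\<in>{n. component a n \<noteq> \<zero>}. x \<otimes> component a m)"
    using component(3)[OF a] finsum_rdistr[OF F xc, of "component a"] c by auto
  moreover have "x \<otimes> component a m \<in> total" for m
  proof -
    have "x \<otimes> component a m = (\<Oplus>k\<in>{n. component x n \<noteq> \<zero>}. component x k \<otimes> component a m)"
      using component(3)[OF xc] finsum_ldistr[OF G, of "component a m" "component x"] c e by auto
    then show ?thesis using finsum_in_subgroup[OF total_additive G] in_I by simp
  qed
  ultimately show "x \<otimes> a \<in> total" using finsum_in_subgroup[OF total_additive F] by simp
qed

lemma total_homogeneous: "homogeneous_ideal R total"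
  unfolding homogeneous_ideal_def
proof (intro conjI total_ideal exI[of _ "\<Union>n. I n"])
  show "(\<Union>n. I n) \<subseteq> (\<Union>n. grade R n)" using piece_grade by blast
  have sub: "(\<Union>n. I n) \<subseteq> carrier R" using piece_grade by blast
  have J: "ideal (Idl (\<Union>n. I n)) R" by (rule genideal_ideal[OF sub])
  have "(\<Union>n. I n) \<subseteq> total" using total_grade piece_grade by blast
  then have "Idl (\<Union>n. I n) \<subseteq> total" by (rule genideal_minimal[OF total_ideal])
  moreover have "total \<subseteq> Idl (\<Union>n. I n)"
  proof
    fix x assume x: "x \<in> total"
    have xc: "x \<in> carrier R" using x by (simp add: total_def)
    have "component x n \<in> Idl (\<Union>n. I n)" for n
      using x genideal_self[OF sub] by (auto simp: total_def)
    then have "(\<Oplus>n\<in>{n. component x n \<noteq> \<zero>}. component x n) \<in> Idl (\<Union>n. I n)"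
      by (intro finsum_in_subgroup[OF ideal.axioms(1)[OF J] component(2)[OF xc]])
    then show "x \<in> Idl (\<Union>n. I n)" using component(3)[OF xc] by simp
  qed
  ultimately show "total = Idl (\<Union>n. I n)" by blast
qed

text \<open>
  Primality is detected on homogeneous elements: compare the highest components of two factors
  that lie outside the ideal.
\<close>

lemma total_prime:
  assumes one: "\<one> \<notin> I 0"
    and prime: "\<And>a b m n. a \<in> grade R m \<Longrightarrow> b \<in> grade R n \<Longrightarrow> a \<otimes> b \<in> I (m + n) \<Longrightarrow> a \<in> I m \<or> b \<in> I n"
  shows "total \<in> Spec R"
  unfolding Spec_def
proof (intro CollectI conjI ballI impI total_homogeneous)
  show "carrier R \<noteq> total" using total_grade[OF grade_one] one by blast
  fix a b assume a: "a \<in> carrier R" and b: "b \<in> carrier R" and ab: "a \<otimes> b \<in> total"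
  show "a \<in> total \<or> b \<in> total"
  proof (rule ccontr)
    assume "\<not> (a \<in> total \<or> b \<in> total)"
    then have ne: "{m. component a m \<notin> I m} \<noteq> {}" "{n. component b n \<notin> I n} \<noteq> {}"
      using a b by (auto simp: total_def)
    have sub: "{m. component a m \<notin> I m} \<subseteq> {m. component a m \<noteq> \<zero>}"
      "{m. component b m \<notin> I m} \<subseteq> {m. component b m \<noteq> \<zero>}" using piece_zero by auto
    note fin = finite_subset[OF sub(1) component(2)[OF a]] finite_subset[OF sub(2) component(2)[OF b]]
    let ?m = "Max {m. component a m \<notin> I m}" and ?n = "Max {n. component b n \<notin> I n}"
    have m: "component a ?m \<notin> I ?m" "\<And>i. i > ?m \<Longrightarrow> component a i \<in> I i"
      using Max_in[OF fin(1) ne(1)] Max_ge[OF fin(1)] by force+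
    have n: "component b ?n \<notin> I ?n" "\<And>i. i > ?n \<Longrightarrow> component b i \<in> I i"
      using Max_in[OF fin(2) ne(2)] Max_ge[OF fin(2)] by force+
    let ?F = "{i. component a i \<noteq> \<zero>}"
    note F = component(2)[OF a] and ca = component(1)[OF a] and cb = component(1)[OF b]
    have mF: "?m \<in> ?F" using m(1) piece_zero by auto
    let ?t = "\<lambda>i. component a i \<otimes> component b (?m + ?n - i)"
    have tg: "?t i \<in> grade R (?m + ?n)" for i
      using grade_mult[OF ca cb, of i "?m + ?n - i"] by simp
    have "a \<otimes> b = (\<Oplus>i\<in>?F. component a i \<otimes> b)"
      using component(3)[OF a] finsum_ldistr[OF F b, of "component a"] ca by auto
    then have "component (a \<otimes> b) (?m + ?n) = (\<Oplus>i\<in>?F. component (component a i \<otimes> b) (?m + ?n))"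
      using component_finsum[OF F, of "\<lambda>i. component a i \<otimes> b" "?m + ?n"] ca b by auto
    also have "\<dots> = (\<Oplus>i\<in>?F. ?t i)"
      by (rule finsum_cong') (use component_mult_left[OF ca b] tg in auto)
    also have "\<dots> = (\<Oplus>i\<in>insert ?m (?F - {?m}). ?t i)" using mF by (simp add: insert_absorb)
    also have "\<dots> = ?t ?m \<oplus> (\<Oplus>i\<in>?F - {?m}. ?t i)"
      by (rule finsum_insert) (use F grade_closed[OF ca] grade_closed[OF cb] in auto)
    finally have eq: "component (a \<otimes> b) (?m + ?n) = ?t ?m \<oplus> (\<Oplus>i\<in>?F - {?m}. ?t i)" .
    let ?r = "\<Oplus>i\<in>?F - {?m}. ?t i"
    \<comment> \<open>Above \<open>?m\<close> the left factor lies in the ideal; below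
      \<open>?m\<close> the right factor has degree above \<open>?n\<close> and lies in it.\<close>
    have "?t i \<in> total" if "i \<in> ?F - {?m}" for i
    proof -
      have "?t i \<in> I (?m + ?n)"
      proof (cases "i > ?m")
        case True
        then show ?thesis using piece_mult_right[OF cb[of "?m + ?n - i"] m(2)[OF True]] by simp
      next
        case False
        then have "?m + ?n - i > ?n" using that by auto
        then show ?thesis using piece_mult[OF ca[of i] n(2)] by fastforce
      qed
      then show ?thesis using total_grade[OF tg] by simp
    qed
    then have r: "?r \<in> total" using F by (intro finsum_in_subgroup[OF total_additive]) auto
    have rg: "?r \<in> grade R (?m + ?n)" using F tg by (intro finsum_in_subgroup[OF grade_subgroup]) auto
    then have rI: "?r \<in> I (?m + ?n)" using total_grade r by blast
    have cI: "component (a \<otimes> b) (?m + ?n) \<in> I (?m + ?n)" using ab by (simp add: total_def)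
    have "?t ?m = component (a \<otimes> b) (?m + ?n) \<oplus> \<ominus> ?r"
      unfolding eq using grade_closed[OF tg[of ?m]] grade_closed[OF rg] by (simp add: a_assoc r_neg)
    then have "?t ?m \<in> I (?m + ?n)" using piece_add[OF cI piece_neg[OF rI]] by simp
    then have "component a ?m \<otimes> component b ?n \<in> I (?m + ?n)" by simp
    then show False using prime[OF ca cb] m(1) n(1) by blast
  qed
qed

end

context graded_commutative_ring
begin

section \<open>Homogeneous primes and the chain condition\<close>

lemma SpecD:
  assumes "p \<in> Spec R"
  shows "ideal p R" "p \<subseteq> carrier R" "\<one> \<notin> p"
    "a \<in> carrier R \<Longrightarrow> b \<in> carrier R \<Longrightarrow> a \<otimes> b \<in> p \<Longrightarrow> a \<in> p \<or> b \<in> p"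
proof -
  show i: "ideal p R" and "a \<in> carrier R \<Longrightarrow> b \<in> carrier R \<Longrightarrow> a \<otimes> b \<in> p \<Longrightarrow> a \<in> p \<or> b \<in> p"
    using assms by (auto simp: Spec_def homogeneous_ideal_def)
  show "p \<subseteq> carrier R" using ideal.axioms(1)[OF i] additive_subgroup.a_subset by blast
  show "\<one> \<notin> p" using ideal.one_imp_carrier[OF i] assms by (auto simp: Spec_def)
qed

text \<open>\<open>p\<close> is generated by homogeneous elements, so not all of these can lie in
  \<open>q\<close>.\<close>

lemma Spec_homogeneous_element:
  assumes p: "p \<in> Spec R" and q: "ideal q R" and n: "\<not> p \<subseteq> q"
  obtains k x where "x \<in> grade R k" "x \<in> p" "x \<notin> q"
proof -
  obtain A where A: "A \<subseteq> (\<Union>n. grade R n)" "p = Idl A"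
    using p by (auto simp: Spec_def homogeneous_ideal_def)
  have "\<not> A \<subseteq> q" using genideal_minimal[OF q] A n by blast
  then obtain x where x: "x \<in> A" "x \<notin> q" by blast
  have "A \<subseteq> carrier R" using A(1) by blast
  then have "x \<in> p" using x A(2) genideal_self by blast
  then show ?thesis using that x A(1) by blast
qed

end

lemma (in noetherian_ring) maximal_ideal_in_set:
  assumes "\<A> \<noteq> {}" "\<And>J. J \<in> \<A> \<Longrightarrow> ideal J R"
  obtains M where "M \<in> \<A>" "\<And>J. J \<in> \<A> \<Longrightarrow> M \<subseteq> J \<Longrightarrow> J = M"
proof -
  have "\<exists>M\<in>\<A>. \<forall>J\<in>\<A>. M \<subseteq> J \<longrightarrow> J = M"
  proof (rule subset_Zorn_nonempty[OF assms(1)])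
    fix C assume C: "C \<noteq> {}" "subset.chain \<A> C"
    have "subset.chain {I. ideal I R} C" using C(2) assms(2) by (auto simp: subset.chain_def)
    then have "\<Union> C \<in> C" by (rule ideal_chain_is_trivial[OF C(1)])
    then show "\<Union> C \<in> \<A>" using C(2) by (auto simp: subset.chain_def)
  qed
  then show ?thesis using that by blast
qed

locale noetherian_graded_ring = graded_commutative_ring R + noetherian_ring R
  for R :: "('r, 'z) graded_ring_scheme" (structure)
begin

text \<open>The chain condition supplies finitely many generators, but not homogeneous ones. Applied
  to the ideals generated by finite subsets of a homogeneous generating set, it yields a maximal
  one, which contains all of \<open>p\<close>. The result is a list because cones will be iterated
  along it.\<close>

lemma Spec_generators:
  assumes p: "p \<in> Spec R"
  obtains xs where "\<And>k x. (k, x) \<in> set xs \<Longrightarrow> x \<in> grade R k \<and> x \<in> p"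
    "\<And>q. ideal q R \<Longrightarrow> \<not> p \<subseteq> q \<Longrightarrow> \<exists>(k, x) \<in> set xs. x \<notin> q"
proof -
  obtain A where A: "A \<subseteq> (\<Union>n. grade R n)" "p = Idl A"
    using p by (auto simp: Spec_def homogeneous_ideal_def)
  have Ac: "A \<subseteq> carrier R" using A(1) by blast
  let ?\<A> = "{Idl F | F. finite F \<and> F \<subseteq> A}"
  have "Idl {} \<in> ?\<A>" by blast
  then have ne: "?\<A> \<noteq> {}" by blast
  have id: "ideal J R" if "J \<in> ?\<A>" for J using that Ac genideal_ideal by blast
  obtain M where M: "M \<in> ?\<A>" "\<And>J. J \<in> ?\<A> \<Longrightarrow> M \<subseteq> J \<Longrightarrow> J = M"
    using maximal_ideal_in_set[OF ne id] by blast
  obtain F where F: "finite F" "F \<subseteq> A" "M = Idl F" using M(1) by blast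
  have "A \<subseteq> M"
  proof
    fix a assume a: "a \<in> A"
    have ins: "insert a F \<subseteq> A" "insert a F \<subseteq> carrier R" using a F Ac by auto
    have "Idl (insert a F) \<in> ?\<A>" using F ins by blast
    moreover have "M \<subseteq> Idl (insert a F)"
      using genideal_minimal[OF genideal_ideal[OF ins(2)], of F] genideal_self[OF ins(2)] F(3) by auto
    ultimately have "Idl (insert a F) = M" by (rule M(2))
    then show "a \<in> M" using genideal_self[OF ins(2)] by blast
  qed
  then have pM: "p \<subseteq> Idl F" using genideal_minimal[OF id[OF M(1)]] A(2) F(3) by simp
  have "\<forall>x\<in>F. \<exists>k. x \<in> grade R k" using F(2) A(1) by blast
  then obtain d where d: "\<And>x. x \<in> F \<Longrightarrow> x \<in> grade R (d x)" by metis
  obtain ys where ys: "set ys = F" using finite_list[OF F(1)] by blast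
  let ?xs = "map (\<lambda>x. (d x, x)) ys"
  have "x \<in> grade R k \<and> x \<in> p" if "(k, x) \<in> set ?xs" for k x
    using that ys d F(2) A(2) genideal_self[OF Ac] by auto
  moreover have "\<exists>(k, x) \<in> set ?xs. x \<notin> q" if "ideal q R" "\<not> p \<subseteq> q" for q
  proof -
    have "\<not> F \<subseteq> q" using genideal_minimal[OF that(1)] pM that(2) by blast
    then show ?thesis using ys by auto
  qed
  ultimately show ?thesis using that[of ?xs] by blast
qed

end

section \<open>Linear triangulated categories\<close>

locale linear_category = triangulated_category T + R: graded_commutative_ring R
  for T :: "('o, 'm, 'y) triangulated_category_scheme" (structure)
    and R :: "('r, 'z) graded_ring_scheme" +
  fixes \<phi> :: "int \<Rightarrow> 'r \<Rightarrow> 'o \<Rightarrow> 'm"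
  assumes linear: "linear_structure T R \<phi>"
begin

section \<open>The action of homogeneous elements on morphisms\<close>

lemma act_center: "r \<in> grade R k \<Longrightarrow> \<phi> k r \<in> graded_center T k"
  using linear by (simp add: linear_structure_def)

lemma act_hom [intro]: "r \<in> grade R k \<Longrightarrow> X \<in> obj T \<Longrightarrow> \<phi> k r X \<in> Hom T X (Sg k X)"
  using act_center by (auto simp: graded_center_def natural_transformation_def)

lemma act_natural: "r \<in> grade R k \<Longrightarrow> f \<in> Hom T X Y \<Longrightarrow> Sa k f \<bullet> \<phi> k r X = \<phi> k r Y \<bullet> f"
  using act_center[of r k] by (auto simp: graded_center_def natural_transformation_def Hom_def)

lemma act_add:
  "r \<in> grade R n \<Longrightarrow> s \<in> grade R n \<Longrightarrow> X \<in> obj T \<Longrightarrow> \<phi> n (r \<oplus>\<^bsub>R\<^esub> s) X = \<phi> n r X \<boxplus> \<phi> n s X"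
  using linear by (simp add: linear_structure_def)

lemma act_mult:
  "r \<in> grade R m \<Longrightarrow> s \<in> grade R n \<Longrightarrow> X \<in> obj T \<Longrightarrow>
     \<phi> (m + n) (r \<otimes>\<^bsub>R\<^esub> s) X = Sa n (\<phi> m r X) \<bullet> \<phi> n s X"
  using linear by (simp add: linear_structure_def)

lemma act_one: "X \<in> obj T \<Longrightarrow> \<phi> 0 \<one>\<^bsub>R\<^esub> X = ident T X"
  using linear by (simp add: linear_structure_def)

lemma act_zero:
  assumes "X \<in> obj T"
  shows "\<phi> n \<zero>\<^bsub>R\<^esub> X = zero_arr T X (Sg n X)"
  using idem_plus_zero[OF act_hom[OF R.grade_zero assms]] act_add[OF R.grade_zero R.grade_zero assms]
  by simp

lemma act_neg:
  assumes "r \<in> grade R n" "X \<in> obj T"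
  shows "\<phi> n (\<ominus>\<^bsub>R\<^esub> r) X = neg_arr T (\<phi> n r X)"
proof (rule neg_unique)
  show "\<phi> n r X \<in> Hom T X (Sg n X)" "\<phi> n (\<ominus>\<^bsub>R\<^esub> r) X \<in> Hom T X (Sg n X)"
    using assms R.grade_neg by blast+
  show "\<phi> n (\<ominus>\<^bsub>R\<^esub> r) X \<boxplus> \<phi> n r X = zero_arr T X (Sg n X)"
    using act_add[OF R.grade_neg[OF assms(1)] assms(1,2)] act_zero[OF assms(2)] assms(1)
    by (simp add: R.l_neg R.grade_closed)
qed

text \<open>The sign is that of \<open>k * n\<close>, but only the alternative is recorded:
  annihilation does not see it, and in products it can be moved into the ring element.\<close>

lemma act_Sg:
  assumes r: "r \<in> grade R k" and X: "X \<in> obj T"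
  shows "\<phi> k r (Sg n X) = Sa n (\<phi> k r X) \<or> \<phi> k r (Sg n X) = neg_arr T (Sa n (\<phi> k r X))"
proof -
  have one: "\<phi> k r (Sg 1 X) = Sa 1 (\<phi> k r X) \<or> \<phi> k r (Sg 1 X) = neg_arr T (Sa 1 (\<phi> k r X))"
    if "X \<in> obj T" for X
    using act_center[OF r] that by (auto simp: graded_center_def sign_arr_def susp_eq)
  note h = act_hom[OF r] and Sh = Sa_hom[OF act_hom[OF r X]]
  show ?thesis
  proof (induction n rule: int_induct[where k = 0])
    case base
    show ?case by simp
  next
    case (step1 i)
    have a: "Sa 1 (Sa i (\<phi> k r X)) = Sa (i + 1) (\<phi> k r X)" using HomD(1)[OF h[OF X]] by (simp add: add.commute)
    have "Sg 1 (Sg i X) = Sg (i + 1) X" using X by (simp add: add.commute)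
    then have "\<phi> k r (Sg (i + 1) X) = Sa 1 (\<phi> k r (Sg i X)) \<or>
        \<phi> k r (Sg (i + 1) X) = neg_arr T (Sa 1 (\<phi> k r (Sg i X)))"
      using one[of "Sg i X"] X by simp
    then show ?case
      using step1(2) a Sa_neg[OF Sh, of 1 i] neg_neg[OF Sh, of "i + 1"] by auto
  next
    case (step2 i)
    let ?Y = "Sg (i - 1) X"
    have Y: "?Y \<in> obj T" "Sg 1 ?Y = Sg i X" using X by simp_all
    have a: "Sa i (\<phi> k r X) = Sa 1 (Sa (i - 1) (\<phi> k r X))" using HomD(1)[OF h[OF X]] by simp
    note hY = h[OF Y(1)] and S1 = Sh[of "i - 1"]
    have nS: "neg_arr T (Sa (i - 1) (\<phi> k r X)) \<in> Hom T ?Y (Sg (i - 1) (Sg k X))" using neg_hom[OF S1] .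
    have "Sa 1 (\<phi> k r ?Y) = Sa 1 (Sa (i - 1) (\<phi> k r X)) \<or>
        Sa 1 (\<phi> k r ?Y) = Sa 1 (neg_arr T (Sa (i - 1) (\<phi> k r X)))"
    proof -
      have 1: "\<phi> k r (Sg i X) = Sa 1 (\<phi> k r ?Y) \<or> \<phi> k r (Sg i X) = neg_arr T (Sa 1 (\<phi> k r ?Y))"
        using one[OF Y(1)] Y(2) by simp
      have 2: "\<phi> k r (Sg i X) = Sa 1 (Sa (i - 1) (\<phi> k r X)) \<or>
          \<phi> k r (Sg i X) = neg_arr T (Sa 1 (Sa (i - 1) (\<phi> k r X)))" using step2(2) a by simp
      have 3: "neg_arr T (neg_arr T (Sa 1 (\<phi> k r ?Y))) = Sa 1 (\<phi> k r ?Y)"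
        using neg_neg[OF Sa_hom[OF hY]] .
      have 4: "neg_arr T (neg_arr T (Sa 1 (Sa (i - 1) (\<phi> k r X)))) = Sa 1 (Sa (i - 1) (\<phi> k r X))"
        using neg_neg[OF Sa_hom[OF S1]] .
      have 5: "Sa 1 (neg_arr T (Sa (i - 1) (\<phi> k r X))) = neg_arr T (Sa 1 (Sa (i - 1) (\<phi> k r X)))"
        using Sa_neg[OF S1] .
      show ?thesis using 1 2 3 4 5 by metis
    qed
    then show ?case using Sa_inj HomD(1)[OF hY] HomD(1)[OF S1] HomD(1)[OF nS] by blast
  qed
qed

text \<open>On morphisms into \<open>Sg n X\<close> there are two actions, by \<open>\<phi>\<close>
  at \<open>Sg n X\<close> and by the suspended \<open>\<phi>\<close> at \<open>X\<close> as in
  \<open>hom_star\<close>. They have the same annihilators.\<close>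

lemma act_Sg_kill:
  assumes r: "r \<in> grade R k" and X: "X \<in> obj T" and f: "f \<in> Hom T C (Sg n X)"
  shows "\<phi> k r (Sg n X) \<bullet> f = zero_arr T C (Sg (n + k) X) \<longleftrightarrow> Sa n (\<phi> k r X) \<bullet> f = zero_arr T C (Sg (n + k) X)"
proof -
  have S: "Sa n (\<phi> k r X) \<in> Hom T (Sg n X) (Sg (n + k) X)" using Sa_hom[OF act_hom[OF r X], of n] X by simp
  have Sf: "Sa n (\<phi> k r X) \<bullet> f \<in> Hom T C (Sg (n + k) X)" using cmp_hom[OF f S] .
  have o: "C \<in> obj T" "Sg (n + k) X \<in> obj T" using Hom_objD[OF Sf] by auto
  show ?thesis
    using act_Sg[OF r X, of n]
  proof
    assume "\<phi> k r (Sg n X) = neg_arr T (Sa n (\<phi> k r X))"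
    then have "\<phi> k r (Sg n X) \<bullet> f = neg_arr T (Sa n (\<phi> k r X) \<bullet> f)" using cmp_neg_left[OF f S] by simp
    then show ?thesis using neg_eq_zero[OF Sf] neg_zero[OF o] by auto
  qed simp
qed

lemma act_Sg_zero:
  assumes r: "r \<in> grade R k" and X: "X \<in> obj T" and z: "\<phi> k r X = zero_arr T X (Sg k X)"
  shows "\<phi> k r (Sg n X) = zero_arr T (Sg n X) (Sg k (Sg n X))"
  using act_Sg[OF r X, of n] z Sa_zero[of X "Sg k X" n] neg_zero[of "Sg n X" "Sg (n + k) X"] X
  by (auto simp: add.commute)

definition kills where
  "kills k r C Y f \<longleftrightarrow> \<phi> k r Y \<bullet> f = zero_arr T C (Sg k Y)"

lemma kills_mult_iff:
  assumes r: "r \<in> grade R m" and s: "s \<in> grade R n" and f: "f \<in> Hom T C Y"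
  shows "kills (m + n) (r \<otimes>\<^bsub>R\<^esub> s) C Y f \<longleftrightarrow> kills m r C (Sg n Y) (\<phi> n s Y \<bullet> f)"
proof -
  have Y: "Y \<in> obj T" using f Hom_objD by blast
  note sf = cmp_hom[OF f act_hom[OF s Y]]
  have "\<phi> (m + n) (r \<otimes>\<^bsub>R\<^esub> s) Y \<bullet> f = Sa n (\<phi> m r Y) \<bullet> (\<phi> n s Y \<bullet> f)"
    using act_mult[OF r s Y] cmp_assoc[OF f act_hom[OF s Y] Sa_hom[OF act_hom[OF r Y]]] by simp
  then show ?thesis using act_Sg_kill[OF r Y sf] Y by (simp add: kills_def add.commute)
qed

lemma kills_mult_left:
  assumes r: "r \<in> grade R m" and s: "s \<in> grade R n" and f: "f \<in> Hom T C Y" and k: "kills n s C Y f"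
  shows "kills (m + n) (r \<otimes>\<^bsub>R\<^esub> s) C Y f"
proof -
  have o: "C \<in> obj T" "Y \<in> obj T" using Hom_objD[OF f] by auto
  then have "kills m r C (Sg n Y) (zero_arr T C (Sg n Y))"
    using cmp_zero_right[OF act_hom[OF r Sg_obj]] by (simp add: kills_def)
  then show ?thesis using kills_mult_iff[OF r s f] k by (simp add: kills_def)
qed

lemma kills_neg:
  assumes r: "r \<in> grade R m" and f: "f \<in> Hom T C Y" and k: "kills m r C Y f"
  shows "kills m (\<ominus>\<^bsub>R\<^esub> r) C Y f"
proof -
  have o: "C \<in> obj T" "Y \<in> obj T" using Hom_objD[OF f] by auto
  then show ?thesis
    using act_neg[OF r o(2)] cmp_neg_left[OF f act_hom[OF r o(2)]] k neg_zero[of C "Sg m Y"]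
    by (simp add: kills_def)
qed

text \<open>Graded commutativity reduces this to the product in the other order, up to a
  sign.\<close>

lemma kills_mult_right:
  assumes r: "r \<in> grade R m" and s: "s \<in> grade R n" and f: "f \<in> Hom T C Y" and k: "kills m r C Y f"
  shows "kills (m + n) (r \<otimes>\<^bsub>R\<^esub> s) C Y f"
proof -
  have "kills (n + m) (s \<otimes>\<^bsub>R\<^esub> r) C Y f" by (rule kills_mult_left[OF s r f k])
  then have k': "kills (m + n) (s \<otimes>\<^bsub>R\<^esub> r) C Y f" by (simp add: add.commute)
  have "s \<otimes>\<^bsub>R\<^esub> r \<in> grade R (m + n)" using R.grade_mult[OF s r] by (simp add: add.commute)
  then show ?thesis using R.grade_commute[OF r s] kills_neg[OF _ f k'] k' by metis
qed

lemma kills_post: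
  assumes r: "r \<in> grade R k" and f: "f \<in> Hom T C Y" and g: "g \<in> Hom T Y Z" and k: "kills k r C Y f"
  shows "kills k r C Z (g \<bullet> f)"
proof -
  note o = Hom_objD[OF f] Hom_objD[OF g]
  have "\<phi> k r Z \<bullet> (g \<bullet> f) = Sa k g \<bullet> (\<phi> k r Y \<bullet> f)"
    using act_natural[OF r g] cmp_assoc[OF f g act_hom[OF r o(4)]]
      cmp_assoc[OF f act_hom[OF r o(2)] Sa_hom[OF g]] by simp
  then show ?thesis using k cmp_zero_right[OF Sa_hom[OF g] o(1)] by (simp add: kills_def)
qed

lemma kills_plus:
  assumes r: "r \<in> grade R k" and f: "f \<in> Hom T C Y" "f' \<in> Hom T C Y"
    and k: "kills k r C Y f" "kills k r C Y f'"
  shows "kills k r C Y (f \<boxplus> f')"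
proof -
  note o = Hom_objD[OF f(1)]
  show ?thesis
    using cmp_plus_right[OF f act_hom[OF r o(2)]] k plus_zero[OF zero_hom[OF o(1)], of "Sg k Y"] o
    by (simp add: kills_def)
qed

lemma kills_zero: "r \<in> grade R k \<Longrightarrow> C \<in> obj T \<Longrightarrow> Y \<in> obj T \<Longrightarrow> kills k r C Y (zero_arr T C Y)"
  using cmp_zero_right[OF act_hom] by (simp add: kills_def)

lemma kills_Sa:
  assumes r: "r \<in> grade R k" and f: "f \<in> Hom T C X" and kf: "kills k r C X f"
  shows "kills k r (Sg n C) (Sg n X) (Sa n f)"
proof -
  note o = Hom_objD[OF f]
  have "Sa n (\<phi> k r X) \<bullet> Sa n f = zero_arr T (Sg n C) (Sg (n + k) X)"
    using Sa_cmp[OF f act_hom[OF r o(2)], of n] kf Sa_zero[of C "Sg k X" n] o by (simp add: kills_def)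
  then have "\<phi> k r (Sg n X) \<bullet> Sa n f = zero_arr T (Sg n C) (Sg (n + k) X)"
    using act_Sg_kill[OF r o(2) Sa_hom[OF f]] by blast
  then show ?thesis using o by (simp add: kills_def add.commute)
qed

lemma kills_if_act_zero:
  assumes "r \<in> grade R k" "f \<in> Hom T C X" "\<phi> k r X = zero_arr T X (Sg k X)"
  shows "kills k r C X f"
  using assms cmp_zero_left[OF assms(2)] Hom_objD[OF assms(2)] by (simp add: kills_def)

text \<open>Degrees are carried along because \<open>\<phi>\<close> takes the degree as an
  argument.\<close>

definition mult_set where
  "mult_set M \<longleftrightarrow> (0, \<one>\<^bsub>R\<^esub>) \<in> M \<and> (\<forall>k s. (k, s) \<in> M \<longrightarrow> s \<in> grade R k) \<and>
     (\<forall>k s l t. (k, s) \<in> M \<longrightarrow> (l, t) \<in> M \<longrightarrow> (k + l, s \<otimes>\<^bsub>R\<^esub> t) \<in> M)"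

text \<open>Morphisms of nonzero degree are covered as well, by suspending the compact test
  object.\<close>

definition mtorsion :: "'k rel \<Rightarrow> (int \<times> 'r) set \<Rightarrow> 'o set" where
  "mtorsion \<kappa> M = {X \<in> obj T. \<forall>C \<in> compacts \<kappa> T. \<forall>f \<in> Hom T C X. \<exists>(k, s) \<in> M. kills k s C X f}"

definition compl :: "'r set \<Rightarrow> (int \<times> 'r) set" where
  "compl p = {(k, s). s \<in> grade R k \<and> s \<notin> p}"

lemma complI: "s \<in> grade R k \<Longrightarrow> s \<notin> p \<Longrightarrow> (k, s) \<in> compl p"
  by (simp add: compl_def)

lemma complD: "(k, s) \<in> compl p \<Longrightarrow> s \<in> grade R k" "(k, s) \<in> compl p \<Longrightarrow> s \<notin> p"
  by (auto simp: compl_def)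

lemma compl_mult:
  assumes p: "p \<in> Spec R" and "(k, s) \<in> compl p" "(l, t) \<in> compl p"
  shows "(k + l, s \<otimes>\<^bsub>R\<^esub> t) \<in> compl p"
proof -
  note h = complD[OF assms(2)] complD[OF assms(3)]
  have "s \<otimes>\<^bsub>R\<^esub> t \<notin> p" using R.SpecD(4)[OF p] h R.grade_closed by blast
  then show ?thesis using R.grade_mult h by (simp add: compl_def)
qed

lemma compl_mult_set: "p \<in> Spec R \<Longrightarrow> mult_set (compl p)"
  unfolding mult_set_def using compl_mult R.grade_one R.SpecD(3) complD complI by blast

lemma mtorsionI:
  assumes "X \<in> obj T" "\<And>C f. C \<in> compacts \<kappa> T \<Longrightarrow> f \<in> Hom T C X \<Longrightarrow> \<exists>(k, s) \<in> M. kills k s C X f"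
  shows "X \<in> mtorsion \<kappa> M"
  using assms by (auto simp: mtorsion_def)

lemma mtorsionE:
  assumes "X \<in> mtorsion \<kappa> M" "C \<in> compacts \<kappa> T" "f \<in> Hom T C X"
  obtains k s where "(k, s) \<in> M" "kills k s C X f"
  using assms by (fastforce simp: mtorsion_def)

text \<open>Closure under coproducts rests on compactness of the test objects: a product of finitely
  many annihilators kills all components at once.\<close>

lemma mtorsion_localizing:
  fixes \<kappa> :: "'k rel"
  assumes M: "mult_set M"
  shows "localizing \<kappa> T (mtorsion \<kappa> M)"
  unfolding localizing_def
proof (intro conjI allI impI)
  note cT = compacts_triangulated[of \<kappa>]
  have one: "(0, \<one>\<^bsub>R\<^esub>) \<in> M" and gr: "\<And>k s. (k, s) \<in> M \<Longrightarrow> s \<in> grade R k"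
    and mm: "\<And>k s l t. (k, s) \<in> M \<Longrightarrow> (l, t) \<in> M \<Longrightarrow> (k + l, s \<otimes>\<^bsub>R\<^esub> t) \<in> M"
    using M unfolding mult_set_def by blast+
  have sub: "mtorsion \<kappa> M \<subseteq> obj T" by (auto simp: mtorsion_def)
  show "triangulated_subcategory T (mtorsion \<kappa> M)"
  proof (rule triangulated_subcategoryI)
    show "mtorsion \<kappa> M \<subseteq> obj T" by fact
    show "Z \<in> mtorsion \<kappa> M" if Z: "zero_obj T Z" for Z
    proof (rule mtorsionI[OF zero_objD[OF Z]])
      fix C f assume f: "f \<in> Hom T C Z"
      have "kills 0 \<one>\<^bsub>R\<^esub> C Z f"
        using zero_obj_hom(1)[OF Z f] kills_zero[OF gr[OF one]] Hom_objD[OF f] by simp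
      then show "\<exists>(k, s) \<in> M. kills k s C Z f" using one by blast
    qed
    show "Y \<in> mtorsion \<kappa> M" if X: "X \<in> mtorsion \<kappa> M" and i: "iso_obj T X Y" for X Y
    proof -
      obtain a b where ab: "a \<in> Hom T X Y" "b \<in> Hom T Y X" "a \<bullet> b = ident T Y"
        using i unfolding iso_obj_def by (metis iso_arrE)
      show ?thesis
      proof (rule mtorsionI[OF Hom_objD(2)[OF ab(1)]])
        fix C f assume C: "C \<in> compacts \<kappa> T" and f: "f \<in> Hom T C Y"
        have bf: "b \<bullet> f \<in> Hom T C X" using cmp_hom[OF f ab(2)] .
        obtain k s where s: "(k, s) \<in> M" "kills k s C X (b \<bullet> f)" using mtorsionE[OF X C bf] by blast
        have "kills k s C Y (a \<bullet> (b \<bullet> f))" using kills_post[OF gr[OF s(1)] bf ab(1) s(2)] .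
        then have "kills k s C Y f" using cmp_assoc[OF f ab(2,1)] ab(3) cmp_ident_left[OF f] by simp
        then show "\<exists>(k, s) \<in> M. kills k s C Y f" using s(1) by blast
      qed
    qed
    show SX: "Sg n X \<in> mtorsion \<kappa> M" if X: "X \<in> mtorsion \<kappa> M" for X n
    proof -
      have oX: "X \<in> obj T" using X sub by blast
      show ?thesis
      proof (rule mtorsionI)
        show "Sg n X \<in> obj T" using oX by simp
        fix C f assume C: "C \<in> compacts \<kappa> T" and f: "f \<in> Hom T C (Sg n X)"
        have oC: "C \<in> obj T" using f Hom_objD by blast
        have "f \<in> Hom T (Sg n (Sg (- n) C)) (Sg n X)" using f oC by simp
        then obtain f0 where f0: "f0 \<in> Hom T (Sg (- n) C) X" "f = Sa n f0"
          using Sa_surj[of f n "Sg (- n) C" X] oC oX by blast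
        have "Sg (- n) C \<in> compacts \<kappa> T" using triangulated_subcategoryD(4)[OF cT C] .
        from mtorsionE[OF X this f0(1)]
        obtain k s where s: "(k, s) \<in> M" "kills k s (Sg (- n) C) X f0" by blast
        have "kills k s C (Sg n X) f" using kills_Sa[OF gr[OF s(1)] f0(1) s(2), of n] f0(2) oC by simp
        then show "\<exists>(k, s) \<in> M. kills k s C (Sg n X) f" using s(1) by blast
      qed
    qed
    show "Z \<in> mtorsion \<kappa> M" if t: "tri X Y Z f g h" and XY: "X \<in> mtorsion \<kappa> M" "Y \<in> mtorsion \<kappa> M"
      for X Y Z f g h
    proof -
      note d = triD[OF t]
      show ?thesis
      proof (rule mtorsionI[OF d(7)])
        fix C u assume C: "C \<in> compacts \<kappa> T" and u: "u \<in> Hom T C Z"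
        have hu: "h \<bullet> u \<in> Hom T C (Sg 1 X)" using cmp_hom[OF u d(4)] .
        obtain k s where s: "(k, s) \<in> M" "kills k s C (Sg 1 X) (h \<bullet> u)"
          using mtorsionE[OF SX[OF XY(1)] C hu] by blast
        note sg = gr[OF s(1)]
        have su: "\<phi> k s Z \<bullet> u \<in> Hom T C (Sg k Z)" using cmp_hom[OF u act_hom[OF sg d(7)]] .
        \<comment> \<open>As \<open>s\<close> kills \<open>h \<bullet> u\<close>, the multiple of
          \<open>u\<close> by \<open>s\<close> comes from \<open>Y\<close>, where some
          \<open>r\<close> kills it. So the product of \<open>r\<close> and \<open>s\<close> kills
          \<open>u\<close>.\<close>
        have "Sa k h \<bullet> (\<phi> k s Z \<bullet> u) = \<phi> k s (Sg 1 X) \<bullet> (h \<bullet> u)"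
          using act_natural[OF sg d(4)] cmp_assoc[OF u act_hom[OF sg d(7)] Sa_hom[OF d(4)]]
            cmp_assoc[OF u d(4) act_hom[OF sg Sg_obj[OF d(5)]]] by simp
        then have "Sa k h \<bullet> (\<phi> k s Z \<bullet> u) = zero_arr T C (Sg k (Sg 1 X))" using s(2) by (simp add: kills_def)
        then obtain v where v: "v \<in> Hom T C (Sg k Y)" "\<phi> k s Z \<bullet> u = Sa k g \<bullet> v"
          using tri_factor_left_pow[OF tri_rotate[OF t] su] by blast
        obtain l r where r: "(l, r) \<in> M" "kills l r C (Sg k Y) v"
          using mtorsionE[OF SX[OF XY(2)] C v(1)] by blast
        have "kills l r C (Sg k Z) (\<phi> k s Z \<bullet> u)"
          using kills_post[OF gr[OF r(1)] v(1) Sa_hom[OF d(3)] r(2)] v(2) by simp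
        then have "kills (l + k) (r \<otimes>\<^bsub>R\<^esub> s) C Z u" using kills_mult_iff[OF gr[OF r(1)] sg u] by blast
        then show "\<exists>(k, s) \<in> M. kills k s C Z u" using mm[OF r(1) s(1)] by blast
      qed
    qed
  qed
  fix I :: "'k set" and X P \<iota>
  assume I: "small \<kappa> I" and P: "is_coproduct T I X P \<iota>" and X: "\<forall>i\<in>I. X i \<in> mtorsion \<kappa> M"
  note h = is_coproduct_hom[OF P]
  show "P \<in> mtorsion \<kappa> M"
  proof (rule mtorsionI[OF h(1)])
    fix C f assume C: "C \<in> compacts \<kappa> T" and f: "f \<in> Hom T C P"
    have oC: "C \<in> obj T" using f Hom_objD by blast
    obtain F where F: "finite F" "F \<subseteq> I" "supported X P \<iota> C F f" using compactsD(2)[OF C I P f] by blast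
    show "\<exists>(k, s) \<in> M. kills k s C P f"
    proof (rule supported_induct[where Q="\<lambda>f. \<exists>(k, s) \<in> M. kills k s C P f", OF P F f])
      show "\<exists>(k, s) \<in> M. kills k s C P (zero_arr T C P)" using kills_zero[OF gr[OF one] oC h(1)] one by blast
      show "\<exists>(k, s) \<in> M. kills k s C P (f \<boxplus> f')"
        if ff: "f \<in> Hom T C P" "f' \<in> Hom T C P" and e: "\<exists>(k, s) \<in> M. kills k s C P f" "\<exists>(k, s) \<in> M. kills k s C P f'"
        for f f'
      proof -
        obtain k s l t where s: "(k, s) \<in> M" "kills k s C P f" and t: "(l, t) \<in> M" "kills l t C P f'"
          using e by blast
        have "kills (k + l) (s \<otimes>\<^bsub>R\<^esub> t) C P f" using kills_mult_right[OF gr[OF s(1)] gr[OF t(1)] ff(1) s(2)] .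
        moreover have "kills (k + l) (s \<otimes>\<^bsub>R\<^esub> t) C P f'" using kills_mult_left[OF gr[OF s(1)] gr[OF t(1)] ff(2) t(2)] .
        ultimately have "kills (k + l) (s \<otimes>\<^bsub>R\<^esub> t) C P (f \<boxplus> f')"
          using kills_plus[OF gr[OF mm[OF s(1) t(1)]] ff] by blast
        then show ?thesis using mm[OF s(1) t(1)] by blast
      qed
      show "\<exists>(k, s) \<in> M. kills k s C P (\<iota> i \<bullet> (\<pi> \<bullet> f))" if i: "i \<in> I" and p: "coproduct_proj I X P \<iota> i \<pi>" for i \<pi>
      proof -
        have pf: "\<pi> \<bullet> f \<in> Hom T C (X i)" using p cmp_hom[OF f] by (simp add: coproduct_proj_def)
        obtain k s where s: "(k, s) \<in> M" "kills k s C (X i) (\<pi> \<bullet> f)" using mtorsionE[OF X[rule_format, OF i] C pf] by blast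
        then show ?thesis using kills_post[OF gr[OF s(1)] pf h(3)[OF i] s(2)] by blast
      qed
    qed
  qed
qed

section \<open>Comparison with homogeneous localization\<close>

lemma hom_star_simps [simp]:
  "gcar (hom_star T \<phi> C X) n = Hom T C (Sg n X)"
  "gzero (hom_star T \<phi> C X) n = zero_arr T C (Sg n X)"
  "gact (hom_star T \<phi> C X) k r n f = Sa n (\<phi> k r X) \<bullet> f"
  "gadd (hom_star T \<phi> C X) = plus_arr T"
  by (simp_all add: hom_star_def)

lemma kills_gact:
  assumes r: "r \<in> grade R k" and X: "X \<in> obj T" and f: "f \<in> Hom T C (Sg n X)"
  shows "kills k r C (Sg n X) f \<longleftrightarrow> Sa n (\<phi> k r X) \<bullet> f = zero_arr T C (Sg (n + k) X)"
  using act_Sg_kill[OF r X f] X by (simp add: kills_def add.commute)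

text \<open>An element with denominator one equals zero in the localization exactly when something
  homogeneous outside \<open>p\<close> kills it.\<close>

lemma localization_is_zero_iff:
  assumes p: "p \<in> Spec R" and C: "C \<in> obj T" and X: "X \<in> obj T"
  shows "localization_is_zero R (hom_star T \<phi> C X) p \<longleftrightarrow>
    (\<forall>n. \<forall>f \<in> Hom T C (Sg n X). \<exists>(k, s) \<in> compl p. kills k s C (Sg n X) f)"
    (is "?L \<longleftrightarrow> ?R")
proof
  let ?M = "hom_star T \<phi> C X"
  assume L: ?L
  show ?R
  proof (intro allI ballI)
    fix n f assume f: "f \<in> Hom T C (Sg n X)"
    let ?r = "fraction_rel R ?M p n"
    have u: "(0, \<one>\<^bsub>R\<^esub>, f) \<in> fractions R ?M p n"
      using f R.grade_one R.SpecD(3)[OF p] by (simp add: fractions_def)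
    have "?r `` {(0, \<one>\<^bsub>R\<^esub>, f)} \<in> localization R ?M p n"
      unfolding localization_def by (rule quotientI[OF u])
    then have "?r `` {(0, \<one>\<^bsub>R\<^esub>, f)} = ?r `` {(0, \<one>\<^bsub>R\<^esub>, gzero ?M n)}"
      unfolding L[unfolded localization_is_zero_def, rule_format, of n] by (rule singletonD)
    moreover have "((0, \<one>\<^bsub>R\<^esub>, f), (0, \<one>\<^bsub>R\<^esub>, f)) \<in> ?r"
    proof -
      have "\<exists>j j'. \<exists>a \<in> grade R j. \<exists>a' \<in> grade R j'.
           j + 0 = j' + 0 \<and> a \<otimes>\<^bsub>R\<^esub> \<one>\<^bsub>R\<^esub> = a' \<otimes>\<^bsub>R\<^esub> \<one>\<^bsub>R\<^esub> \<and> a \<otimes>\<^bsub>R\<^esub> \<one>\<^bsub>R\<^esub> \<notin> p \<and>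
           gact ?M j a (n + 0) f = gact ?M j' a' (n + 0) f"
        using R.grade_one R.SpecD(3)[OF p]
        by (intro exI[of _ 0] bexI[of _ "\<one>\<^bsub>R\<^esub>"]) auto
      then show ?thesis using u by (simp add: fraction_rel_def)
    qed
    ultimately have "((0, \<one>\<^bsub>R\<^esub>, gzero ?M n), (0, \<one>\<^bsub>R\<^esub>, f)) \<in> ?r" by auto
    then obtain j j' a a' where a: "a \<in> grade R j" "a' \<in> grade R j'" "j = j'"
      "a \<otimes>\<^bsub>R\<^esub> \<one>\<^bsub>R\<^esub> = a' \<otimes>\<^bsub>R\<^esub> \<one>\<^bsub>R\<^esub>" "a \<otimes>\<^bsub>R\<^esub> \<one>\<^bsub>R\<^esub> \<notin> p"
      "Sa n (\<phi> j a X) \<bullet> zero_arr T C (Sg n X) = Sa n (\<phi> j' a' X) \<bullet> f"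
      by (auto simp: fraction_rel_def)
    have a': "a' = a" "a \<notin> p" using a R.grade_closed[OF a(1)] R.grade_closed[OF a(2)] by simp_all
    have "Sa n (\<phi> j a X) \<bullet> f = zero_arr T C (Sg (n + j) X)"
      using a(6) a' a(3) cmp_zero_right[OF Sa_hom[OF act_hom[OF a(1) X]] C, of n] X by simp
    then have "kills j a C (Sg n X) f" using kills_gact[OF a(1) X f] by blast
    then show "\<exists>(k, s) \<in> compl p. kills k s C (Sg n X) f" using complI[OF a(1) a'(2)] by blast
  qed
next
  let ?M = "hom_star T \<phi> C X"
  assume Rt: ?R
  \<comment> \<open>Any two fractions are identified: expanding by annihilators of both numerators
    reaches a common denominator with both numerators zero.\<close>
  have rel: "(u, v) \<in> fraction_rel R ?M p d" if u: "u \<in> fractions R ?M p d" and v: "v \<in> fractions R ?M p d" for u v d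
  proof -
    obtain k s x where ue: "u = (k, s, x)" by (cases u)
    obtain k' s' x' where ve: "v = (k', s', x')" by (cases v)
    have s: "s \<in> grade R k" "s \<notin> p" "x \<in> Hom T C (Sg (d + k) X)" using u ue by (auto simp: fractions_def)
    have s': "s' \<in> grade R k'" "s' \<notin> p" "x' \<in> Hom T C (Sg (d + k') X)" using v ve by (auto simp: fractions_def)
    obtain m y where y: "(m, y) \<in> compl p" "kills m y C (Sg (d + k) X) x" using Rt s(3) by blast
    obtain m' y' where y': "(m', y') \<in> compl p" "kills m' y' C (Sg (d + k') X) x'" using Rt s'(3) by blast
    note yg = complD(1)[OF y(1)] and yg' = complD(1)[OF y'(1)]
    let ?w = "y' \<otimes>\<^bsub>R\<^esub> (y \<otimes>\<^bsub>R\<^esub> s)" and ?dw = "m' + (m + k)"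
    let ?a = "s' \<otimes>\<^bsub>R\<^esub> (y' \<otimes>\<^bsub>R\<^esub> y)" and ?da = "k' + (m' + m)"
    have wc: "(?dw, ?w) \<in> compl p" using compl_mult[OF p y'(1) compl_mult[OF p y(1) complI[OF s(1,2)]]] .
    note wg = complD(1)[OF wc]
    have ag: "?a \<in> grade R ?da" using R.grade_mult[OF s'(1) R.grade_mult[OF yg' yg]] .
    have as: "?a \<otimes>\<^bsub>R\<^esub> s = s' \<otimes>\<^bsub>R\<^esub> ?w"
      using R.grade_closed[OF s(1)] R.grade_closed[OF s'(1)] R.grade_closed[OF yg] R.grade_closed[OF yg']
      by (simp add: R.m_assoc)
    have asp: "?a \<otimes>\<^bsub>R\<^esub> s \<notin> p" unfolding as using compl_mult[OF p complI[OF s'(1,2)] wc] complD(2) by blast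
    have ax: "kills ?da ?a C (Sg (d + k) X) x"
      using kills_mult_left[OF s'(1) R.grade_mult[OF yg' yg] s(3) kills_mult_left[OF yg' yg s(3) y(2)]] .
    have wx: "kills ?dw ?w C (Sg (d + k') X) x'"
      using kills_mult_right[OF yg' R.grade_mult[OF yg s(1)] s'(3) y'(2)] .
    \<comment> \<open>Moving \<open>s'\<close> past \<open>?w\<close> may cost a sign, which is put
      into the multiplier.\<close>
    define a' where "a' = (if s' \<otimes>\<^bsub>R\<^esub> ?w = ?w \<otimes>\<^bsub>R\<^esub> s' then ?w else \<ominus>\<^bsub>R\<^esub> ?w)"
    have a'g: "a' \<in> grade R ?dw" using wg R.grade_neg by (simp add: a'_def)
    have a's: "?a \<otimes>\<^bsub>R\<^esub> s = a' \<otimes>\<^bsub>R\<^esub> s'"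
      using R.grade_commute[OF s'(1) wg] as R.l_minus[OF R.grade_closed[OF wg] R.grade_closed[OF s'(1)]]
      by (auto simp: a'_def)
    have a'x: "kills ?dw a' C (Sg (d + k') X) x'" using wx kills_neg[OF wg s'(3)] by (simp add: a'_def)
    have "Sa (d + k) (\<phi> ?da ?a X) \<bullet> x = Sa (d + k') (\<phi> ?dw a' X) \<bullet> x'"
      using kills_gact[OF ag X s(3)] kills_gact[OF a'g X s'(3)] ax a'x by (simp add: add_ac)
    then have "\<exists>j j'. \<exists>a \<in> grade R j. \<exists>a' \<in> grade R j'.
           j + k = j' + k' \<and> a \<otimes>\<^bsub>R\<^esub> s = a' \<otimes>\<^bsub>R\<^esub> s' \<and> a \<otimes>\<^bsub>R\<^esub> s \<notin> p \<and>
           gact ?M j a (d + k) x = gact ?M j' a' (d + k') x'"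
      using ag a'g a's asp by (intro exI[of _ ?da] exI[of _ ?dw] bexI[of _ ?a] bexI[of _ a']) auto
    then show ?thesis using u v ue ve by (simp add: fraction_rel_def)
  qed
  show ?L
    unfolding localization_is_zero_def
  proof
    fix d
    let ?r = "fraction_rel R ?M p d" and ?F = "fractions R ?M p d"
    have u0: "(0, \<one>\<^bsub>R\<^esub>, gzero ?M d) \<in> ?F"
      using R.grade_one R.SpecD(3)[OF p] zero_hom C X by (simp add: fractions_def)
    have "?r `` {u} = ?F" if "u \<in> ?F" for u
      using rel[OF that] by (auto simp: fraction_rel_def)
    then show "localization R ?M p d = {?r `` {(0, \<one>\<^bsub>R\<^esub>, gzero ?M d)}}"
      using u0 by (auto simp: localization_def quotient_def)
  qed
qed

lemma torsion_eq:
  "torsion \<kappa> T R \<phi> V = {X \<in> obj T. \<forall>p \<in> Spec R - V. X \<in> mtorsion \<kappa> (compl p)}"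
proof -
  have "(\<forall>C \<in> compacts \<kappa> T. localization_is_zero R (hom_star T \<phi> C X) p) \<longleftrightarrow> X \<in> mtorsion \<kappa> (compl p)"
    if X: "X \<in> obj T" and p: "p \<in> Spec R" for X p
  proof
    assume "\<forall>C \<in> compacts \<kappa> T. localization_is_zero R (hom_star T \<phi> C X) p"
    then have *: "\<forall>C \<in> compacts \<kappa> T. \<forall>n. \<forall>f \<in> Hom T C (Sg n X). \<exists>(k, s) \<in> compl p. kills k s C (Sg n X) f"
      using localization_is_zero_iff[OF p compactsD(1) X] by blast
    show "X \<in> mtorsion \<kappa> (compl p)"
    proof (rule mtorsionI[OF X])
      fix C f assume "C \<in> compacts \<kappa> T" "f \<in> Hom T C X"
      then show "\<exists>(k, s) \<in> compl p. kills k s C X f" using *[rule_format, of C f 0] by simp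
    qed
  next
    assume m: "X \<in> mtorsion \<kappa> (compl p)"
    have "Sg n X \<in> mtorsion \<kappa> (compl p)" for n
      using triangulated_subcategoryD(4)[OF localizingD(1)[OF mtorsion_localizing[OF compl_mult_set[OF p]]] m] .
    then show "\<forall>C \<in> compacts \<kappa> T. localization_is_zero R (hom_star T \<phi> C X) p"
      using localization_is_zero_iff[OF p compactsD(1) X] unfolding mtorsion_def by blast
  qed
  then show ?thesis unfolding torsion_def by blast
qed

lemma torsion_localizing: "localizing \<kappa> T (torsion \<kappa> T R \<phi> V)"
proof -
  \<comment> \<open>\<open>obj T\<close> keeps the family nonempty when \<open>V\<close> contains
    every prime.\<close>
  have "torsion \<kappa> T R \<phi> V = \<Inter> (insert (obj T) ((\<lambda>p. mtorsion \<kappa> (compl p)) ` (Spec R - V)))"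
    unfolding torsion_eq by auto
  also have "localizing \<kappa> T \<dots>"
    by (rule localizing_Inter) (use obj_localizing mtorsion_localizing compl_mult_set in auto)
  finally show ?thesis .
qed

text \<open>The primes outside \<open>Zset R p\<close> are those contained in \<open>p\<close>.
  Their complements are larger, so torsion at \<open>p\<close> implies torsion at each of
  them.\<close>

lemma torsion_Zset:
  assumes p: "p \<in> Spec R"
  shows "torsion \<kappa> T R \<phi> (Zset R p) = mtorsion \<kappa> (compl p)"
proof
  have "p \<in> Spec R - Zset R p" using p by (simp add: Zset_def)
  then show "torsion \<kappa> T R \<phi> (Zset R p) \<subseteq> mtorsion \<kappa> (compl p)" unfolding torsion_eq by blast
  have "mtorsion \<kappa> (compl p) \<subseteq> mtorsion \<kappa> (compl q)" if "q \<subseteq> p" for q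
    using that unfolding mtorsion_def compl_def by fast
  then show "mtorsion \<kappa> (compl p) \<subseteq> torsion \<kappa> T R \<phi> (Zset R p)"
    unfolding torsion_eq by (auto simp: Zset_def mtorsion_def)
qed

end

section \<open>Koszul objects and torsion\<close>

context linear_category
begin

text \<open>As \<open>r\<close> kills \<open>g\<close>, its action on \<open>Z\<close> is
  \<open>v \<bullet> h\<close> for some \<open>v\<close>. A second \<open>r\<close> passes
  \<open>v\<close> by naturality and kills \<open>h\<close>. This is the source of the squares in
  the lemmas on Koszul objects.\<close>

lemma cone_act_square_zero:
  assumes t: "tri X Y Z f g h" and r: "r \<in> grade R l"
    and z: "\<phi> l r Z \<bullet> g = zero_arr T Y (Sg l Z)" "kills l r Z (Sg 1 X) h"
  shows "\<phi> (l + l) (r \<otimes>\<^bsub>R\<^esub> r) Z = zero_arr T Z (Sg (l + l) Z)"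
proof -
  note d = triD[OF t] and a = act_hom[OF r triD(7)[OF t]]
  obtain v where v: "v \<in> Hom T (Sg 1 X) (Sg l Z)" "\<phi> l r Z = v \<bullet> h"
    using tri_factor_right[OF tri_rotate[OF t] a z(1)] by blast
  have "kills l r Z (Sg l Z) (v \<bullet> h)" by (rule kills_post[OF r d(4) v(1) z(2)])
  then have "kills l r Z (Sg l Z) (\<phi> l r Z \<bullet> ident T Z)" using v(2) cmp_ident_right[OF a] by simp
  then have "kills (l + l) (r \<otimes>\<^bsub>R\<^esub> r) Z Z (ident T Z)"
    using kills_mult_iff[OF r r ident_hom[OF d(7)]] by blast
  then show ?thesis
    using cmp_ident_right[OF act_hom[OF R.grade_mult[OF r r] d(7)]] by (simp add: kills_def)
qed

definition kos :: "int \<times> 'r \<Rightarrow> 'o \<Rightarrow> 'o" where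
  "kos x X = (SOME Z. \<exists>g h. tri X (Sg (fst x) X) Z (\<phi> (fst x) (snd x) X) g h)"

lemma kos_tri:
  assumes "r \<in> grade R k" "X \<in> obj T"
  obtains g h where "tri X (Sg k X) (kos (k, r) X) (\<phi> k r X) g h"
proof -
  have "\<exists>Z g h. tri X (Sg k X) Z (\<phi> k r X) g h" using tri_cone[OF act_hom[OF assms]] by metis
  from someI_ex[OF this] show ?thesis using that unfolding kos_def by auto
qed

lemma kos_obj: "r \<in> grade R k \<Longrightarrow> X \<in> obj T \<Longrightarrow> kos (k, r) X \<in> obj T"
  using kos_tri triD(7) by metis

lemma kos_compact:
  assumes "r \<in> grade R k" "C \<in> compacts \<kappa> T"
  shows "kos (k, r) C \<in> compacts \<kappa> T"
proof -
  note c = triangulated_subcategoryD[OF compacts_triangulated[of \<kappa>]]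
  obtain g h where "tri C (Sg k C) (kos (k, r) C) (\<phi> k r C) g h"
    using kos_tri[OF assms(1)] c(1) assms(2) by blast
  then show ?thesis using c(5) assms(2) c(4) by blast
qed

text \<open>Up to signs, both conditions of \<open>cone_act_square_zero\<close> say that consecutive
  morphisms of the defining triangle compose to zero.\<close>

lemma kos_act_self:
  assumes r: "r \<in> grade R k" and X: "X \<in> obj T"
  shows "\<phi> (k + k) (r \<otimes>\<^bsub>R\<^esub> r) (kos (k, r) X) = zero_arr T (kos (k, r) X) (Sg (k + k) (kos (k, r) X))"
proof -
  obtain g h where t: "tri X (Sg k X) (kos (k, r) X) (\<phi> k r X) g h" using kos_tri[OF r X] by blast
  note d = triD[OF t] and z = tri_cmp_zero[OF t]
  note S = Sa_hom[OF d(2), of k]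
  have gS: "Sa k g \<bullet> Sa k (\<phi> k r X) = zero_arr T (Sg k X) (Sg k (kos (k, r) X))"
    using Sa_cmp[OF d(2,3), of k] z(1) Sa_zero[OF d(5,7), of k] by simp
  then have "Sa k g \<bullet> neg_arr T (Sa k (\<phi> k r X)) = zero_arr T (Sg k X) (Sg k (kos (k, r) X))"
    using cmp_neg_right[OF S Sa_hom[OF d(3)]] neg_zero[of "Sg k X" "Sg k (kos (k, r) X)"] d by simp
  then have "Sa k g \<bullet> \<phi> k r (Sg k X) = zero_arr T (Sg k X) (Sg k (kos (k, r) X))"
    using act_Sg[OF r X, of k] gS by auto
  then have 1: "\<phi> k r (kos (k, r) X) \<bullet> g = zero_arr T (Sg k X) (Sg k (kos (k, r) X))"
    using act_natural[OF r d(3)] by simp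
  have "Sa 1 (\<phi> k r X) \<bullet> h = zero_arr T (kos (k, r) X) (Sg (1 + k) X)" using z(3) X by simp
  then have "kills k r (kos (k, r) X) (Sg 1 X) h" using kills_gact[OF r X d(4)] by blast
  then show ?thesis using cone_act_square_zero[OF t r 1] by blast
qed

lemma kos_act_other:
  assumes r: "r \<in> grade R k" and X: "X \<in> obj T" and s: "s \<in> grade R l"
    and z: "\<phi> l s X = zero_arr T X (Sg l X)"
  shows "\<phi> (l + l) (s \<otimes>\<^bsub>R\<^esub> s) (kos (k, r) X) = zero_arr T (kos (k, r) X) (Sg (l + l) (kos (k, r) X))"
proof -
  obtain g h where t: "tri X (Sg k X) (kos (k, r) X) (\<phi> k r X) g h" using kos_tri[OF r X] by blast
  note d = triD[OF t]
  have "\<phi> l s (kos (k, r) X) \<bullet> g = Sa l g \<bullet> zero_arr T (Sg k X) (Sg l (Sg k X))"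
    using act_natural[OF s d(3)] act_Sg_zero[OF s X z, of k] by simp
  then have 1: "\<phi> l s (kos (k, r) X) \<bullet> g = zero_arr T (Sg k X) (Sg l (kos (k, r) X))"
    using cmp_zero_right[OF Sa_hom[OF d(3)] d(6)] by simp
  have "kills l s (kos (k, r) X) (Sg 1 X) h" by (rule kills_if_act_zero[OF s d(4) act_Sg_zero[OF s X z]])
  then show ?thesis using cone_act_square_zero[OF t s 1] by blast
qed

text \<open>If \<open>r\<close> kills \<open>f\<close>, then the suspended \<open>f\<close> extends
  over the cone of \<open>r\<close> on \<open>D\<close>, where it must vanish. So \<open>r\<close>
  acts injectively on morphisms from \<open>D\<close> as soon as nothing maps out of the Koszul
  object in the relevant degree.\<close>

lemma kos_injective:
  assumes r: "r \<in> grade R k" and f: "f \<in> Hom T D Y" and k: "kills k r D Y f"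
    and z: "\<And>v. v \<in> Hom T (kos (k, r) D) (Sg k Y) \<Longrightarrow> v = zero_arr T (kos (k, r) D) (Sg k Y)"
  shows "f = zero_arr T D Y"
proof -
  note o = Hom_objD[OF f]
  obtain g h where t: "tri D (Sg k D) (kos (k, r) D) (\<phi> k r D) g h" using kos_tri[OF r o(1)] by blast
  note d = triD[OF t] and Sf = Sa_hom[OF f, of k]
  have "Sa k f \<bullet> \<phi> k r D = zero_arr T D (Sg k Y)" using act_natural[OF r f] k by (simp add: kills_def)
  then obtain v where v: "v \<in> Hom T (kos (k, r) D) (Sg k Y)" "Sa k f = v \<bullet> g"
    using tri_factor_right[OF t Sf] by blast
  then have "Sa k f = zero_arr T (Sg k D) (Sg k Y)" using z[OF v(1)] cmp_zero_left[OF d(3) Sg_obj[OF o(2)]] by simp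
  then show ?thesis using Sa_eq_zero f by blast
qed

text \<open>All degrees are included, in contrast to \<open>right_perp\<close>.\<close>

definition hom_zero where
  "hom_zero D Y \<longleftrightarrow> (\<forall>n. \<forall>f \<in> Hom T D (Sg n Y). f = zero_arr T D (Sg n Y))"

lemma hom_zeroD: "hom_zero D Y \<Longrightarrow> f \<in> Hom T D (Sg n Y) \<Longrightarrow> f = zero_arr T D (Sg n Y)"
  by (auto simp: hom_zero_def)

lemma hom_zero_iff:
  assumes D: "D \<in> obj T" and Y: "Y \<in> obj T"
  shows "hom_zero D Y \<longleftrightarrow> (\<forall>n. \<forall>f \<in> Hom T (Sg n D) Y. f = zero_arr T (Sg n D) Y)"
proof
  assume z: "hom_zero D Y"
  show "\<forall>n. \<forall>f \<in> Hom T (Sg n D) Y. f = zero_arr T (Sg n D) Y"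
  proof (intro allI ballI)
    fix n f assume f: "f \<in> Hom T (Sg n D) Y"
    then have "f \<in> Hom T (Sg n D) (Sg n (Sg (- n) Y))" using Y by simp
    then obtain f0 where f0: "f0 \<in> Hom T D (Sg (- n) Y)" "f = Sa n f0"
      using Sa_surj[of f n D "Sg (- n) Y"] D Y by blast
    then show "f = zero_arr T (Sg n D) Y"
      using hom_zeroD[OF z f0(1)] Sa_zero[OF D, of "Sg (- n) Y" n] Y by simp
  qed
next
  assume z: "\<forall>n. \<forall>f \<in> Hom T (Sg n D) Y. f = zero_arr T (Sg n D) Y"
  show "hom_zero D Y" unfolding hom_zero_def using Sg_hom_transpose[OF _ Y] z by blast
qed

definition susp_closure where "susp_closure A = (\<lambda>(n, X). Sg n X) ` ((UNIV :: int set) \<times> A)"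

lemma susp_closure:
  assumes A: "A \<subseteq> compacts \<kappa> T"
  shows "A \<subseteq> susp_closure A" "susp_closure A \<subseteq> compacts \<kappa> T" "susp_closed T (susp_closure A)"
proof -
  note c = triangulated_subcategoryD[OF compacts_triangulated[of \<kappa>]]
  show "A \<subseteq> susp_closure A"
  proof
    fix X assume "X \<in> A"
    then show "X \<in> susp_closure A" unfolding susp_closure_def by (intro image_eqI[of _ _ "(0, X)"]) auto
  qed
  show sub: "susp_closure A \<subseteq> compacts \<kappa> T" using c(4) A by (auto simp: susp_closure_def)
  have "Sg m (Sg n X) \<in> susp_closure A" if "X \<in> A" for m n X
    unfolding susp_closure_def using that A c(1) by (intro image_eqI[of _ _ "(m + n, X)"]) auto
  then show "susp_closed T (susp_closure A)"
    using sub c(1) by (auto simp: susp_closed_def susp_closure_def)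
qed

lemma susp_closure_small:
  assumes "size_cardinal \<kappa>" "small \<kappa> A"
  shows "small \<kappa> (susp_closure A)"
  unfolding susp_closure_def using assms by (intro small_image small_Times small_countable) auto

lemma hom_zero_susp_closure:
  assumes A: "A \<subseteq> obj T" and Y: "Y \<in> right_perp T (susp_closure A)" and a: "a \<in> A"
  shows "hom_zero a Y"
proof -
  have "Sg n a \<in> susp_closure A" for n unfolding susp_closure_def using a by auto
  then show ?thesis using hom_zero_iff[of a Y] right_perpD[OF Y] A a by blast
qed

text \<open>A compact object may serve as its own test object: an annihilator of its identity
  annihilates the whole object.\<close>

lemma compact_torsion_annihilated:
  assumes D: "D \<in> compacts \<kappa> T" "D \<in> torsion \<kappa> T R \<phi> V" and q: "q \<in> Spec R - V"
  obtains l t where "(l, t) \<in> compl q" "\<phi> l t D = zero_arr T D (Sg l D)"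
proof -
  have D': "D \<in> obj T" "D \<in> mtorsion \<kappa> (compl q)" using D(2) q unfolding torsion_eq by auto
  obtain l t where t: "(l, t) \<in> compl q" "kills l t D D (ident T D)"
    using mtorsionE[OF D'(2) D(1) ident_hom[OF D'(1)]] by blast
  then have "\<phi> l t D = zero_arr T D (Sg l D)"
    using cmp_ident_right[OF act_hom[OF complD(1)[OF t(1)] D'(1)]] by (simp add: kills_def)
  then show ?thesis using that t by blast
qed

lemma annihilated_mtorsion:
  assumes X: "X \<in> obj T" and t: "(l, t) \<in> M" "t \<in> grade R l" and z: "\<phi> l t X = zero_arr T X (Sg l X)"
  shows "X \<in> mtorsion \<kappa> M"
  using kills_if_act_zero[OF t(2) _ z] t(1) X by (intro mtorsionI) blast+

end

locale noetherian_linear_category = linear_category T R \<phi> + R: noetherian_graded_ring R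
  for T :: "('o, 'm, 'y) triangulated_category_scheme" (structure)
    and R :: "('r, 'z) graded_ring_scheme" and \<phi>
begin

text \<open>
  Among the annihilators of the nonzero homogeneous elements of \<open>Hom(D, Y)\<close> a maximal one is a
  prime. As \<open>x\<close> acts injectively it avoids \<open>x\<close>, so \<open>Y\<close> would be torsion there.
\<close>

lemma hom_zero_if_injective:
  assumes Y: "Y \<in> torsion \<kappa> T R \<phi> (Vset R p)" and D: "D \<in> compacts \<kappa> T"
    and x: "x \<in> grade R k" "x \<in> p"
    and inj: "\<And>n f. f \<in> Hom T D (Sg n Y) \<Longrightarrow> kills k x D (Sg n Y) f \<Longrightarrow> f = zero_arr T D (Sg n Y)"
  shows "hom_zero D Y"
proof (rule ccontr)
  have Yo: "Y \<in> obj T" using Y by (simp add: torsion_def)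
  have Do: "D \<in> obj T" using D compactsD(1) by blast
  define Ann where "Ann n f i = {r \<in> grade R i. kills i r D (Sg n Y) f}" for n f i
  have ideal: "graded_ideal R (Ann n f)" if f: "f \<in> Hom T D (Sg n Y)" for n f
  proof unfold_locales
    show "Ann n f i \<subseteq> grade R i" for i by (auto simp: Ann_def)
    have o: "Sg n Y \<in> obj T" using Yo by simp
    show "\<zero>\<^bsub>R\<^esub> \<in> Ann n f i" for i
      using act_zero[OF o, of i] kills_if_act_zero[OF R.grade_zero f] by (simp add: Ann_def)
    show "r \<oplus>\<^bsub>R\<^esub> s \<in> Ann n f i" if "r \<in> Ann n f i" "s \<in> Ann n f i" for r s i
    proof -
      have rs: "r \<in> grade R i" "s \<in> grade R i" using that by (auto simp: Ann_def)
      have "\<phi> i (r \<oplus>\<^bsub>R\<^esub> s) (Sg n Y) \<bullet> f = zero_arr T D (Sg i (Sg n Y)) \<boxplus> zero_arr T D (Sg i (Sg n Y))"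
        using act_add[OF rs o] cmp_plus_left[OF f act_hom[OF rs(1) o] act_hom[OF rs(2) o]] that
        by (simp add: Ann_def kills_def)
      then show ?thesis using R.grade_add[OF rs] plus_zero(1)[OF zero_hom] Do o
        by (simp add: Ann_def kills_def)
    qed
    show "a \<otimes>\<^bsub>R\<^esub> r \<in> Ann n f (m + i)" if "a \<in> grade R m" "r \<in> Ann n f i" for a r m i
      using that kills_mult_left[OF that(1) _ f] R.grade_mult by (auto simp: Ann_def)
  qed
  \<comment> \<open>All degrees are taken together, because a multiple of \<open>f\<close> has
    another degree than \<open>f\<close>.\<close>
  define \<A> where "\<A> = {graded_ideal.total R (Ann n f) | n f. f \<in> Hom T D (Sg n Y) \<and> f \<noteq> zero_arr T D (Sg n Y)}"
  assume "\<not> hom_zero D Y"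
  then have ne: "\<A> \<noteq> {}" by (auto simp: hom_zero_def \<A>_def)
  have id: "ideal J R" if "J \<in> \<A>" for J
    using that graded_ideal.total_ideal[OF ideal] by (auto simp: \<A>_def)
  obtain M where M: "M \<in> \<A>" "\<And>J. J \<in> \<A> \<Longrightarrow> M \<subseteq> J \<Longrightarrow> J = M"
    using R.maximal_ideal_in_set[OF ne id] by blast
  obtain n f where f: "f \<in> Hom T D (Sg n Y)" "f \<noteq> zero_arr T D (Sg n Y)"
    "M = graded_ideal.total R (Ann n f)" using M(1) by (auto simp: \<A>_def)
  interpret I: graded_ideal R "Ann n f" by (rule ideal[OF f(1)])
  have So: "Sg n Y \<in> obj T" using Yo by simp
  have q: "M \<in> Spec R"
    unfolding f(3)
  proof (rule I.total_prime)
    show "\<one>\<^bsub>R\<^esub> \<notin> Ann n f 0"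
      using f act_one[OF So] cmp_ident_left[OF f(1)] by (simp add: Ann_def kills_def)
    fix a b i j assume a: "a \<in> grade R i" and b: "b \<in> grade R j" and ab: "a \<otimes>\<^bsub>R\<^esub> b \<in> Ann n f (i + j)"
    show "a \<in> Ann n f i \<or> b \<in> Ann n f j"
    proof (rule disjCI)
      assume nb: "b \<notin> Ann n f j"
      \<comment> \<open>\<open>?g\<close> is nonzero and its annihilator contains that of
        \<open>f\<close>, so the two are equal by maximality. As \<open>a\<close> annihilates
        \<open>?g\<close>, it annihilates \<open>f\<close>.\<close>
      let ?g = "\<phi> j b (Sg n Y) \<bullet> f"
      have S: "Sg j (Sg n Y) = Sg (j + n) Y" using Yo by simp
      have g: "?g \<in> Hom T D (Sg (j + n) Y)" using cmp_hom[OF f(1) act_hom[OF b So]] S by simp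
      have g0: "?g \<noteq> zero_arr T D (Sg (j + n) Y)" using nb b S by (simp add: Ann_def kills_def)
      interpret J: graded_ideal R "Ann (j + n) ?g" by (rule ideal[OF g])
      have iff: "c \<in> Ann (j + n) ?g i \<longleftrightarrow> c \<in> grade R i \<and> kills (i + j) (c \<otimes>\<^bsub>R\<^esub> b) D (Sg n Y) f" for c i
        using kills_mult_iff[OF _ b f(1)] S by (auto simp: Ann_def)
      have "Ann n f i \<subseteq> Ann (j + n) ?g i" for i
        using iff kills_mult_right[OF _ b f(1)] by (auto simp: Ann_def)
      then have "I.total \<subseteq> J.total" by (auto simp: I.total_def J.total_def)
      moreover have "J.total \<in> \<A>" using g g0 by (auto simp: \<A>_def)
      ultimately have "J.total = I.total" using M(2) f(3) by blast
      moreover have "a \<in> J.total" unfolding J.total_grade[OF a] iff using a ab by (simp add: Ann_def)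
      ultimately show "a \<in> Ann n f i" using I.total_grade[OF a] by simp
    qed
  qed
  have "x \<notin> M"
    using inj[OF f(1)] f(2,3) I.total_grade[OF x(1)] by (auto simp: Ann_def)
  then have "M \<in> Spec R - Vset R p" using q x by (auto simp: Vset_def)
  then have m: "Y \<in> mtorsion \<kappa> (compl M)" using Y unfolding torsion_eq by blast
  have "Sg n Y \<in> mtorsion \<kappa> (compl M)"
    using triangulated_subcategoryD(4)[OF localizingD(1)[OF mtorsion_localizing[OF compl_mult_set[OF q]]] m] .
  from mtorsionE[OF this D f(1)]
  obtain l t where t: "(l, t) \<in> compl M" "kills l t D (Sg n Y) f" by blast
  then have "t \<in> M" using I.total_grade[of t l] f(3) complD(1)[OF t(1)] by (simp add: Ann_def)
  then show False using complD(2)[OF t(1)] by blast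
qed

lemma kos_hom_zero:
  assumes Y: "Y \<in> torsion \<kappa> T R \<phi> (Vset R p)" and D: "D \<in> compacts \<kappa> T"
    and x: "x \<in> grade R k" "x \<in> p" and z: "hom_zero (kos (k, x) D) Y"
  shows "hom_zero D Y"
proof (rule hom_zero_if_injective[OF Y D x])
  fix n f assume f: "f \<in> Hom T D (Sg n Y)" and k: "kills k x D (Sg n Y) f"
  have Yo: "Y \<in> obj T" using Y by (simp add: torsion_def)
  show "f = zero_arr T D (Sg n Y)"
    by (rule kos_injective[OF x(1) f k]) (use hom_zeroD[OF z, of _ "k + n"] Yo in simp)
qed

end

section \<open>Compact generators of the torsion subcategories\<close>

locale generated_linear_category = noetherian_linear_category T R \<phi>
  for T :: "('o, 'm, 'y) triangulated_category_scheme" (structure)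
    and R :: "('r, 'z) graded_ring_scheme" and \<phi> +
  fixes \<kappa> :: "'k rel"
  assumes size: "size_cardinal \<kappa>" and small_ring: "small \<kappa> (carrier R)"
    and hom_small: "locally_small \<kappa> T" and coproducts: "has_coproducts \<kappa> T"
    and generated: "compactly_generated \<kappa> T"
begin

text \<open>An object orthogonal to all suspensions of \<open>G\<close> is orthogonal to what they
  generate, hence to itself.\<close>

lemma generators:
  obtains G where "G \<subseteq> compacts \<kappa> T" "small \<kappa> G"
    "\<And>Y. Y \<in> obj T \<Longrightarrow> (\<And>C. C \<in> G \<Longrightarrow> hom_zero C Y) \<Longrightarrow> zero_obj T Y"
proof -
  obtain G where G: "G \<subseteq> compacts \<kappa> T" "small \<kappa> G" "Loc \<kappa> T G = obj T"
    using generated by (auto simp: compactly_generated_def)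
  have "zero_obj T Y" if Y: "Y \<in> obj T" and z: "\<And>C. C \<in> G \<Longrightarrow> hom_zero C Y" for Y
  proof -
    let ?K = "susp_closure G"
    note K = susp_closure[OF G(1)]
    have Go: "G \<subseteq> obj T" using G(1) compactsD(1) by blast
    have "Y \<in> right_perp T ?K"
    proof (rule right_perpI[OF Y])
      fix X f assume "X \<in> ?K" "f \<in> Hom T X Y"
      then show "f = zero_arr T X Y"
        using z hom_zero_iff[OF _ Y] Go by (auto simp: susp_closure_def)
    qed
    then have "Y \<in> right_perp T (Loc \<kappa> T ?K)" using right_perp_Loc[OF K(3)] by blast
    moreover have "Loc \<kappa> T ?K = obj T"
    proof
      have Ko: "?K \<subseteq> obj T" using K(3) by (simp add: susp_closed_def)
      show "Loc \<kappa> T ?K \<subseteq> obj T" by (rule localizingD(2)[OF Loc_localizing[OF Ko]])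
      show "obj T \<subseteq> Loc \<kappa> T ?K"
        using Loc_least[OF Loc_localizing[OF Ko, of \<kappa>], of G] K(1) Loc_subset[of ?K] G(3) by blast
    qed
    ultimately show ?thesis using in_perp_zero Y by simp
  qed
  then show ?thesis using that G by blast
qed

lemma reflection_Loc_exists:
  assumes "susp_closed T K" "K \<subseteq> compacts \<kappa> T" "small \<kappa> K" "X \<in> obj T"
  shows "\<exists>Y g. reflection (Loc \<kappa> T K) X Y g"
  by (rule compact_approximation[OF size coproducts hom_small assms])

text \<open>In the Bousfield triangle of an object of \<open>S\<close> the reflection lies in
  \<open>S\<close> and is orthogonal to \<open>K\<close>; by assumption it is zero, so the object
  lies in \<open>Loc \<kappa> T K\<close>.\<close>

lemma Loc_eq_if_no_perp:
  assumes S: "localizing \<kappa> T S" and K: "susp_closed T K" "K \<subseteq> compacts \<kappa> T" "small \<kappa> K" "K \<subseteq> S"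
    and z: "\<And>Y. Y \<in> S \<Longrightarrow> Y \<in> right_perp T K \<Longrightarrow> zero_obj T Y"
  shows "Loc \<kappa> T K = S"
proof
  have Ko: "K \<subseteq> obj T" using K(1) by (simp add: susp_closed_def)
  show LS: "Loc \<kappa> T K \<subseteq> S" using Loc_least[OF S K(4)] .
  show "S \<subseteq> Loc \<kappa> T K"
  proof
    fix X assume X: "X \<in> S"
    then have "X \<in> obj T" using localizingD(2)[OF S] by blast
    then obtain Y g where r: "reflection (Loc \<kappa> T K) X Y g" using reflection_Loc_exists[OF K(1-3)] by blast
    obtain U f h where t: "tri U X Y f g h" "U \<in> Loc \<kappa> T K" "Y \<in> right_perp T (Loc \<kappa> T K)"
      using reflectionE[OF r] by blast
    have "Y \<in> S" using triangulated_subcategoryD(5)[OF localizingD(1)[OF S] t(1)] t(2) LS X by blast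
    moreover have "Y \<in> right_perp T K" using t(3) right_perp_Loc[OF K(1)] by blast
    ultimately have "zero_obj T Y" by (rule z)
    then show "X \<in> Loc \<kappa> T K"
      using reflection_zero_iff[OF localizingD(1)[OF Loc_localizing[OF Ko]] r] by blast
  qed
qed

text \<open>The generators are the cones of elements outside \<open>p\<close> on the compact
  generators of \<open>T\<close>; they form a small set because \<open>carrier R\<close> is small. A
  morphism into a torsion object is killed by some such element, so \<open>kos_injective\<close>
  makes it zero if the object is orthogonal to the cones.\<close>

lemma torsion_Zset_generated:
  assumes p: "p \<in> Spec R"
  obtains K where "susp_closed T K" "K \<subseteq> compacts \<kappa> T" "small \<kappa> K" "Loc \<kappa> T K = torsion \<kappa> T R \<phi> (Zset R p)"
    "\<And>k s C. (k, s) \<in> compl p \<Longrightarrow> C \<in> obj T \<Longrightarrow> kos (k, s) C \<in> torsion \<kappa> T R \<phi> (Zset R p)"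
proof -
  let ?S = "torsion \<kappa> T R \<phi> (Zset R p)"
  obtain G where G: "G \<subseteq> compacts \<kappa> T" "small \<kappa> G"
    "\<And>Y. Y \<in> obj T \<Longrightarrow> (\<And>C. C \<in> G \<Longrightarrow> hom_zero C Y) \<Longrightarrow> zero_obj T Y" using generators by blast
  have Go: "G \<subseteq> obj T" using G(1) compactsD(1) by blast
  have loc: "localizing \<kappa> T ?S" by (rule torsion_localizing)
  have kS: "kos (k, s) C \<in> ?S" if s: "(k, s) \<in> compl p" and C: "C \<in> obj T" for k s C
  proof -
    note sg = complD(1)[OF s]
    show ?thesis
      unfolding torsion_Zset[OF p]
      by (rule annihilated_mtorsion[OF kos_obj[OF sg C] compl_mult[OF p s s] R.grade_mult[OF sg sg]
            kos_act_self[OF sg C]])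
  qed
  let ?A = "(\<lambda>(C, x). kos x C) ` (G \<times> compl p)"
  have A: "?A \<subseteq> compacts \<kappa> T" using G(1) by (auto intro!: kos_compact dest: complD(1))
  have Ao: "?A \<subseteq> obj T" using A compactsD(1) by blast
  have "small \<kappa> ((UNIV :: int set) \<times> carrier R)"
    by (intro small_Times size small_countable small_ring)
  then have "small \<kappa> (compl p)"
    by (rule small_subset) (use complD(1)[THEN R.grade_closed] in auto)
  then have As: "small \<kappa> ?A" using size G(2) by (intro small_image small_Times) auto
  let ?K = "susp_closure ?A"
  note K = susp_closure[OF A] and Ks = susp_closure_small[OF size As]
  have "?A \<subseteq> ?S" using kS Go by auto
  then have KS: "?K \<subseteq> ?S"
    using triangulated_subcategoryD(4)[OF localizingD(1)[OF loc]] by (auto simp: susp_closure_def)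
  have "Loc \<kappa> T ?K = ?S"
  proof (rule Loc_eq_if_no_perp[OF loc K(3,2) Ks KS])
    fix Y assume Y: "Y \<in> ?S" and perp: "Y \<in> right_perp T ?K"
    have Yo: "Y \<in> obj T" using perp right_perpD by blast
    show "zero_obj T Y"
    proof (rule G(3)[OF Yo])
      fix C assume C: "C \<in> G"
      show "hom_zero C Y"
        unfolding hom_zero_def
      proof (intro allI ballI)
        fix n f assume f: "f \<in> Hom T C (Sg n Y)"
        have "Sg n Y \<in> ?S" using triangulated_subcategoryD(4)[OF localizingD(1)[OF loc] Y] .
        then have "Sg n Y \<in> mtorsion \<kappa> (compl p)" using torsion_Zset[OF p] by blast
        from mtorsionE[OF this _ f] obtain k s where s: "(k, s) \<in> compl p" "kills k s C (Sg n Y) f"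
          using C G(1) by blast
        have "kos (k, s) C \<in> ?A" using C s(1) by (intro image_eqI[of _ _ "(C, (k, s))"]) auto
        then have hz: "hom_zero (kos (k, s) C) Y" using hom_zero_susp_closure[OF Ao perp] by blast
        show "f = zero_arr T C (Sg n Y)"
          by (rule kos_injective[OF complD(1)[OF s(1)] f s(2)])
             (use hom_zeroD[OF hz, of _ "k + n"] Yo in simp)
      qed
    qed
  qed
  then show ?thesis using that[OF K(3,2) Ks] kS by blast
qed

text \<open>The generators are iterated cones along a list of homogeneous elements of
  \<open>p\<close> as in \<open>Spec_generators\<close>. A prime not containing \<open>p\<close>
  misses an element of the list, and a power of that element annihilates the iterated cone.\<close>

lemma torsion_Vset_generated:
  assumes p: "p \<in> Spec R"
  obtains K where "susp_closed T K" "K \<subseteq> compacts \<kappa> T" "small \<kappa> K" "Loc \<kappa> T K = torsion \<kappa> T R \<phi> (Vset R p)"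
proof -
  let ?S = "torsion \<kappa> T R \<phi> (Vset R p)"
  obtain G where G: "G \<subseteq> compacts \<kappa> T" "small \<kappa> G"
    "\<And>Y. Y \<in> obj T \<Longrightarrow> (\<And>C. C \<in> G \<Longrightarrow> hom_zero C Y) \<Longrightarrow> zero_obj T Y" using generators by blast
  have Go: "G \<subseteq> obj T" using G(1) compactsD(1) by blast
  have loc: "localizing \<kappa> T ?S" by (rule torsion_localizing)
  obtain xs where xs: "\<And>k x. (k, x) \<in> set xs \<Longrightarrow> x \<in> grade R k \<and> x \<in> p"
    "\<And>q. ideal q R \<Longrightarrow> \<not> p \<subseteq> q \<Longrightarrow> \<exists>(k, x) \<in> set xs. x \<notin> q" using R.Spec_generators[OF p] by blast
  have compact: "foldr kos ys C \<in> compacts \<kappa> T" if "set ys \<subseteq> set xs" "C \<in> compacts \<kappa> T" for ys C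
    using that(1)
  proof (induction ys)
    case (Cons y ys)
    obtain k x where y: "y = (k, x)" by (cases y)
    then show ?case using Cons xs(1)[of k x] by (simp add: kos_compact)
  qed (simp add: that)
  \<comment> \<open>Each further cone replaces the annihilator by its square, which still lies
    outside \<open>q\<close>.\<close>
  have ann: "\<exists>(l, t) \<in> compl q. \<phi> l t (foldr kos ys C) = zero_arr T (foldr kos ys C) (Sg l (foldr kos ys C))"
    if q: "q \<in> Spec R" and C: "C \<in> compacts \<kappa> T" and ys: "set ys \<subseteq> set xs" and x: "(k, x) \<in> set ys" "x \<notin> q"
    for q C ys k x
    using ys x(1)
  proof (induction ys)
    case (Cons y ys)
    obtain l z where y: "y = (l, z)" by (cases y)
    have z: "z \<in> grade R l" using xs(1)[of l z] Cons(2) y by auto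
    have o: "foldr kos ys C \<in> obj T" using compact[of ys C] Cons(2) C compactsD(1) by auto
    show ?case
    proof (cases "(k, x) = y")
      case True
      then have "(l, z) \<in> compl q" using z x(2) y complI by simp
      then have "(l + l, z \<otimes>\<^bsub>R\<^esub> z) \<in> compl q" using compl_mult[OF q] by blast
      then show ?thesis using kos_act_self[OF z o] y by auto
    next
      case False
      then obtain m t where t: "(m, t) \<in> compl q"
        "\<phi> m t (foldr kos ys C) = zero_arr T (foldr kos ys C) (Sg m (foldr kos ys C))"
        using Cons by auto
      have "(m + m, t \<otimes>\<^bsub>R\<^esub> t) \<in> compl q" using compl_mult[OF q t(1) t(1)] .
      then show ?thesis using kos_act_other[OF z o complD(1)[OF t(1)] t(2)] y by auto
    qed
  qed simp
  let ?A = "foldr kos xs ` G"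
  have A: "?A \<subseteq> compacts \<kappa> T" using G(1) compact by auto
  have Ao: "?A \<subseteq> obj T" using A compactsD(1) by blast
  have As: "small \<kappa> ?A" using G(2) by (rule small_image)
  let ?K = "susp_closure ?A"
  note K = susp_closure[OF A] and Ks = susp_closure_small[OF size As]
  have "?A \<subseteq> ?S"
  proof
    fix E assume "E \<in> ?A"
    then obtain C where C: "C \<in> G" "E = foldr kos xs C" by blast
    have "E \<in> mtorsion \<kappa> (compl q)" if q: "q \<in> Spec R - Vset R p" for q
    proof -
      have "\<not> p \<subseteq> q" "q \<in> Spec R" using q by (auto simp: Vset_def)
      then obtain k x where x: "(k, x) \<in> set xs" "x \<notin> q" using xs(2) R.SpecD(1) by blast
      obtain l t where "(l, t) \<in> compl q" "\<phi> l t E = zero_arr T E (Sg l E)"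
        using ann[OF \<open>q \<in> Spec R\<close> _ order_refl x, of C] C G(1) by blast
      then show ?thesis using annihilated_mtorsion[of E l t] complD(1) C(2) Ao C(1) by blast
    qed
    then show "E \<in> ?S" unfolding torsion_eq using Ao \<open>E \<in> ?A\<close> by blast
  qed
  then have KS: "?K \<subseteq> ?S"
    using triangulated_subcategoryD(4)[OF localizingD(1)[OF loc]] by (auto simp: susp_closure_def)
  have "Loc \<kappa> T ?K = ?S"
  proof (rule Loc_eq_if_no_perp[OF loc K(3,2) Ks KS])
    fix Y assume Y: "Y \<in> ?S" and perp: "Y \<in> right_perp T ?K"
    have Yo: "Y \<in> obj T" using perp right_perpD by blast
    show "zero_obj T Y"
    proof (rule G(3)[OF Yo])
      fix C assume C: "C \<in> G"
      \<comment> \<open>Vanishing passes back from the iterated cone to \<open>C\<close>, one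
        element at a time, by \<open>kos_hom_zero\<close>.\<close>
      have "hom_zero C Y" if "set ys \<subseteq> set xs" "hom_zero (foldr kos ys C) Y" for ys
        using that
      proof (induction ys)
        case (Cons y ys)
        obtain k x where y: "y = (k, x)" by (cases y)
        have x: "x \<in> grade R k" "x \<in> p" using xs(1)[of k x] Cons(2) y by auto
        have c: "foldr kos ys C \<in> compacts \<kappa> T" using compact[of ys C] Cons(2) C G(1) by auto
        have "hom_zero (foldr kos ys C) Y" using kos_hom_zero[OF Y c x] Cons(3) y by simp
        then show ?case using Cons by simp
      qed simp
      moreover have "hom_zero (foldr kos xs C) Y" using hom_zero_susp_closure[OF Ao perp] C by blast
      ultimately show "hom_zero C Y" by blast
    qed
  qed
  then show ?thesis using that[OF K(3,2) Ks] by blast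
qed

text \<open>Precisely the existence that the choice in \<open>torsion_localization\<close> relies
  on.\<close>

definition localizable where
  "localizable V \<longleftrightarrow> (\<exists>Lo La \<eta>. localization_functor T Lo La \<eta> \<and> Ker T Lo = torsion \<kappa> T R \<phi> V)"

lemma localizableI:
  assumes "susp_closed T K" "K \<subseteq> compacts \<kappa> T" "small \<kappa> K" "Loc \<kappa> T K = torsion \<kappa> T R \<phi> V"
  shows "localizable V"
  unfolding localizable_def
proof (rule localization_functor_exists)
  show "triangulated_subcategory T (torsion \<kappa> T R \<phi> V)" using localizingD(1)[OF torsion_localizing] .
  show "\<exists>Y g. reflection (torsion \<kappa> T R \<phi> V) X Y g" if "X \<in> obj T" for X
    using reflection_Loc_exists[OF assms(1-3) that] assms(4) by simp
qed

lemma localizable_Zset: "p \<in> Spec R \<Longrightarrow> localizable (Zset R p)"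
  using torsion_Zset_generated localizableI by metis

lemma localizable_Vset: "p \<in> Spec R \<Longrightarrow> localizable (Vset R p)"
  using torsion_Vset_generated localizableI by metis

lemma L_localization:
  assumes "localizable V"
  obtains La where "bousfield_localization T (L_obj \<kappa> T R \<phi> V) La (L_unit \<kappa> T R \<phi> V)"
    "Ker T (L_obj \<kappa> T R \<phi> V) = torsion \<kappa> T R \<phi> V"
proof -
  let ?P = "\<lambda>(Lo, La, \<eta>). localization_functor T Lo La \<eta> \<and> Ker T Lo = torsion \<kappa> T R \<phi> V"
  obtain Lo La \<eta> where "?P (Lo, La, \<eta>)" using assms by (auto simp: localizable_def)
  then have P: "?P (torsion_localization \<kappa> T R \<phi> V)" unfolding torsion_localization_def by (rule someI)
  obtain Lo La \<eta> where e: "torsion_localization \<kappa> T R \<phi> V = (Lo, La, \<eta>)" by (cases "torsion_localization \<kappa> T R \<phi> V")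
  have "L_obj \<kappa> T R \<phi> V = Lo" "L_unit \<kappa> T R \<phi> V = \<eta>" using e by (auto simp: L_obj_def L_unit_def)
  moreover have "localization_functor T Lo La \<eta>" "Ker T Lo = torsion \<kappa> T R \<phi> V" using P e by auto
  ultimately show ?thesis
    using that triangulated_category_axioms
    by (auto simp: bousfield_localization_def bousfield_localization_axioms_def)
qed

lemma L_reflection:
  assumes V: "localizable V" and X: "X \<in> obj T"
  shows "reflection (torsion \<kappa> T R \<phi> V) X (L_obj \<kappa> T R \<phi> V X) (L_unit \<kappa> T R \<phi> V X)"
proof -
  obtain La where "bousfield_localization T (L_obj \<kappa> T R \<phi> V) La (L_unit \<kappa> T R \<phi> V)"
    "Ker T (L_obj \<kappa> T R \<phi> V) = torsion \<kappa> T R \<phi> V" using L_localization[OF V] by blast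
  then show ?thesis using bousfield_localization.unit_reflection[of T] X by metis
qed

text \<open>Whichever fibre of the unit \<open>Gamma_obj\<close> selects, the localization functor
  sends it to zero.\<close>

lemma Gamma_tri:
  assumes V: "localizable V" and X: "X \<in> obj T"
  obtains f h where "tri (Gamma_obj \<kappa> T R \<phi> V X) X (L_obj \<kappa> T R \<phi> V X) f (L_unit \<kappa> T R \<phi> V X) h"
    "Gamma_obj \<kappa> T R \<phi> V X \<in> torsion \<kappa> T R \<phi> V"
proof -
  let ?\<eta> = "L_unit \<kappa> T R \<phi> V X"
  obtain La where L: "bousfield_localization T (L_obj \<kappa> T R \<phi> V) La (L_unit \<kappa> T R \<phi> V)"
    "Ker T (L_obj \<kappa> T R \<phi> V) = torsion \<kappa> T R \<phi> V" using L_localization[OF V] by blast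
  note \<eta> = reflection_hom(1)[OF L_reflection[OF V X]]
  obtain U f h where "tri U X (L_obj \<kappa> T R \<phi> V X) f ?\<eta> h" using reflectionE[OF L_reflection[OF V X]] by metis
  from triD(1,2)[OF this] have "(f, ?\<eta>, h) \<in> exact_triangles T \<and> Dom T f = U" by (simp add: HomD)
  then have "\<exists>U f h. (f, ?\<eta>, h) \<in> exact_triangles T \<and> Dom T f = U" by blast
  from someI_ex[OF this]
  obtain f h where fh: "(f, ?\<eta>, h) \<in> exact_triangles T" "Dom T f = Gamma_obj \<kappa> T R \<phi> V X"
    unfolding Gamma_obj_def by blast
  note t = exact_tri[OF fh(1)]
  have t': "tri (Gamma_obj \<kappa> T R \<phi> V X) X (L_obj \<kappa> T R \<phi> V X) f ?\<eta> h"
    using t fh(2) triD(3)[OF t] \<eta> by (auto simp: Hom_def)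
  then show ?thesis using that bousfield_localization.unit_fibre_Ker[OF L(1) X t'] L(2) by blast
qed

end

section \<open>Nakayama's lemma for graded homomorphisms\<close>

context linear_category
begin

lemma act_cmp_hom:
  assumes "r \<in> grade R k" "h \<in> Hom T D (Sg n E)" "E \<in> obj T"
  shows "\<phi> k r (Sg n E) \<bullet> h \<in> Hom T D (Sg (k + n) E)"
  using cmp_hom[OF assms(2) act_hom[OF assms(1)]] assms(3) by simp

text \<open>
  The action of a product agrees with the iterated action only up to sign, because of the
  suspension in \<open>act_Sg\<close>. The sign is absorbed into the ring element.
\<close>

lemma act_act:
  assumes r: "r \<in> grade R k" and s: "s \<in> grade R l" and h: "h \<in> Hom T D (Sg n E)" and E: "E \<in> obj T"
  obtains u where "u \<in> grade R (k + l)" "u = r \<otimes>\<^bsub>R\<^esub> s \<or> u = \<ominus>\<^bsub>R\<^esub> (r \<otimes>\<^bsub>R\<^esub> s)"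
    "\<phi> k r (Sg (l + n) E) \<bullet> (\<phi> l s (Sg n E) \<bullet> h) = \<phi> (k + l) u (Sg n E) \<bullet> h"
proof -
  have o: "Sg n E \<in> obj T" using E by simp
  have rs: "r \<otimes>\<^bsub>R\<^esub> s \<in> grade R (k + l)" by (rule R.grade_mult[OF r s])
  note S = Sa_hom[OF act_hom[OF r o], of l] and a = act_hom[OF s o]
  have e: "\<phi> (k + l) (r \<otimes>\<^bsub>R\<^esub> s) (Sg n E) \<bullet> h = Sa l (\<phi> k r (Sg n E)) \<bullet> (\<phi> l s (Sg n E) \<bullet> h)"
    using act_mult[OF r s o] cmp_assoc[OF h a S] by simp
  have SS: "Sg l (Sg n E) = Sg (l + n) E" using E by simp
  show ?thesis
    using act_Sg[OF r o, of l]
  proof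
    assume "\<phi> k r (Sg l (Sg n E)) = Sa l (\<phi> k r (Sg n E))"
    then show ?thesis using that[OF rs] e SS by simp
  next
    assume n: "\<phi> k r (Sg l (Sg n E)) = neg_arr T (Sa l (\<phi> k r (Sg n E)))"
    have "\<phi> (k + l) (\<ominus>\<^bsub>R\<^esub> (r \<otimes>\<^bsub>R\<^esub> s)) (Sg n E) \<bullet> h = neg_arr T (\<phi> (k + l) (r \<otimes>\<^bsub>R\<^esub> s) (Sg n E) \<bullet> h)"
      using act_neg[OF rs o] cmp_neg_left[OF h act_hom[OF rs o]] by simp
    also have "\<dots> = \<phi> k r (Sg (l + n) E) \<bullet> (\<phi> l s (Sg n E) \<bullet> h)"
      using e n SS cmp_neg_left[OF cmp_hom[OF h a] S] by simp
    finally show ?thesis using that[OF R.grade_neg[OF rs]] by simp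
  qed
qed

lemma act_neg_cmp:
  assumes r: "r \<in> grade R k" and h: "h \<in> Hom T D (Sg n E)" and E: "E \<in> obj T"
  shows "\<phi> k (\<ominus>\<^bsub>R\<^esub> r) (Sg n E) \<bullet> h = neg_arr T (\<phi> k r (Sg n E) \<bullet> h)"
  using act_neg[OF r] cmp_neg_left[OF h act_hom[OF r]] E by simp

lemma act_commute:
  assumes r: "r \<in> grade R k" and s: "s \<in> grade R l" and h: "h \<in> Hom T D (Sg n E)" and E: "E \<in> obj T"
  shows "\<phi> k r (Sg (l + n) E) \<bullet> (\<phi> l s (Sg n E) \<bullet> h) = \<phi> l s (Sg (k + n) E) \<bullet> (\<phi> k r (Sg n E) \<bullet> h) \<or>
    \<phi> k r (Sg (l + n) E) \<bullet> (\<phi> l s (Sg n E) \<bullet> h) = neg_arr T (\<phi> l s (Sg (k + n) E) \<bullet> (\<phi> k r (Sg n E) \<bullet> h))"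
proof -
  obtain u where u: "u \<in> grade R (k + l)" "u = r \<otimes>\<^bsub>R\<^esub> s \<or> u = \<ominus>\<^bsub>R\<^esub> (r \<otimes>\<^bsub>R\<^esub> s)"
    "\<phi> k r (Sg (l + n) E) \<bullet> (\<phi> l s (Sg n E) \<bullet> h) = \<phi> (k + l) u (Sg n E) \<bullet> h" using act_act[OF r s h E] .
  obtain w where w: "w \<in> grade R (l + k)" "w = s \<otimes>\<^bsub>R\<^esub> r \<or> w = \<ominus>\<^bsub>R\<^esub> (s \<otimes>\<^bsub>R\<^esub> r)"
    "\<phi> l s (Sg (k + n) E) \<bullet> (\<phi> k r (Sg n E) \<bullet> h) = \<phi> (l + k) w (Sg n E) \<bullet> h" using act_act[OF s r h E] .
  have sr: "s \<otimes>\<^bsub>R\<^esub> r \<in> carrier R" using r s by auto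
  have "u = w \<or> u = \<ominus>\<^bsub>R\<^esub> w"
    using u(2) w(2) R.grade_commute[OF r s] R.minus_minus[OF sr] by metis
  then show ?thesis
    using u(3) w(3) act_neg_cmp[OF w(1) h E] by (auto simp: add.commute)
qed

text \<open>The action is by \<open>\<phi>\<close> at \<open>Sg n E\<close>, not by
  \<open>gact\<close> of \<open>hom_star\<close>. The two differ by a sign at most, so they have the
  same submodules.\<close>

definition submodule where
  "submodule D E K \<longleftrightarrow> (\<forall>n. K n \<subseteq> Hom T D (Sg n E) \<and> zero_arr T D (Sg n E) \<in> K n \<and>
     (\<forall>x \<in> K n. \<forall>y \<in> K n. x \<boxplus> y \<in> K n) \<and>
     (\<forall>k r. r \<in> grade R k \<longrightarrow> (\<forall>x \<in> K n. \<phi> k r (Sg n E) \<bullet> x \<in> K (k + n))))"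

text \<open>The elements that lie in \<open>K\<close> after localization at \<open>q\<close>. This
  replaces forming the localized module.\<close>

definition saturation where
  "saturation q D E K n = {h \<in> Hom T D (Sg n E). \<exists>(l, t) \<in> compl q. \<phi> l t (Sg n E) \<bullet> h \<in> K (l + n)}"

text \<open>\<open>B\<close> generates the localization of \<open>Hom(D, E)\<close> at \<open>q\<close>.\<close>

definition generates where
  "generates q D E B \<longleftrightarrow> (\<forall>K. submodule D E K \<and> (\<forall>n. saturation q D E K n \<subseteq> K n) \<and>
     (\<forall>(n, h) \<in> B. h \<in> K n) \<longrightarrow> (\<forall>n. Hom T D (Sg n E) \<subseteq> K n))"

lemma submoduleD:
  assumes "submodule D E K"
  shows "x \<in> K n \<Longrightarrow> x \<in> Hom T D (Sg n E)" "zero_arr T D (Sg n E) \<in> K n"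
    "x \<in> K n \<Longrightarrow> y \<in> K n \<Longrightarrow> x \<boxplus> y \<in> K n"
    "r \<in> grade R k \<Longrightarrow> x \<in> K n \<Longrightarrow> \<phi> k r (Sg n E) \<bullet> x \<in> K (k + n)"
  using assms unfolding submodule_def by blast+

lemma submodule_neg:
  assumes K: "submodule D E K" and x: "x \<in> K n" and E: "E \<in> obj T"
  shows "neg_arr T x \<in> K n"
proof -
  note h = submoduleD(1)[OF K x]
  have "\<phi> 0 (\<ominus>\<^bsub>R\<^esub> \<one>\<^bsub>R\<^esub>) (Sg n E) \<bullet> x \<in> K (0 + n)" by (rule submoduleD(4)[OF K R.grade_neg[OF R.grade_one] x])
  then show ?thesis using act_neg_cmp[OF R.grade_one h E] act_one[of "Sg n E"] cmp_ident_left[OF h] E by simp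
qed

lemma compl_neg:
  assumes q: "q \<in> Spec R" and t: "(l, t) \<in> compl q"
  shows "(l, \<ominus>\<^bsub>R\<^esub> t) \<in> compl q"
proof -
  note h = complD[OF t] and i = ideal.axioms(1)[OF R.SpecD(1)[OF q]]
  have "\<ominus>\<^bsub>R\<^esub> t \<notin> q"
    using additive_subgroup.a_inv_closed[OF i, of "\<ominus>\<^bsub>R\<^esub> t"] h R.minus_minus[of t] by auto
  then show ?thesis using R.grade_neg[OF h(1)] by (simp add: compl_def)
qed

lemma act_act_compl:
  assumes q: "q \<in> Spec R" and s: "(k, s) \<in> compl q" and t: "(l, t) \<in> compl q"
    and h: "h \<in> Hom T D (Sg n E)" and E: "E \<in> obj T"
  obtains u where "(k + l, u) \<in> compl q"
    "\<phi> k s (Sg (l + n) E) \<bullet> (\<phi> l t (Sg n E) \<bullet> h) = \<phi> (k + l) u (Sg n E) \<bullet> h"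
proof -
  obtain u where u: "u = s \<otimes>\<^bsub>R\<^esub> t \<or> u = \<ominus>\<^bsub>R\<^esub> (s \<otimes>\<^bsub>R\<^esub> t)"
    "\<phi> k s (Sg (l + n) E) \<bullet> (\<phi> l t (Sg n E) \<bullet> h) = \<phi> (k + l) u (Sg n E) \<bullet> h"
    using act_act[OF complD(1)[OF s] complD(1)[OF t] h E] by metis
  have "(k + l, u) \<in> compl q" using u(1) compl_mult[OF q s t] compl_neg[OF q] by blast
  then show ?thesis using that u(2) by blast
qed

text \<open>Applying both denominators to a sum gives a common one. Actions commute only up to sign,
  which is harmless as \<open>K\<close> is closed under negatives.\<close>

lemma saturation_submodule:
  assumes q: "q \<in> Spec R" and K: "submodule D E K" and D: "D \<in> obj T" and E: "E \<in> obj T"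
  shows "submodule D E (saturation q D E K)" "saturation q D E (saturation q D E K) n \<subseteq> saturation q D E K n"
    "K n \<subseteq> saturation q D E K n"
proof -
  let ?S = "saturation q D E K"
  have one: "(0, \<one>\<^bsub>R\<^esub>) \<in> compl q" using R.grade_one R.SpecD(3)[OF q] by (simp add: compl_def)
  note KD = submoduleD[OF K]
  have inc: "K n \<subseteq> ?S n" for n
  proof
    fix h assume h: "h \<in> K n"
    then have "\<phi> 0 \<one>\<^bsub>R\<^esub> (Sg n E) \<bullet> h \<in> K (0 + n)" using KD(4)[OF R.grade_one] by blast
    then show "h \<in> ?S n" using KD(1)[OF h] one unfolding saturation_def by blast
  qed
  then show "K n \<subseteq> ?S n" .
  have SI: "h \<in> ?S n" if "h \<in> Hom T D (Sg n E)" "(l, t) \<in> compl q" "\<phi> l t (Sg n E) \<bullet> h \<in> K (l + n)" for h n l t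
    using that unfolding saturation_def by blast
  have SE: "h \<in> Hom T D (Sg n E) \<and> (\<exists>l t. (l, t) \<in> compl q \<and> \<phi> l t (Sg n E) \<bullet> h \<in> K (l + n))"
    if "h \<in> ?S n" for h n using that unfolding saturation_def by blast
  have comm: "\<phi> k r (Sg (l + n) E) \<bullet> (\<phi> l s (Sg n E) \<bullet> h) \<in> K m"
    if "r \<in> grade R k" "s \<in> grade R l" "h \<in> Hom T D (Sg n E)"
      "\<phi> l s (Sg (k + n) E) \<bullet> (\<phi> k r (Sg n E) \<bullet> h) \<in> K m" for k r l s n h m
    using act_commute[OF that(1-3) E] that(4) submodule_neg[OF K that(4) E] by auto
  show "submodule D E ?S"
    unfolding submodule_def
  proof (intro allI conjI ballI impI)
    fix n
    show "?S n \<subseteq> Hom T D (Sg n E)" unfolding saturation_def by blast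
    show "zero_arr T D (Sg n E) \<in> ?S n" using inc KD(2) by blast
    show "x \<boxplus> y \<in> ?S n" if x: "x \<in> ?S n" and y: "y \<in> ?S n" for x y
    proof -
      obtain l t where t: "(l, t) \<in> compl q" "\<phi> l t (Sg n E) \<bullet> x \<in> K (l + n)" using SE[OF x] by blast
      obtain m s where s: "(m, s) \<in> compl q" "\<phi> m s (Sg n E) \<bullet> y \<in> K (m + n)" using SE[OF y] by blast
      note xh = conjunct1[OF SE[OF x]] and yh = conjunct1[OF SE[OF y]]
      note tg = complD(1)[OF t(1)] and sg = complD(1)[OF s(1)]
      have 1: "\<phi> m s (Sg (l + n) E) \<bullet> (\<phi> l t (Sg n E) \<bullet> x) \<in> K (l + (m + n))"
        using KD(4)[OF sg t(2)] by (simp add: add_ac)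
      have x': "\<phi> l t (Sg (m + n) E) \<bullet> (\<phi> m s (Sg n E) \<bullet> x) \<in> K (l + (m + n))"
        by (rule comm[OF tg sg xh 1])
      have y': "\<phi> l t (Sg (m + n) E) \<bullet> (\<phi> m s (Sg n E) \<bullet> y) \<in> K (l + (m + n))"
        by (rule KD(4)[OF tg s(2)])
      note sx = act_cmp_hom[OF sg xh E] and sy = act_cmp_hom[OF sg yh E]
      have o: "Sg n E \<in> obj T" "Sg (m + n) E \<in> obj T" using E by simp_all
      have "\<phi> m s (Sg n E) \<bullet> (x \<boxplus> y) = \<phi> m s (Sg n E) \<bullet> x \<boxplus> \<phi> m s (Sg n E) \<bullet> y"
        using cmp_plus_right[OF xh yh act_hom[OF sg o(1)]] .
      then have "\<phi> l t (Sg (m + n) E) \<bullet> (\<phi> m s (Sg n E) \<bullet> (x \<boxplus> y)) \<in> K (l + (m + n))"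
        using cmp_plus_right[OF sx sy act_hom[OF tg o(2)]] KD(3)[OF x' y'] by simp
      moreover obtain u where u: "(l + m, u) \<in> compl q"
        "\<phi> l t (Sg (m + n) E) \<bullet> (\<phi> m s (Sg n E) \<bullet> (x \<boxplus> y)) = \<phi> (l + m) u (Sg n E) \<bullet> (x \<boxplus> y)"
        using act_act_compl[OF q t(1) s(1) plus_hom[OF xh yh] E] .
      ultimately show ?thesis using SI[OF plus_hom[OF xh yh] u(1)] by (simp add: add_ac)
    qed
    show "\<phi> k r (Sg n E) \<bullet> x \<in> ?S (k + n)" if r: "r \<in> grade R k" and x: "x \<in> ?S n" for k r x
    proof -
      obtain l t where t: "(l, t) \<in> compl q" "\<phi> l t (Sg n E) \<bullet> x \<in> K (l + n)" using SE[OF x] by blast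
      note xh = conjunct1[OF SE[OF x]] and tg = complD(1)[OF t(1)]
      have "\<phi> k r (Sg (l + n) E) \<bullet> (\<phi> l t (Sg n E) \<bullet> x) \<in> K (l + (k + n))"
        using KD(4)[OF r t(2)] by (simp add: add_ac)
      then have "\<phi> l t (Sg (k + n) E) \<bullet> (\<phi> k r (Sg n E) \<bullet> x) \<in> K (l + (k + n))"
        by (rule comm[OF tg r xh])
      then show ?thesis using SI[OF act_cmp_hom[OF r xh E] t(1)] by blast
    qed
  qed
  show "saturation q D E ?S n \<subseteq> ?S n"
  proof
    fix h assume "h \<in> saturation q D E ?S n"
    then obtain l t where h: "h \<in> Hom T D (Sg n E)" and t: "(l, t) \<in> compl q" "\<phi> l t (Sg n E) \<bullet> h \<in> ?S (l + n)"
      unfolding saturation_def[of q D E "?S"] by blast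
    obtain m s where s: "(m, s) \<in> compl q" "\<phi> m s (Sg (l + n) E) \<bullet> (\<phi> l t (Sg n E) \<bullet> h) \<in> K (m + (l + n))"
      using SE[OF t(2)] by blast
    obtain u where u: "(m + l, u) \<in> compl q"
        "\<phi> m s (Sg (l + n) E) \<bullet> (\<phi> l t (Sg n E) \<bullet> h) = \<phi> (m + l) u (Sg n E) \<bullet> h"
        using act_act_compl[OF q s(1) t(1) h E] .
    then show "h \<in> ?S n" using SI[OF h u(1)] s(2) by (simp add: add_ac)
  qed
qed

text \<open>\<open>K'\<close> is \<open>K\<close> plus the multiples of \<open>a\<close>. In degree
  \<open>n\<close> the coefficient of \<open>a\<close> has degree \<open>n - m\<close>, since
  \<open>a\<close> has degree \<open>m\<close>.\<close>

lemma submodule_adjoin: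
  assumes K: "submodule D E K" and a: "a \<in> Hom T D (Sg m E)" and D: "D \<in> obj T" and E: "E \<in> obj T"
  defines "K' \<equiv> \<lambda>n. {z \<boxplus> \<phi> (n - m) r (Sg m E) \<bullet> a | z r. z \<in> K n \<and> r \<in> grade R (n - m)}"
  shows "submodule D E K'" "K n \<subseteq> K' n" "a \<in> K' m"
proof -
  note KD = submoduleD[OF K]
  have o: "Sg m E \<in> obj T" using E by simp
  have ra: "\<phi> (n - m) r (Sg m E) \<bullet> a \<in> Hom T D (Sg n E)" if "r \<in> grade R (n - m)" for n r
    using act_cmp_hom[OF that a E] by simp
  have KI: "z \<boxplus> \<phi> (n - m) r (Sg m E) \<bullet> a \<in> K' n" if "z \<in> K n" "r \<in> grade R (n - m)" for z r n
    using that unfolding K'_def by blast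
  have KE: "\<exists>z r. x = z \<boxplus> \<phi> (n - m) r (Sg m E) \<bullet> a \<and> z \<in> K n \<and> r \<in> grade R (n - m)" if "x \<in> K' n" for x n
    using that unfolding K'_def by blast
  have z: "\<phi> (n - m) \<zero>\<^bsub>R\<^esub> (Sg m E) \<bullet> a = zero_arr T D (Sg n E)" for n
    using act_zero[OF o, of "n - m"] cmp_zero_left[OF a, of "Sg n E"] E by simp
  have inc: "K n \<subseteq> K' n" for n
  proof
    fix x assume x: "x \<in> K n"
    have "x \<boxplus> \<phi> (n - m) \<zero>\<^bsub>R\<^esub> (Sg m E) \<bullet> a \<in> K' n" by (rule KI[OF x R.grade_zero])
    then show "x \<in> K' n" using z plus_zero(2)[OF KD(1)[OF x]] by simp
  qed
  then show "K n \<subseteq> K' n" .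
  have "zero_arr T D (Sg m E) \<boxplus> \<phi> (m - m) \<one>\<^bsub>R\<^esub> (Sg m E) \<bullet> a \<in> K' m"
    using KI[OF KD(2), of "\<one>\<^bsub>R\<^esub>" m] R.grade_one by simp
  then show "a \<in> K' m" using act_one[OF o] cmp_ident_left[OF a] plus_zero(1)[OF a] by simp
  show "submodule D E K'"
    unfolding submodule_def
  proof (intro allI conjI ballI impI)
    fix n
    show "K' n \<subseteq> Hom T D (Sg n E)" unfolding K'_def using plus_hom[OF KD(1) ra] by blast
    show "zero_arr T D (Sg n E) \<in> K' n" using inc KD(2) by blast
    show "x \<boxplus> y \<in> K' n" if x: "x \<in> K' n" and y: "y \<in> K' n" for x y
    proof -
      obtain z r where x: "x = z \<boxplus> \<phi> (n - m) r (Sg m E) \<bullet> a" "z \<in> K n" "r \<in> grade R (n - m)" using KE[OF x] by blast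
      obtain w s where y: "y = w \<boxplus> \<phi> (n - m) s (Sg m E) \<bullet> a" "w \<in> K n" "s \<in> grade R (n - m)" using KE[OF y] by blast
      let ?r = "\<phi> (n - m) r (Sg m E) \<bullet> a" and ?s = "\<phi> (n - m) s (Sg m E) \<bullet> a"
      note h = KD(1)[OF x(2)] KD(1)[OF y(2)] ra[OF x(3)] ra[OF y(3)]
      have "x \<boxplus> y = z \<boxplus> (?r \<boxplus> (w \<boxplus> ?s))" using x y plus_assoc[OF h(1,3) plus_hom[OF h(2,4)]] by simp
      also have "?r \<boxplus> (w \<boxplus> ?s) = w \<boxplus> (?r \<boxplus> ?s)"
        using plus_assoc[OF h(3,2,4)] plus_assoc[OF h(2,3,4)] plus_comm[OF h(3,2)] by simp
      also have "z \<boxplus> (w \<boxplus> (?r \<boxplus> ?s)) = (z \<boxplus> w) \<boxplus> (?r \<boxplus> ?s)"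
        using plus_assoc[OF h(1,2) plus_hom[OF h(3,4)]] by simp
      also have "?r \<boxplus> ?s = \<phi> (n - m) (r \<oplus>\<^bsub>R\<^esub> s) (Sg m E) \<bullet> a"
        using act_add[OF x(3) y(3) o] cmp_plus_left[OF a act_hom[OF x(3) o] act_hom[OF y(3) o]] by simp
      finally show ?thesis using KI[OF KD(3)[OF x(2) y(2)] R.grade_add[OF x(3) y(3)]] by simp
    qed
    show "\<phi> k r (Sg n E) \<bullet> x \<in> K' (k + n)" if r: "r \<in> grade R k" and x: "x \<in> K' n" for k r x
    proof -
      obtain z s where x: "x = z \<boxplus> \<phi> (n - m) s (Sg m E) \<bullet> a" "z \<in> K n" "s \<in> grade R (n - m)" using KE[OF x] by blast
      have on: "Sg n E \<in> obj T" using E by simp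
      obtain u where u: "u \<in> grade R (k + (n - m))"
        "\<phi> k r (Sg ((n - m) + m) E) \<bullet> (\<phi> (n - m) s (Sg m E) \<bullet> a) = \<phi> (k + (n - m)) u (Sg m E) \<bullet> a"
        using act_act[OF r x(3) a E] by metis
      have "\<phi> k r (Sg n E) \<bullet> x = \<phi> k r (Sg n E) \<bullet> z \<boxplus> \<phi> (k + n - m) u (Sg m E) \<bullet> a"
        using x(1) cmp_plus_right[OF KD(1)[OF x(2)] ra[OF x(3)] act_hom[OF r on]] u(2) by (simp add: add_diff_eq)
      then show ?thesis using KI[OF KD(4)[OF r x(2)], of u] u(1) by (simp add: add_diff_eq)
    qed
  qed
qed

text \<open>The core of Nakayama's lemma. Write \<open>a\<close> as \<open>x\<close> times
  \<open>b\<close>. Some \<open>t\<close> outside \<open>q\<close> takes \<open>b\<close> to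
  \<open>z\<close> plus \<open>r\<close> times \<open>a\<close>, with \<open>z\<close> in
  \<open>K\<close>. Multiplying by \<open>x\<close> gives, up to sign, \<open>t\<close> times
  \<open>a\<close> as \<open>x\<close> times \<open>z\<close> plus \<open>u\<close> times
  \<open>a\<close>, where \<open>u\<close> is \<open>x\<close> times \<open>r\<close> up to sign and
  hence lies in \<open>q\<close>. So \<open>t\<close> minus \<open>u\<close> stays outside
  \<open>q\<close> and takes \<open>a\<close> into \<open>K\<close>.\<close>

lemma generates_remove:
  assumes q: "q \<in> Spec R" and D: "D \<in> obj T" and E: "E \<in> obj T"
    and x: "x \<in> grade R k" "x \<in> q"
    and div: "\<And>n h. h \<in> Hom T D (Sg n E) \<Longrightarrow>
      \<exists>h' \<in> Hom T D (Sg (n - k) E). \<phi> k x (Sg (n - k) E) \<bullet> h' = h"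
    and a: "a \<in> Hom T D (Sg m E)" and g: "generates q D E (insert (m, a) B)"
  shows "generates q D E B"
  unfolding generates_def
proof (intro allI impI)
  fix K n assume K0: "submodule D E K \<and> (\<forall>n. saturation q D E K n \<subseteq> K n) \<and> (\<forall>(n, h) \<in> B. h \<in> K n)"
  then have K: "submodule D E K" and sat: "\<And>n. saturation q D E K n \<subseteq> K n"
    and B: "\<And>n h. (n, h) \<in> B \<Longrightarrow> h \<in> K n" by auto
  note KD = submoduleD[OF K]
  define K' where "K' = (\<lambda>n. {z \<boxplus> \<phi> (n - m) r (Sg m E) \<bullet> a | z r. z \<in> K n \<and> r \<in> grade R (n - m)})"
  have K': "submodule D E K'" "\<And>n. K n \<subseteq> K' n" "a \<in> K' m"
    unfolding K'_def by (rule submodule_adjoin[OF K a D E])+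
  note S = saturation_submodule[OF q K'(1) D E]
  have "Hom T D (Sg n E) \<subseteq> saturation q D E K' n" for n
  proof -
    have "\<forall>(n, h) \<in> insert (m, a) B. h \<in> saturation q D E K' n" using S(3) K'(2,3) B by blast
    then show ?thesis using g S(1,2) unfolding generates_def by blast
  qed
  moreover obtain b where b: "b \<in> Hom T D (Sg (m - k) E)" "\<phi> k x (Sg (m - k) E) \<bullet> b = a" using div[OF a] by blast
  ultimately obtain l t where t: "(l, t) \<in> compl q" "\<phi> l t (Sg (m - k) E) \<bullet> b \<in> K' (l + (m - k))"
    unfolding saturation_def by blast
  then obtain z r where zr: "\<phi> l t (Sg (m - k) E) \<bullet> b = z \<boxplus> \<phi> (l + (m - k) - m) r (Sg m E) \<bullet> a"
    "z \<in> K (l + (m - k))" "r \<in> grade R (l + (m - k) - m)" unfolding K'_def by blast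
  let ?d = "l + (m - k)"
  have d: "?d - m = l - k" by simp
  have r: "r \<in> grade R (l - k)" using zr(3) d by simp
  note tg = complD(1)[OF t(1)]
  have o: "Sg ?d E \<in> obj T" "Sg m E \<in> obj T" using E by simp_all
  obtain u where u: "u \<in> grade R (k + (l - k))" "u = x \<otimes>\<^bsub>R\<^esub> r \<or> u = \<ominus>\<^bsub>R\<^esub> (x \<otimes>\<^bsub>R\<^esub> r)"
    "\<phi> k x (Sg ((l - k) + m) E) \<bullet> (\<phi> (l - k) r (Sg m E) \<bullet> a) = \<phi> (k + (l - k)) u (Sg m E) \<bullet> a"
    using act_act[OF x(1) r a E] .
  have u': "u \<in> grade R l" "\<phi> k x (Sg ?d E) \<bullet> (\<phi> (l - k) r (Sg m E) \<bullet> a) = \<phi> l u (Sg m E) \<bullet> a"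
    using u(1,3) by (simp_all add: algebra_simps)
  have uq: "u \<in> q"
  proof -
    note i = R.SpecD(1)[OF q]
    have "x \<otimes>\<^bsub>R\<^esub> r \<in> q" using ideal.I_r_closed[OF i x(2)] r by auto
    then show ?thesis using u(2) additive_subgroup.a_inv_closed[OF ideal.axioms(1)[OF i]] by auto
  qed
  have ra: "\<phi> (l - k) r (Sg m E) \<bullet> a \<in> Hom T D (Sg ?d E)"
    using act_cmp_hom[OF r a E] by (simp add: algebra_simps)
  have "\<phi> k x (Sg ?d E) \<bullet> (\<phi> l t (Sg (m - k) E) \<bullet> b) = \<phi> k x (Sg ?d E) \<bullet> z \<boxplus> \<phi> l u (Sg m E) \<bullet> a"
    using zr(1) d cmp_plus_right[OF KD(1)[OF zr(2)] ra act_hom[OF x(1) o(1)]] u'(2) by simp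
  moreover have xz: "\<phi> k x (Sg ?d E) \<bullet> z \<in> K (l + m)" using KD(4)[OF x(1) zr(2)] by (simp add: algebra_simps)
  \<comment> \<open>Commuting \<open>x\<close> past \<open>t\<close> may change the sign;
    \<open>t'\<close> below absorbs it.\<close>
  moreover have "\<phi> k x (Sg ?d E) \<bullet> (\<phi> l t (Sg (m - k) E) \<bullet> b) = \<phi> l t (Sg m E) \<bullet> a \<or>
     \<phi> k x (Sg ?d E) \<bullet> (\<phi> l t (Sg (m - k) E) \<bullet> b) = \<phi> l (\<ominus>\<^bsub>R\<^esub> t) (Sg m E) \<bullet> a"
    using act_commute[OF x(1) tg b(1) E] b(2) act_neg_cmp[OF tg a E] by simp
  ultimately obtain t' where t': "t' = t \<or> t' = \<ominus>\<^bsub>R\<^esub> t"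
    "\<phi> l t' (Sg m E) \<bullet> a = \<phi> k x (Sg ?d E) \<bullet> z \<boxplus> \<phi> l u (Sg m E) \<bullet> a" by metis
  have t'c: "(l, t') \<in> compl q" using t'(1) t(1) compl_neg[OF q] by blast
  note t'g = complD(1)[OF t'c]
  let ?v = "t' \<oplus>\<^bsub>R\<^esub> \<ominus>\<^bsub>R\<^esub> u"
  have vg: "?v \<in> grade R l" using R.grade_add[OF t'g R.grade_neg[OF u'(1)]] .
  have "?v \<notin> q"
  proof
    assume "?v \<in> q"
    then have "?v \<oplus>\<^bsub>R\<^esub> u \<in> q"
      using additive_subgroup.a_closed[OF ideal.axioms(1)[OF R.SpecD(1)[OF q]]] uq by blast
    then have "t' \<in> q" using R.grade_closed[OF t'g] R.grade_closed[OF u'(1)] by (simp add: R.a_assoc R.l_neg)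
    then show False using complD(2)[OF t'c] by blast
  qed
  then have vc: "(l, ?v) \<in> compl q" using vg by (simp add: compl_def)
  note ua = act_cmp_hom[OF u'(1) a E]
  have xzh: "\<phi> k x (Sg ?d E) \<bullet> z \<in> Hom T D (Sg (l + m) E)" using KD(1)[OF xz] .
  have "\<phi> l ?v (Sg m E) \<bullet> a = \<phi> l t' (Sg m E) \<bullet> a \<boxplus> neg_arr T (\<phi> l u (Sg m E) \<bullet> a)"
    using act_add[OF t'g R.grade_neg[OF u'(1)] o(2)]
      cmp_plus_left[OF a act_hom[OF t'g o(2)] act_hom[OF R.grade_neg[OF u'(1)] o(2)]]
      act_neg_cmp[OF u'(1) a E] by simp
  also have "\<dots> = \<phi> k x (Sg ?d E) \<bullet> z"
    using t'(2) plus_assoc[OF xzh ua neg_hom[OF ua]] plus_neg(2)[OF ua] plus_zero(2)[OF xzh] by simp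
  finally have "\<phi> l ?v (Sg m E) \<bullet> a \<in> K (l + m)" using xz by simp
  then have "a \<in> K m" using sat[of m] a vc unfolding saturation_def by blast
  then have "\<forall>(n, h) \<in> insert (m, a) B. h \<in> K n" using B by blast
  then show "Hom T D (Sg n E) \<subseteq> K n" using g K sat unfolding generates_def by blast
qed

text \<open>Removing generators one by one leaves the empty set, so every saturated submodule is
  everything. By \<open>inj\<close> the zero submodule is saturated. Divisibility by
  \<open>x\<close> is the form in which the module equals \<open>q\<close> times itself.\<close>

lemma nakayama:
  assumes q: "q \<in> Spec R" and D: "D \<in> obj T" and E: "E \<in> obj T"
    and x: "x \<in> grade R k" "x \<in> q"
    and div: "\<And>n h. h \<in> Hom T D (Sg n E) \<Longrightarrow>
      \<exists>h' \<in> Hom T D (Sg (n - k) E). \<phi> k x (Sg (n - k) E) \<bullet> h' = h"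
    and inj: "\<And>n h l t. h \<in> Hom T D (Sg n E) \<Longrightarrow> (l, t) \<in> compl q \<Longrightarrow> kills l t D (Sg n E) h
      \<Longrightarrow> h = zero_arr T D (Sg n E)"
    and B: "finite B" "\<And>n h. (n, h) \<in> B \<Longrightarrow> h \<in> Hom T D (Sg n E)" and g: "generates q D E B"
  shows "hom_zero D E"
proof -
  have "generates q D E {}"
    using B g
  proof (induction B)
    case (insert b B)
    obtain m a where b: "b = (m, a)" by (cases b)
    have "a \<in> Hom T D (Sg m E)" using insert b by blast
    then have "generates q D E B" using generates_remove[OF q D E x div] insert b by blast
    then show ?case using insert by blast
  qed simp
  moreover let ?K = "\<lambda>n. {zero_arr T D (Sg n E)}"
  have "submodule D E ?K"
    unfolding submodule_def
  proof (intro allI conjI ballI impI)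
    fix n
    have z: "zero_arr T D (Sg n E) \<in> Hom T D (Sg n E)" using D E by blast
    show "?K n \<subseteq> Hom T D (Sg n E)" using z by blast
    show "y \<boxplus> z' \<in> ?K n" if "y \<in> ?K n" "z' \<in> ?K n" for y z' using that plus_zero[OF z] by simp
    show "\<phi> k r (Sg n E) \<bullet> y \<in> ?K (k + n)" if "r \<in> grade R k" "y \<in> ?K n" for k r y
      using that cmp_zero_right[OF act_hom[OF that(1)] D, of "Sg n E"] E by simp
  qed simp
  moreover have "saturation q D E ?K n \<subseteq> ?K n" for n
    unfolding saturation_def using inj E by (fastforce simp: kills_def)
  ultimately have "\<And>n. Hom T D (Sg n E) \<subseteq> ?K n" unfolding generates_def by blast
  then show ?thesis unfolding hom_zero_def by blast
qed

end

section \<open>Local subcategories\<close>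

context triangulated_category
begin

text \<open>A morphism killed by the suspended \<open>u\<close> factors through a suspension of
  \<open>Y\<close>, which receives nothing from \<open>Z\<close>.\<close>

lemma coreflection_zeroI:
  assumes S: "susp_closed T S" and t: "tri U X Y u g h" and Y: "Y \<in> right_perp T S"
    and Z: "Z \<in> S" and v: "v \<in> Hom T Z (Sg k U)" "Sa k u \<bullet> v = zero_arr T Z (Sg k X)"
  shows "v = zero_arr T Z (Sg k U)"
proof -
  note d = triD[OF t]
  note perp = triangulated_subcategoryD[OF right_perp_triangulated[OF S]]
  obtain w where w: "w \<in> Hom T Z (Sg k (Sg (- 1) Y))" "v = Sa k (neg_arr T (Sa (- 1) h)) \<bullet> w"
    using tri_factor_left_pow[OF tri_rotate_back[OF t] v] by blast
  have "w = zero_arr T Z (Sg k (Sg (- 1) Y))"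
    using right_perpD(1)[OF perp(4)[OF perp(4)[OF Y]] Z w(1)] .
  then show ?thesis
    using w(2) cmp_zero_right[OF Sa_hom[OF triD(2)[OF tri_rotate_back[OF t]]]] Hom_objD[OF v(1)] by simp
qed

lemma coreflection_lift:
  assumes t: "tri U X Y u g h" and Y: "Y \<in> right_perp T S"
    and Z: "Z \<in> S" and w: "w \<in> Hom T Z X"
  obtains v where "v \<in> Hom T Z U" "w = u \<bullet> v"
proof -
  have "g \<bullet> w = zero_arr T Z Y" using right_perpD(1)[OF Y Z] cmp_hom[OF w triD(3)[OF t]] by blast
  then show ?thesis using tri_factor_left[OF t w] that by blast
qed

end

context generated_linear_category
begin

abbreviation tors where "tors V \<equiv> torsion \<kappa> T R \<phi> V"
abbreviation L where "L V \<equiv> L_obj \<kappa> T R \<phi> V"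
abbreviation \<eta>L where "\<eta>L V \<equiv> L_unit \<kappa> T R \<phi> V"
abbreviation \<Gamma> where "\<Gamma> p \<equiv> Gamma_at \<kappa> T R \<phi> p"

lemma tors_triangulated: "triangulated_subcategory T (tors V)"
  using localizingD(1)[OF torsion_localizing] .

lemma tors_susp_closed: "susp_closed T (tors V)"
  using triangulated_susp_closed[OF tors_triangulated] .

lemmas tors_perp = right_perp_triangulated[OF tors_susp_closed]

text \<open>The torsion subcategory is generated by compact objects, and being orthogonal to compact
  objects is inherited by coproducts.\<close>

lemma perp_Zset_localizing:
  assumes "p \<in> Spec R"
  shows "localizing \<kappa> T (right_perp T (tors (Zset R p)))"
proof -
  obtain K where K: "susp_closed T K" "K \<subseteq> compacts \<kappa> T" "Loc \<kappa> T K = tors (Zset R p)"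
    using torsion_Zset_generated[OF assms] by metis
  have "right_perp T (tors (Zset R p)) = right_perp T K" using right_perp_Loc[OF K(1), of \<kappa>] K(3) by simp
  then show ?thesis using right_perp_compacts_localizing[OF K(1,2)] by simp
qed

lemma kos_tors_Zset:
  assumes "p \<in> Spec R" "(k, s) \<in> compl p" "X \<in> obj T"
  shows "kos (k, s) X \<in> tors (Zset R p)"
  using torsion_Zset_generated[OF assms(1)] assms(2,3) by metis

text \<open>The cone of \<open>s\<close> on \<open>W\<close> is torsion, because the square of
  \<open>s\<close> annihilates it, and it is orthogonal to torsion together with \<open>W\<close>.
  So it is zero.\<close>

lemma perp_act_iso:
  assumes p: "p \<in> Spec R" and s: "(k, s) \<in> compl p" and W: "W \<in> right_perp T (tors (Zset R p))"
  shows "iso_arr T (\<phi> k s W)"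
proof -
  note Wo = right_perpD(2)[OF W] and sg = complD(1)[OF s]
  obtain g h where t: "tri W (Sg k W) (kos (k, s) W) (\<phi> k s W) g h" using kos_tri[OF sg Wo] by blast
  have "kos (k, s) W \<in> right_perp T (tors (Zset R p))"
    using triangulated_subcategoryD(5)[OF tors_perp t W triangulated_subcategoryD(4)[OF tors_perp W]] .
  then have "zero_obj T (kos (k, s) W)" using in_perp_zero[OF kos_tors_Zset[OF p s Wo]] by blast
  then show ?thesis using iso_if_cone_zero t by blast
qed

lemma perp_kills_zero:
  assumes p: "p \<in> Spec R" and s: "(k, s) \<in> compl p" and W: "W \<in> right_perp T (tors (Zset R p))"
    and f: "f \<in> Hom T C (Sg n W)" and z: "kills k s C (Sg n W) f"
  shows "f = zero_arr T C (Sg n W)"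
proof -
  have SW: "Sg n W \<in> right_perp T (tors (Zset R p))" for n using triangulated_subcategoryD(4)[OF tors_perp W] .
  note Wo = right_perpD(2)[OF W] and C = Hom_objD(1)[OF f]
  show ?thesis
  proof (rule kos_injective[OF complD(1)[OF s] f z])
    fix v assume "v \<in> Hom T (kos (k, s) C) (Sg k (Sg n W))"
    then show "v = zero_arr T (kos (k, s) C) (Sg k (Sg n W))"
      using right_perpD(1)[OF SW kos_tors_Zset[OF p s C], of v "k + n"] Wo by simp
  qed
qed

text \<open>Orthogonality can be tested on compact generators of the torsion subcategory. Each is
  annihilated by some \<open>t\<close> outside \<open>p\<close>, while \<open>t\<close> acts
  invertibly on \<open>Y\<close>.\<close>

lemma perp_if_act_iso:
  assumes p: "p \<in> Spec R" and Y: "Y \<in> obj T" and i: "\<And>k s. (k, s) \<in> compl p \<Longrightarrow> iso_arr T (\<phi> k s Y)"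
  shows "Y \<in> right_perp T (tors (Zset R p))"
proof -
  obtain K where K: "susp_closed T K" "K \<subseteq> compacts \<kappa> T" "Loc \<kappa> T K = tors (Zset R p)"
    using torsion_Zset_generated[OF p] by metis
  have "Y \<in> right_perp T K"
  proof (rule right_perpI[OF Y])
    fix C f assume C: "C \<in> K" and f: "f \<in> Hom T C Y"
    have Co: "C \<in> compacts \<kappa> T" "C \<in> tors (Zset R p)" "C \<in> obj T"
      using C K Loc_subset Hom_objD[OF f] by blast+
    have q: "p \<in> Spec R - Zset R p" using p by (simp add: Zset_def)
    obtain l t where t: "(l, t) \<in> compl p" "\<phi> l t C = zero_arr T C (Sg l C)"
      using compact_torsion_annihilated[OF Co(1,2) q] by blast
    note tg = complD(1)[OF t(1)]
    note a = act_hom[OF tg Y]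
    obtain e where e: "e \<in> Hom T (Sg l Y) Y" "e \<bullet> \<phi> l t Y = ident T Y" using iso_arrE[OF i[OF t(1)] a] by blast
    have "\<phi> l t Y \<bullet> f = zero_arr T C (Sg l Y)"
      using act_natural[OF tg f] t(2) cmp_zero_right[OF Sa_hom[OF f] Co(3)] by simp
    then have "e \<bullet> (\<phi> l t Y \<bullet> f) = zero_arr T C Y" using cmp_zero_right[OF e(1) Co(3)] by simp
    then show "f = zero_arr T C Y" using cmp_assoc[OF f a e(1)] e(2) cmp_ident_left[OF f] by simp
  qed
  then show ?thesis using right_perp_Loc[OF K(1), of \<kappa>] K(3) by simp
qed

text \<open>A description of \<open>Gamma_subcategory \<kappa> T R \<phi> p\<close> that involves no
  chosen localization functor; the orthogonal consists of the objects local at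
  \<open>p\<close>.\<close>

definition stratum where "stratum p = tors (Vset R p) \<inter> right_perp T (tors (Zset R p))"

lemma stratum_localizing: "p \<in> Spec R \<Longrightarrow> localizing \<kappa> T (stratum p)"
  unfolding stratum_def using localizing_Int torsion_localizing perp_Zset_localizing by blast

lemma L_perp: "localizable V \<Longrightarrow> X \<in> obj T \<Longrightarrow> L V X \<in> right_perp T (tors V)"
  using reflection_hom(4)[OF L_reflection] .

lemma L_iso_if_perp:
  assumes V: "localizable V" and X: "X \<in> right_perp T (tors V)"
  shows "iso_obj T X (L V X)"
proof -
  note r = L_reflection[OF V right_perpD(2)[OF X]]
  show ?thesis using iso_objI[OF reflection_hom(1)[OF r] reflection_iso_if_perp[OF tors_susp_closed r X]] .
qed

text \<open>The point is that the fibre stays local at \<open>p\<close>. Elements outside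
  \<open>p\<close> act invertibly on \<open>?W\<close>, hence bijectively on morphisms from torsion
  objects into the fibre. As the fibre and its suspensions are torsion themselves, they suffice as
  test objects.\<close>

lemma Gamma_in_stratum:
  assumes p: "p \<in> Spec R" and X: "X \<in> obj T"
  shows "\<Gamma> p X \<in> stratum p"
proof -
  let ?W = "L (Zset R p) X"
  have W: "?W \<in> right_perp T (tors (Zset R p))" using L_perp[OF localizable_Zset[OF p] X] .
  note Wo = right_perpD(2)[OF W]
  obtain u h where t: "tri (\<Gamma> p X) ?W (L (Vset R p) ?W) u (\<eta>L (Vset R p) ?W) h" and GV: "\<Gamma> p X \<in> tors (Vset R p)"
    using Gamma_tri[OF localizable_Vset[OF p] Wo] unfolding Gamma_at_def by blast
  note d = triD[OF t]
  have LV: "L (Vset R p) ?W \<in> right_perp T (tors (Vset R p))" using L_perp[OF localizable_Vset[OF p] Wo] .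
  have "\<Gamma> p X \<in> right_perp T (tors (Zset R p))"
  proof (rule perp_if_act_iso[OF p d(5)])
    fix k s assume s: "(k, s) \<in> compl p"
    note sg = complD(1)[OF s]
    let ?G = "\<Gamma> p X"
    note aG = act_hom[OF sg d(5)] and aW = act_hom[OF sg Wo]
    obtain e where e: "e \<in> Hom T (Sg k ?W) ?W" "e \<bullet> \<phi> k s ?W = ident T ?W" "\<phi> k s ?W \<bullet> e = ident T (Sg k ?W)"
      using iso_arrE[OF perp_act_iso[OF p s W] aW] by blast
    have nat: "Sa k u \<bullet> (\<phi> k s ?G \<bullet> g) = \<phi> k s ?W \<bullet> (u \<bullet> g)" if "g \<in> Hom T Z ?G" for g Z
      using act_natural[OF sg d(2)] cmp_assoc[OF that aG Sa_hom[OF d(2)]] cmp_assoc[OF that d(2) aW] by simp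
    have "bij_betw (\<lambda>g. \<phi> k s ?G \<bullet> g) (Hom T Z ?G) (Hom T Z (Sg k ?G))" if Z: "Z \<in> tors (Vset R p)" for Z
    proof -
      have Zo: "Z \<in> obj T" using Z by (simp add: torsion_def)
      have inj: "g = zero_arr T Z ?G" if g: "g \<in> Hom T Z ?G" "\<phi> k s ?G \<bullet> g = zero_arr T Z (Sg k ?G)" for g
      proof -
        have ug: "u \<bullet> g \<in> Hom T Z ?W" using cmp_hom[OF g(1) d(2)] .
        have "\<phi> k s ?W \<bullet> (u \<bullet> g) = zero_arr T Z (Sg k ?W)"
          using nat[OF g(1)] g(2) cmp_zero_right[OF Sa_hom[OF d(2)] Zo] by simp
        then have "e \<bullet> (\<phi> k s ?W \<bullet> (u \<bullet> g)) = zero_arr T Z ?W" using cmp_zero_right[OF e(1) Zo] by simp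
        then have "u \<bullet> g = zero_arr T Z ?W" using cmp_assoc[OF ug aW e(1)] e(2) cmp_ident_left[OF ug] by simp
        then show ?thesis using coreflection_zeroI[OF tors_susp_closed t LV Z, of g 0] g(1) by simp
      qed
      have "inj_on (\<lambda>g. \<phi> k s ?G \<bullet> g) (Hom T Z ?G)"
      proof (rule inj_onI)
        fix g g' assume g: "g \<in> Hom T Z ?G" "g' \<in> Hom T Z ?G" "\<phi> k s ?G \<bullet> g = \<phi> k s ?G \<bullet> g'"
        have "\<phi> k s ?G \<bullet> (g \<boxminus> g') = zero_arr T Z (Sg k ?G)"
          using cmp_minus_right[OF g(1,2) aG] g(3) minus_self[OF cmp_hom[OF g(2) aG]] by simp
        then show "g = g'" using inj[OF minus_hom[OF g(1,2)]] minus_eq_zero[OF g(1,2)] by blast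
      qed
      moreover have "x \<in> (\<lambda>g. \<phi> k s ?G \<bullet> g) ` Hom T Z ?G" if x: "x \<in> Hom T Z (Sg k ?G)" for x
      proof -
        have ux: "Sa k u \<bullet> x \<in> Hom T Z (Sg k ?W)" using cmp_hom[OF x Sa_hom[OF d(2)]] .
        obtain g where g: "g \<in> Hom T Z ?G" "e \<bullet> (Sa k u \<bullet> x) = u \<bullet> g"
          using coreflection_lift[OF t LV Z cmp_hom[OF ux e(1)]] .
        note ag = cmp_hom[OF g(1) aG]
        have "Sa k u \<bullet> (\<phi> k s ?G \<bullet> g) = \<phi> k s ?W \<bullet> (e \<bullet> (Sa k u \<bullet> x))" using nat[OF g(1)] g(2) by simp
        also have "\<dots> = Sa k u \<bullet> x" using cmp_assoc[OF ux e(1) aW] e(3) cmp_ident_left[OF ux] by simp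
        finally have "Sa k u \<bullet> (x \<boxminus> \<phi> k s ?G \<bullet> g) = zero_arr T Z (Sg k ?W)"
          using cmp_minus_right[OF x ag Sa_hom[OF d(2)]] minus_self[OF ux] by simp
        then have "x \<boxminus> \<phi> k s ?G \<bullet> g = zero_arr T Z (Sg k ?G)"
          using coreflection_zeroI[OF tors_susp_closed t LV Z minus_hom[OF x ag]] by blast
        then show ?thesis using minus_eq_zero[OF x ag] g(1) by blast
      qed
      moreover have "\<phi> k s ?G \<bullet> g \<in> Hom T Z (Sg k ?G)" if "g \<in> Hom T Z ?G" for g using cmp_hom[OF that aG] .
      ultimately show ?thesis unfolding bij_betw_def by blast
    qed
    then show "iso_arr T (\<phi> k s ?G)"
      using iso_arr_if_bij_postcomp[OF aG] GV triangulated_subcategoryD(4)[OF tors_triangulated GV] by blast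
  qed
  then show ?thesis using GV by (simp add: stratum_def)
qed

text \<open>On such an object the first localization changes nothing and the second is zero.\<close>

lemma stratum_in_Gamma:
  assumes p: "p \<in> Spec R" and Y: "Y \<in> stratum p"
  shows "iso_obj T (\<Gamma> p Y) Y" "Y \<in> obj T"
proof -
  have YV: "Y \<in> tors (Vset R p)" and YZ: "Y \<in> right_perp T (tors (Zset R p))" using Y by (auto simp: stratum_def)
  show Yo: "Y \<in> obj T" using YZ right_perpD by blast
  let ?W = "L (Zset R p) Y"
  have i: "iso_obj T Y ?W" using L_iso_if_perp[OF localizable_Zset[OF p] YZ] .
  have WV: "?W \<in> tors (Vset R p)" using triangulated_subcategoryD(3)[OF tors_triangulated YV i] .
  have Wo: "?W \<in> obj T" using WV by (simp add: torsion_def)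
  obtain u h where t: "tri (\<Gamma> p Y) ?W (L (Vset R p) ?W) u (\<eta>L (Vset R p) ?W) h"
    using Gamma_tri[OF localizable_Vset[OF p] Wo] unfolding Gamma_at_def by blast
  have "zero_obj T (L (Vset R p) ?W)"
    using reflection_zero_iff[OF tors_triangulated L_reflection[OF localizable_Vset[OF p] Wo]] WV by blast
  then have "iso_arr T u" using iso_if_cone_zero[OF t] by blast
  then have "iso_obj T (\<Gamma> p Y) ?W" using iso_objI triD(2)[OF t] by blast
  then show "iso_obj T (\<Gamma> p Y) Y" using i iso_obj_sym iso_obj_trans by blast
qed

lemma Gamma_subcategory_eq:
  assumes p: "p \<in> Spec R"
  shows "Gamma_subcategory \<kappa> T R \<phi> p = stratum p"
proof
  show "Gamma_subcategory \<kappa> T R \<phi> p \<subseteq> stratum p"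
    using Gamma_in_stratum[OF p] triangulated_subcategoryD(3)[OF localizingD(1)[OF stratum_localizing[OF p]]]
    by (auto simp: Gamma_subcategory_def)
  show "stratum p \<subseteq> Gamma_subcategory \<kappa> T R \<phi> p"
    using stratum_in_Gamma[OF p] by (auto simp: Gamma_subcategory_def)
qed

text \<open>By naturality the action on \<open>Y\<close> vanishes after \<open>g\<close>, and
  morphisms from a reflection into the orthogonal are determined by that composite.\<close>

lemma reflection_annihilated:
  assumes S: "susp_closed T S" and r: "reflection S X Y g" and s: "s \<in> grade R k"
    and z: "\<phi> k s X = zero_arr T X (Sg k X)"
  shows "\<phi> k s Y = zero_arr T Y (Sg k Y)"
proof -
  note h = reflection_hom[OF r]
  have "\<phi> k s Y \<bullet> g = zero_arr T X (Sg k Y)"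
    using act_natural[OF s h(1)] z cmp_zero_right[OF Sa_hom[OF h(1)] h(2)] by simp
  then show ?thesis
    using reflection_zeroI[OF S r triangulated_subcategoryD(4)[OF right_perp_triangulated[OF S] h(4)]
        act_hom[OF s h(3)]] by blast
qed

end

section \<open>Smashing subcategories\<close>

text \<open>\<open>S\<close> stands for the kernel of the given localization functor. Of the functor
  only the Bousfield triangles remain, together with the fact that kernel and orthogonal are
  localizing.\<close>

locale stratified_smashing = generated_linear_category T R \<phi> \<kappa>
  for T :: "('o, 'm, 'y) triangulated_category_scheme" (structure)
    and R :: "('r, 'z) graded_ring_scheme" and \<phi> and \<kappa> :: "'k rel" +
  fixes S :: "'o set"
  assumes noetherian: "noetherian_category \<kappa> T R \<phi>" and strat: "stratified \<kappa> T R \<phi>"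
    and S_localizing: "localizing \<kappa> T S" and perp_localizing: "localizing \<kappa> T (right_perp T S)"
    and S_reflection: "X \<in> obj T \<Longrightarrow> \<exists>Y g. reflection S X Y g"
begin

lemma Gamma_in_localizing:
  assumes "localizing \<kappa> T A" "X \<in> A" "p \<in> Spec R"
  shows "\<Gamma> p X \<in> A"
proof -
  have "X \<in> obj T" using localizingD(2)[OF assms(1)] assms(2) by blast
  then have "Loc \<kappa> T {X} = Loc \<kappa> T {\<Gamma> p X | p. p \<in> Spec R}"
    using strat by (simp add: stratified_def local_global_principle_def)
  moreover have "\<Gamma> p X \<in> Loc \<kappa> T {\<Gamma> p X | p. p \<in> Spec R}"
    by (rule subsetD[OF Loc_subset]) (use assms(3) in blast)
  moreover have "Loc \<kappa> T {X} \<subseteq> A" using Loc_least[OF assms(1)] assms(2) by blast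
  ultimately show ?thesis by blast
qed

lemma in_localizing_if_Gamma:
  assumes "localizing \<kappa> T A" "X \<in> obj T" "\<And>p. p \<in> Spec R \<Longrightarrow> \<Gamma> p X \<in> A"
  shows "X \<in> A"
proof -
  have "Loc \<kappa> T {X} = Loc \<kappa> T {\<Gamma> p X | p. p \<in> Spec R}"
    using strat assms(2) by (simp add: stratified_def local_global_principle_def)
  moreover have "Loc \<kappa> T {\<Gamma> p X | p. p \<in> Spec R} \<subseteq> A"
    by (rule Loc_least[OF assms(1)]) (use assms(3) in blast)
  ultimately show ?thesis using Loc_subset[of "{X}" \<kappa>] by blast
qed

text \<open>Otherwise minimality makes the intersections of the stratum with \<open>S\<close> and
  with its orthogonal zero. Every \<open>X\<close> in the stratum lies in a triangle between an
  object of \<open>S\<close> and one of the orthogonal, both with vanishing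
  \<open>\<Gamma> p\<close>, which forces \<open>X\<close> to be zero.\<close>

lemma stratum_dichotomy:
  assumes p: "p \<in> Spec R"
  shows "stratum p \<subseteq> S \<or> stratum p \<subseteq> right_perp T S"
proof (rule ccontr)
  assume n: "\<not> (stratum p \<subseteq> S \<or> stratum p \<subseteq> right_perp T S)"
  note St = localizingD(1)[OF S_localizing] and Pt = localizingD(1)[OF perp_localizing]
  have nz: "\<not> zero_subcategory T (stratum p)"
    using n triangulated_subcategoryD(2)[OF St] by (auto simp: zero_subcategory_def)
  then have min: "minimal_localizing \<kappa> T (stratum p)"
    using strat p Gamma_subcategory_eq[OF p] by (auto simp: stratified_def)
  have cut: "zero_subcategory T (stratum p \<inter> A)" if "localizing \<kappa> T A" "\<not> stratum p \<subseteq> A" for A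
    using min that localizing_Int[OF stratum_localizing[OF p] that(1)] unfolding minimal_localizing_def by blast
  note zS = cut[OF S_localizing] and zP = cut[OF perp_localizing]
  let ?Z = "Zset R p" and ?V = "Vset R p"
  note lZ = localizable_Zset[OF p] and lV = localizable_Vset[OF p]
  \<comment> \<open>\<open>\<Gamma> p\<close> is only an assignment on objects. Its vanishing is
    restated through \<open>L ?Z\<close>, which is exact, so that the condition passes from
    \<open>A\<close> and \<open>B\<close> to \<open>X\<close>.\<close>
  have perp: "L ?Z A \<in> right_perp T (tors ?V)" if A: "A \<in> obj T" "zero_obj T (\<Gamma> p A)" for A
  proof -
    have Wo: "L ?Z A \<in> obj T" using right_perpD(2)[OF L_perp[OF lZ A(1)]] .
    obtain u h where t: "tri (\<Gamma> p A) (L ?Z A) (L ?V (L ?Z A)) u (\<eta>L ?V (L ?Z A)) h"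
      using Gamma_tri[OF lV Wo] unfolding Gamma_at_def by blast
    have "iso_arr T (\<eta>L ?V (L ?Z A))" using iso_if_cone_zero[OF tri_rotate[OF t] zero_Sg[OF A(2)]] .
    then have "iso_obj T (L ?V (L ?Z A)) (L ?Z A)" using iso_objI[OF triD(3)[OF t]] iso_obj_sym by blast
    then show ?thesis using triangulated_subcategoryD(3)[OF tors_perp L_perp[OF lV Wo]] by blast
  qed
  have "zero_obj T X" if X: "X \<in> stratum p" for X
  proof -
    have Xo: "X \<in> obj T" using stratum_in_Gamma(2)[OF p X] .
    obtain B g where "reflection S X B g" using S_reflection[OF Xo] by blast
    then obtain A f h where t: "tri A X B f g h" "A \<in> S" "B \<in> right_perp T S" using reflectionE by metis
    note d = triD[OF t(1)]
    have "zero_obj T (\<Gamma> p A)"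
      using zS n Gamma_in_localizing[OF S_localizing t(2) p] Gamma_in_stratum[OF p d(5)]
      by (auto simp: zero_subcategory_def)
    then have LA: "L ?Z A \<in> right_perp T (tors ?V)" using perp d by blast
    have "zero_obj T (\<Gamma> p B)"
      using zP n Gamma_in_localizing[OF perp_localizing t(3) p] Gamma_in_stratum[OF p d(7)]
      by (auto simp: zero_subcategory_def)
    then have LB: "L ?Z B \<in> right_perp T (tors ?V)" using perp d by blast
    obtain La where bl: "bousfield_localization T (L ?Z) La (\<eta>L ?Z)" using L_localization[OF lZ] by blast
    obtain h' where "tri (L ?Z A) (L ?Z X) (L ?Z B) (La f) (La g) h'"
      using bousfield_localization.L_tri[OF bl t(1)] by blast
    then have "L ?Z X \<in> right_perp T (tors ?V)" using triangulated_subcategoryD(7)[OF tors_perp] LA LB by blast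
    moreover have "iso_obj T (L ?Z X) X" using L_iso_if_perp[OF lZ] X iso_obj_sym by (auto simp: stratum_def)
    ultimately have "X \<in> right_perp T (tors ?V)" using triangulated_subcategoryD(3)[OF tors_perp] by blast
    moreover have "X \<in> tors ?V" using X by (simp add: stratum_def)
    ultimately show ?thesis using in_perp_zero by blast
  qed
  then show False using nz by (simp add: zero_subcategory_def)
qed

text \<open>An object of \<open>tors V\<close> is already torsion at \<open>p\<close>, so
  \<open>\<Gamma> p X\<close> is both torsion at \<open>p\<close> and orthogonal to such
  torsion.\<close>

lemma Gamma_zero_if_torsion:
  assumes X: "X \<in> tors V" and p: "p \<in> Spec R - V"
  shows "zero_obj T (\<Gamma> p X)"
proof -
  have p': "p \<in> Spec R" using p by blast
  have "X \<in> tors (Zset R p)" using X p torsion_Zset[OF p'] unfolding torsion_eq[of \<kappa> V] by blast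
  then have "\<Gamma> p X \<in> tors (Zset R p)" using Gamma_in_localizing[OF torsion_localizing _ p'] by blast
  moreover have "\<Gamma> p X \<in> right_perp T (tors (Zset R p))"
    using Gamma_in_stratum[OF p'] X by (auto simp: stratum_def torsion_def)
  ultimately show ?thesis by (rule in_perp_zero)
qed

text \<open>An element of \<open>p\<close> outside \<open>q\<close> acts injectively on morphisms
  into \<open>\<Gamma> p X\<close>, which remains local at \<open>q\<close>. By
  \<open>hom_zero_if_injective\<close> this is impossible for a nonzero object of
  \<open>tors (Vset R p)\<close>.\<close>

lemma Gamma_zero_if_stratum:
  assumes X: "X \<in> right_perp T (tors (Zset R q))" and p: "p \<in> Spec R" "q \<in> Spec R" and n: "\<not> p \<subseteq> q"
  shows "zero_obj T (\<Gamma> p X)"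
proof -
  obtain k x where x: "x \<in> grade R k" "x \<in> p" "x \<notin> q"
    using R.Spec_homogeneous_element[OF p(1) R.SpecD(1)[OF p(2)] n] .
  have xc: "(k, x) \<in> compl q" using x by (simp add: compl_def)
  have Xo: "X \<in> obj T" using X right_perpD by blast
  have GV: "\<Gamma> p X \<in> tors (Vset R p)" using Gamma_in_stratum[OF p(1) Xo] by (simp add: stratum_def)
  have GZ: "\<Gamma> p X \<in> right_perp T (tors (Zset R q))"
    by (rule Gamma_in_localizing[OF perp_Zset_localizing[OF p(2)] X p(1)])
  obtain G where G: "G \<subseteq> compacts \<kappa> T"
    "\<And>Y. Y \<in> obj T \<Longrightarrow> (\<And>C. C \<in> G \<Longrightarrow> hom_zero C Y) \<Longrightarrow> zero_obj T Y" using generators by metis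
  show ?thesis
  proof (rule G(2))
    show "\<Gamma> p X \<in> obj T" using GZ right_perpD by blast
    fix C assume "C \<in> G"
    then have C: "C \<in> compacts \<kappa> T" using G by blast
    show "hom_zero C (\<Gamma> p X)"
      by (rule hom_zero_if_injective[OF GV C x(1,2)]) (rule perp_kills_zero[OF p(2) xc GZ])
  qed
qed

text \<open>
  The gap between a compact object \<open>D\<close> supported on \<open>V(r)\<close>, localized at \<open>q\<close>, and its further
  localization at \<open>r\<close> lies in the orthogonal of \<open>S\<close>. So \<open>D\<^sub>r\<close> is a direct summand of \<open>D\<^sub>q\<close>, and
  \<open>Hom(D, D\<^sub>r)\<close> is finitely generated at \<open>q\<close>, although elements of \<open>q - r\<close> act invertibly on it.
\<close>

lemma no_gap:
  assumes r: "r \<in> Spec R" and q: "q \<in> Spec R" and rq: "r \<subseteq> q" "r \<noteq> q"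
    and rS: "stratum r \<subseteq> S" and nz: "\<not> zero_subcategory T (stratum r)"
    and gap: "\<And>s. s \<in> Spec R \<Longrightarrow> r \<subseteq> s \<Longrightarrow> s \<subseteq> q \<Longrightarrow> s \<noteq> r \<Longrightarrow> stratum s \<subseteq> right_perp T S"
  shows False
proof -
  let ?Zq = "Zset R q" and ?Zr = "Zset R r"
  obtain Y where Y: "Y \<in> stratum r" "\<not> zero_obj T Y" using nz by (auto simp: zero_subcategory_def)
  obtain K where K: "susp_closed T K" "K \<subseteq> compacts \<kappa> T" "Loc \<kappa> T K = tors (Vset R r)"
    using torsion_Vset_generated[OF r] by metis
  \<comment> \<open>Otherwise \<open>Y\<close> would be orthogonal to itself. The nonzero
    \<open>v\<close> is kept to refute the vanishing of \<open>?\<epsilon>\<close> at the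
    end.\<close>
  have "\<exists>D\<in>K. \<exists>v\<in>Hom T D Y. v \<noteq> zero_arr T D Y"
  proof (rule ccontr)
    assume "\<not> ?thesis"
    then have "Y \<in> right_perp T K" using stratum_in_Gamma(2)[OF r Y(1)] by (auto simp: right_perp_def)
    then have "Y \<in> right_perp T (tors (Vset R r))" using right_perp_Loc[OF K(1), of \<kappa>] K(3) by simp
    then show False using in_perp_zero[of Y "tors (Vset R r)"] Y by (auto simp: stratum_def)
  qed
  then obtain D v where D: "D \<in> K" and v: "v \<in> Hom T D Y" "v \<noteq> zero_arr T D Y" by blast
  have Dc: "D \<in> compacts \<kappa> T" "D \<in> tors (Vset R r)" "D \<in> obj T"
    using D K Loc_subset Hom_objD[OF v(1)] by blast+
  let ?Dq = "L ?Zq D" and ?g = "\<eta>L ?Zq D"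
  note rD = L_reflection[OF localizable_Zset[OF q] Dc(3)]
  note hD = reflection_hom[OF rD]
  let ?E = "L ?Zr ?Dq" and ?\<pi> = "\<eta>L ?Zr ?Dq"
  note rE = L_reflection[OF localizable_Zset[OF r] hD(3)]
  note hE = reflection_hom[OF rE]
  have "compl q \<subseteq> compl r" using rq(1) by (auto simp: compl_def)
  then have "mtorsion \<kappa> (compl q) \<subseteq> mtorsion \<kappa> (compl r)" unfolding mtorsion_def by blast
  then have "tors ?Zq \<subseteq> tors ?Zr" using torsion_Zset q r by blast
  then have perp_sub: "right_perp T (tors ?Zr) \<subseteq> right_perp T (tors ?Zq)" by (auto simp: right_perp_def)
  have Eq: "?E \<in> right_perp T (tors ?Zq)" using hE(4) perp_sub by blast
  obtain W w h where t: "tri W ?Dq ?E w ?\<pi> h" "W \<in> tors ?Zr" using reflectionE[OF rE] by metis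
  note d = triD[OF t(1)]
  have Wq: "W \<in> right_perp T (tors ?Zq)" using triangulated_subcategoryD(6)[OF tors_perp t(1) hD(4) Eq] .
  have ann: "?Dq \<in> mtorsion \<kappa> (compl s) \<and> ?E \<in> mtorsion \<kappa> (compl s)" if s: "s \<in> Spec R - Vset R r" for s
  proof -
    obtain l c where c: "(l, c) \<in> compl s" "\<phi> l c D = zero_arr T D (Sg l D)"
      using compact_torsion_annihilated[OF Dc(1,2) s] by blast
    note cg = complD(1)[OF c(1)]
    have 1: "\<phi> l c ?Dq = zero_arr T ?Dq (Sg l ?Dq)" using reflection_annihilated[OF tors_susp_closed rD cg c(2)] .
    have 2: "\<phi> l c ?E = zero_arr T ?E (Sg l ?E)" using reflection_annihilated[OF tors_susp_closed rE cg 1] .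
    show ?thesis using annihilated_mtorsion[OF hD(3) c(1) cg 1] annihilated_mtorsion[OF hE(3) c(1) cg 2] by blast
  qed
  then have V: "?Dq \<in> tors (Vset R r)" "?E \<in> tors (Vset R r)" unfolding torsion_eq using hD(3) hE(3) by blast+
  have WV: "W \<in> tors (Vset R r)" using triangulated_subcategoryD(6)[OF tors_triangulated t(1) V] .
  have "?E \<in> stratum r" using V hE(4) by (simp add: stratum_def)
  then have ES: "?E \<in> S" using rS by blast
  \<comment> \<open>\<open>W\<close> is torsion for \<open>Vset R r\<close>, local at
    \<open>q\<close>, and torsion at \<open>r\<close>. Hence \<open>\<Gamma> s W\<close> can be
    nonzero only for \<open>s\<close> strictly above \<open>r\<close> and inside \<open>q\<close>,
    where \<open>gap\<close> applies.\<close>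
  have WS: "W \<in> right_perp T S"
  proof (rule in_localizing_if_Gamma[OF perp_localizing d(5)])
    fix s assume s: "s \<in> Spec R"
    note zero = triangulated_subcategoryD(2)[OF localizingD(1)[OF perp_localizing]]
    show "\<Gamma> s W \<in> right_perp T S"
    proof (cases "r \<subseteq> s \<and> s \<subseteq> q \<and> s \<noteq> r")
      case True
      then show ?thesis using gap[OF s] Gamma_in_stratum[OF s d(5)] by blast
    next
      case False
      then consider "\<not> r \<subseteq> s" | "\<not> s \<subseteq> q" | "s = r" by blast
      then have "zero_obj T (\<Gamma> s W)"
      proof cases
        case 1
        then have "s \<in> Spec R - Vset R r" using s by (auto simp: Vset_def)
        then show ?thesis using Gamma_zero_if_torsion[OF WV] by blast
      next
        case 2
        then show ?thesis using Gamma_zero_if_stratum[OF Wq s q] by blast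
      next
        case 3
        then have "s \<in> Spec R - ?Zr" using s by (auto simp: Zset_def)
        then show ?thesis using Gamma_zero_if_torsion[OF t(2)] by blast
      qed
      then show ?thesis by (rule zero)
    qed
  qed
  \<comment> \<open>\<open>?E\<close> lies in \<open>S\<close> and \<open>W\<close> in its
    orthogonal, so the connecting morphism vanishes and \<open>?\<pi>\<close> acquires a section
    \<open>\<sigma>\<close>.\<close>
  have "h = zero_arr T ?E (Sg 1 W)"
    using right_perpD(1)[OF triangulated_subcategoryD(4)[OF localizingD(1)[OF perp_localizing] WS] ES d(4)] .
  then have "h \<bullet> ident T ?E = zero_arr T ?E (Sg 1 W)" using cmp_ident_right[OF d(4)] by simp
  then obtain \<sigma> where \<sigma>: "\<sigma> \<in> Hom T ?E ?Dq" "ident T ?E = ?\<pi> \<bullet> \<sigma>"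
    using tri_factor_left[OF tri_rotate[OF t(1)] ident_hom[OF hE(3)]] by blast
  let ?\<epsilon> = "?\<pi> \<bullet> ?g"
  have \<epsilon>: "?\<epsilon> \<in> Hom T D ?E" using cmp_hom[OF hD(1) hE(1)] .
  have "\<not> q \<subseteq> r" using rq by blast
  then obtain k x where x: "x \<in> grade R k" "x \<in> q" "x \<notin> r"
    using R.Spec_homogeneous_element[OF q R.SpecD(1)[OF r]] by blast
  have xc: "(k, x) \<in> compl r" using x by (simp add: compl_def)
  \<comment> \<open>\<open>x\<close> lies outside \<open>r\<close> and \<open>?E\<close> is local at
    \<open>r\<close>, so \<open>x\<close> acts invertibly on it although it belongs to
    \<open>q\<close>.\<close>
  have div: "\<exists>h' \<in> Hom T D (Sg (n - k) ?E). \<phi> k x (Sg (n - k) ?E) \<bullet> h' = h" if h: "h \<in> Hom T D (Sg n ?E)" for n h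
  proof -
    have SE: "Sg (n - k) ?E \<in> right_perp T (tors ?Zr)" using triangulated_subcategoryD(4)[OF tors_perp hE(4)] .
    have a: "\<phi> k x (Sg (n - k) ?E) \<in> Hom T (Sg (n - k) ?E) (Sg n ?E)"
      using act_hom[OF x(1), of "Sg (n - k) ?E"] hE(3) by simp
    obtain e where e: "e \<in> Hom T (Sg n ?E) (Sg (n - k) ?E)" "\<phi> k x (Sg (n - k) ?E) \<bullet> e = ident T (Sg n ?E)"
      using iso_arrE[OF perp_act_iso[OF r xc SE] a] by blast
    have "\<phi> k x (Sg (n - k) ?E) \<bullet> (e \<bullet> h) = h" using cmp_assoc[OF h e(1) a] e(2) cmp_ident_left[OF h] by simp
    then show ?thesis using cmp_hom[OF h e(1)] by blast
  qed
  \<comment> \<open>The section moves \<open>y\<close> to \<open>?Dq\<close>. There a denominator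
    \<open>c\<close> outside \<open>q\<close> kills the obstruction to lifting to \<open>D\<close>,
    and \<open>?\<pi>\<close> leads back to \<open>?E\<close>.\<close>
  have lift: "\<exists>l c f. (l, c) \<in> compl q \<and> f \<in> Hom T D (Sg (l + n) D) \<and> \<phi> l c (Sg n ?E) \<bullet> y = Sa (l + n) ?\<epsilon> \<bullet> f"
    if y: "y \<in> Hom T D (Sg n ?E)" for n y
  proof -
    obtain U a b where u: "tri U D ?Dq a ?g b" "U \<in> tors ?Zq" using reflectionE[OF rD] by metis
    note du = triD[OF u(1)]
    let ?z = "Sa n \<sigma> \<bullet> y"
    have z: "?z \<in> Hom T D (Sg n ?Dq)" using cmp_hom[OF y Sa_hom[OF \<sigma>(1)]] .
    note Sb = Sa_hom[OF du(4), of n]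
    have bz: "Sa n b \<bullet> ?z \<in> Hom T D (Sg n (Sg 1 U))" using cmp_hom[OF z Sb] .
    have "Sg n (Sg 1 U) \<in> tors ?Zq" using triangulated_subcategoryD(4)[OF tors_triangulated] u(2) by blast
    then have "Sg n (Sg 1 U) \<in> mtorsion \<kappa> (compl q)" using torsion_Zset[OF q] by blast
    from mtorsionE[OF this Dc(1) bz]
    obtain l c where c: "(l, c) \<in> compl q" "kills l c D (Sg n (Sg 1 U)) (Sa n b \<bullet> ?z)" by blast
    note cg = complD(1)[OF c(1)]
    have o: "Sg n ?Dq \<in> obj T" "Sg n (Sg 1 U) \<in> obj T" "Sg n ?E \<in> obj T" using hD hE du by simp_all
    note cD = act_hom[OF cg o(1)] and cU = act_hom[OF cg o(2)] and cE = act_hom[OF cg o(3)]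
    have cz: "\<phi> l c (Sg n ?Dq) \<bullet> ?z \<in> Hom T D (Sg (l + n) ?Dq)" using act_cmp_hom[OF cg z hD(3)] .
    have "Sa l (Sa n b) \<bullet> (\<phi> l c (Sg n ?Dq) \<bullet> ?z) = \<phi> l c (Sg n (Sg 1 U)) \<bullet> (Sa n b \<bullet> ?z)"
      using act_natural[OF cg Sb] cmp_assoc[OF z cD Sa_hom[OF Sb]] cmp_assoc[OF z Sb cU] by simp
    then have "Sa (l + n) b \<bullet> (\<phi> l c (Sg n ?Dq) \<bullet> ?z) = zero_arr T D (Sg (l + n) (Sg 1 U))"
      using c(2) HomD(1)[OF du(4)] du(5) by (simp add: kills_def add.assoc)
    then obtain f where f: "f \<in> Hom T D (Sg (l + n) D)" "\<phi> l c (Sg n ?Dq) \<bullet> ?z = Sa (l + n) ?g \<bullet> f"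
      using tri_factor_left_pow[OF tri_rotate[OF u(1)] cz] by blast
    note S\<pi> = Sa_hom[OF hE(1), of n] and S\<pi>' = Sa_hom[OF hE(1), of "l + n"] and Sg' = Sa_hom[OF hD(1), of "l + n"]
    have "Sa (l + n) ?\<epsilon> \<bullet> f = Sa (l + n) ?\<pi> \<bullet> (\<phi> l c (Sg n ?Dq) \<bullet> ?z)"
      using Sa_cmp[OF hD(1) hE(1)] cmp_assoc[OF f(1) Sg' S\<pi>'] f(2) by simp
    also have "Sa (l + n) ?\<pi> = Sa l (Sa n ?\<pi>)" using HomD(1)[OF hE(1)] by simp
    also have "Sa l (Sa n ?\<pi>) \<bullet> (\<phi> l c (Sg n ?Dq) \<bullet> ?z) = \<phi> l c (Sg n ?E) \<bullet> (Sa n ?\<pi> \<bullet> ?z)"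
      using act_natural[OF cg S\<pi>] cmp_assoc[OF z cD Sa_hom[OF S\<pi>]] cmp_assoc[OF z S\<pi> cE] by simp
    also have "Sa n ?\<pi> \<bullet> ?z = y"
      using cmp_assoc[OF y Sa_hom[OF \<sigma>(1)] S\<pi>] Sa_cmp[OF \<sigma>(1) hE(1), of n] \<sigma>(2) Sa_ident[OF hE(3), of n]
        cmp_ident_left[OF y] by simp
    finally show ?thesis using c(1) f(1) by metis
  qed
  obtain A where A: "finite A" "\<forall>(n, f) \<in> A. f \<in> Hom T D (Sg n D)"
    "\<And>N. graded_submodule R (hom_star T \<phi> D D) N \<Longrightarrow> \<forall>(n, f) \<in> A. f \<in> N n \<Longrightarrow> N = gcar (hom_star T \<phi> D D)"
  proof -
    have "finitely_generated_module R (hom_star T \<phi> D D)"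
      using noetherian Dc(1) by (simp add: noetherian_category_def)
    then show ?thesis using that unfolding finitely_generated_module_def hom_star_simps by blast
  qed
  let ?B = "(\<lambda>(n, f). (n, Sa n ?\<epsilon> \<bullet> f)) ` A"
  have \<epsilon>f: "Sa n ?\<epsilon> \<bullet> f \<in> Hom T D (Sg n ?E)" if "f \<in> Hom T D (Sg n D)" for n f
    using cmp_hom[OF that Sa_hom[OF \<epsilon>]] .
  have gen: "generates q D ?E ?B"
    unfolding generates_def
  proof (intro allI impI)
    fix K n assume K0: "submodule D ?E K \<and> (\<forall>n. saturation q D ?E K n \<subseteq> K n) \<and> (\<forall>(n, h) \<in> ?B. h \<in> K n)"
    then have K: "submodule D ?E K" and sat: "\<And>n. saturation q D ?E K n \<subseteq> K n"
      and B: "\<And>n f. (n, f) \<in> A \<Longrightarrow> Sa n ?\<epsilon> \<bullet> f \<in> K n" by auto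
    note KD = submoduleD[OF K]
    \<comment> \<open>The preimage of \<open>K\<close> under composition with
      \<open>?\<epsilon>\<close>. It contains the generators of the graded endomorphisms of
      \<open>D\<close>, hence all of them.\<close>
    define N where "N = (\<lambda>n. {f \<in> Hom T D (Sg n D). Sa n ?\<epsilon> \<bullet> f \<in> K n})"
    have "graded_submodule R (hom_star T \<phi> D D) N"
      unfolding graded_submodule_def hom_star_simps
    proof (intro allI conjI ballI impI)
      fix n
      have on: "Sg n D \<in> obj T" using Dc by simp
      show "N n \<subseteq> Hom T D (Sg n D)" by (auto simp: N_def)
      show "zero_arr T D (Sg n D) \<in> N n"
        using KD(2) cmp_zero_right[OF Sa_hom[OF \<epsilon>] Dc(3)] zero_hom[OF Dc(3) on] by (simp add: N_def)
      show "f \<boxplus> f' \<in> N n" if f: "f \<in> N n" "f' \<in> N n" for f f'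
      proof -
        have fh: "f \<in> Hom T D (Sg n D)" "f' \<in> Hom T D (Sg n D)" using f by (auto simp: N_def)
        then show ?thesis using f KD(3) cmp_plus_right[OF fh Sa_hom[OF \<epsilon>]] plus_hom[OF fh] by (simp add: N_def)
      qed
      show "Sa n (\<phi> k r D) \<bullet> f \<in> N (k + n)" if r: "r \<in> grade R k" and f: "f \<in> N n" for k r f
      proof -
        have fh: "f \<in> Hom T D (Sg n D)" and fK: "Sa n ?\<epsilon> \<bullet> f \<in> K n" using f by (auto simp: N_def)
        note a = act_hom[OF r Dc(3)] and aE = act_hom[OF r hE(3)]
        note Sa' = Sa_hom[OF a, of n] and SaE = Sa_hom[OF aE, of n] and S\<epsilon> = Sa_hom[OF \<epsilon>, of n]
        have af: "Sa n (\<phi> k r D) \<bullet> f \<in> Hom T D (Sg (k + n) D)"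
          using cmp_hom[OF fh Sa'] Dc by (simp add: add.commute)
        have e: "Sa (k + n) ?\<epsilon> = Sa n (Sa k ?\<epsilon>)" using HomD(1)[OF \<epsilon>] by (simp add: add.commute)
        have S2: "Sa n (Sa k ?\<epsilon>) \<in> Hom T (Sg n (Sg k D)) (Sg n (Sg k ?E))" using Sa_hom[OF Sa_hom[OF \<epsilon>]] .
        have "Sa (k + n) ?\<epsilon> \<bullet> (Sa n (\<phi> k r D) \<bullet> f) = (Sa n (Sa k ?\<epsilon>) \<bullet> Sa n (\<phi> k r D)) \<bullet> f"
          unfolding e using cmp_assoc[OF fh Sa' S2] by simp
        also have "Sa n (Sa k ?\<epsilon>) \<bullet> Sa n (\<phi> k r D) = Sa n (\<phi> k r ?E) \<bullet> Sa n ?\<epsilon>"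
          using Sa_cmp[OF a Sa_hom[OF \<epsilon>], of n] Sa_cmp[OF \<epsilon> aE, of n] act_natural[OF r \<epsilon>] by simp
        also have "(Sa n (\<phi> k r ?E) \<bullet> Sa n ?\<epsilon>) \<bullet> f = Sa n (\<phi> k r ?E) \<bullet> (Sa n ?\<epsilon> \<bullet> f)"
          using cmp_assoc[OF fh S\<epsilon> SaE] .
        finally have eq: "Sa (k + n) ?\<epsilon> \<bullet> (Sa n (\<phi> k r D) \<bullet> f) = Sa n (\<phi> k r ?E) \<bullet> (Sa n ?\<epsilon> \<bullet> f)" .
        have k: "\<phi> k r (Sg n ?E) \<bullet> (Sa n ?\<epsilon> \<bullet> f) \<in> K (k + n)" using KD(4)[OF r fK] .
        \<comment> \<open>The actions used by \<open>hom_star\<close> and by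
          \<open>submodule\<close> differ by a sign here, which \<open>K\<close> tolerates.\<close>
        have "Sa n (\<phi> k r ?E) \<bullet> (Sa n ?\<epsilon> \<bullet> f) \<in> K (k + n)"
          using act_Sg[OF r hE(3), of n]
        proof
          assume "\<phi> k r (Sg n ?E) = Sa n (\<phi> k r ?E)"
          then show ?thesis using k by simp
        next
          assume n: "\<phi> k r (Sg n ?E) = neg_arr T (Sa n (\<phi> k r ?E))"
          have "neg_arr T (\<phi> k r (Sg n ?E) \<bullet> (Sa n ?\<epsilon> \<bullet> f)) = Sa n (\<phi> k r ?E) \<bullet> (Sa n ?\<epsilon> \<bullet> f)"
            using n cmp_neg_left[OF \<epsilon>f[OF fh] SaE] neg_neg[OF cmp_hom[OF \<epsilon>f[OF fh] SaE]] by simp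
          then show ?thesis using submodule_neg[OF K k hE(3)] by simp
        qed
        then show ?thesis using af eq by (simp add: N_def)
      qed
    qed
    moreover have "\<forall>(n, f) \<in> A. f \<in> N n" using A(2) B by (auto simp: N_def)
    ultimately have N: "N = gcar (hom_star T \<phi> D D)" by (rule A(3))
    have NK: "Sa m ?\<epsilon> \<bullet> f \<in> K m" if "f \<in> Hom T D (Sg m D)" for m f
    proof -
      have "f \<in> N m" using that by (simp add: N)
      then show ?thesis by (simp add: N_def)
    qed
    show "Hom T D (Sg n ?E) \<subseteq> K n"
    proof
      fix y assume y: "y \<in> Hom T D (Sg n ?E)"
      obtain l c f where c: "(l, c) \<in> compl q" "f \<in> Hom T D (Sg (l + n) D)"
        "\<phi> l c (Sg n ?E) \<bullet> y = Sa (l + n) ?\<epsilon> \<bullet> f" using lift[OF y] by blast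
      then have "\<phi> l c (Sg n ?E) \<bullet> y \<in> K (l + n)" using NK by simp
      then have "y \<in> saturation q D ?E K n" using y c(1) unfolding saturation_def by blast
      then show "y \<in> K n" using sat by blast
    qed
  qed
  have "hom_zero D ?E"
  proof (rule nakayama[OF q Dc(3) hE(3) x(1,2) div _ _ _ gen])
    show "finite ?B" using A(1) by simp
    show "h \<in> Hom T D (Sg n ?E)" if "(n, h) \<in> ?B" for n h using that A(2) \<epsilon>f by auto
    show "h = zero_arr T D (Sg n ?E)"
      if "h \<in> Hom T D (Sg n ?E)" "(l, c) \<in> compl q" "kills l c D (Sg n ?E) h" for n h l c
      using perp_kills_zero[OF q that(2) Eq that(1,3)] .
  qed
  then have \<epsilon>0: "?\<epsilon> = zero_arr T D ?E" using hom_zeroD[of D ?E ?\<epsilon> 0] \<epsilon> by simp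
  \<comment> \<open>As \<open>Y\<close> is local at \<open>r\<close>, and so at \<open>q\<close>,
    the morphism \<open>v\<close> extends over both localizations and thus factors through
    \<open>?\<epsilon>\<close>, which is zero.\<close>
  have Yr: "Y \<in> right_perp T (tors ?Zr)" using Y(1) by (simp add: stratum_def)
  then have Yq: "Y \<in> right_perp T (tors ?Zq)" using perp_sub by blast
  obtain v1 where v1: "v1 \<in> Hom T ?Dq Y" "v1 \<bullet> ?g = v" using reflection_lift[OF rD Yq v(1)] .
  obtain v2 where v2: "v2 \<in> Hom T ?E Y" "v2 \<bullet> ?\<pi> = v1" using reflection_lift[OF rE Yr v1(1)] .
  have "v = v2 \<bullet> ?\<epsilon>" using v1 v2 cmp_assoc[OF hD(1) hE(1) v2(1)] by simp
  then have "v = zero_arr T D Y" using \<epsilon>0 cmp_zero_right[OF v2(1) Dc(3)] by simp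
  then show False using v(2) by blast
qed

text \<open>\<open>p\<close> and \<open>q\<close> need not be adjacent. A maximal \<open>r\<close>
  is chosen instead, so that each stratum strictly above \<open>r\<close> and inside
  \<open>q\<close> is zero or not contained in \<open>S\<close>; in either case it lies in the
  orthogonal, by the dichotomy.\<close>

lemma stratum_specialization_closed:
  assumes p: "p \<in> Spec R" and q: "q \<in> Spec R" and pq: "p \<subseteq> q"
    and pS: "stratum p \<subseteq> S" and nz: "\<not> zero_subcategory T (stratum p)"
  shows "stratum q \<subseteq> S"
proof (rule ccontr)
  assume n: "\<not> stratum q \<subseteq> S"
  let ?\<A> = "{r \<in> Spec R. p \<subseteq> r \<and> r \<subseteq> q \<and> stratum r \<subseteq> S \<and> \<not> zero_subcategory T (stratum r)}"
  have ne: "?\<A> \<noteq> {}" using assms by blast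
  have id: "ideal J R" if "J \<in> ?\<A>" for J using that R.SpecD(1) by blast
  obtain r where r: "r \<in> ?\<A>" "\<And>J. J \<in> ?\<A> \<Longrightarrow> r \<subseteq> J \<Longrightarrow> J = r"
    using R.maximal_ideal_in_set[OF ne id] by blast
  have rq: "r \<subseteq> q" "r \<noteq> q" using r n by auto
  show False
  proof (rule no_gap[of r q])
    fix s assume s: "s \<in> Spec R" "r \<subseteq> s" "s \<subseteq> q" "s \<noteq> r"
    then have "s \<notin> ?\<A>" using r(2)[of s] by auto
    then have "\<not> stratum s \<subseteq> S \<or> zero_subcategory T (stratum s)" using s r(1) by blast
    then show "stratum s \<subseteq> right_perp T S"
    proof
      assume "zero_subcategory T (stratum s)"
      then show ?thesis using triangulated_subcategoryD(2)[OF localizingD(1)[OF perp_localizing]]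
        by (auto simp: zero_subcategory_def)
    qed (use stratum_dichotomy[OF s(1)] in blast)
  qed (use r(1) q rq in auto)
qed

lemma compactly_generated_smashing: "S = Loc \<kappa> T (S \<inter> compacts \<kappa> T)"
proof
  have Co: "S \<inter> compacts \<kappa> T \<subseteq> obj T" using compactsD(1) by blast
  note loc = Loc_localizing[OF Co, of \<kappa>]
  note St = localizingD(1)[OF S_localizing]
  show "Loc \<kappa> T (S \<inter> compacts \<kappa> T) \<subseteq> S" using Loc_least[OF S_localizing] by blast
  show "S \<subseteq> Loc \<kappa> T (S \<inter> compacts \<kappa> T)"
  proof
    fix X assume X: "X \<in> S"
    have Xo: "X \<in> obj T" using X localizingD(2)[OF S_localizing] by blast
    show "X \<in> Loc \<kappa> T (S \<inter> compacts \<kappa> T)"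
    proof (rule in_localizing_if_Gamma[OF loc Xo])
      fix p assume p: "p \<in> Spec R"
      have GS: "\<Gamma> p X \<in> S" using Gamma_in_localizing[OF S_localizing X p] .
      have Gl: "\<Gamma> p X \<in> stratum p" using Gamma_in_stratum[OF p Xo] .
      show "\<Gamma> p X \<in> Loc \<kappa> T (S \<inter> compacts \<kappa> T)"
      proof (cases "zero_obj T (\<Gamma> p X)")
        case True
        then show ?thesis using triangulated_subcategoryD(2)[OF localizingD(1)[OF loc]] by blast
      next
        case False
        then have nz: "\<not> zero_subcategory T (stratum p)" using Gl by (auto simp: zero_subcategory_def)
        have "\<not> stratum p \<subseteq> right_perp T S" using False in_perp_zero[OF GS] Gl by blast
        then have pS: "stratum p \<subseteq> S" using stratum_dichotomy[OF p] by blast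
        obtain K where K: "susp_closed T K" "K \<subseteq> compacts \<kappa> T" "Loc \<kappa> T K = tors (Vset R p)"
          using torsion_Vset_generated[OF p] by metis
        \<comment> \<open>Only primes containing \<open>p\<close> contribute to an object of
          \<open>K\<close>, and their strata lie in \<open>S\<close> by specialization
          closure.\<close>
        have "K \<subseteq> S"
        proof
          fix D assume D: "D \<in> K"
          have DV: "D \<in> tors (Vset R p)" using D K(3) Loc_subset by blast
          have Do: "D \<in> obj T" using D K(2) compactsD(1) by blast
          show "D \<in> S"
          proof (rule in_localizing_if_Gamma[OF S_localizing Do])
            fix s assume s: "s \<in> Spec R"
            show "\<Gamma> s D \<in> S"
            proof (cases "p \<subseteq> s")
              case True
              then show ?thesis using stratum_specialization_closed[OF p s True pS nz] Gamma_in_stratum[OF s Do] by blast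
            next
              case False
              then have "s \<in> Spec R - Vset R p" using s by (auto simp: Vset_def)
              then have "zero_obj T (\<Gamma> s D)" using Gamma_zero_if_torsion[OF DV] by blast
              then show ?thesis using triangulated_subcategoryD(2)[OF St] by blast
            qed
          qed
        qed
        then have "K \<subseteq> S \<inter> compacts \<kappa> T" using K(2) by blast
        then have "K \<subseteq> Loc \<kappa> T (S \<inter> compacts \<kappa> T)" using Loc_subset by blast
        then have "Loc \<kappa> T K \<subseteq> Loc \<kappa> T (S \<inter> compacts \<kappa> T)" by (rule Loc_least[OF loc])
        then show ?thesis using K(3) Gl by (auto simp: stratum_def)
      qed
    qed
  qed
qed

end

theorem theorem1p4:
  fixes \<kappa> :: "'k rel"
    and T :: "('o, 'm) triangulated_category"
    and R :: "'r graded_ring"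
    and \<phi> :: "int \<Rightarrow> 'r \<Rightarrow> 'o \<Rightarrow> 'm"
    and Lo :: "'o \<Rightarrow> 'o" and La :: "'m \<Rightarrow> 'm" and \<eta> :: "'o \<Rightarrow> 'm"
  assumes "size_cardinal \<kappa>"
    and "graded_commutative_ring R" and "noetherian_ring R" and "small \<kappa> (carrier R)"
    and "triangulated_category T" and "locally_small \<kappa> T"
    and "has_coproducts \<kappa> T" and "compactly_generated \<kappa> T"
    and "linear_structure T R \<phi>"
    and "noetherian_category \<kappa> T R \<phi>" and "stratified \<kappa> T R \<phi>"
    and "localization_functor T Lo La \<eta>" and "preserves_coproducts \<kappa> T Lo La"
  shows "\<exists>G \<subseteq> compacts \<kappa> T. Ker T Lo = Loc \<kappa> T G"
proof -
  interpret L: bousfield_localization T Lo La \<eta>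
    using assms(5,12) by (simp add: bousfield_localization_def bousfield_localization_axioms_def)
  \<comment> \<open>Preservation of coproducts enters through the orthogonal of the kernel; the
    units supply the Bousfield triangles.\<close>
  have "stratified_smashing T R \<phi> \<kappa> (Ker T Lo)"
  proof (intro stratified_smashing.intro generated_linear_category.intro noetherian_linear_category.intro
      linear_category.intro noetherian_graded_ring.intro
      linear_category_axioms.intro generated_linear_category_axioms.intro stratified_smashing_axioms.intro assms)
    show "localizing \<kappa> T (Ker T Lo)" by (rule L.Ker_localizing)
    show "localizing \<kappa> T (right_perp T (Ker T Lo))" by (rule L.right_perp_Ker_localizing[OF assms(13)])
    show "\<exists>Y g. triangulated_category.reflection T (Ker T Lo) X Y g" if "X \<in> obj T" for X
      using L.unit_reflection[OF that] by blast
  qed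
  then interpret stratified_smashing T R \<phi> \<kappa> "Ker T Lo" .
  show ?thesis using compactly_generated_smashing by blast
qed

end
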